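(* Let $\lambda=\mu^{+}$ and let $\kappa<\lambda$ be a regular cardinal. Assume $\lambda\in I[\lambda]$. For an ordinal $\alpha$ and $\lambda^{+},\kappa+1$-trees $I_{0}$, $I_{1}$ consider the statement $$( * )\qquad I_{0}\equiv^{\lambda}_{\alpha}I_{1}\quad\Longleftrightarrow\quad I_{0}\cong I_{1}.$$ (a) If $\alpha=\mu\times\kappa+1$, then $( * )$ holds for all $\lambda^{+},\kappa+1$-trees $I_{0}$ and $I_{1}$. (b) If $\mu$ is regular (and $\lambda^{<\kappa}=\lambda$), then (a) is best possible: there are $\lambda^{+},\kappa+1$-trees $I_{0}$ and $I_{1}$ such that $I_{0}\equiv^{\lambda}_{\mu\times\kappa}I_{1}$ and $I_{0}\not\cong I_{1}$. (c) If $\mu$ is not regular, then better results hold in the following cases: if $\kappa<\mathrm{cf}(\mu)<\mu$, then $( * )$ holds for all $\lambda^{+},\kappa+1$-trees $I_{0}$, $I_{1}$ with $\alpha=\mu$; and if $\kappa=\mathrm{cf}(\mu)<\mu$, then $( * )$ holds for all $\lambda^{+},\kappa+1$-trees $I_{0}$, $I_{1}$ with $\alpha=\mu+1$.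
   Context: Here $\mu$ is an infinite cardinal and $\kappa$ is infinite. Trees. A tree is a partial order $(t,<)$ such that for each $x\in t$ the set $\mathrm{pred}(x)=\{y\in t : y<x\}$ is well-ordered by $<$. Trees are regarded as structures in the language $\{<\}$; ordinals are also trees. Write $x\sim y$ if $\mathrm{pred}(x)=\mathrm{pred}(y)$, and let $[x]$ be the $\sim$-class of $x$. A $\lambda^{+},\kappa+1$-tree is a tree $I$ such that: (i) $|[x]|<\lambda^{+}$ for every $x\in I$; (ii) for every $x\in I$ the order type of $\mathrm{pred}(x)$ is at most $\kappa$ (so levels $0,1,\dots,\kappa$ may be nonempty, and there are no higher levels); (iii) $I$ has a unique root; (iv) if $x,y\in I$ have no immediate predecessors and $x\sim y$, then $x=y$. Game. Let $t$ be a tree, $\lambda$ a cardinal and $\mathcal A,\mathcal B$ structures in the same relational language. In the Ehrenfeucht-Fraisse game $G^{\lambda}_{t}(\mathcal A,\mathcal B)$, at each move $\xi$ player $\forall$ chooses $x_\xi\in t$, some $\lambda_\xi<\lambda$ and either elements $a_\xi^\beta\in\mathcal A$ ($\beta<\lambda_\xi$) or elements $b_\xi^\beta\in\mathcal B$ ($\beta<\lambda_\xi$); then player $\exists$ answers with $b_\xi^\beta\in\mathcal B$ ($\beta<\lambda_\xi$) in the first case and with $a_\xi^\beta\in\mathcal A$ ($\beta<\lambda_\xi$) in the second. Player $\forall$ must move so that $(x_\beta)_{\beta\le\xi}$ is strictly increasing in $t$; player $\exists$ must move so that $\{(a_\gamma^\beta,b_\gamma^\beta):\gamma\le\xi,\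 \beta<\lambda_\gamma\}$ is a partial isomorphism from $\mathcal A$ to $\mathcal B$. The player who first has to break the rules loses. $\mathcal A\equiv^{\lambda}_{t}\mathcal B$ means that $\exists$ has a winning strategy in $G^{\lambda}_{t}(\mathcal A,\mathcal B)$. The ideal $I[\lambda]$. For a regular cardinal $\lambda$, $I[\lambda]$ is the set of all $A\subseteq\lambda$ for which there exist a cub $E\subseteq\lambda$ and $\{P_\alpha:\alpha<\lambda\}$ such that (1) each $P_\alpha$ is a set of subsets of $\alpha$ with $|P_\alpha|<\lambda$; (2) for every limit $\delta\in A\cap E$ with $\mathrm{cf}(\delta)<\delta$ there is $C\subseteq\delta$ such that the order type of $C$ is $<\delta$, $\sup C=\delta$, and $C\cap\alpha\in\bigcup_{\beta<\delta}P_\beta$ for all $\alpha<\delta$. Sums and products such as $\mu\times\kappa$, $\mu\times\kappa+1$ and $\mu+1$ are ordinal operations ($\mu\times\kappa$ is $\kappa$ consecutive copies of $\mu$), and the resulting ordinals are regarded as trees. $\lambda^{<\kappa}$ is cardinal exponentiation. *)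

theory Defs
  imports Main
begin

unbundle cardinal_syntax

text \<open>
  Ordinals and cardinals are the reflexive (well-)orders of \<open>BNF_Cardinal_Order_Relation\<close>.
  The ordinals below an ordinal \<open>r\<close> are the elements of \<open>Field r\<close>; the set of ordinals below
  such an element \<open>x\<close> is \<open>underS r x\<close>.
\<close>

section \<open>Ordinals and cardinals\<close>

definition initial :: "'a rel \<Rightarrow> 'a \<Rightarrow> 'a rel" where
  "initial r x = Restr r (underS r x)"

text \<open>\<open>ord_times r s\<close> is \<open>s\<close> consecutive copies of \<open>r\<close>.\<close>

definition ord_times :: "'a rel \<Rightarrow> 'b rel \<Rightarrow> ('a \<times> 'b) rel" where
  "ord_times r s = {((x, y), (x', y')). x \<in> Field r \<and> x' \<in> Field r \<and> y \<in> Field s \<and> y' \<in> Field s \<and>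
     (y \<in> underS s y' \<or> y = y' \<and> (x, x') \<in> r)}"

definition ord_succ :: "'a rel \<Rightarrow> 'a option rel" where
  "ord_succ r = {(Some x, Some y) | x y. (x, y) \<in> r} \<union> {(z, None) | z. z \<in> insert None (Some ` Field r)}"

text \<open>
  The library predicate \<open>cofinal K r\<close> asks for elements of \<open>K\<close> strictly above each element of
  \<open>r\<close>, so this is meaningful for limit ordinals only (in particular for infinite cardinals).
\<close>

definition cofinality :: "'a rel \<Rightarrow> 'a rel" where
  "cofinality r = (SOME c. \<exists>K. K \<subseteq> Field r \<and> cofinal K r \<and> c = |K| \<and>
     (\<forall>K'. K' \<subseteq> Field r \<and> cofinal K' r \<longrightarrow> |K| \<le>o |K'| ))"

text \<open>The cardinal \<open>lam\<^sup><\<^sup>\<kappa>\<close>, as the number of sequences in \<open>lam\<close> of length less than \<open>\<kappa>\<close>.\<close>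

definition weak_power :: "'l rel \<Rightarrow> 'k rel \<Rightarrow> ('k \<rightharpoonup> 'l) rel" where
  "weak_power lam \<kappa> = |{s. \<exists>\<alpha>\<in>Field \<kappa>. dom s = underS \<kappa> \<alpha> \<and> ran s \<subseteq> Field lam}|"

section \<open>The ideal \<open>I[\<lambda>]\<close>\<close>

definition is_limit :: "'l rel \<Rightarrow> 'l \<Rightarrow> bool" where
  "is_limit r \<delta> \<longleftrightarrow> \<delta> \<in> Field r \<and> underS r \<delta> \<noteq> {} \<and>
     (\<forall>\<alpha>\<in>underS r \<delta>. \<exists>\<beta>\<in>underS r \<delta>. \<alpha> \<in> underS r \<beta>)"

definition cub :: "'l rel \<Rightarrow> 'l set \<Rightarrow> bool" where
  "cub lam E \<longleftrightarrow> E \<subseteq> Field lam \<and> cofinal E lam \<and>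
     (\<forall>X. X \<subseteq> E \<and> X \<noteq> {} \<and> Above lam X \<noteq> {} \<longrightarrow> wo_rel.supr lam X \<in> E)"

definition approachability_ideal :: "'l rel \<Rightarrow> 'l set set" where
  "approachability_ideal lam = {A. A \<subseteq> Field lam \<and>
     (\<exists>E P. cub lam E \<and>
       (\<forall>\<alpha>\<in>Field lam. P \<alpha> \<subseteq> Pow (underS lam \<alpha>) \<and> |P \<alpha>| <o lam) \<and>
       (\<forall>\<delta>\<in>A \<inter> E. is_limit lam \<delta> \<and> cofinality (initial lam \<delta>) <o initial lam \<delta> \<longrightarrow>
         (\<exists>C. C \<subseteq> underS lam \<delta> \<and> Restr lam C <o initial lam \<delta> \<and> wo_rel.supr lam C = \<delta> \<and>
           (\<forall>\<alpha>\<in>underS lam \<delta>. C \<inter> underS lam \<alpha> \<in> (\<Union>\<beta>\<in>underS lam \<delta>. P \<beta>)))))}"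

section \<open>Trees\<close>

text \<open>
  A tree is given by its reflexive order \<open>T\<close>, so its set of nodes is \<open>Field T\<close>, its strict order
  is \<open>y \<in> underS T x\<close>, and \<open>pred(x)\<close> is \<open>underS T x\<close>. Ordinals are trees as they stand.
\<close>

definition is_tree :: "'t rel \<Rightarrow> bool" where
  "is_tree T \<longleftrightarrow> Partial_order T \<and> (\<forall>x\<in>Field T. Well_order (Restr T (underS T x)))"

definition sim :: "'t rel \<Rightarrow> 't \<Rightarrow> 't \<Rightarrow> bool" where
  "sim T x y \<longleftrightarrow> underS T x = underS T y"

definition sim_class :: "'t rel \<Rightarrow> 't \<Rightarrow> 't set" where
  "sim_class T x = {y \<in> Field T. sim T x y}"

definition immediate_pred :: "'t rel \<Rightarrow> 't \<Rightarrow> 't \<Rightarrow> bool" where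
  "immediate_pred T y x \<longleftrightarrow> y \<in> underS T x \<and> \<not> (\<exists>z. y \<in> underS T z \<and> z \<in> underS T x)"

text \<open>
  The \<open>\<lambda>\<^sup>+,\<kappa>+1\<close>-trees. By the last condition a node at a limit level is determined by its
  predecessors, so such a tree has at most \<open>\<lambda>\<^sup>\<kappa>\<close> nodes; for infinite \<open>\<kappa> < \<lambda>\<close> this is at most
  \<open>2\<^sup>\<lambda>\<close>, and hence every such tree has an isomorphic copy on the type \<open>'l set\<close> if \<open>lam :: 'l rel\<close>.
\<close>

definition lambda_kappa_tree :: "'l rel \<Rightarrow> 'k rel \<Rightarrow> 't rel \<Rightarrow> bool" where
  "lambda_kappa_tree lam \<kappa> T \<longleftrightarrow> is_tree T \<and>
     (\<forall>x\<in>Field T. |sim_class T x| <o cardSuc lam) \<and>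
     (\<forall>x\<in>Field T. Restr T (underS T x) \<le>o \<kappa>) \<and>
     (\<exists>!x. x \<in> Field T \<and> underS T x = {}) \<and>
     (\<forall>x\<in>Field T. \<forall>y\<in>Field T.
        (\<nexists>z. immediate_pred T z x) \<and> (\<nexists>z. immediate_pred T z y) \<and> sim T x y \<longrightarrow> x = y)"

text \<open>
  Isomorphisms, partial isomorphisms and the game are only needed for trees, that is, for
  structures in the language with the one relation symbol \<open><\<close>.
\<close>

definition isomorphic :: "'a rel \<Rightarrow> 'b rel \<Rightarrow> bool" where
  "isomorphic A B \<longleftrightarrow> (\<exists>f. bij_betw f (Field A) (Field B) \<and>
     (\<forall>x\<in>Field A. \<forall>y\<in>Field A. x \<in> underS A y \<longleftrightarrow> f x \<in> underS B (f y)))"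

definition partial_isomorphism :: "'a rel \<Rightarrow> 'b rel \<Rightarrow> ('a \<times> 'b) set \<Rightarrow> bool" where
  "partial_isomorphism A B p \<longleftrightarrow> p \<subseteq> Field A \<times> Field B \<and>
     (\<forall>(a, b)\<in>p. \<forall>(a', b')\<in>p. (a = a' \<longleftrightarrow> b = b') \<and> (a \<in> underS A a' \<longleftrightarrow> b \<in> underS B b'))"

section \<open>The Ehrenfeucht-Fraisse game\<close>

text \<open>
  Apart from the node \<open>x\<^sub>\<xi>\<close>, a move of player \<open>\<forall>\<close> consists of an ordinal \<open>l < \<lambda>\<close> and a
  sequence of length \<open>l\<close> in one of the two structures. Sequences of length \<open>l\<close> are functions on
  \<open>underS lam l\<close>, extended by \<open>undefined\<close> (see \<open>Func\<close>).
\<close>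

datatype ('l, 'a, 'b) challenge = Choose_left 'l "'l \<Rightarrow> 'a" | Choose_right 'l "'l \<Rightarrow> 'b"

fun legal_challenge :: "'l rel \<Rightarrow> 'a rel \<Rightarrow> 'b rel \<Rightarrow> ('l, 'a, 'b) challenge \<Rightarrow> bool" where
  "legal_challenge lam A B (Choose_left l f) \<longleftrightarrow>
     l \<in> Field lam \<and> f \<in> BNF_Wellorder_Constructions.Func (underS lam l) (Field A)"
| "legal_challenge lam A B (Choose_right l g) \<longleftrightarrow>
     l \<in> Field lam \<and> g \<in> BNF_Wellorder_Constructions.Func (underS lam l) (Field B)"

text \<open>
  The nodes \<open>x\<^sub>0 < x\<^sub>1 < \<dots>\<close> chosen by \<open>\<forall>\<close> form a chain of the tree \<open>t\<close>, and every chain of a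
  tree is well-ordered and so has a unique increasing enumeration. The sequence of moves of
  \<open>\<forall>\<close> is therefore the same thing as a map that is defined on a chain of \<open>t\<close> and sends
  \<open>x\<^sub>\<xi>\<close> to the rest of move \<open>\<xi>\<close>.
\<close>

type_synonym ('t, 'l, 'a, 'b) moves = "'t \<rightharpoonup> ('l, 'a, 'b) challenge"

definition legal_moves ::
  "'l rel \<Rightarrow> 't rel \<Rightarrow> 'a rel \<Rightarrow> 'b rel \<Rightarrow> ('t, 'l, 'a, 'b) moves \<Rightarrow> bool" where
  "legal_moves lam t A B h \<longleftrightarrow> dom h \<subseteq> Field t \<and>
     (\<forall>x\<in>dom h. \<forall>y\<in>dom h. (x, y) \<in> t \<or> (y, x) \<in> t) \<and>
     (\<forall>c\<in>ran h. legal_challenge lam A B c)"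

text \<open>
  A strategy of \<open>\<exists>\<close> maps the moves of \<open>\<forall>\<close> up to and including the current one to an answer.
  The first component is the answer if \<open>\<forall>\<close> has just chosen elements of the left structure, the
  second one is the answer if he has chosen elements of the right structure.
\<close>

type_synonym ('t, 'l, 'a, 'b) strategy = "('t, 'l, 'a, 'b) moves \<Rightarrow> ('l \<Rightarrow> 'b) \<times> ('l \<Rightarrow> 'a)"

fun round_pairs ::
  "'l rel \<Rightarrow> ('l, 'a, 'b) challenge \<Rightarrow> ('l \<Rightarrow> 'b) \<times> ('l \<Rightarrow> 'a) \<Rightarrow> ('a \<times> 'b) set" where
  "round_pairs lam (Choose_left l f) ans = {(f \<beta>, fst ans \<beta>) | \<beta>. \<beta> \<in> underS lam l}"
| "round_pairs lam (Choose_right l g) ans = {(snd ans \<beta>, g \<beta>) | \<beta>. \<beta> \<in> underS lam l}"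

text \<open>The pairs played up to and including the move in which \<open>\<forall>\<close> chooses the node \<open>x\<close>.\<close>

definition played_pairs :: "'l rel \<Rightarrow> 't rel \<Rightarrow> ('t, 'l, 'a, 'b) strategy \<Rightarrow>
    ('t, 'l, 'a, 'b) moves \<Rightarrow> 't \<Rightarrow> ('a \<times> 'b) set" where
  "played_pairs lam t \<sigma> h x =
     (\<Union>y\<in>dom h \<inter> under t x. round_pairs lam (the (h y)) (\<sigma> (h |` under t y)))"

definition winning_strategy ::
  "'l rel \<Rightarrow> 't rel \<Rightarrow> 'a rel \<Rightarrow> 'b rel \<Rightarrow> ('t, 'l, 'a, 'b) strategy \<Rightarrow> bool" where
  "winning_strategy lam t A B \<sigma> \<longleftrightarrow>
     (\<forall>h. legal_moves lam t A B h \<longrightarrow>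
       (\<forall>x\<in>dom h. partial_isomorphism A B (played_pairs lam t \<sigma> h x)))"

definition game_equiv :: "'l rel \<Rightarrow> 't rel \<Rightarrow> 'a rel \<Rightarrow> 'b rel \<Rightarrow> bool" where
  "game_equiv lam t A B \<longleftrightarrow> (\<exists>\<sigma>. winning_strategy lam t A B \<sigma>)"

end

theory Submission
  imports Defs
begin

text \<open>
  For (a) and (c), a play that respects a winning strategy of \<open>\<exists>\<close> is extended level by level to an
  isomorphism: \<open>(x, f x)\<close> is always a pair played in some position \<open>H x\<close>, and \<open>H x\<close> grows along
  branches. The difficulty is to match all immediate successors of \<open>x\<close> with those of \<open>f x\<close>, of
  which there may be \<open>\<lambda>\<close> many, while only a bounded part of the clock may be used. Index the
  successors by ordinals below \<open>\<lambda>\<close>. For club many \<open>\<epsilon>\<close> the assumption \<open>\<lambda> \<in> I[\<lambda>]\<close> gives a cofinal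
  \<open>C \<subseteq> \<epsilon>\<close> of order type \<open>\<gamma> < \<epsilon>\<close> whose initial segments are all listed before \<open>\<epsilon>\<close>. Playing the
  successors with index below \<open>d\<close> for the \<open>d \<in> C\<close> in turn then yields only answers with index below
  \<open>\<epsilon>\<close>, and \<open>\<mu>\<close> moves suffice since a cofinal subset of \<open>\<gamma>\<close> embeds into \<open>\<mu>\<close>. So the indices below
  \<open>\<epsilon>\<close> are matched among themselves, and \<open>\<omega>\<close> more moves close off an interval \<open>[\<epsilon>, \<epsilon>')\<close>. Such
  intervals cover \<open>\<lambda>\<close>. What remains is to see how many levels the clock admits.

  For (b), the inner nodes are sequences of length less than \<open>\<kappa>\<close> of pairs \<open>(o, \<xi>)\<close> of ordinals below
  \<open>\<lambda>\<close>, with side branches that make \<open>o\<close>, but not \<open>\<xi>\<close>, visible to isomorphisms. Let \<open>S\<close> be the set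
  of ordinals below \<open>\<lambda>\<close> of cofinality \<open>\<mu>\<close>. A branch \<open>b\<close> has the origin \<open>\<beta>\<close> if \<open>o (b \<nu>) = o (\<beta> \<nu>)\<close>
  codes \<open>\<beta> | \<nu>\<close> for all \<open>\<nu>\<close>, and it is good if \<open>\<xi> (b \<nu>) < \<xi> (\<beta> \<nu>)\<close> for all large \<open>\<nu>\<close> with
  \<open>\<xi> (\<beta> \<nu>) \<in> S\<close>. The good branches with an origin get a top node in both trees, the origins
  themselves only in the first one. An isomorphism induces a permutation of the \<open>\<xi>\<close> at each node,
  and no permutation of \<open>\<lambda>\<close> is regressive on all of \<open>S\<close>; hence some origin would be mapped to a
  branch that is nowhere good. In the game of length \<open>\<mu> \<times> \<kappa>\<close>, however, player \<open>\<exists>\<close> may permute each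
  interval of the \<open>\<xi>\<close> that become relevant at the same time separately, and regressively on \<open>S\<close>
  unless the interval begins in \<open>S\<close>. This happens at times \<open>(0, \<beta>')\<close> only, that is, on fewer than
  \<open>\<kappa>\<close> levels.
\<close>

text \<open>Positions only have to cohere along branches, so different successors of one node may be
  reached by incompatible plays, and at each level it is enough that every single pair occurs in
  some play (\<open>realized\<close>). Such plays control the answers in one direction only and give
  an injection. Exchanging the structures gives a second one, and each pair of the Cantor-Bernstein
  bijection comes from one of the two.

  With the clock \<open>\<mu> \<times> \<kappa> + 1\<close> a level spends one copy of \<mu>; its
  \<omega> further moves are the first moves of the next copy, and the last node of the clock serves
  level \<kappa>. For singular \<mu> the cofinal sets can be taken of size less than \<mu>, so a
  level costs only a bounded part of one \<mu>.

  In (b), \<open>weak_power lam \<kappa> =o lam\<close> allows an entry to name an initial segment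
  of the origin \<beta>. A branch that has left \<beta> keeps naming initial segments of \<beta>,
  which are no longer its own. The permutations act only on entries that name the branch's own
  initial segment, so they fix the tail of such a branch. This is why goodness is a property of
  tails: only the origins themselves can change their status.\<close>

abbreviation lt :: "'a rel \<Rightarrow> 'a \<Rightarrow> 'a \<Rightarrow> bool" where
  "lt r a b \<equiv> a \<in> underS r b"

section \<open>Well-orders\<close>

lemma lt_iff: "lt r a b \<longleftrightarrow> a \<noteq> b \<and> (a, b) \<in> r"
  by (simp add: underS_def)

lemma lt_Field1: "lt r a b \<Longrightarrow> a \<in> Field r"
  and lt_Field2: "lt r a b \<Longrightarrow> b \<in> Field r"
  by (auto simp: lt_iff Field_def)

lemma lt_le: "lt r a b \<Longrightarrow> (a, b) \<in> r"
  by (simp add: lt_iff)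

lemma lt_irrefl [simp]: "\<not> lt r a a"
  by (simp add: lt_iff)

lemma order_lt_trans:
  assumes "Partial_order r"
  shows lt_trans: "lt r a b \<Longrightarrow> lt r b c \<Longrightarrow> lt r a c"
    and le_lt_trans: "(a, b) \<in> r \<Longrightarrow> lt r b c \<Longrightarrow> lt r a c"
    and lt_le_trans: "lt r a b \<Longrightarrow> (b, c) \<in> r \<Longrightarrow> lt r a c"
    and le_trans: "(a, b) \<in> r \<Longrightarrow> (b, c) \<in> r \<Longrightarrow> (a, c) \<in> r"
    and lt_asym: "lt r a b \<Longrightarrow> \<not> (b, a) \<in> r"
    and le_antisym: "(a, b) \<in> r \<Longrightarrow> (b, a) \<in> r \<Longrightarrow> a = b"
    and le_refl: "a \<in> Field r \<Longrightarrow> (a, a) \<in> r"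
    and under_eq: "a \<in> Field r \<Longrightarrow> under r a = insert a (underS r a)"
proof -
  have tr: "trans r" and as: "antisym r" and rf: "refl_on (Field r) r"
    using assms by (auto simp: order_on_defs)
  show "lt r a b \<Longrightarrow> lt r b c \<Longrightarrow> lt r a c" "(a, b) \<in> r \<Longrightarrow> lt r b c \<Longrightarrow> lt r a c"
    "lt r a b \<Longrightarrow> (b, c) \<in> r \<Longrightarrow> lt r a c"
    "(a, b) \<in> r \<Longrightarrow> (b, c) \<in> r \<Longrightarrow> (a, c) \<in> r" "lt r a b \<Longrightarrow> \<not> (b, a) \<in> r"
    "(a, b) \<in> r \<Longrightarrow> (b, a) \<in> r \<Longrightarrow> a = b"
    using tr as unfolding lt_iff trans_def antisym_def by blast+
  show "a \<in> Field r \<Longrightarrow> (a, a) \<in> r"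
    using rf by (auto simp: refl_on_def)
  then show "a \<in> Field r \<Longrightarrow> under r a = insert a (underS r a)"
    by (auto simp: under_def underS_def)
qed

locale well =
  fixes r :: "'a rel"
  assumes wo: "Well_order r"
begin

lemma po: "Partial_order r"
  using wo by (auto simp: order_on_defs)

lemma wo_rel: "wo_rel r"
  using wo by (simp add: wo_rel_def)

lemmas ltt = lt_trans[OF po] and lelt = le_lt_trans[OF po] and ltle = lt_le_trans[OF po]
  and lele = le_trans[OF po] and asym = lt_asym[OF po] and antisym = le_antisym[OF po]
  and refl = le_refl[OF po]

lemma total: "a \<in> Field r \<Longrightarrow> b \<in> Field r \<Longrightarrow> (a, b) \<in> r \<or> (b, a) \<in> r"
  using wo_rel.TOTALS[OF wo_rel] by blast

lemma not_lt: "a \<in> Field r \<Longrightarrow> b \<in> Field r \<Longrightarrow> \<not> lt r a b \<longleftrightarrow> (b, a) \<in> r"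
  using total asym refl by (metis lt_iff)

lemma not_le: "a \<in> Field r \<Longrightarrow> b \<in> Field r \<Longrightarrow> \<not> (a, b) \<in> r \<longleftrightarrow> lt r b a"
  using not_lt by blast

lemma cases3: "a \<in> Field r \<Longrightarrow> b \<in> Field r \<Longrightarrow> lt r a b \<or> a = b \<or> lt r b a"
  using total by (auto simp: lt_iff)

lemma induct [consumes 1, case_names less]:
  assumes "a \<in> Field r" "\<And>a. a \<in> Field r \<Longrightarrow> (\<And>b. lt r b a \<Longrightarrow> P b) \<Longrightarrow> P a"
  shows "P a"
proof -
  have "a \<in> Field r \<longrightarrow> P a"
  proof (rule wo_rel.well_order_induct[OF wo_rel, where P = "\<lambda>a. a \<in> Field r \<longrightarrow> P a"])
    fix x assume "\<forall>y. y \<noteq> x \<and> (y, x) \<in> r \<longrightarrow> y \<in> Field r \<longrightarrow> P y"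
    then show "x \<in> Field r \<longrightarrow> P x" using assms(2)[of x] lt_Field1[of _ r x] lt_iff[of _ r x] by blast
  qed
  with assms(1) show ?thesis by blast
qed

lemma ex_least:
  assumes "A \<subseteq> Field r" "A \<noteq> {}"
  shows "\<exists>a\<in>A. \<forall>b\<in>A. (a, b) \<in> r"
  using wo_rel.minim_in[OF wo_rel assms] wo_rel.minim_least[OF wo_rel assms(1)] by blast

lemma wf_lt: "wf {(a, b). lt r a b}"
proof -
  have "{(a, b). lt r a b} = r - Id" by (auto simp: lt_iff)
  then show ?thesis using wo by (simp add: well_order_on_def)
qed

lemma underS_mono: "(a, b) \<in> r \<Longrightarrow> underS r a \<subseteq> underS r b"
  using ltle by blast

lemma underS_eq: "a \<in> Field r \<Longrightarrow> b \<in> Field r \<Longrightarrow> underS r a = underS r b \<Longrightarrow> a = b"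
  using cases3 lt_irrefl by metis

lemma ofilter_underS: "wo_rel.ofilter r (underS r a)"
  using wo_rel.underS_ofilter[OF wo_rel] .

lemma Well_order_Restr': "Well_order (Restr r A)"
  using Well_order_Restr[OF wo] .

lemma Field_Restr: "A \<subseteq> Field r \<Longrightarrow> Field (Restr r A) = A"
  using po by (intro Refl_Field_Restr2) (auto simp: order_on_defs)

lemma Field_initial: "Field (initial r a) = underS r a"
  unfolding initial_def by (rule Field_Restr) (auto simp: lt_iff Field_def)

lemma lt_Restr: "lt (Restr r A) a b \<longleftrightarrow> a \<in> A \<and> b \<in> A \<and> lt r a b"
  by (auto simp: lt_iff)

lemma initial_less: "lt r a b \<Longrightarrow> initial r a <o initial r b"
  using ofilter_subset_ordLess[OF wo ofilter_underS ofilter_underS, of a b]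
    underS_mono[OF lt_le, of a b] lt_irrefl unfolding initial_def by (metis psubsetI)

lemma initial_inj: "a \<in> Field r \<Longrightarrow> b \<in> Field r \<Longrightarrow> initial r a =o initial r b \<Longrightarrow> a = b"
  using cases3 initial_less not_ordLess_ordIso ordIso_symmetric by metis

lemma initial_less_iff:
  assumes "a \<in> Field r" "b \<in> Field r"
  shows "initial r a <o initial r b \<longleftrightarrow> lt r a b"
  using initial_less cases3[OF assms] ordLess_irreflexive ordLess_transitive by metis

lemma initial_lt: "a \<in> Field r \<Longrightarrow> initial r a <o r"
  unfolding initial_def by (intro underS_Restr_ordLess[OF wo]) auto

lemma ordLess_initial:
  assumes "s <o r"
  shows "\<exists>a\<in>Field r. s =o initial r a"
  using ordLess_iff_ordIso_Restr[OF wo, of s] assms ordLess_iff unfolding initial_def by blast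

lemma regular_bounded:
  assumes "regularCard r" "X \<subseteq> Field r" "|X| <o r"
  shows "\<exists>c\<in>Field r. \<forall>x\<in>X. (x, c) \<in> r"
proof (rule ccontr)
  assume no: "\<not> ?thesis"
  have "cofinal X r" unfolding cofinal_def
  proof
    fix a assume a: "a \<in> Field r"
    then obtain x where x: "x \<in> X" "\<not> (x, a) \<in> r" using no by auto
    have "x \<in> Field r" using x(1) assms(2) by auto
    then have "lt r a x" using x(2) not_le[OF _ a] by simp
    then show "\<exists>b\<in>X. a \<noteq> b \<and> (a, b) \<in> r" using x(1) by (auto simp: lt_iff)
  qed
  then have "|X| =o r" using assms(1,2) by (simp add: regularCard_def)
  then show False using assms(3) not_ordLess_ordIso by blast
qed

end

lemma strict_embedding:
  assumes "r \<le>o s"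
  shows "\<exists>j. (\<forall>x\<in>Field r. j x \<in> Field s) \<and> (\<forall>x y. lt r x y \<longrightarrow> lt s (j x) (j y))"
proof -
  obtain f where wr: "Well_order r" and ws: "Well_order s" and f: "embed r s f"
    using assms unfolding ordLeq_def by blast
  have inj: "inj_on f (Field r)" and comp: "compat r s f" and im: "f ` Field r \<subseteq> Field s"
    using f embed_inj_on[OF wr f] embed_compat[OF f] embed_Field[OF f] by auto
  show ?thesis
  proof (intro exI[of _ f] conjI ballI allI impI)
    fix x y assume "lt r x y"
    then show "lt s (f x) (f y)"
      using inj comp lt_Field1[of x r y] lt_Field2[of x r y]
      unfolding lt_iff compat_def inj_on_def by blast
  qed (use im in auto)
qed

lemma strict_embedding_less:
  assumes "r <o s"
  shows "\<exists>j b. b \<in> Field s \<and> (\<forall>x\<in>Field r. lt s (j x) b) \<and> (\<forall>x y. lt r x y \<longrightarrow> lt s (j x) (j y))"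
proof -
  interpret s: well s using assms by (simp add: well_def ordLess_def)
  obtain b where b: "b \<in> Field s" "r =o initial s b" using s.ordLess_initial[OF assms] by blast
  obtain j where "\<forall>x\<in>Field r. j x \<in> Field (initial s b)" "\<forall>x y. lt r x y \<longrightarrow> lt (initial s b) (j x) (j y)"
    using strict_embedding[OF ordIso_imp_ordLeq[OF b(2)]] by blast
  then show ?thesis using b(1) unfolding s.Field_initial unfolding initial_def s.lt_Restr
    by (intro exI[of _ j] exI[of _ b]) auto
qed

section \<open>A successor cardinal\<close>

text \<open>Requiring only an isomorphism with \<open>cardSuc mu\<close> leaves the type of
  \<open>lam\<close> free.\<close>

locale succ_card =
  fixes mu :: "'m rel" and lam :: "'l rel"
  assumes mu: "Card_order mu" "infinite (Field mu)"
    and lam_card: "Card_order lam"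
    and lam_succ: "lam =o cardSuc mu"
begin

lemma mu_less: "mu <o lam"
  using cardSuc_greater[OF mu(1)] ordLess_ordIso_trans ordIso_symmetric[OF lam_succ] by blast

lemma below: "|A| <o lam \<Longrightarrow> |A| \<le>o mu"
  using cardSuc_ordLeq_ordLess[OF mu(1) card_of_Card_order] ordLess_ordIso_trans[OF _ lam_succ] by blast

lemma reg: "regularCard lam"
proof (rule regularCard_ordIso[OF ordIso_symmetric[OF lam_succ]])
  show "Cinfinite (cardSuc mu)" using mu by (intro Cinfinite_cardSuc) (simp add: cinfinite_def)
  show "regularCard (cardSuc mu)" using mu infinite_cardSuc_regularCard by blast
qed

sublocale lam: well lam
  using lam_card by unfold_locales (simp add: card_order_on_well_order_on)

sublocale mu: well mu
  using mu by unfold_locales (simp add: card_order_on_well_order_on)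

lemma infinite_lam: "infinite (Field lam)"
  using card_of_ordLeq_infinite[OF card_of_mono2[OF ordLess_imp_ordLeq[OF mu_less]] mu(2)] .

lemma mu_lt: "|A| \<le>o mu \<Longrightarrow> |A| <o lam"
  using mu_less ordLeq_ordLess_trans by blast

lemma card_underS: "|underS lam a| \<le>o mu"
proof (cases "a \<in> Field lam")
  case True
  then show ?thesis using below card_of_underS[OF lam_card] by blast
next
  case False
  then have "underS lam a = {}" by (auto simp: lt_iff Field_def)
  then show ?thesis by (simp add: mu card_of_empty1 mu.wo)
qed

lemma no_max: "a \<in> Field lam \<Longrightarrow> \<exists>b. lt lam a b"
  using infinite_Card_order_limit[OF lam_card infinite_lam] by (metis lt_iff)

text \<open>Regularity of the successor cardinal: an unbounded set would have size
  \<open>lam\<close>.\<close>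

lemma bounded:
  assumes "A \<subseteq> Field lam" "|A| \<le>o mu"
  shows "\<exists>b\<in>Field lam. \<forall>a\<in>A. lt lam a b"
proof (rule ccontr)
  assume *: "\<not> ?thesis"
  have "cofinal A lam" unfolding cofinal_def
  proof
    fix a assume a: "a \<in> Field lam"
    obtain b where b: "lt lam a b" using no_max[OF a] by blast
    have b': "b \<in> Field lam" using lt_Field2[OF b] .
    then obtain c where c: "c \<in> A" "\<not> lt lam c b" using * by auto
    then have "(b, c) \<in> lam" using lam.not_lt[of c b] b' assms by auto
    then show "\<exists>b\<in>A. a \<noteq> b \<and> (a, b) \<in> lam" using lam.ltle[OF b] c(1) by (auto simp: lt_iff)
  qed
  then have "|A| =o lam" using reg assms by (simp add: regularCard_def)
  then show False using mu_lt[OF assms(2)] not_ordLess_ordIso by blast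
qed

lemma UN_le: "|I| \<le>o mu \<Longrightarrow> (\<And>i. i \<in> I \<Longrightarrow> |A i| \<le>o mu) \<Longrightarrow> |\<Union>i\<in>I. A i| \<le>o mu"
  by (rule card_of_UNION_ordLeq_infinite_Field[OF mu(2,1)]) auto

lemma Un_le: "|A| \<le>o mu \<Longrightarrow> |B| \<le>o mu \<Longrightarrow> |A \<union> B| \<le>o mu"
  by (rule card_of_Un_ordLeq_infinite_Field[OF mu(2) _ _ mu(1)])

lemma image_le: "|A| \<le>o mu \<Longrightarrow> |f ` A| \<le>o mu"
  using card_of_image ordLeq_transitive by blast

lemma subset_le: "|A| \<le>o mu \<Longrightarrow> B \<subseteq> A \<Longrightarrow> |B| \<le>o mu"
  using card_of_mono1 ordLeq_transitive by blast

lemma finite_le: "finite A \<Longrightarrow> |A| \<le>o mu"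
  using mu finite_ordLess_infinite[OF card_of_Well_order mu.wo, of A]
  by (simp add: Field_card_of ordLess_imp_ordLeq)

lemma Times_le: "|A| \<le>o mu \<Longrightarrow> |B| \<le>o mu \<Longrightarrow> |A \<times> B| \<le>o mu"
  by (rule card_of_Times_ordLeq_infinite_Field[OF mu(2) _ _ mu(1)])

lemma card_insert_le: "|A| \<le>o mu \<Longrightarrow> |insert x A| \<le>o mu"
  using Un_le[of "{x}" A] finite_le[of "{x}"] by simp

definition zero :: 'l where "zero = wo_rel.minim lam (Field lam)"

lemma Field_lam_ne: "Field lam \<noteq> {}"
  using infinite_lam by auto

lemma zero: "zero \<in> Field lam" "a \<in> Field lam \<Longrightarrow> (zero, a) \<in> lam" "underS lam zero = {}"
proof -
  show 1: "zero \<in> Field lam" unfolding zero_def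
    using wo_rel.minim_in[OF lam.wo_rel _ Field_lam_ne] by blast
  show 2: "a \<in> Field lam \<Longrightarrow> (zero, a) \<in> lam" for a unfolding zero_def
    using wo_rel.minim_least[OF lam.wo_rel] by blast
  show "underS lam zero = {}"
  proof (rule equals0I)
    fix a assume a: "lt lam a zero"
    then show False using 2[OF lt_Field1[OF a]] lam.asym by auto
  qed
qed

lemma big_initial: "\<exists>a\<in>Field lam. mu =o initial lam a"
  using lam.ordLess_initial[OF mu_less] .

definition lub :: "'l set \<Rightarrow> 'l" where
  "lub A = wo_rel.minim lam {b \<in> Field lam. \<forall>a\<in>A. (a, b) \<in> lam}"

lemma lub:
  assumes "A \<subseteq> Field lam" "b \<in> Field lam" "\<And>a. a \<in> A \<Longrightarrow> (a, b) \<in> lam"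
  shows lub_Field: "lub A \<in> Field lam" and lub_upper: "a \<in> A \<Longrightarrow> (a, lub A) \<in> lam"
    and lub_least: "(lub A, b) \<in> lam" and lt_lub: "lt lam c (lub A) \<Longrightarrow> \<exists>a\<in>A. lt lam c a"
proof -
  let ?B = "{b \<in> Field lam. \<forall>a\<in>A. (a, b) \<in> lam}"
  have B: "?B \<subseteq> Field lam" "?B \<noteq> {}" using assms by auto
  have in_B: "lub A \<in> ?B" unfolding lub_def using wo_rel.minim_in[OF lam.wo_rel B] .
  then show "lub A \<in> Field lam" "a \<in> A \<Longrightarrow> (a, lub A) \<in> lam" by auto
  have least: "(lub A, c) \<in> lam" if "c \<in> ?B" for c
    unfolding lub_def using wo_rel.minim_least[OF lam.wo_rel B(1) that] .
  then show "(lub A, b) \<in> lam" using assms by blast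
  assume c: "lt lam c (lub A)"
  then have "c \<notin> ?B" using least lam.asym by blast
  then show "\<exists>a\<in>A. lt lam c a" using lt_Field1[OF c] lam.not_le assms(1) by blast
qed

lemma supr_eq_lub: "wo_rel.supr lam A = lub A"
  unfolding wo_rel.supr_def[OF lam.wo_rel] lub_def Above_def ..

lemma ex_upper:
  assumes "A \<subseteq> Field lam" "|A| \<le>o mu"
  shows "\<exists>b\<in>Field lam. \<forall>a\<in>A. (a, b) \<in> lam"
  using bounded[OF assms] lt_le[of _ lam] by fast

end

lemma succ_card_cardSuc:
  assumes "Card_order mu" "infinite (Field mu)"
  shows "succ_card mu (cardSuc mu)"
  using assms by unfold_locales (simp_all add: cardSuc_Card_order ordIso_refl)

section \<open>Positions of the game\<close>

text \<open>In contrast to \<open>played_pairs\<close> no last move is singled out, so that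
  positions without a last move are covered; they arise as unions at limit levels.\<close>

definition all_pairs :: "'l rel \<Rightarrow> 't rel \<Rightarrow> ('t, 'l, 'a, 'b) strategy \<Rightarrow>
    ('t, 'l, 'a, 'b) moves \<Rightarrow> ('a \<times> 'b) set" where
  "all_pairs lam t \<sigma> h = (\<Union>y\<in>dom h. round_pairs lam (the (h y)) (\<sigma> (h |` under t y)))"

text \<open>Inclusion of maps would be too weak: a new move below an old one changes the history on
  which the old answer depends. If all new moves come above the old ones, every earlier answer
  persists, see \<open>end_ext_restrict\<close>.\<close>

definition end_ext :: "'t rel \<Rightarrow> ('t \<rightharpoonup> 'c) \<Rightarrow> ('t \<rightharpoonup> 'c) \<Rightarrow> bool" where
  "end_ext t h h' \<longleftrightarrow> h \<subseteq>\<^sub>m h' \<and> (\<forall>y\<in>dom h' - dom h. \<forall>z\<in>dom h. lt t z y)"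

lemma end_ext_refl [simp]: "end_ext t h h"
  by (simp add: end_ext_def)

lemma end_ext_trans:
  assumes "end_ext t h h'" "end_ext t h' h''"
  shows "end_ext t h h''"
  unfolding end_ext_def
proof (intro conjI ballI)
  show "h \<subseteq>\<^sub>m h''" using assms map_le_trans by (auto simp: end_ext_def)
  fix y z assume "y \<in> dom h'' - dom h" "z \<in> dom h"
  then show "lt t z y" using assms map_le_implies_dom_le[of h h'] unfolding end_ext_def by blast
qed

lemma end_ext_restrict:
  assumes "well t" "end_ext t h h'" "y \<in> dom h"
  shows "h' |` under t y = h |` under t y"
proof
  fix z
  interpret well t by fact
  show "(h' |` under t y) z = (h |` under t y) z"
  proof (cases "z \<in> under t y \<and> z \<in> dom h'")
    case True
    have "z \<in> dom h"
    proof (rule ccontr)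
      assume "z \<notin> dom h"
      then have "lt t y z" using True assms unfolding end_ext_def by blast
      then show False using True asym by (auto simp: under_def)
    qed
    then show ?thesis using assms(2) True unfolding end_ext_def map_le_def by simp
  next
    case False
    then have "z \<in> under t y \<Longrightarrow> h z = None"
      using map_le_implies_dom_le[of h h'] assms(2) by (auto simp: end_ext_def)
    then show ?thesis using False by (auto simp: restrict_map_def)
  qed
qed

lemma all_pairs_mono:
  assumes "well t" "end_ext t h h'"
  shows "all_pairs lam t \<sigma> h \<subseteq> all_pairs lam t \<sigma> h'"
proof -
  have eq: "h' y = h y" "h' |` under t y = h |` under t y" if "y \<in> dom h" for y
    using end_ext_restrict[OF assms that] assms(2) that unfolding end_ext_def map_le_def by auto
  show ?thesis unfolding all_pairs_def
  proof (intro UN_least)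
    fix y assume y: "y \<in> dom h"
    then have "y \<in> dom h'" using eq(1) by (simp add: domIff)
    then show "round_pairs lam (the (h y)) (\<sigma> (h |` under t y)) \<subseteq>
      (\<Union>y\<in>dom h'. round_pairs lam (the (h' y)) (\<sigma> (h' |` under t y)))"
      unfolding eq[OF y, symmetric]
      by (intro UN_upper[of y "dom h'", THEN subset_trans[rotated]]) (simp_all add: eq[OF y])
  qed
qed

locale game =
  succ_card mu lam + t: well t
  for mu :: "'m rel" and lam :: "'l rel" and t :: "'t rel" +
  fixes A :: "'a rel" and B :: "'b rel" and \<sigma> :: "('t, 'l, 'a, 'b) strategy"
  assumes win: "winning_strategy lam t A B \<sigma>"
    and t_card: "|Field t| \<le>o mu"
begin

abbreviation "legal \<equiv> legal_moves lam t A B"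
abbreviation "pairs \<equiv> all_pairs lam t \<sigma>"

lemma wt: "well t" ..

text \<open>Of the two nodes at which the pairs were played, the later one has both pairs among its
  \<open>played_pairs\<close>, and there the winning condition applies.\<close>

lemma pairs_iso:
  assumes "legal h" "(a, b) \<in> pairs h" "(a', b') \<in> pairs h"
  shows "a \<in> Field A" "b \<in> Field B" "a = a' \<longleftrightarrow> b = b'" "lt A a a' \<longleftrightarrow> lt B b b'"
proof -
  obtain y y' where y: "y \<in> dom h" "(a, b) \<in> round_pairs lam (the (h y)) (\<sigma> (h |` under t y))"
    "y' \<in> dom h" "(a', b') \<in> round_pairs lam (the (h y')) (\<sigma> (h |` under t y'))"
    using assms unfolding all_pairs_def by blast
  have F: "y \<in> Field t" "y' \<in> Field t" using y assms(1) by (auto simp: legal_moves_def)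
  define z where "z = (if (y, y') \<in> t then y' else y)"
  have z: "z \<in> dom h" "y \<in> under t z" "y' \<in> under t z"
    using y F t.total[OF F] t.refl[OF F(1)] t.refl[OF F(2)] by (auto simp: z_def under_def)
  have "(a, b) \<in> played_pairs lam t \<sigma> h z" "(a', b') \<in> played_pairs lam t \<sigma> h z"
    using y z unfolding played_pairs_def by blast+
  moreover have "partial_isomorphism A B (played_pairs lam t \<sigma> h z)"
    using win assms(1) z(1) unfolding winning_strategy_def by simp
  ultimately show "a \<in> Field A" "b \<in> Field B" "a = a' \<longleftrightarrow> b = b'" "lt A a a' \<longleftrightarrow> lt B b b'"
    unfolding partial_isomorphism_def by auto
qed

lemma pairs_mono: "end_ext t h h' \<Longrightarrow> pairs h \<subseteq> pairs h'"
  using all_pairs_mono[OF wt] .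

lemma legal_upd:
  assumes "legal h" "b \<in> Field t" "dom h \<subseteq> underS t b" "legal_challenge lam A B c"
  shows "legal (h(b \<mapsto> c))" "end_ext t h (h(b \<mapsto> c))"
proof -
  have nb: "h b = None" using assms(3) by (auto simp: underS_def)
  have le: "\<And>x. x \<in> dom h \<Longrightarrow> (x, b) \<in> t" using assms(3) lt_le[of _ t b] by auto
  have "ran (h(b \<mapsto> c)) = insert c (ran h)" using nb by auto
  then show "legal (h(b \<mapsto> c))"
    using assms le t.refl[OF assms(2)] unfolding legal_moves_def by auto
  show "end_ext t h (h(b \<mapsto> c))" using nb assms(3) unfolding end_ext_def
    by (auto simp: map_le_def)
qed

text \<open>At most \<open>mu\<close> rounds with at most \<open>mu\<close> pairs each. This is why
  the indices of all elements occurring in one position are bounded below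
  \<open>lam\<close>.\<close>

lemma card_pairs: assumes "dom h \<subseteq> Field t" shows "|pairs h| \<le>o mu"
proof -
  have "|round_pairs lam c ans| \<le>o mu" for c :: "('l, 'a, 'b) challenge" and ans
  proof (cases c)
    case (Choose_left l f)
    have "round_pairs lam c ans = (\<lambda>\<beta>. (f \<beta>, fst ans \<beta>)) ` underS lam l"
      using Choose_left by auto
    then show ?thesis using image_le card_underS by metis
  next
    case (Choose_right l f)
    have "round_pairs lam c ans = (\<lambda>\<beta>. (snd ans \<beta>, f \<beta>)) ` underS lam l"
      using Choose_right by auto
    then show ?thesis using image_le card_underS by metis
  qed
  then show ?thesis unfolding all_pairs_def by (intro UN_le subset_le[OF t_card assms])
qed

text \<open>Repetitions are allowed in a challenge, so one length \<open>l\<close> of order type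
  \<open>mu\<close> serves all nonempty sets of size at most \<open>mu\<close>; the empty set is
  asked with length \<open>zero\<close>.\<close>

lemma ex_enumeration:
  assumes "X \<subseteq> F" "|X| \<le>o mu"
  shows "\<exists>l f. l \<in> Field lam \<and> f \<in> BNF_Wellorder_Constructions.Func (underS lam l) F \<and> f ` underS lam l = X"
proof (cases "X = {}")
  case True
  then show ?thesis using zero by (intro exI[of _ zero] exI[of _ "\<lambda>_. undefined"])
      (auto simp: BNF_Wellorder_Constructions.Func_def)
next
  case False
  obtain l where l: "l \<in> Field lam" "mu =o initial lam l" using big_initial by blast
  have "mu =o |underS lam l|"
    using card_of_cong[OF l(2)] card_of_Field_ordIso[OF mu(1)] lam.Field_initial
    by (metis ordIso_symmetric ordIso_transitive)
  then have "|X| \<le>o |underS lam l|" by (rule ordLeq_ordIso_trans[OF assms(2)])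
  then obtain g where g: "g ` underS lam l = X"
    using iffD2[OF card_of_ordLeq2[OF False, of "underS lam l"]] by metis
  have "(\<lambda>x. if x \<in> underS lam l then g x else undefined) ` underS lam l = X" using g by auto
  then show ?thesis using l(1) g assms(1)
    by (intro exI[of _ l] exI[of _ "\<lambda>x. if x \<in> underS lam l then g x else undefined"])
       (auto simp: BNF_Wellorder_Constructions.Func_def)
qed

definition left_challenge :: "'a set \<Rightarrow> ('l, 'a, 'b) challenge" where
  "left_challenge X = (SOME c. legal_challenge lam A B c \<and>
     (\<exists>l f. c = Choose_left l f \<and> f ` underS lam l = X))"

definition right_challenge :: "'b set \<Rightarrow> ('l, 'a, 'b) challenge" where
  "right_challenge Y = (SOME c. legal_challenge lam A B c \<and>
     (\<exists>l f. c = Choose_right l f \<and> f ` underS lam l = Y))"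

lemma left_challenge:
  assumes "X \<subseteq> Field A" "|X| \<le>o mu"
  shows "legal_challenge lam A B (left_challenge X)"
    and "a \<in> X \<Longrightarrow> \<exists>b. (a, b) \<in> round_pairs lam (left_challenge X) ans"
proof -
  have ex: "\<exists>c. legal_challenge lam A B c \<and> (\<exists>l f. c = Choose_left l f \<and> f ` underS lam l = X)"
    using ex_enumeration[OF assms] by (metis legal_challenge.simps(1))
  note * = someI_ex[OF ex, folded left_challenge_def]
  show "legal_challenge lam A B (left_challenge X)" using * by blast
  obtain l f where "left_challenge X = Choose_left l f" "f ` underS lam l = X" using * by blast
  then show "a \<in> X \<Longrightarrow> \<exists>b. (a, b) \<in> round_pairs lam (left_challenge X) ans" by auto
qed

lemma right_challenge:
  assumes "Y \<subseteq> Field B" "|Y| \<le>o mu"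
  shows "legal_challenge lam A B (right_challenge Y)"
    and "b \<in> Y \<Longrightarrow> \<exists>a. (a, b) \<in> round_pairs lam (right_challenge Y) ans"
proof -
  have ex: "\<exists>c. legal_challenge lam A B c \<and> (\<exists>l f. c = Choose_right l f \<and> f ` underS lam l = Y)"
    using ex_enumeration[OF assms] by (metis legal_challenge.simps(2))
  note * = someI_ex[OF ex, folded right_challenge_def]
  show "legal_challenge lam A B (right_challenge Y)" using * by blast
  obtain l f where "right_challenge Y = Choose_right l f" "f ` underS lam l = Y" using * by blast
  then show "b \<in> Y \<Longrightarrow> \<exists>a. (a, b) \<in> round_pairs lam (right_challenge Y) ans" by auto
qed

lemma round_in_pairs: "h y = Some c \<Longrightarrow> round_pairs lam c (\<sigma> (h |` under t y)) \<subseteq> pairs h"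
  unfolding all_pairs_def by force

lemma play_left:
  assumes "legal h" "b \<in> Field t" "dom h \<subseteq> underS t b" "X \<subseteq> Field A" "|X| \<le>o mu"
  shows "\<exists>h'. legal h' \<and> end_ext t h h' \<and> dom h' = insert b (dom h) \<and> (\<forall>x\<in>X. \<exists>y. (x, y) \<in> pairs h')"
proof (intro exI[of _ "h(b \<mapsto> left_challenge X)"] conjI ballI)
  let ?h = "h(b \<mapsto> left_challenge X)"
  show "legal ?h" "end_ext t h ?h" using legal_upd[OF assms(1-3) left_challenge(1)[OF assms(4,5)]] .
  fix x assume "x \<in> X"
  then show "\<exists>y. (x, y) \<in> pairs ?h"
    using left_challenge(2)[OF assms(4,5), of x "\<sigma> (?h |` under t b)"]
      subsetD[OF round_in_pairs[of ?h b "left_challenge X"]] by (metis fun_upd_same)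
qed simp

lemma play_right:
  assumes "legal h" "b \<in> Field t" "dom h \<subseteq> underS t b" "Y \<subseteq> Field B" "|Y| \<le>o mu"
  shows "\<exists>h'. legal h' \<and> end_ext t h h' \<and> dom h' = insert b (dom h) \<and> (\<forall>y\<in>Y. \<exists>x. (x, y) \<in> pairs h')"
proof (intro exI[of _ "h(b \<mapsto> right_challenge Y)"] conjI ballI)
  let ?h = "h(b \<mapsto> right_challenge Y)"
  show "legal ?h" "end_ext t h ?h" using legal_upd[OF assms(1-3) right_challenge(1)[OF assms(4,5)]] .
  fix y assume "y \<in> Y"
  then show "\<exists>x. (x, y) \<in> pairs ?h"
    using right_challenge(2)[OF assms(4,5), of y "\<sigma> (?h |` under t b)"]
      subsetD[OF round_in_pairs[of ?h b "right_challenge Y"]] by (metis fun_upd_same)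
qed simp

end

subsection \<open>Exchanging the two structures\<close>

text \<open>The construction at a level gives an injection from the left successors to the right
  ones. The exchanged game turns it into one from right to left.\<close>

fun flip :: "('l, 'a, 'b) challenge \<Rightarrow> ('l, 'b, 'a) challenge" where
  "flip (Choose_left l f) = Choose_right l f"
| "flip (Choose_right l f) = Choose_left l f"

definition flip_moves :: "('t, 'l, 'a, 'b) moves \<Rightarrow> ('t, 'l, 'b, 'a) moves" where
  "flip_moves h = map_option flip \<circ> h"

definition flip_strategy :: "('t, 'l, 'a, 'b) strategy \<Rightarrow> ('t, 'l, 'b, 'a) strategy" where
  "flip_strategy \<sigma> h = prod.swap (\<sigma> (flip_moves h))"

lemma flip_flip [simp]: "flip (flip c) = c"
  by (cases c) auto

lemma flip_moves_flip [simp]: "flip_moves (flip_moves h) = h"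
  by (auto simp: flip_moves_def fun_eq_iff option.map_comp comp_def option.map_ident)

lemma dom_flip [simp]: "dom (flip_moves h) = dom h"
  by (auto simp: flip_moves_def)

lemma flip_restrict: "flip_moves (h |` S) = flip_moves h |` S"
  by (auto simp: flip_moves_def restrict_map_def)

lemma legal_flip_challenge [simp]: "legal_challenge lam B A (flip c) = legal_challenge lam A B c"
  by (cases c) auto

lemma round_flip: "round_pairs lam (flip c) (prod.swap ans) = (round_pairs lam c ans)\<inverse>"
  by (cases c) auto

lemma legal_flip [simp]: "legal_moves lam t B A (flip_moves h) = legal_moves lam t A B h"
proof -
  have "ran (flip_moves h) = flip ` ran h"
    by (auto simp: flip_moves_def ran_def image_iff)
  then show ?thesis unfolding legal_moves_def by simp
qed

lemma end_ext_flip [simp]: "end_ext t (flip_moves h) (flip_moves h') = end_ext t h h'"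
proof -
  have "g \<subseteq>\<^sub>m g' \<Longrightarrow> flip_moves g \<subseteq>\<^sub>m flip_moves g'" for g g' :: "('a, 'e, 'f, 'g) moves"
    by (auto simp: map_le_def flip_moves_def dom_def)
  moreover have "g \<subseteq>\<^sub>m g' \<Longrightarrow> flip_moves g \<subseteq>\<^sub>m flip_moves g'" for g g' :: "('a, 'e, 'g, 'f) moves"
    by (auto simp: map_le_def flip_moves_def dom_def)
  ultimately have "flip_moves h \<subseteq>\<^sub>m flip_moves h' \<longleftrightarrow> h \<subseteq>\<^sub>m h'" by (metis flip_moves_flip)
  then show ?thesis unfolding end_ext_def by simp
qed

lemma flip_round:
  assumes "y \<in> dom h"
  shows "round_pairs lam (the (flip_moves h y)) (flip_strategy \<sigma> (flip_moves h |` S)) =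
    (round_pairs lam (the (h y)) (\<sigma> (h |` S)))\<inverse>"
proof -
  obtain c where "h y = Some c" using assms by blast
  moreover have "flip_strategy \<sigma> (flip_moves h |` S) = prod.swap (\<sigma> (h |` S))"
    unfolding flip_strategy_def flip_restrict[symmetric] by simp
  ultimately show ?thesis by (simp add: round_flip) (simp add: flip_moves_def round_flip)
qed

lemma all_pairs_flip: "all_pairs lam t (flip_strategy \<sigma>) (flip_moves h) = (all_pairs lam t \<sigma> h)\<inverse>"
  unfolding all_pairs_def dom_flip converse_UNION using flip_round[of _ h lam \<sigma>] by (intro SUP_cong) auto

lemma winning_flip:
  assumes "winning_strategy lam t A B \<sigma>"
  shows "winning_strategy lam t B A (flip_strategy \<sigma>)"
  unfolding winning_strategy_def
proof (intro allI impI ballI)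
  fix h x
  assume h: "legal_moves lam t B A h" "x \<in> dom h"
  have "played_pairs lam t (flip_strategy \<sigma>) h x = (played_pairs lam t \<sigma> (flip_moves h) x)\<inverse>"
    using flip_round[of _ "flip_moves h" lam \<sigma>] unfolding played_pairs_def converse_UNION
    by (intro SUP_cong) auto
  moreover have "partial_isomorphism A B (played_pairs lam t \<sigma> (flip_moves h) x)"
    using assms h unfolding winning_strategy_def by simp
  ultimately show "partial_isomorphism B A (played_pairs lam t (flip_strategy \<sigma>) h x)"
    unfolding partial_isomorphism_def by auto
qed

lemma (in game) game_flip: "game mu lam t B A (flip_strategy \<sigma>)"
  using winning_flip[OF win] t_card by unfold_locales

section \<open>Strategies given by relations\<close>

fun left_elems :: "'l rel \<Rightarrow> ('l, 'a, 'b) challenge \<Rightarrow> 'a set" where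
  "left_elems lam (Choose_left l f) = f ` underS lam l"
| "left_elems lam (Choose_right l f) = {}"

fun right_elems :: "'l rel \<Rightarrow> ('l, 'a, 'b) challenge \<Rightarrow> 'b set" where
  "right_elems lam (Choose_left l f) = {}"
| "right_elems lam (Choose_right l f) = f ` underS lam l"

lemma partial_isomorphism_subset:
  assumes "partial_isomorphism A B p" "q \<subseteq> p"
  shows "partial_isomorphism A B q"
proof -
  have "q \<subseteq> Field A \<times> Field B" using assms by (auto simp: partial_isomorphism_def)
  moreover have "(a = a' \<longleftrightarrow> b = b') \<and> (lt A a a' \<longleftrightarrow> lt B b b')" if "(a, b) \<in> q" "(a', b') \<in> q" for a b a' b'
    using assms(1) subsetD[OF assms(2) that(1)] subsetD[OF assms(2) that(2)]
    unfolding partial_isomorphism_def by auto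
  ultimately show ?thesis unfolding partial_isomorphism_def by (simp add: split_beta)
qed

text \<open>\<open>R\<close> is the relation from which answers are taken at a position, while
  \<open>P\<close> is attached to a whole history. The relation may change in the course of the
  play; \<open>sub\<close> demands that a pair answered earlier still belongs to the partial
  isomorphism of the longer history.\<close>

lemma game_equivI:
  assumes "well t"
    and left: "\<And>h x a. legal_moves lam t A B h \<Longrightarrow> x \<in> dom h \<Longrightarrow> a \<in> left_elems lam (the (h x)) \<Longrightarrow>
      \<exists>b. (a, b) \<in> R (h |` under t x)"
    and right: "\<And>h x b. legal_moves lam t A B h \<Longrightarrow> x \<in> dom h \<Longrightarrow> b \<in> right_elems lam (the (h x)) \<Longrightarrow>
      \<exists>a. (a, b) \<in> R (h |` under t x)"
    and iso: "\<And>h. legal_moves lam t A B h \<Longrightarrow> partial_isomorphism A B (P h)"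
    and sub: "\<And>h x a b. legal_moves lam t A B h \<Longrightarrow> x \<in> dom h \<Longrightarrow> (a, b) \<in> R (h |` under t x) \<Longrightarrow>
      a \<in> left_elems lam (the (h x)) \<or> b \<in> right_elems lam (the (h x)) \<Longrightarrow> (a, b) \<in> P h"
  shows "game_equiv lam t A B"
proof -
  interpret well t by fact
  \<comment> \<open>The current move sits at the largest node of the history. The component of the
    answer that the round does not read is \<open>undefined\<close>.\<close>
  define \<sigma> where
    "\<sigma> h = (case h (SOME x. x \<in> dom h \<and> (\<forall>y\<in>dom h. (y, x) \<in> t)) of
         Some (Choose_left l s) \<Rightarrow> (\<lambda>\<beta>. SOME b. (s \<beta>, b) \<in> R h, undefined)
       | Some (Choose_right l s) \<Rightarrow> (undefined, \<lambda>\<beta>. SOME a. (a, s \<beta>) \<in> R h) | None \<Rightarrow> undefined)" for h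
  have graph: "round_pairs lam (the (h y)) (\<sigma> (h |` under t y)) \<subseteq> P h"
    if h: "legal_moves lam t A B h" "y \<in> dom h" for h y
  proof -
    have yF: "y \<in> Field t" using h by (auto simp: legal_moves_def)
    let ?h = "h |` under t y"
    have dom: "dom ?h = dom h \<inter> under t y" by (auto simp: restrict_map_def split: if_splits)
    have yu: "y \<in> under t y" using refl[OF yF] by (simp add: under_def)
    have "(SOME x. x \<in> dom ?h \<and> (\<forall>y\<in>dom ?h. (y, x) \<in> t)) = y"
    proof (rule some_equality)
      show "y \<in> dom ?h \<and> (\<forall>z\<in>dom ?h. (z, y) \<in> t)"
        using h yu unfolding dom by (auto simp: under_def)
      fix x assume "x \<in> dom ?h \<and> (\<forall>y\<in>dom ?h. (y, x) \<in> t)"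
      then show "x = y" using h yu antisym unfolding dom by (auto simp: under_def)
    qed
    then have \<sigma>: "\<sigma> ?h = (case h y of
         Some (Choose_left l s) \<Rightarrow> (\<lambda>\<beta>. SOME b. (s \<beta>, b) \<in> R ?h, undefined)
       | Some (Choose_right l s) \<Rightarrow> (undefined, \<lambda>\<beta>. SOME a. (a, s \<beta>) \<in> R ?h) | None \<Rightarrow> undefined)"
      unfolding \<sigma>_def using yu by simp
    obtain c where c: "h y = Some c" using h by blast
    show ?thesis
    proof (cases c)
      case (Choose_left l s)
      have "(s \<beta>, SOME b. (s \<beta>, b) \<in> R ?h) \<in> P h" if "\<beta> \<in> underS lam l" for \<beta>
      proof (rule sub[OF h])
        have el: "s \<beta> \<in> left_elems lam (the (h y))" using c Choose_left that by simp
        then show "s \<beta> \<in> left_elems lam (the (h y)) \<or> (SOME b. (s \<beta>, b) \<in> R ?h) \<in> right_elems lam (the (h y))" ..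
        show "(s \<beta>, SOME b. (s \<beta>, b) \<in> R ?h) \<in> R ?h" using someI_ex[OF left[OF h el]] .
      qed
      then show ?thesis unfolding \<sigma> c Choose_left by auto
    next
      case (Choose_right l s)
      have "(SOME a. (a, s \<beta>) \<in> R ?h, s \<beta>) \<in> P h" if "\<beta> \<in> underS lam l" for \<beta>
      proof (rule sub[OF h])
        have el: "s \<beta> \<in> right_elems lam (the (h y))" using c Choose_right that by simp
        then show "(SOME a. (a, s \<beta>) \<in> R ?h) \<in> left_elems lam (the (h y)) \<or> s \<beta> \<in> right_elems lam (the (h y))" ..
        show "(SOME a. (a, s \<beta>) \<in> R ?h, s \<beta>) \<in> R ?h" using someI_ex[OF right[OF h el]] .
      qed
      then show ?thesis unfolding \<sigma> c Choose_right by auto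
    qed
  qed
  have "winning_strategy lam t A B \<sigma>" unfolding winning_strategy_def
  proof (intro allI impI ballI)
    fix h x
    assume h: "legal_moves lam t A B h" "x \<in> dom h"
    have "played_pairs lam t \<sigma> h x \<subseteq> P h"
      unfolding played_pairs_def using graph[OF h(1)] by blast
    then show "partial_isomorphism A B (played_pairs lam t \<sigma> h x)"
      by (rule partial_isomorphism_subset[OF iso[OF h(1)]])
  qed
  then show ?thesis unfolding game_equiv_def by blast
qed

lemma legal_elems:
  assumes "legal_moves lam t A B h" "x \<in> dom h"
  shows "left_elems lam (the (h x)) \<subseteq> Field A" "right_elems lam (the (h x)) \<subseteq> Field B"
proof -
  obtain c where c: "h x = Some c" using assms by blast
  then have "legal_challenge lam A B c" using assms by (auto simp: legal_moves_def ran_def)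
  then show "left_elems lam (the (h x)) \<subseteq> Field A" "right_elems lam (the (h x)) \<subseteq> Field B"
    unfolding c by (cases c; auto simp: BNF_Wellorder_Constructions.Func_def)+
qed

lemma isomorphic_game_equiv:
  assumes "well t" "isomorphic A B"
  shows "game_equiv lam t A B"
proof -
  obtain f where f: "bij_betw f (Field A) (Field B)"
    "\<And>x y. x \<in> Field A \<Longrightarrow> y \<in> Field A \<Longrightarrow> lt A x y \<longleftrightarrow> lt B (f x) (f y)"
    using assms unfolding isomorphic_def by blast
  let ?P = "{(a, f a) | a. a \<in> Field A}"
  show ?thesis
  proof (rule game_equivI[OF assms(1), where R = "\<lambda>_. ?P" and P = "\<lambda>_. ?P"])
    show "partial_isomorphism A B ?P"
      using f by (auto simp: partial_isomorphism_def bij_betw_def inj_on_def)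
  qed (use legal_elems f(1) in \<open>fastforce simp: bij_betw_def\<close>)+
qed

section \<open>Ordinals as order types\<close>

text \<open>Otherwise composition with an embedding of \<open>s\<close> below some \<open>b\<close>
  is a strictly increasing map of \<open>r\<close> into itself that moves \<open>b\<close> down,
  whereas such a map is never below the identity.\<close>

lemma strict_mono_ordLeq:
  assumes "Well_order r" "Well_order s"
    and f: "\<And>x. x \<in> Field r \<Longrightarrow> f x \<in> Field s" "\<And>x y. lt r x y \<Longrightarrow> lt s (f x) (f y)"
  shows "r \<le>o s"
proof (rule ccontr)
  interpret r: well r using assms by unfold_locales
  assume "\<not> ?thesis"
  then have "s <o r" using not_ordLeq_iff_ordLess[OF assms(2,1)] by simp
  then obtain j b where j: "b \<in> Field r" "\<forall>x\<in>Field s. lt r (j x) b" "\<forall>x y. lt s x y \<longrightarrow> lt r (j x) (j y)"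
    using strict_embedding_less by metis
  have "(x, j (f x)) \<in> r" if "x \<in> Field r" for x
    using that
  proof (induct x rule: r.induct)
    case (less x)
    have jF: "j (f x) \<in> Field r" using j(2) f(1)[OF less(1)] lt_Field1[of _ r b] by metis
    show ?case
    proof (rule ccontr)
      assume "(x, j (f x)) \<notin> r"
      then have *: "lt r (j (f x)) x" using r.not_le[OF less(1) jF] by simp
      then have "lt r (j (f (j (f x)))) (j (f x))" using f(2) j(3) by simp
      then show False using less(2)[OF *] r.asym by simp
    qed
  qed
  then have "(b, j (f b)) \<in> r" "lt r (j (f b)) b" using j f(1) by auto
  then show False using r.asym by simp
qed

context well begin

lemma Restr_ordLeq: "A \<subseteq> B \<Longrightarrow> B \<subseteq> Field r \<Longrightarrow> Restr r A \<le>o Restr r B"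
  by (rule strict_mono_ordLeq[of _ _ id, OF Well_order_Restr' Well_order_Restr'])
    (auto simp: Field_Restr lt_Restr)

lemma well_Restr: "well (Restr r A)"
  using Well_order_Restr' by unfold_locales

lemma initial_Restr: "d \<in> D \<Longrightarrow> initial (Restr r D) d = Restr r (D \<inter> underS r d)"
  by (auto simp: initial_def lt_Restr)

lemma Restr_underS_ordLeq: "Restr r (D \<inter> underS r d) \<le>o initial r d"
  unfolding initial_def by (rule Restr_ordLeq) (auto dest: lt_Field1)

lemma ordLess_initial_lt:
  assumes "s <o initial r b" "b \<in> Field r"
  shows "\<exists>a. lt r a b \<and> s =o initial r a"
proof -
  obtain a where a: "a \<in> Field r" "s =o initial r a"
    using ordLess_initial[OF ordLess_transitive[OF assms(1) initial_lt[OF assms(2)]]] by auto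
  then have "initial r a <o initial r b" using assms(1) ordIso_ordLess_trans ordIso_symmetric by metis
  then show ?thesis using a initial_less_iff assms(2) by auto
qed

text \<open>The position of \<open>d\<close> in the increasing enumeration of \<open>D\<close>, as
  an element of \<open>r\<close>. It depends only on the part of \<open>D\<close> below
  \<open>d\<close>; this is what makes a play along an initial segment of \<open>D\<close> an
  initial part of the play along \<open>D\<close>.\<close>

definition rk :: "'a set \<Rightarrow> 'a \<Rightarrow> 'a" where
  "rk D d = (THE a. a \<in> Field r \<and> Restr r (D \<inter> underS r d) =o initial r a)"

lemma rk:
  assumes "d \<in> Field r"
  shows "rk D d \<in> Field r" "Restr r (D \<inter> underS r d) =o initial r (rk D d)"
proof -
  have "Restr r (D \<inter> underS r d) <o r"
    using Restr_underS_ordLeq initial_lt[OF assms] ordLeq_ordLess_trans by metis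
  then obtain a where a: "a \<in> Field r" "Restr r (D \<inter> underS r d) =o initial r a"
    using ordLess_initial by metis
  have "\<exists>!a. a \<in> Field r \<and> Restr r (D \<inter> underS r d) =o initial r a"
  proof (rule ex1I[of _ a])
    fix c assume c: "c \<in> Field r \<and> Restr r (D \<inter> underS r d) =o initial r c"
    then have "initial r c =o initial r a" using a(2) ordIso_symmetric ordIso_transitive by metis
    then show "c = a" using initial_inj c a by simp
  qed (use a in simp)
  from theI'[OF this] show "rk D d \<in> Field r" "Restr r (D \<inter> underS r d) =o initial r (rk D d)"
    unfolding rk_def by auto
qed

lemma rk_unique: "d \<in> Field r \<Longrightarrow> a \<in> Field r \<Longrightarrow> Restr r (D \<inter> underS r d) =o initial r a \<Longrightarrow> rk D d = a"
  using rk[of d D] initial_inj ordIso_symmetric ordIso_transitive by metis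

lemma rk_mono:
  assumes "D \<subseteq> Field r" "d \<in> D" "d' \<in> D" "lt r d d'"
  shows "lt r (rk D d) (rk D d')"
proof -
  interpret s: well "Restr r D" by (rule well_Restr)
  have d: "d \<in> Field r" "d' \<in> Field r" using assms by auto
  have "initial (Restr r D) d <o initial (Restr r D) d'"
    using assms by (intro s.initial_less) (simp add: lt_Restr)
  then have "Restr r (D \<inter> underS r d) <o Restr r (D \<inter> underS r d')" using initial_Restr assms by simp
  then have "initial r (rk D d) <o initial r (rk D d')"
    using rk[OF d(1)] rk[OF d(2)] ordIso_ordLess_trans ordLess_ordIso_trans ordIso_symmetric by metis
  then show ?thesis using initial_less_iff rk d by simp
qed

lemma rk_cong: "D' \<inter> underS r d = D \<inter> underS r d \<Longrightarrow> rk D' d = rk D d"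
  by (simp add: rk_def)

lemma rk_range:
  assumes "D \<subseteq> Field r" "Restr r D =o initial r \<gamma>" "\<gamma> \<in> Field r"
  shows rk_bound: "d \<in> D \<Longrightarrow> lt r (rk D d) \<gamma>"
    and rk_surj: "lt r i \<gamma> \<Longrightarrow> \<exists>d\<in>D. rk D d = i"
proof -
  interpret s: well "Restr r D" by (rule well_Restr)
  have F: "Field (Restr r D) = D" using Field_Restr assms by simp
  {
    assume d: "d \<in> D"
    then have dF: "d \<in> Field r" using assms by auto
    have "initial (Restr r D) d <o Restr r D" using s.initial_lt d F by simp
    then have "Restr r (D \<inter> underS r d) <o initial r \<gamma>"
      using initial_Restr[OF d] assms(2) ordLess_ordIso_trans by metis
    then have "initial r (rk D d) <o initial r \<gamma>"
      using rk(2)[OF dF] ordIso_ordLess_trans ordIso_symmetric by metis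
    then show "lt r (rk D d) \<gamma>" using initial_less_iff rk(1)[OF dF] assms by simp
  }
  assume i: "lt r i \<gamma>"
  then have "initial r i <o Restr r D"
    using initial_less assms(2) ordLess_ordIso_trans ordIso_symmetric by metis
  then obtain d where d: "d \<in> D" "initial r i =o initial (Restr r D) d"
    using s.ordLess_initial F by auto
  then have "Restr r (D \<inter> underS r d) =o initial r i" using initial_Restr ordIso_symmetric by metis
  then have "rk D d = i" using rk_unique lt_Field1[OF i] d assms by auto
  then show "\<exists>d\<in>D. rk D d = i" using d by auto
qed

end

lemma cofinality_exists:
  assumes "cofinal K0 r" "K0 \<subseteq> Field r"
  shows "\<exists>K. K \<subseteq> Field r \<and> cofinal K r \<and> cofinality r = |K| \<and>
    (\<forall>K'. K' \<subseteq> Field r \<and> cofinal K' r \<longrightarrow> |K| \<le>o |K'| )"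
proof -
  let ?R = "{|K| | K. K \<subseteq> Field r \<and> cofinal K r}"
  have "\<exists>c\<in>?R. \<forall>c'\<in>?R. c \<le>o c'"
    using assms by (intro exists_minim_Card_order) (auto simp: card_of_Card_order)
  then have "\<exists>c K. K \<subseteq> Field r \<and> cofinal K r \<and> c = |K| \<and>
    (\<forall>K'. K' \<subseteq> Field r \<and> cofinal K' r \<longrightarrow> |K| \<le>o |K'| )" by auto
  from someI_ex[OF this] show ?thesis unfolding cofinality_def by auto
qed

context succ_card begin

lemma omega_limit:
  assumes "\<And>n. lt lam (s n) (s (Suc n))"
  shows "lub (range s) \<in> Field lam" "lt lam (s n) (lub (range s))"
    "lt lam c (lub (range s)) \<Longrightarrow> \<exists>n. lt lam c (s n)" "is_limit lam (lub (range s))"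
proof -
  have sF: "range s \<subseteq> Field lam" using lt_Field1[OF assms] by auto
  have "|range s| \<le>o mu"
    by (rule image_le) (use mu infinite_iff_card_of_nat[of "Field mu"] card_of_Field_ordIso[OF mu(1)]
        ordLeq_ordIso_trans in metis)
  then obtain u where u: "u \<in> Field lam" "\<And>a. a \<in> range s \<Longrightarrow> (a, u) \<in> lam"
    using ex_upper[OF sF] by auto
  show F: "lub (range s) \<in> Field lam" using lub_Field[OF sF u] .
  have up: "(s n, lub (range s)) \<in> lam" for n using lub_upper[OF sF u] by simp
  show lts: "lt lam (s n) (lub (range s))" for n using lam.ltle[OF assms up] .
  show ex: "lt lam c (lub (range s)) \<Longrightarrow> \<exists>n. lt lam c (s n)" for c using lt_lub[OF sF u, of c] by auto
  show "is_limit lam (lub (range s))" unfolding is_limit_def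
    using F lts ex by (metis empty_iff)
qed

text \<open>The ideal makes a promise only at ordinals larger than their cofinality. Beyond
  \<open>mu\<close> this always holds, as cofinalities of ordinals below \<open>lam\<close> are at
  most \<open>mu\<close>.\<close>

lemma cofinality_initial:
  assumes "is_limit lam \<epsilon>" "mu =o initial lam m" "lt lam m \<epsilon>"
  shows "cofinality (initial lam \<epsilon>) <o initial lam \<epsilon>"
proof -
  have "cofinal (Field (initial lam \<epsilon>)) (initial lam \<epsilon>)" unfolding cofinal_def lam.Field_initial
  proof
    fix a assume "a \<in> underS lam \<epsilon>"
    then obtain b where "b \<in> underS lam \<epsilon>" "a \<in> underS lam b" using assms(1) by (auto simp: is_limit_def)
    then show "\<exists>b\<in>underS lam \<epsilon>. a \<noteq> b \<and> (a, b) \<in> initial lam \<epsilon>"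
      using \<open>a \<in> underS lam \<epsilon>\<close> unfolding initial_def by (intro bexI[of _ b]) (auto simp: lt_iff)
  qed
  from cofinality_exists[OF this subset_refl] have "cofinality (initial lam \<epsilon>) \<le>o |underS lam \<epsilon>|"
    using card_of_mono1 lam.Field_initial by metis
  also have "|underS lam \<epsilon>| \<le>o mu" by (rule card_underS)
  also (ordLeq_transitive) have "mu =o initial lam m" by fact
  also (ordLeq_ordIso_trans) have "initial lam m <o initial lam \<epsilon>" using lam.initial_less assms by simp
  finally show ?thesis .
qed

end

section \<open>Matching the successors of two nodes\<close>

definition children :: "'a rel \<Rightarrow> 'a \<Rightarrow> 'a set" where
  "children T x = {y \<in> Field T. immediate_pred T x y}"

text \<open>A node strictly between parent and child on one side could be asked at \<open>b\<close>,
  and its answer would lie strictly between on the other side. So one free move is all that is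
  needed.\<close>

lemma (in game) child_match:
  assumes "legal h" "(x, y) \<in> pairs h" "(x', y') \<in> pairs h" "b \<in> Field t" "dom h \<subseteq> underS t b"
  shows "x' \<in> children A x \<longleftrightarrow> y' \<in> children B y"
proof -
  note iso = pairs_iso[OF assms(1)]
  have F: "x' \<in> Field A" "y' \<in> Field B" using iso(1,2)[OF assms(3,3)] by auto
  have lt: "lt A x x' \<longleftrightarrow> lt B y y'" using iso(4)[OF assms(2,3)] .
  have "(\<exists>z. lt A x z \<and> lt A z x') \<longleftrightarrow> (\<exists>z. lt B y z \<and> lt B z y')"
  proof
    assume "\<exists>z. lt A x z \<and> lt A z x'"
    then obtain z where z: "lt A x z" "lt A z x'" by auto
    then have "{z} \<subseteq> Field A" using lt_Field1 by fastforce
    then obtain h' where h': "legal h'" "end_ext t h h'" "\<forall>x\<in>{z}. \<exists>y. (x, y) \<in> pairs h'"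
      using play_left[OF assms(1,4,5), of "{z}"] finite_le[of "{z}"] by auto
    then obtain w where w: "(z, w) \<in> pairs h'" by auto
    have "(x, y) \<in> pairs h'" "(x', y') \<in> pairs h'" using pairs_mono[OF h'(2)] assms by auto
    then show "\<exists>z. lt B y z \<and> lt B z y'" using pairs_iso(4)[OF h'(1)] w z by metis
  next
    assume "\<exists>z. lt B y z \<and> lt B z y'"
    then obtain z where z: "lt B y z" "lt B z y'" by auto
    then have "{z} \<subseteq> Field B" using lt_Field1 by fastforce
    then obtain h' where h': "legal h'" "end_ext t h h'" "\<forall>x\<in>{z}. \<exists>y. (y, x) \<in> pairs h'"
      using play_right[OF assms(1,4,5), of "{z}"] finite_le[of "{z}"] by auto
    then obtain w where w: "(w, z) \<in> pairs h'" by auto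
    have "(x, y) \<in> pairs h'" "(x', y') \<in> pairs h'" using pairs_mono[OF h'(2)] assms by auto
    then show "\<exists>z. lt A x z \<and> lt A z x'" using pairs_iso(4)[OF h'(1)] w z by metis
  qed
  then show ?thesis unfolding children_def immediate_pred_def using F lt by auto
qed

text \<open>
  Room for one level: above \<open>b\<close> there is, for every ordinal \<open>\<gamma> < \<lambda>\<close>, a copy of a cofinal subset
  of \<open>\<gamma>\<close>, and after that arbitrarily many finite continuations inside \<open>Q\<close>.
\<close>

definition room :: "'t rel \<Rightarrow> 'l rel \<Rightarrow> 't \<Rightarrow> 't set \<Rightarrow> bool" where
  "room t lam b Q \<longleftrightarrow> Q \<subseteq> Field t \<and> (\<forall>q\<in>Q. \<exists>q'\<in>Q. lt t q q') \<and>
     (\<forall>\<gamma>\<in>Field lam. \<exists>e j. \<exists>q\<in>Q. e \<subseteq> underS lam \<gamma> \<and> (\<forall>i\<in>underS lam \<gamma>. \<exists>i'\<in>e. (i, i') \<in> lam) \<and>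
        (\<forall>i\<in>e. (b, j i) \<in> t \<and> lt t (j i) q) \<and>
        (\<forall>i\<in>e. \<forall>i'\<in>e. lt lam i i' \<longrightarrow> lt t (j i) (j i')) \<and> (b, q) \<in> t)"

locale level = game mu lam t A B \<sigma>
  for mu :: "'m rel" and lam :: "'l rel" and t :: "'t rel" and A :: "'a rel" and B :: "'b rel"
    and \<sigma> :: "('t, 'l, 'a, 'b) strategy" +
  fixes h0 :: "('t, 'l, 'a, 'b) moves" and b :: 't and Q :: "'t set" and x :: 'a and y :: 'b
  assumes h0: "legal h0" "dom h0 \<subseteq> underS t b" "b \<in> Field t" "(x, y) \<in> pairs h0"
    and room: "room t lam b Q"
    and card_children: "|children A x| \<le>o lam" "|children B y| \<le>o lam"
    and ideal: "Field lam \<in> approachability_ideal lam"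
begin

text \<open>Each pair may have its own play. The plays for different successors need not be
  compatible, since only positions along one branch are ever united.\<close>

definition realized :: "('a \<times> 'b) \<Rightarrow> bool" where
  "realized c \<longleftrightarrow> (\<exists>h. \<exists>q\<in>Q. legal h \<and> end_ext t h0 h \<and> dom h \<subseteq> underS t q \<and> c \<in> pairs h)"

abbreviation "X \<equiv> children A x"
abbreviation "Y \<equiv> children B y"

lemma Q: "q \<in> Q \<Longrightarrow> q \<in> Field t" "q \<in> Q \<Longrightarrow> \<exists>q'\<in>Q. lt t q q'"
  using room by (auto simp: room_def)

lemma card_lam: "|Field lam| =o lam"
  using card_of_Field_ordIso[OF lam_card] .

lemma ex_index: "|Z| \<le>o lam \<Longrightarrow> \<exists>f. inj_on f Z \<and> f ` Z \<subseteq> Field lam"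
  using card_of_ordLeq[of Z "Field lam"] ordLeq_ordIso_trans ordIso_symmetric[OF card_lam] by metis

definition "ix = (SOME f. inj_on f X \<and> f ` X \<subseteq> Field lam)"
definition "iy = (SOME f. inj_on f Y \<and> f ` Y \<subseteq> Field lam)"

lemma ix: "inj_on ix X" "x' \<in> X \<Longrightarrow> ix x' \<in> Field lam"
  using someI_ex[OF ex_index[OF card_children(1)]] unfolding ix_def by auto

lemma iy: "inj_on iy Y" "y' \<in> Y \<Longrightarrow> iy y' \<in> Field lam"
  using someI_ex[OF ex_index[OF card_children(2)]] unfolding iy_def by auto

definition "Xb \<epsilon> = {x' \<in> X. lt lam (ix x') \<epsilon>}"
definition "Yb \<epsilon> = {y' \<in> Y. lt lam (iy y') \<epsilon>}"

lemma Xb: "Xb \<epsilon> \<subseteq> Field A" "|Xb \<epsilon>| \<le>o mu"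
proof -
  show "Xb \<epsilon> \<subseteq> Field A" by (auto simp: Xb_def children_def)
  have "inj_on ix (Xb \<epsilon>)" "ix ` Xb \<epsilon> \<subseteq> underS lam \<epsilon>"
    using ix inj_on_subset[of ix X "Xb \<epsilon>"] by (auto simp: Xb_def)
  then show "|Xb \<epsilon>| \<le>o mu" using card_of_ordLeq[of "Xb \<epsilon>" "underS lam \<epsilon>"] card_underS ordLeq_transitive by metis
qed

lemma Yb: "Yb \<epsilon> \<subseteq> Field B" "|Yb \<epsilon>| \<le>o mu"
proof -
  show "Yb \<epsilon> \<subseteq> Field B" by (auto simp: Yb_def children_def)
  have "inj_on iy (Yb \<epsilon>)" "iy ` Yb \<epsilon> \<subseteq> underS lam \<epsilon>"
    using iy inj_on_subset[of iy Y "Yb \<epsilon>"] by (auto simp: Yb_def)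
  then show "|Yb \<epsilon>| \<le>o mu" using card_of_ordLeq[of "Yb \<epsilon>" "underS lam \<epsilon>"] card_underS ordLeq_transitive by metis
qed

lemma ex_ejq: "\<exists>e j q. \<forall>\<gamma>\<in>Field lam. q \<gamma> \<in> Q \<and> e \<gamma> \<subseteq> underS lam \<gamma> \<and>
    (\<forall>i\<in>underS lam \<gamma>. \<exists>i'\<in>e \<gamma>. (i, i') \<in> lam) \<and> (\<forall>i\<in>e \<gamma>. (b, j \<gamma> i) \<in> t \<and> lt t (j \<gamma> i) (q \<gamma>)) \<and>
    (\<forall>i\<in>e \<gamma>. \<forall>i'\<in>e \<gamma>. lt lam i i' \<longrightarrow> lt t (j \<gamma> i) (j \<gamma> i')) \<and> (b, q \<gamma>) \<in> t"
proof -
  have "\<forall>\<gamma>\<in>Field lam. \<exists>e j q. q \<in> Q \<and> e \<subseteq> underS lam \<gamma> \<and>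
    (\<forall>i\<in>underS lam \<gamma>. \<exists>i'\<in>e. (i, i') \<in> lam) \<and> (\<forall>i\<in>e. (b, j i) \<in> t \<and> lt t (j i) q) \<and>
    (\<forall>i\<in>e. \<forall>i'\<in>e. lt lam i i' \<longrightarrow> lt t (j i) (j i')) \<and> (b, q) \<in> t"
    using room unfolding room_def by (simp only: bex_simps Bex_def) metis
  then show ?thesis by (simp only: bchoice_iff)
qed

text \<open>The witnesses of \<open>room\<close> are fixed once for each \<gamma>. Thus the position
  \<open>pos D \<gamma>\<close> is determined by \<open>D\<close> and \<gamma> alone, and one can
  close off under the answers in all such positions.\<close>

definition "ejq = (SOME (e, j, q). \<forall>\<gamma>\<in>Field lam. q \<gamma> \<in> Q \<and> e \<gamma> \<subseteq> underS lam \<gamma> \<and>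
    (\<forall>i\<in>underS lam \<gamma>. \<exists>i'\<in>e \<gamma>. (i, i') \<in> lam) \<and> (\<forall>i\<in>e \<gamma>. (b, j \<gamma> i) \<in> t \<and> lt t (j \<gamma> i) (q \<gamma>)) \<and>
    (\<forall>i\<in>e \<gamma>. \<forall>i'\<in>e \<gamma>. lt lam i i' \<longrightarrow> lt t (j \<gamma> i) (j \<gamma> i')) \<and> (b, q \<gamma>) \<in> t)"
definition "ee = fst ejq"
definition "jj = fst (snd ejq)"
definition "qq = snd (snd ejq)"

lemma ejq:
  assumes "\<gamma> \<in> Field lam"
  shows "qq \<gamma> \<in> Q" "ee \<gamma> \<subseteq> underS lam \<gamma>" "i \<in> underS lam \<gamma> \<Longrightarrow> \<exists>i'\<in>ee \<gamma>. (i, i') \<in> lam"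
    "i \<in> ee \<gamma> \<Longrightarrow> (b, jj \<gamma> i) \<in> t" "i \<in> ee \<gamma> \<Longrightarrow> lt t (jj \<gamma> i) (qq \<gamma>)"
    "i \<in> ee \<gamma> \<Longrightarrow> i' \<in> ee \<gamma> \<Longrightarrow> lt lam i i' \<Longrightarrow> lt t (jj \<gamma> i) (jj \<gamma> i')" "(b, qq \<gamma>) \<in> t"
proof -
  let ?P = "\<lambda>(e, j, q). \<forall>\<gamma>\<in>Field lam. q \<gamma> \<in> Q \<and> e \<gamma> \<subseteq> underS lam \<gamma> \<and>
    (\<forall>i\<in>underS lam \<gamma>. \<exists>i'\<in>e \<gamma>. (i, i') \<in> lam) \<and> (\<forall>i\<in>e \<gamma>. (b, j \<gamma> i) \<in> t \<and> lt t (j \<gamma> i) (q \<gamma>)) \<and>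
    (\<forall>i\<in>e \<gamma>. \<forall>i'\<in>e \<gamma>. lt lam i i' \<longrightarrow> lt t (j \<gamma> i) (j \<gamma> i')) \<and> (b, q \<gamma>) \<in> t"
  have "?P ejq" unfolding ejq_def by (rule someI_ex) (use ex_ejq in simp)
  then have "?P (ee, jj, qq)" unfolding ee_def jj_def qq_def by simp
  note P = bspec[OF this[simplified], OF assms]
  show "qq \<gamma> \<in> Q" "ee \<gamma> \<subseteq> underS lam \<gamma>" "i \<in> underS lam \<gamma> \<Longrightarrow> \<exists>i'\<in>ee \<gamma>. (i, i') \<in> lam"
    "i \<in> ee \<gamma> \<Longrightarrow> (b, jj \<gamma> i) \<in> t" "i \<in> ee \<gamma> \<Longrightarrow> lt t (jj \<gamma> i) (qq \<gamma>)"
    "i \<in> ee \<gamma> \<Longrightarrow> i' \<in> ee \<gamma> \<Longrightarrow> lt lam i i' \<Longrightarrow> lt t (jj \<gamma> i) (jj \<gamma> i')" "(b, qq \<gamma>) \<in> t"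
    using P by auto
qed

subsection \<open>Playing along a set of ordinals\<close>

text \<open>The type \<gamma> of \<open>D\<close> may be too long for the clock. Therefore only
  those elements of \<open>D\<close> are played whose position in \<open>D\<close> belongs to the
  cofinal set \<open>ee \<gamma>\<close>, for which there is room.\<close>

definition idx :: "'l set \<Rightarrow> 'l \<Rightarrow> 'l set" where
  "idx D \<gamma> = {d \<in> D. lam.rk D d \<in> ee \<gamma>}"
definition node :: "'l set \<Rightarrow> 'l \<Rightarrow> 'l \<Rightarrow> 't" where
  "node D \<gamma> d = jj \<gamma> (lam.rk D d)"
definition pos :: "'l set \<Rightarrow> 'l \<Rightarrow> ('t, 'l, 'a, 'b) moves" where
  "pos D \<gamma> z = (if z \<in> node D \<gamma> ` idx D \<gamma>
     then Some (right_challenge (Yb (inv_into (idx D \<gamma>) (node D \<gamma>) z))) else h0 z)"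

context
  fixes D :: "'l set" and \<gamma> :: 'l
  assumes D: "D \<subseteq> Field lam" and \<gamma>: "\<gamma> \<in> Field lam"
begin

lemma node_mono: "d \<in> idx D \<gamma> \<Longrightarrow> d' \<in> idx D \<gamma> \<Longrightarrow> lt lam d d' \<Longrightarrow> lt t (node D \<gamma> d) (node D \<gamma> d')"
  unfolding idx_def node_def using ejq(6)[OF \<gamma>] lam.rk_mono[OF D] by simp

lemma node_inj: "inj_on (node D \<gamma>) (idx D \<gamma>)"
proof (rule inj_onI)
  fix d d' assume *: "d \<in> idx D \<gamma>" "d' \<in> idx D \<gamma>" "node D \<gamma> d = node D \<gamma> d'"
  then have "d \<in> Field lam" "d' \<in> Field lam" using D by (auto simp: idx_def)
  then show "d = d'" using lam.cases3[of d d'] node_mono * lt_irrefl by metis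
qed

lemma node_bounds: "d \<in> idx D \<gamma> \<Longrightarrow> (b, node D \<gamma> d) \<in> t" "d \<in> idx D \<gamma> \<Longrightarrow> lt t (node D \<gamma> d) (qq \<gamma>)"
  unfolding idx_def node_def using ejq(4,5)[OF \<gamma>] by auto

lemma pos_node: "d \<in> idx D \<gamma> \<Longrightarrow> pos D \<gamma> (node D \<gamma> d) = Some (right_challenge (Yb d))"
  unfolding pos_def using node_inj by simp

lemma node_Field: "d \<in> idx D \<gamma> \<Longrightarrow> node D \<gamma> d \<in> Field t"
  using node_bounds(2) lt_Field1 by metis

lemma node_notin: "d \<in> idx D \<gamma> \<Longrightarrow> node D \<gamma> d \<notin> dom h0"
  using h0(2) node_bounds(1) t.asym by auto

lemma pos_h0: "z \<in> dom h0 \<Longrightarrow> pos D \<gamma> z = h0 z"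
  unfolding pos_def using node_notin by auto

lemma dom_pos: "dom (pos D \<gamma>) = dom h0 \<union> node D \<gamma> ` idx D \<gamma>"
  unfolding pos_def by (auto split: if_splits)

lemma pos_legal: "legal (pos D \<gamma>)"
proof -
  have chain: "(u, v) \<in> t \<or> (v, u) \<in> t" if "u \<in> dom (pos D \<gamma>)" "v \<in> dom (pos D \<gamma>)" for u v
  proof -
    have "z \<in> Field t" if "z \<in> dom (pos D \<gamma>)" for z
      using that h0(1) node_Field unfolding dom_pos by (auto simp: legal_moves_def)
    then show ?thesis using t.total that by simp
  qed
  have "ran (pos D \<gamma>) \<subseteq> ran h0 \<union> range (\<lambda>d. right_challenge (Yb d))"
    unfolding pos_def by (auto simp: ran_def)
  then have "legal_challenge lam A B c" if "c \<in> ran (pos D \<gamma>)" for c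
    using that h0(1) right_challenge(1)[OF Yb] by (auto simp: legal_moves_def)
  moreover have "dom (pos D \<gamma>) \<subseteq> Field t"
    using h0(1) node_Field unfolding dom_pos by (auto simp: legal_moves_def)
  ultimately show ?thesis unfolding legal_moves_def using chain by auto
qed

lemma pos_end_ext: "end_ext t h0 (pos D \<gamma>)"
  unfolding end_ext_def map_le_def
proof (intro conjI ballI)
  fix z z' assume "z \<in> dom (pos D \<gamma>) - dom h0" "z' \<in> dom h0"
  then show "lt t z' z" using node_bounds(1) h0(2) t.ltle unfolding dom_pos by auto
qed (simp add: pos_h0)

lemma pos_dom: "dom (pos D \<gamma>) \<subseteq> underS t (qq \<gamma>)"
  using h0(2) node_bounds(2) t.ltle[OF _ ejq(7)[OF \<gamma>]] unfolding dom_pos by auto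

end

text \<open>Positions in \<open>D\<close> are computed from below, so truncating \<open>D\<close>
  truncates the play. Hence the answers for small elements of \<open>D\<close> are already
  determined by an initial segment of \<open>D\<close>, which may be listed early even if
  \<open>D\<close> is not.\<close>

lemma pos_initial:
  assumes "D \<subseteq> Field lam" "\<gamma> \<in> Field lam"
  shows "idx (D \<inter> underS lam \<alpha>) \<gamma> = idx D \<gamma> \<inter> underS lam \<alpha>"
    and "d \<in> idx (D \<inter> underS lam \<alpha>) \<gamma> \<Longrightarrow> node (D \<inter> underS lam \<alpha>) \<gamma> d = node D \<gamma> d"
    and "end_ext t (pos (D \<inter> underS lam \<alpha>) \<gamma>) (pos D \<gamma>)"
proof -
  let ?D = "D \<inter> underS lam \<alpha>"
  have D': "?D \<subseteq> Field lam" using assms by auto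
  have rk: "lam.rk ?D d = lam.rk D d" if "d \<in> ?D" for d
    using that lam.ltt by (intro lam.rk_cong) auto
  then show 1: "idx ?D \<gamma> = idx D \<gamma> \<inter> underS lam \<alpha>" unfolding idx_def by auto
  show 2: "node ?D \<gamma> d = node D \<gamma> d" if "d \<in> idx ?D \<gamma>" for d
    using rk that unfolding node_def idx_def by simp
  show "end_ext t (pos ?D \<gamma>) (pos D \<gamma>)" unfolding end_ext_def map_le_def
  proof (intro conjI ballI)
    fix z assume "z \<in> dom (pos ?D \<gamma>)"
    then consider "z \<in> dom h0" | d where "d \<in> idx ?D \<gamma>" "z = node ?D \<gamma> d"
      unfolding dom_pos[OF D' assms(2)] by auto
    then show "pos ?D \<gamma> z = pos D \<gamma> z"
    proof cases
      case 1
      then show ?thesis using pos_h0[OF D' assms(2)] pos_h0[OF assms] by simp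
    next
      case 2
      then have "d \<in> idx D \<gamma>" "z = node D \<gamma> d" using \<open>idx ?D \<gamma> = _\<close> \<open>\<And>d. d \<in> idx ?D \<gamma> \<Longrightarrow> _\<close> by auto
      then show ?thesis using pos_node[OF D' assms(2)] pos_node[OF assms] 2 by metis
    qed
  next
    fix z z' assume z: "z \<in> dom (pos D \<gamma>) - dom (pos ?D \<gamma>)" and z': "z' \<in> dom (pos ?D \<gamma>)"
    from z obtain d where d: "d \<in> idx D \<gamma>" "z = node D \<gamma> d" "d \<notin> idx ?D \<gamma>"
      unfolding dom_pos[OF D' assms(2)] dom_pos[OF assms] using 2 by auto
    from z' consider "z' \<in> dom h0" | d' where "d' \<in> idx ?D \<gamma>" "z' = node ?D \<gamma> d'"
      unfolding dom_pos[OF D' assms(2)] by auto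
    then show "lt t z' z"
    proof cases
      case 1
      then show ?thesis using d(1,2) node_bounds(1)[OF assms] h0(2) t.ltle by auto
    next
      case 2
      then have d': "d' \<in> idx D \<gamma>" "lt lam d' \<alpha>" "z' = node D \<gamma> d'"
        using \<open>idx ?D \<gamma> = _\<close> \<open>\<And>d. d \<in> idx ?D \<gamma> \<Longrightarrow> _\<close> by auto
      have dF: "d \<in> Field lam" "\<alpha> \<in> Field lam" using d(1) assms(1) lt_Field2[OF d'(2)] by (auto simp: idx_def)
      have "(\<alpha>, d) \<in> lam" using d(1,3) lam.not_lt[OF dF] unfolding 1 by auto
      then have "lt lam d' d" using lam.ltle[OF d'(2)] by simp
      then show ?thesis using node_mono[OF assms d'(1) d(1)] d d' by simp
    qed
  qed
qed

end

context level begin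

subsection \<open>Ordinals closed under the responses\<close>

definition start :: "'l \<Rightarrow> bool" where
  "start \<epsilon> \<longleftrightarrow> (\<exists>p. \<exists>q\<in>Q. legal p \<and> end_ext t h0 p \<and> dom p \<subseteq> underS t q \<and>
     (\<forall>y'\<in>Yb \<epsilon>. \<exists>x'\<in>Xb \<epsilon>. (x', y') \<in> pairs p))"

definition resp :: "('t, 'l, 'a, 'b) moves \<Rightarrow> 'l set" where
  "resp p = ix ` {x' \<in> X. \<exists>y'. (x', y') \<in> pairs p}"

lemma resp: assumes "legal p" shows "resp p \<subseteq> Field lam" "|resp p| \<le>o mu"
proof -
  show "resp p \<subseteq> Field lam" using ix by (auto simp: resp_def)
  have "resp p \<subseteq> (ix \<circ> fst) ` pairs p" unfolding resp_def by force
  then show "|resp p| \<le>o mu"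
    using image_le[OF card_pairs] assms subset_le by (metis legal_moves_def)
qed

text \<open>At a limit \<epsilon> closed under \<open>F\<close>, the set \<open>C\<close> guessed
  for \<epsilon> need not be listed before \<epsilon>. But each single answer in the play along
  \<open>C\<close> occurs in the play along some \<open>C \<inter> underS lam \<alpha>\<close> with
  \<alpha> below \<epsilon>; that segment is listed before \<epsilon>, so the index of the answer is
  below \<epsilon>.\<close>

lemma ex_closed_set:
  "\<exists>E'. E' \<subseteq> Field lam \<and> (\<forall>\<zeta>\<in>Field lam. \<exists>\<epsilon>\<in>E'. lt lam \<zeta> \<epsilon>) \<and>
     (\<forall>Z u. Z \<subseteq> E' \<and> Z \<noteq> {} \<and> u \<in> Field lam \<and> (\<forall>a\<in>Z. (a, u) \<in> lam) \<longrightarrow> lub Z \<in> E') \<and>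
     (\<forall>\<epsilon>\<in>E'. start \<epsilon>)"
proof -
  obtain E P where cub: "cub lam E" and P: "\<And>\<alpha>. \<alpha> \<in> Field lam \<Longrightarrow> P \<alpha> \<subseteq> Pow (underS lam \<alpha>) \<and> |P \<alpha>| <o lam"
    and guess: "\<And>\<delta>. \<delta> \<in> E \<Longrightarrow> is_limit lam \<delta> \<Longrightarrow> cofinality (initial lam \<delta>) <o initial lam \<delta> \<Longrightarrow>
      (\<exists>C. C \<subseteq> underS lam \<delta> \<and> Restr lam C <o initial lam \<delta> \<and> lub C = \<delta> \<and>
           (\<forall>\<alpha>\<in>underS lam \<delta>. C \<inter> underS lam \<alpha> \<in> (\<Union>\<beta>\<in>underS lam \<delta>. P \<beta>)))"
  proof -
    from ideal obtain E P where *: "cub lam E" "\<forall>\<alpha>\<in>Field lam. P \<alpha> \<subseteq> Pow (underS lam \<alpha>) \<and> |P \<alpha>| <o lam"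
      "\<forall>\<delta>\<in>Field lam \<inter> E. is_limit lam \<delta> \<and> cofinality (initial lam \<delta>) <o initial lam \<delta> \<longrightarrow>
         (\<exists>C. C \<subseteq> underS lam \<delta> \<and> Restr lam C <o initial lam \<delta> \<and> wo_rel.supr lam C = \<delta> \<and>
           (\<forall>\<alpha>\<in>underS lam \<delta>. C \<inter> underS lam \<alpha> \<in> (\<Union>\<beta>\<in>underS lam \<delta>. P \<beta>)))"
      unfolding approachability_ideal_def by auto
    show thesis
      by (rule that[of E P]) (use * in \<open>auto simp: supr_eq_lub is_limit_def\<close>)
  qed
  have EF: "E \<subseteq> Field lam" and Ecof: "\<And>\<zeta>. \<zeta> \<in> Field lam \<Longrightarrow> \<exists>\<epsilon>\<in>E. lt lam \<zeta> \<epsilon>"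
    and Esup: "\<And>Z u. Z \<subseteq> E \<Longrightarrow> Z \<noteq> {} \<Longrightarrow> u \<in> Field lam \<Longrightarrow> (\<forall>a\<in>Z. (a, u) \<in> lam) \<Longrightarrow> lub Z \<in> E"
  proof -
    show "E \<subseteq> Field lam" using cub by (simp add: cub_def)
    show "\<exists>\<epsilon>\<in>E. lt lam \<zeta> \<epsilon>" if "\<zeta> \<in> Field lam" for \<zeta>
      using cub that by (simp add: cub_def cofinal_def lt_iff)
    show "lub Z \<in> E" if Z: "Z \<subseteq> E" "Z \<noteq> {}" "u \<in> Field lam" "\<forall>a\<in>Z. (a, u) \<in> lam" for Z u
    proof -
      have "u \<in> Above lam Z" using Z by (simp add: Above_def)
      then show ?thesis using cub Z unfolding cub_def supr_eq_lub by (metis empty_iff)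
    qed
  qed
  have Psub: "D \<subseteq> Field lam" if "\<beta> \<in> Field lam" "D \<in> P \<beta>" for \<beta> D
    using P[OF that(1)] that(2) lt_Field1 by fastforce
  obtain m where m: "m \<in> Field lam" "mu =o initial lam m" using big_initial by auto
  \<comment> \<open>The indices answered in plays along sets listed up to \<alpha>, with the
    parameter \<gamma> also up to \<alpha>. Few sets are listed and positions are small, so
    \<open>F \<alpha>\<close> is bounded in \<open>lam\<close> and club many ordinals are closed
    under \<open>F\<close>.\<close>
  define F where "F \<alpha> = (\<Union>(\<beta>, \<gamma>)\<in>under lam \<alpha> \<times> under lam \<alpha>. \<Union>D\<in>P \<beta>. resp (pos D \<gamma>))" for \<alpha>
  have F: "F \<alpha> \<subseteq> Field lam" "|F \<alpha>| \<le>o mu" if "\<alpha> \<in> Field lam" for \<alpha>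
  proof -
    have u: "under lam \<alpha> \<subseteq> Field lam" "|under lam \<alpha>| \<le>o mu"
      using card_insert_le[OF card_underS] by (auto simp: under_eq[OF lam.po that] that dest: lt_Field1)
    have leg: "legal (pos D \<gamma>)" if "\<beta> \<in> under lam \<alpha>" "\<gamma> \<in> under lam \<alpha>" "D \<in> P \<beta>" for \<beta> \<gamma> D
      by (rule pos_legal[OF Psub[OF subsetD[OF u(1) that(1)] that(3)] subsetD[OF u(1) that(2)]])
    show "F \<alpha> \<subseteq> Field lam" unfolding F_def using resp(1)[OF leg] by fastforce
    have "|\<Union>D\<in>P \<beta>. resp (pos D \<gamma>)| \<le>o mu" if "\<beta> \<in> under lam \<alpha>" "\<gamma> \<in> under lam \<alpha>" for \<beta> \<gamma>
      by (rule UN_le) (use P below u that resp(2)[OF leg] in auto)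
    then show "|F \<alpha>| \<le>o mu" unfolding F_def by (intro UN_le Times_le u) auto
  qed
  \<comment> \<open>The ordinal \<open>m\<close> has order type \<open>mu\<close>; being above it
    guarantees that the cofinality of \<epsilon> is smaller than \<epsilon>, so the guess at
    \<epsilon> is available.\<close>
  define E' where "E' = {\<epsilon> \<in> E. is_limit lam \<epsilon> \<and> lt lam m \<epsilon> \<and> (\<forall>\<alpha>\<in>underS lam \<epsilon>. F \<alpha> \<subseteq> underS lam \<epsilon>)}"
  have "\<exists>\<epsilon>\<in>E'. lt lam \<zeta> \<epsilon>" if \<zeta>: "\<zeta> \<in> Field lam" for \<zeta>
  proof -
    have step: "\<exists>z. z \<in> E \<and> lt lam m z \<and> lt lam \<zeta> z \<and> lt lam z0 z \<and> (\<forall>\<alpha>\<in>under lam z0. F \<alpha> \<subseteq> underS lam z)"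
      if z0: "z0 \<in> Field lam" for z0
    proof -
      have u: "under lam z0 \<subseteq> Field lam" "|under lam z0| \<le>o mu"
        using card_insert_le[OF card_underS] by (auto simp: under_eq[OF lam.po z0] z0 dest: lt_Field1)
      have "|(\<Union>\<alpha>\<in>under lam z0. F \<alpha>) \<union> {m, \<zeta>, z0}| \<le>o mu"
        by (intro Un_le UN_le u(2) F(2) finite_le) (use u in auto)
      moreover have "(\<Union>\<alpha>\<in>under lam z0. F \<alpha>) \<union> {m, \<zeta>, z0} \<subseteq> Field lam"
        using F(1) u(1) m(1) \<zeta> z0 by auto
      ultimately obtain c where c: "c \<in> Field lam" "\<forall>a\<in>(\<Union>\<alpha>\<in>under lam z0. F \<alpha>) \<union> {m, \<zeta>, z0}. lt lam a c"
        using bounded by metis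
      obtain z where "z \<in> E" "lt lam c z" using Ecof[OF c(1)] by auto
      then show ?thesis using c(2) lam.ltt[of _ c z] by (intro exI[of _ z]) auto
    qed
    have "\<exists>s. \<forall>n. (s n \<in> E \<and> lt lam m (s n) \<and> lt lam \<zeta> (s n)) \<and> (lt lam (s n) (s (Suc n)) \<and>
        (\<forall>\<alpha>\<in>under lam (s n). F \<alpha> \<subseteq> underS lam (s (Suc n))))"
    proof (rule dependent_nat_choice)
      show "\<exists>z. z \<in> E \<and> lt lam m z \<and> lt lam \<zeta> z" using step[OF \<zeta>] by auto
      fix z0 :: 'l and n :: nat assume "z0 \<in> E \<and> lt lam m z0 \<and> lt lam \<zeta> z0"
      then show "\<exists>z. (z \<in> E \<and> lt lam m z \<and> lt lam \<zeta> z) \<and>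
          lt lam z0 z \<and> (\<forall>\<alpha>\<in>under lam z0. F \<alpha> \<subseteq> underS lam z)"
        using step[of z0] subsetD[OF EF] by auto
    qed
    then obtain s where s: "\<And>n. s n \<in> E" "\<And>n. lt lam m (s n)" "\<And>n. lt lam \<zeta> (s n)"
      "\<And>n. lt lam (s n) (s (Suc n))" "\<And>n \<alpha>. \<alpha> \<in> under lam (s n) \<Longrightarrow> F \<alpha> \<subseteq> underS lam (s (Suc n))" by metis
    note l = omega_limit[of s, OF s(4)]
    have "lub (range s) \<in> E" using s(1) l(1) lt_le[OF l(2)] by (intro Esup[of _ "lub (range s)"]) auto
    moreover have "F \<alpha> \<subseteq> underS lam (lub (range s))" if *: "lt lam \<alpha> (lub (range s))" for \<alpha>
    proof -
      obtain n where n: "lt lam \<alpha> (s n)" using l(3)[OF *] by auto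
      then have "F \<alpha> \<subseteq> underS lam (s (Suc n))" using s(5)[of \<alpha> n] lt_le[OF n] by (simp add: under_def)
      then show ?thesis using lam.ltt[OF _ l(2)] by auto
    qed
    ultimately have "lub (range s) \<in> E'" unfolding E'_def using l(2,4) lam.ltt[OF s(2) l(2)] by auto
    then show ?thesis using lam.ltt[OF s(3) l(2)] by auto
  qed
  moreover have "lub Z \<in> E'" if Z: "Z \<subseteq> E'" "Z \<noteq> {}" "u \<in> Field lam" "\<forall>a\<in>Z. (a, u) \<in> lam" for Z u
  proof -
    have ZF: "Z \<subseteq> Field lam" using Z(1) EF by (auto simp: E'_def)
    note l = lub[OF ZF Z(3) Z(4)[rule_format]]
    have ex: "\<exists>a\<in>Z. lt lam c a" if "lt lam c (lub Z)" for c using l(4)[OF _ that] by simp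
    obtain a0 where a0: "a0 \<in> Z" using Z(2) by auto
    have "lub Z \<in> E" using Esup[of Z u] Z by (auto simp: E'_def)
    moreover have m': "lt lam m (lub Z)" using a0 Z(1) l(2)[OF _ a0] lam.ltle by (auto simp: E'_def)
    moreover have "is_limit lam (lub Z)" unfolding is_limit_def
    proof (intro conjI ballI)
      show "lub Z \<in> Field lam" using l(1) by simp
      show "underS lam (lub Z) \<noteq> {}" using m' by auto
      fix \<alpha> assume "\<alpha> \<in> underS lam (lub Z)"
      then obtain a where a: "a \<in> Z" "lt lam \<alpha> a" using ex by auto
      then have "is_limit lam a" using Z(1) by (auto simp: E'_def)
      then obtain \<beta> where "lt lam \<beta> a" "lt lam \<alpha> \<beta>" using a(2) by (auto simp: is_limit_def)
      then show "\<exists>\<beta>\<in>underS lam (lub Z). \<alpha> \<in> underS lam \<beta>" using l(2)[OF _ a(1)] lam.ltle by auto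
    qed
    moreover have "F \<alpha> \<subseteq> underS lam (lub Z)" if *: "lt lam \<alpha> (lub Z)" for \<alpha>
    proof -
      obtain a where a: "a \<in> Z" "lt lam \<alpha> a" using ex[OF *] by auto
      then have "F \<alpha> \<subseteq> underS lam a" using Z(1) by (auto simp: E'_def)
      then show ?thesis using l(2)[OF _ a(1)] lam.ltle by auto
    qed
    ultimately show ?thesis by (auto simp: E'_def)
  qed
  moreover have "start \<epsilon>" if \<epsilon>: "\<epsilon> \<in> E'" for \<epsilon>
  proof -
    have e: "\<epsilon> \<in> E" "is_limit lam \<epsilon>" "lt lam m \<epsilon>" "\<And>\<alpha>. lt lam \<alpha> \<epsilon> \<Longrightarrow> F \<alpha> \<subseteq> underS lam \<epsilon>" "\<epsilon> \<in> Field lam"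
      using \<epsilon> EF by (auto simp: E'_def)
    obtain C where C: "C \<subseteq> underS lam \<epsilon>" "Restr lam C <o initial lam \<epsilon>" "lub C = \<epsilon>"
      "\<And>\<alpha>. lt lam \<alpha> \<epsilon> \<Longrightarrow> C \<inter> underS lam \<alpha> \<in> (\<Union>\<beta>\<in>underS lam \<epsilon>. P \<beta>)"
      using guess[OF e(1,2) cofinality_initial[OF e(2) m(2) e(3)]] by auto
    \<comment> \<open>That the type of \<open>C\<close> is smaller than \<epsilon> matters here: it
      makes \<gamma> one of the parameters under which \<epsilon> is closed.\<close>
    obtain \<gamma> where \<gamma>: "lt lam \<gamma> \<epsilon>" "Restr lam C =o initial lam \<gamma>"
      using lam.ordLess_initial_lt[OF C(2) e(5)] by auto
    have CF: "C \<subseteq> Field lam" using C(1) lt_Field1 by fastforce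
    have \<gamma>F: "\<gamma> \<in> Field lam" using lt_Field1[OF \<gamma>(1)] .
    note pos = pos_legal[OF CF \<gamma>F] pos_end_ext[OF CF \<gamma>F] pos_dom[OF CF \<gamma>F]
    have q: "qq \<gamma> \<in> Q" using ejq(1)[OF \<gamma>F] .
    have "\<exists>x'\<in>Xb \<epsilon>. (x', y') \<in> pairs (pos C \<gamma>)" if y': "y' \<in> Yb \<epsilon>" for y'
    proof -
      have y'Y: "y' \<in> Y" "lt lam (iy y') (lub C)" using y' C(3) by (auto simp: Yb_def)
      obtain a where a: "a \<in> C" "lt lam (iy y') a"
        using lub(4)[OF CF e(5) _ y'Y(2)] C(1) lt_le[of _ lam] by fastforce
      have "lt lam (lam.rk C a) \<gamma>" using lam.rk_bound[OF CF \<gamma>(2) \<gamma>F a(1)] .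
      \<comment> \<open>The element \<open>a\<close> itself may not be among the played ones; it is
        replaced by a later \<open>d\<close> in \<open>C\<close> whose position \<open>i\<close>
        lies in \<open>ee \<gamma>\<close>.\<close>
      then obtain i where i: "i \<in> ee \<gamma>" "(lam.rk C a, i) \<in> lam" using ejq(3)[OF \<gamma>F] by auto
      then have "lt lam i \<gamma>" using ejq(2)[OF \<gamma>F] by auto
      then obtain d where d: "d \<in> C" "lam.rk C d = i" using lam.rk_surj[OF CF \<gamma>(2) \<gamma>F] by auto
      have "\<not> lt lam d a" using lam.rk_mono[OF CF d(1) a(1)] d(2) i(2) lam.asym by auto
      then have "(a, d) \<in> lam" using lam.not_lt[of d a] d(1) a(1) CF by auto
      then have id: "lt lam (iy y') d" using lam.ltle[OF a(2)] by simp
      \<comment> \<open>The cut is taken above \<open>d\<close>, so that the move for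
        \<open>d\<close> itself belongs to the truncated play.\<close>
      obtain \<alpha> where \<alpha>: "lt lam \<alpha> \<epsilon>" "lt lam d \<alpha>" using e(2) C(1) d(1) by (auto simp: is_limit_def)
      obtain \<beta> where \<beta>: "lt lam \<beta> \<epsilon>" "C \<inter> underS lam \<alpha> \<in> P \<beta>" using C(4)[OF \<alpha>(1)] by auto
      let ?D = "C \<inter> underS lam \<alpha>"
      have DF: "?D \<subseteq> Field lam" using CF by auto
      have "d \<in> idx C \<gamma>" using d i(1) by (simp add: idx_def)
      then have dD: "d \<in> idx ?D \<gamma>" unfolding pos_initial(1)[OF CF \<gamma>F] using \<alpha> by simp
      have "y' \<in> Yb d" using y'Y id by (simp add: Yb_def)
      then obtain x' where x': "(x', y') \<in> pairs (pos ?D \<gamma>)"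
        using right_challenge(2)[OF Yb, of y' d "\<sigma> (pos ?D \<gamma> |` under t (node ?D \<gamma> d))"]
          subsetD[OF round_in_pairs[of "pos ?D \<gamma>" "node ?D \<gamma> d", OF pos_node[OF DF \<gamma>F dD]]] by metis
      have x'C: "(x', y') \<in> pairs (pos C \<gamma>)"
        using x' pairs_mono[OF pos_initial(3)[OF CF \<gamma>F]] by auto
      have "(x, y) \<in> pairs (pos C \<gamma>)" using h0(4) pairs_mono[OF pos(2)] by auto
      then have x'X: "x' \<in> X"
        using child_match[OF pos(1) _ x'C Q(1)[OF q] pos(3)] y'Y(1) by simp
      \<comment> \<open>The larger of \<beta> and \<gamma>, which is still below \<epsilon>.\<close>
      define \<alpha>' where "\<alpha>' = (if (\<beta>, \<gamma>) \<in> lam then \<gamma> else \<beta>)"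
      have \<alpha>': "lt lam \<alpha>' \<epsilon>" "\<beta> \<in> under lam \<alpha>'" "\<gamma> \<in> under lam \<alpha>'"
        using \<beta>(1) \<gamma>(1) lam.total[of \<beta> \<gamma>] lt_Field1[OF \<beta>(1)] \<gamma>F lam.refl by (auto simp: \<alpha>'_def under_def)
      have "ix x' \<in> resp (pos ?D \<gamma>)" using x' x'X by (auto simp: resp_def)
      then have "ix x' \<in> F \<alpha>'" unfolding F_def using \<alpha>'(2,3) \<beta>(2) by auto
      then have "lt lam (ix x') \<epsilon>" using e(4)[OF \<alpha>'(1)] by auto
      then show ?thesis using x'C x'X by (auto simp: Xb_def)
    qed
    then show ?thesis unfolding start_def using pos q by auto
  qed
  moreover have "E' \<subseteq> Field lam" using EF by (auto simp: E'_def)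
  ultimately show ?thesis by (intro exI[of _ E']) blast
qed

subsection \<open>Playing \<open>\<omega>\<close> further moves\<close>

text \<open>The two closure conditions are deliberately different. As the right successors below
  \<epsilon> are already taken by left ones below \<epsilon>, a left successor with index in
  \<open>[\<epsilon>, \<zeta>)\<close> must get a partner with index in
  \<open>[\<epsilon>, \<zeta>)\<close>.\<close>

definition block :: "'l \<Rightarrow> 'l \<Rightarrow> ('a \<times> 'b) set \<Rightarrow> bool" where
  "block \<epsilon> \<zeta> U \<longleftrightarrow> lt lam \<epsilon> \<zeta> \<and> (\<forall>c\<in>U. realized c) \<and>
     (\<forall>(a, b)\<in>U. \<forall>(a', b')\<in>U. a = a' \<longleftrightarrow> b = b') \<and>
     (\<forall>x'\<in>Xb \<zeta>. \<exists>y'\<in>Yb \<zeta>. (x', y') \<in> U) \<and> (\<forall>y'\<in>Yb \<epsilon>. \<exists>x'\<in>Xb \<epsilon>. (x', y') \<in> U)"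

lemma blockD:
  assumes "block \<epsilon> \<zeta> U"
  shows "lt lam \<epsilon> \<zeta>" "c \<in> U \<Longrightarrow> realized c" "(u, v) \<in> U \<Longrightarrow> (u', v') \<in> U \<Longrightarrow> u = u' \<longleftrightarrow> v = v'"
    "x' \<in> Xb \<zeta> \<Longrightarrow> \<exists>y'\<in>Yb \<zeta>. (x', y') \<in> U" "y' \<in> Yb \<epsilon> \<Longrightarrow> \<exists>x'\<in>Xb \<epsilon>. (x', y') \<in> U"
  using assms unfolding block_def by auto

text \<open>The play witnessing \<open>start \<epsilon>\<close> is continued by asking left
  successors only: those below \<open>s n\<close> are answered below \<open>s (Suc n)\<close>, and
  \<zeta> is the supremum. Every pair of \<open>U\<close> occurs at a finite stage, so the \<omega>
  moves need no common bound in \<open>Q\<close>.\<close>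

lemma ex_block:
  assumes E': "E' \<subseteq> Field lam" "\<And>\<zeta>. \<zeta> \<in> Field lam \<Longrightarrow> \<exists>\<epsilon>\<in>E'. lt lam \<zeta> \<epsilon>"
    "\<And>Z u. Z \<subseteq> E' \<Longrightarrow> Z \<noteq> {} \<Longrightarrow> u \<in> Field lam \<Longrightarrow> \<forall>a\<in>Z. (a, u) \<in> lam \<Longrightarrow> lub Z \<in> E'"
    and \<epsilon>: "\<epsilon> \<in> Field lam" "start \<epsilon>"
  shows "\<exists>\<zeta>\<in>E'. \<exists>U. block \<epsilon> \<zeta> U"
proof -
  obtain p q where p: "q \<in> Q" "legal p" "end_ext t h0 p" "dom p \<subseteq> underS t q"
    "\<And>y'. y' \<in> Yb \<epsilon> \<Longrightarrow> \<exists>x'\<in>Xb \<epsilon>. (x', y') \<in> pairs p"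
    using \<epsilon>(2) unfolding start_def by auto
  define I where "I = (\<lambda>(h, q, s). legal h \<and> end_ext t p h \<and> q \<in> Q \<and> dom h \<subseteq> underS t q \<and> s \<in> E' \<and> lt lam \<epsilon> s)"
  define S where "S = (\<lambda>(h :: ('t, 'l, 'a, 'b) moves, q :: 't, s) (h', q' :: 't, s'). end_ext t h h' \<and> lt lam s s' \<and>
      (\<forall>x'\<in>Xb s. \<exists>y'\<in>Yb s'. (x', y') \<in> pairs h'))"
  have step: "\<exists>c'. I c' \<and> S c c'" if "I c" for c
  proof -
    obtain h q s where c: "c = (h, q, s)" by (cases c)
    have h: "legal h" "end_ext t p h" "q \<in> Q" "dom h \<subseteq> underS t q" "s \<in> E'" "lt lam \<epsilon> s"
      using that by (auto simp: c I_def)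
    obtain h' where h': "legal h'" "end_ext t h h'" "dom h' = insert q (dom h)" "\<forall>x\<in>Xb s. \<exists>y. (x, y) \<in> pairs h'"
      using play_left[OF h(1) Q(1)[OF h(3)] h(4) Xb] by metis
    obtain q' where q': "q' \<in> Q" "lt t q q'" using Q(2)[OF h(3)] by auto
    have d: "dom h' \<subseteq> underS t q'" unfolding h'(3) using h(4) q'(2) t.ltt by auto
    let ?V = "insert s (iy ` {y' \<in> Y. \<exists>x'. (x', y') \<in> pairs h'})"
    have "iy ` {y' \<in> Y. \<exists>x'. (x', y') \<in> pairs h'} \<subseteq> (iy \<circ> snd) ` pairs h'" by force
    then have "|?V| \<le>o mu"
      using subset_le[OF image_le[OF card_pairs]] h'(1) by (intro card_insert_le) (auto simp: legal_moves_def)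
    moreover have "?V \<subseteq> Field lam" using iy h(5) E'(1) by auto
    ultimately have "\<exists>u\<in>Field lam. \<forall>a\<in>?V. lt lam a u" by (intro bounded)
    then obtain u where u: "u \<in> Field lam" "\<forall>a\<in>?V. lt lam a u" by (elim bexE)
    obtain s' where s': "s' \<in> E'" "lt lam u s'" using E'(2)[OF u(1)] by auto
    have ss': "lt lam s s'" using u(2) lam.ltt[OF _ s'(2)] by simp
    have xy: "(x, y) \<in> pairs h'" using h0(4) pairs_mono[OF p(3)] pairs_mono[OF h(2)] pairs_mono[OF h'(2)] by auto
    have "\<exists>y'\<in>Yb s'. (x', y') \<in> pairs h'" if x': "x' \<in> Xb s" for x'
    proof -
      obtain y' where y': "(x', y') \<in> pairs h'" using h'(4) x' by auto
      have "y' \<in> Y" using child_match[OF h'(1) xy y' Q(1)[OF q'(1)] d] x' by (simp add: Xb_def)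
      moreover from this have "lt lam (iy y') u" using u(2) y' by auto
      ultimately show ?thesis using y' lam.ltt[OF _ s'(2)] by (auto simp: Yb_def)
    qed
    then have "I (h', q', s') \<and> S c (h', q', s')" unfolding I_def S_def c
      using h h' q' d s'(1) ss' lam.ltt[OF h(6) ss'] end_ext_trans[OF h(2) h'(2)] by auto
    then show ?thesis by auto
  qed
  obtain s0 where s0: "s0 \<in> E'" "lt lam \<epsilon> s0" using E'(2)[OF \<epsilon>(1)] by auto
  have "\<exists>f. (\<forall>n. I (f n)) \<and> (\<forall>n. S (f n) (f (Suc n)))"
  proof -
    have "I (p, q, s0)" using p s0 by (simp add: I_def)
    from dependent_nat_choice[of "\<lambda>_. I" "\<lambda>_. S"] this step show ?thesis by metis
  qed
  then obtain f where f: "\<And>n. I (f n)" "\<And>n. S (f n) (f (Suc n))" by auto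
  define h q s where "h n = fst (f n)" and "q n = fst (snd (f n))" and "s n = snd (snd (f n))" for n
  have fn: "f n = (h n, q n, s n)" for n by (simp add: h_def q_def s_def)
  have h: "legal (h n)" "end_ext t p (h n)" "q n \<in> Q" "dom (h n) \<subseteq> underS t (q n)" "s n \<in> E'" "lt lam \<epsilon> (s n)" for n
    using f(1)[of n] unfolding fn I_def by auto
  have hS: "end_ext t (h n) (h (Suc n))" "lt lam (s n) (s (Suc n))"
    "x' \<in> Xb (s n) \<Longrightarrow> \<exists>y'\<in>Yb (s (Suc n)). (x', y') \<in> pairs (h (Suc n))" for n x'
    using f(2)[of n] unfolding fn S_def by auto
  note l = omega_limit[of s, OF hS(2)]
  have "lub (range s) \<in> E'" using h(5) l(1) lt_le[OF l(2)] by (intro E'(3)[of _ "lub (range s)"]) auto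
  moreover have "block \<epsilon> (lub (range s)) (\<Union>n. pairs (h n))" unfolding block_def
  proof (intro conjI)
    show "lt lam \<epsilon> (lub (range s))" using lam.ltt[OF h(6) l(2)] .
    show "\<forall>c\<in>\<Union>n. pairs (h n). realized c"
    proof
      fix c assume c: "c \<in> (\<Union>n. pairs (h n))"
      obtain n where "c \<in> pairs (h n)" using c by auto
      then show "realized c" unfolding realized_def using h[of n] end_ext_trans[OF p(3) h(2)]
        by (intro exI[of _ "h n"] bexI[of _ "q n"]) simp_all
    qed
    have mono: "pairs (h m) \<subseteq> pairs (h n)" if "m \<le> n" for m n
      by (rule lift_Suc_mono_le[OF _ that]) (rule pairs_mono[OF hS(1)])
    show "\<forall>(a, b)\<in>\<Union>n. pairs (h n). \<forall>(a', b')\<in>\<Union>n. pairs (h n). (a = a') = (b = b')"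
    proof clarify
      fix m n a b a' b' assume "(a, b) \<in> pairs (h m)" "(a', b') \<in> pairs (h n)"
      then have "(a, b) \<in> pairs (h (max m n))" "(a', b') \<in> pairs (h (max m n))"
        using mono[of m "max m n"] mono[of n "max m n"] by auto
      then show "(a = a') = (b = b')" by (rule pairs_iso(3)[OF h(1)])
    qed
    show "\<forall>x'\<in>Xb (lub (range s)). \<exists>y'\<in>Yb (lub (range s)). (x', y') \<in> (\<Union>n. pairs (h n))"
    proof
      fix x' assume *: "x' \<in> Xb (lub (range s))"
      obtain n where "lt lam (ix x') (s n)" using l(3)[of "ix x'"] * by (auto simp: Xb_def)
      then have "x' \<in> Xb (s n)" using * by (auto simp: Xb_def)
      then obtain y' where y': "y' \<in> Yb (s (Suc n))" "(x', y') \<in> pairs (h (Suc n))" using hS(3) by auto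
      moreover have "y' \<in> Yb (lub (range s))" using y'(1) lam.ltt[OF _ l(2)] by (auto simp: Yb_def)
      ultimately show "\<exists>y'\<in>Yb (lub (range s)). (x', y') \<in> (\<Union>n. pairs (h n))" by auto
    qed
    show "\<forall>y'\<in>Yb \<epsilon>. \<exists>x'\<in>Xb \<epsilon>. (x', y') \<in> (\<Union>n. pairs (h n))"
      using p(5) pairs_mono[OF h(2)[of 0]] by fastforce
  qed
  ultimately show ?thesis by auto
qed

lemma start_zero: "start zero"
proof -
  have "Yb zero = {}" using zero(3) by (auto simp: Yb_def)
  moreover have "dom h0 \<subseteq> underS t (qq zero)"
    using h0(2) t.ltle[OF _ ejq(7)[OF zero(1)]] by auto
  ultimately show ?thesis unfolding start_def using h0(1) ejq(1)[OF zero(1)]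
    by (intro exI[of _ h0] bexI[of _ "qq zero"]) auto
qed

text \<open>The intervals from \<open>eps i\<close> to \<open>nx (eps i)\<close> cover
  \<open>lam\<close>, and each successor uses the block of its own interval. Within one block the
  pairs are one-to-one. A value coming from an earlier interval is already assigned, by the later
  block, to a left successor below that block, so it cannot be taken again.\<close>

lemma injection: "\<exists>\<pi>. inj_on \<pi> X \<and> \<pi> ` X \<subseteq> Y \<and> (\<forall>x'\<in>X. realized (x', \<pi> x'))"
proof -
  obtain E' where E': "E' \<subseteq> Field lam" "\<And>\<zeta>. \<zeta> \<in> Field lam \<Longrightarrow> \<exists>\<epsilon>\<in>E'. lt lam \<zeta> \<epsilon>"
    "\<And>Z u. Z \<subseteq> E' \<Longrightarrow> Z \<noteq> {} \<Longrightarrow> u \<in> Field lam \<Longrightarrow> \<forall>a\<in>Z. (a, u) \<in> lam \<Longrightarrow> lub Z \<in> E'"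
    "\<And>\<epsilon>. \<epsilon> \<in> E' \<Longrightarrow> start \<epsilon>"
  proof -
    from ex_closed_set obtain E' where "E' \<subseteq> Field lam" "\<forall>\<zeta>\<in>Field lam. \<exists>\<epsilon>\<in>E'. lt lam \<zeta> \<epsilon>"
      "\<forall>Z u. Z \<subseteq> E' \<and> Z \<noteq> {} \<and> u \<in> Field lam \<and> (\<forall>a\<in>Z. (a, u) \<in> lam) \<longrightarrow> lub Z \<in> E'"
      "\<forall>\<epsilon>\<in>E'. start \<epsilon>" by (elim exE conjE)
    then show thesis by (intro that[of E']) (simp, simp, metis, simp)
  qed
  \<comment> \<open>The recursion starts with the supremum of the empty set, which is
    \<open>zero\<close> and need not belong to \<open>E'\<close>.\<close>
  define good where "good = insert zero E'"
  have goodF: "good \<subseteq> Field lam" using E'(1) zero(1) by (auto simp: good_def)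
  have "\<forall>\<epsilon>\<in>good. \<exists>\<zeta> U. \<zeta> \<in> E' \<and> block \<epsilon> \<zeta> U"
  proof
    fix \<epsilon> assume "\<epsilon> \<in> good"
    then have "\<epsilon> \<in> Field lam" "start \<epsilon>" using goodF E'(4) start_zero by (auto simp: good_def)
    then have "\<exists>\<zeta>\<in>E'. \<exists>U. block \<epsilon> \<zeta> U" by (intro ex_block[OF E'(1,2)]) (use E'(3) in auto)
    then show "\<exists>\<zeta> U. \<zeta> \<in> E' \<and> block \<epsilon> \<zeta> U" by auto
  qed
  from bchoice[OF this] obtain nx where "\<forall>\<epsilon>\<in>good. \<exists>U. nx \<epsilon> \<in> E' \<and> block \<epsilon> (nx \<epsilon>) U" by auto
  from bchoice[OF this] obtain U
    where nx: "\<And>\<epsilon>. \<epsilon> \<in> good \<Longrightarrow> nx \<epsilon> \<in> E' \<and> block \<epsilon> (nx \<epsilon>) (U \<epsilon>)" by auto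
  define R where "R = {(a, b). lt lam a b}"
  define eps where "eps = wfrec R (\<lambda>f i. lub ((\<lambda>i'. nx (f i')) ` underS lam i))"
  have eps: "eps i = lub ((\<lambda>i'. nx (eps i')) ` underS lam i)" for i
  proof -
    have "eps i = lub ((\<lambda>i'. nx (cut eps R i i')) ` underS lam i)"
      unfolding eps_def by (subst wfrec) (simp_all add: R_def lam.wf_lt)
    also have "(\<lambda>i'. nx (cut eps R i i')) ` underS lam i = (\<lambda>i'. nx (eps i')) ` underS lam i"
      by (intro image_cong) (auto simp: R_def cut_apply)
    finally show ?thesis .
  qed
  have main: "eps i \<in> good \<and> (\<forall>i'. lt lam i' i \<longrightarrow> (nx (eps i'), eps i) \<in> lam) \<and>
      (\<forall>c\<in>Field lam. (\<forall>i'. lt lam i' i \<longrightarrow> (nx (eps i'), c) \<in> lam) \<longrightarrow> (eps i, c) \<in> lam)"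
    if "i \<in> Field lam" for i
    using that
  proof (induct i rule: lam.induct)
    case (less i)
    let ?A = "(\<lambda>i'. nx (eps i')) ` underS lam i"
    have AE: "?A \<subseteq> E'" using less(2) nx by auto
    then have AF: "?A \<subseteq> Field lam" using E'(1) by auto
    obtain u where u: "u \<in> Field lam" "\<And>a. a \<in> ?A \<Longrightarrow> (a, u) \<in> lam"
      using ex_upper[OF AF image_le[OF card_underS]] by auto
    have "eps i \<in> good"
    proof (cases "underS lam i = {}")
      case True
      then show ?thesis unfolding eps[of i] by (simp add: good_def lub_def zero_def)
    next
      case False
      then show ?thesis unfolding eps[of i] good_def using E'(3)[OF AE _ u(1)] u(2) by auto
    qed
    moreover have "(nx (eps i'), eps i) \<in> lam" if "lt lam i' i" for i'
      unfolding eps[of i] using that by (intro lub_upper[OF AF u]) auto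
    moreover have "(eps i, c) \<in> lam" if "c \<in> Field lam" "\<forall>i'. lt lam i' i \<longrightarrow> (nx (eps i'), c) \<in> lam" for c
      unfolding eps[of i] using that by (intro lub_least[OF AF]) auto
    ultimately show ?case by simp
  qed
  have good: "eps i \<in> good" "nx (eps i) \<in> Field lam" "eps i \<in> Field lam" "lt lam (eps i) (nx (eps i))"
    "block (eps i) (nx (eps i)) (U (eps i))" if "i \<in> Field lam" for i
    using main[OF that] nx[of "eps i"] E'(1) goodF blockD(1)[of "eps i"] by auto
  have grow: "(i, eps i) \<in> lam" if "i \<in> Field lam" for i
    using that
  proof (induct i rule: lam.induct)
    case (less i)
    show ?case
    proof (rule ccontr)
      assume "(i, eps i) \<notin> lam"
      then have *: "lt lam (eps i) i" using lam.not_le[OF less(1) good(3)[OF less(1)]] by simp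
      have "lt lam (eps (eps i)) (nx (eps (eps i)))" using good(4) lt_Field1[OF *] by simp
      moreover have "(nx (eps (eps i)), eps i) \<in> lam" using main[OF less(1)] * by simp
      moreover have "(eps i, eps (eps i)) \<in> lam" using less(2)[OF *] .
      ultimately show False using lam.lele lam.asym by metis
    qed
  qed
  have "\<exists>i. i \<in> Field lam \<and> lt lam j (nx (eps i)) \<and> (eps i, j) \<in> lam" if j: "j \<in> Field lam" for j
  proof -
    \<comment> \<open>For the least \<open>i\<close> whose interval ends beyond \<open>j\<close>,
      all earlier intervals end at or below \<open>j\<close>, hence so does their supremum
      \<open>eps i\<close>.\<close>
    let ?I = "{i \<in> Field lam. lt lam j (nx (eps i))}"
    have "j \<in> ?I" using j lam.lelt[OF grow good(4)] by auto
    then obtain i where i: "i \<in> ?I" "\<forall>i'\<in>?I. (i, i') \<in> lam" using lam.ex_least[of ?I] by auto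
    have "(nx (eps i'), j) \<in> lam" if "lt lam i' i" for i'
    proof -
      have "i' \<notin> ?I" using i(2) that lam.asym by auto
      then show ?thesis using lt_Field1[OF that] good(2) lam.not_lt[OF j] by auto
    qed
    then have "(eps i, j) \<in> lam" using main i(1) j by auto
    then show ?thesis using i(1) by auto
  qed
  then obtain st where st: "\<And>j. j \<in> Field lam \<Longrightarrow> st j \<in> Field lam \<and> lt lam j (nx (eps (st j))) \<and> (eps (st j), j) \<in> lam"
    by metis
  define i where "i x' = st (ix x')" for x'
  have i: "i x' \<in> Field lam" "x' \<in> Xb (nx (eps (i x')))" "(eps (i x'), ix x') \<in> lam" if "x' \<in> X" for x'
    using st[OF ix(2)[OF that]] that by (auto simp: i_def Xb_def)
  have "\<forall>x'\<in>X. \<exists>y'. y' \<in> Yb (nx (eps (i x'))) \<and> (x', y') \<in> U (eps (i x'))"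
    using blockD(4)[OF good(5)[OF i(1)] i(2)] by auto
  from bchoice[OF this] obtain \<pi>
    where \<pi>: "\<And>x'. x' \<in> X \<Longrightarrow> \<pi> x' \<in> Yb (nx (eps (i x'))) \<and> (x', \<pi> x') \<in> U (eps (i x'))"
    by auto
  have less: False if *: "x1 \<in> X" "x2 \<in> X" "\<pi> x1 = \<pi> x2" "lt lam (i x1) (i x2)" for x1 x2
  proof -
    have "(nx (eps (i x1)), eps (i x2)) \<in> lam" using main[OF i(1)[OF *(2)]] *(4) by auto
    then have "\<pi> x1 \<in> Yb (eps (i x2))" using \<pi>[OF *(1)] lam.ltle by (auto simp: Yb_def)
    then obtain x'' where x'': "x'' \<in> Xb (eps (i x2))" "(x'', \<pi> x2) \<in> U (eps (i x2))"
      using blockD(5)[OF good(5)[OF i(1)[OF *(2)]]] *(3) by auto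
    then have "x'' = x2" using \<pi>[OF *(2)] blockD(3)[OF good(5)[OF i(1)[OF *(2)]]] by auto
    then show False using x''(1) i(3)[OF *(2)] lam.asym by (auto simp: Xb_def)
  qed
  have "inj_on \<pi> X"
  proof (rule inj_onI)
    fix x1 x2 assume x: "x1 \<in> X" "x2 \<in> X" "\<pi> x1 = \<pi> x2"
    then have "i x1 = i x2" using less lam.cases3[OF i(1) i(1)] by metis
    then show "x1 = x2" using \<pi>[OF x(1)] \<pi>[OF x(2)] x(3) blockD(3)[OF good(5)[OF i(1)[OF x(1)]]]
      by auto
  qed
  moreover have "realized (x', \<pi> x')" if "x' \<in> X" for x'
    using \<pi>[OF that] blockD(2)[OF good(5)[OF i(1)[OF that]]] by auto
  moreover have "\<pi> ` X \<subseteq> Y" using \<pi> by (auto simp: Yb_def)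
  ultimately show ?thesis by auto
qed

end

lemma (in level) level_flip: "level mu lam t B A (flip_strategy \<sigma>) (flip_moves h0) b Q y x"
proof -
  interpret f: game mu lam t B A "flip_strategy \<sigma>" by (rule game_flip)
  show ?thesis
    by unfold_locales (use h0 room card_children ideal in \<open>simp_all add: all_pairs_flip\<close>)
qed

text \<open>The usual fixed point argument. The last clause is the point: every pair of the
  bijection stems from one of the two injections, and so inherits that it is realized.\<close>

lemma Schroeder_Bernstein_selection:
  assumes "inj_on f X" "f ` X \<subseteq> Y" "inj_on g Y" "g ` Y \<subseteq> X"
  shows "\<exists>\<pi>. bij_betw \<pi> X Y \<and> (\<forall>x\<in>X. \<pi> x = f x \<or> x = g (\<pi> x))"
proof -
  \<comment> \<open>The least set that contains the points of \<open>X\<close> outside the range of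
    \<open>g\<close> and is closed under \<open>g\<close> after \<open>f\<close>.\<close>
  define Z where "Z = lfp (\<lambda>Z. X - g ` (Y - f ` Z))"
  have Z: "Z = X - g ` (Y - f ` Z)" unfolding Z_def by (rule lfp_unfold) (rule monoI, fast)
  define \<pi> where "\<pi> x = (if x \<in> Z then f x else inv_into Y g x)" for x
  have ZX: "Z \<subseteq> X" by (subst Z) (rule Diff_subset)
  have out: "x \<in> g ` (Y - f ` Z)" if "x \<in> X" "x \<notin> Z" for x using that(2) by (subst (asm) Z) (use that(1) in simp)
  have out': "inv_into Y g x \<in> Y - f ` Z" "g (inv_into Y g x) = x" if "x \<in> X" "x \<notin> Z" for x
    using out[OF that] assms(3) by auto
  have "inj_on \<pi> X"
  proof (rule inj_onI)
    fix a b assume ab: "a \<in> X" "b \<in> X" "\<pi> a = \<pi> b"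
    show "a = b"
    proof (cases "a \<in> Z")
      case aZ: True
      show ?thesis
      proof (cases "b \<in> Z")
        case True
        then show ?thesis using aZ ab inj_onD[OF assms(1)] by (simp add: \<pi>_def)
      next
        case False
        then show ?thesis using aZ ab out'(1)[of b] imageI[OF aZ, of f] by (simp add: \<pi>_def)
      qed
    next
      case aZ: False
      show ?thesis
      proof (cases "b \<in> Z")
        case True
        then show ?thesis using aZ ab out'(1)[of a] imageI[OF True, of f] by (simp add: \<pi>_def)
      next
        case False
        then have "inv_into Y g a = inv_into Y g b" using aZ ab(3) by (simp add: \<pi>_def)
        then show ?thesis using out'(2)[OF ab(1) aZ] out'(2)[OF ab(2) False] by metis
      qed
    qed
  qed
  moreover have "\<pi> ` X = Y"
  proof
    show "\<pi> ` X \<subseteq> Y" using out'(1) assms(2) unfolding \<pi>_def by auto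
    show "Y \<subseteq> \<pi> ` X"
    proof
      fix y assume y: "y \<in> Y"
      show "y \<in> \<pi> ` X"
      proof (cases "y \<in> f ` Z")
        case True
        then show ?thesis using ZX unfolding \<pi>_def by auto
      next
        case False
        then have gy: "g y \<in> g ` (Y - f ` Z)" "g y \<in> X" using y assms(4) by auto
        then have "g y \<notin> Z" by (subst Z) simp
        then show ?thesis using y gy(2) assms(3) unfolding \<pi>_def by (intro image_eqI[of _ _ "g y"]) auto
      qed
    qed
  qed
  moreover have "\<pi> x = f x \<or> x = g (\<pi> x)" if "x \<in> X" for x
    using out'[OF that] unfolding \<pi>_def by auto
  ultimately show ?thesis by (auto simp: bij_betw_def)
qed

context level begin

theorem bijection: "\<exists>\<pi>. bij_betw \<pi> X Y \<and> (\<forall>x'\<in>X. realized (x', \<pi> x'))"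
proof -
  interpret f: level mu lam t B A "flip_strategy \<sigma>" "flip_moves h0" b Q y x by (rule level_flip)
  obtain \<pi>1 where 1: "inj_on \<pi>1 X" "\<pi>1 ` X \<subseteq> Y" "\<And>x'. x' \<in> X \<Longrightarrow> realized (x', \<pi>1 x')"
    using injection by auto
  obtain \<pi>2 where 2: "inj_on \<pi>2 Y" "\<pi>2 ` Y \<subseteq> X" "\<And>y'. y' \<in> Y \<Longrightarrow> f.realized (y', \<pi>2 y')"
    using f.injection by auto
  have fr: "realized (a, b)" if *: "f.realized (b, a)" for a b
  proof -
    obtain h q where h: "q \<in> Q" "f.legal h" "end_ext t (flip_moves h0) h" "dom h \<subseteq> underS t q" "(b, a) \<in> f.pairs h"
      using * unfolding f.realized_def by auto
    have "legal (flip_moves h)" "end_ext t h0 (flip_moves h)" "(a, b) \<in> pairs (flip_moves h)"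
      using h(2,3,5) end_ext_flip[of t "flip_moves h0" h] all_pairs_flip[of lam t "flip_strategy \<sigma>" h]
        all_pairs_flip[of lam t \<sigma> "flip_moves h"] by auto
    then show ?thesis unfolding realized_def using h(1,4)
      by (intro exI[of _ "flip_moves h"] bexI[of _ q] conjI) (simp_all only: dom_flip)
  qed
  obtain \<pi> where \<pi>: "bij_betw \<pi> X Y" "\<And>x. x \<in> X \<Longrightarrow> \<pi> x = \<pi>1 x \<or> x = \<pi>2 (\<pi> x)"
    using Schroeder_Bernstein_selection[OF 1(1,2) 2(1,2)] by auto
  have "realized (x', \<pi> x')" if "x' \<in> X" for x'
    using \<pi>(2)[OF that] 1(3)[OF that] 2(3)[of "\<pi> x'"] fr bij_betwE[OF \<pi>(1)] that by metis
  then show ?thesis using \<pi>(1) by auto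
qed

end

section \<open>Trees\<close>

locale tree =
  fixes T :: "'a rel"
  assumes tree: "is_tree T"
begin

lemma po: "Partial_order T"
  using tree by (simp add: is_tree_def)

lemmas ltt = lt_trans[OF po] and lelt = le_lt_trans[OF po] and ltle = lt_le_trans[OF po]
  and asym = lt_asym[OF po] and antisym = le_antisym[OF po] and refl = le_refl[OF po]

lemma wo_underS: "x \<in> Field T \<Longrightarrow> well (Restr T (underS T x))"
  using tree by (simp add: is_tree_def well_def)

lemma Field_underS: "Field (Restr T (underS T x)) = underS T x"
  using po by (intro Refl_Field_Restr2) (auto simp: order_on_defs dest: lt_Field1)

lemma lt_Restr: "lt (Restr T A) a b \<longleftrightarrow> a \<in> A \<and> b \<in> A \<and> lt T a b"
  by (auto simp: lt_iff)

lemma comparable: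
  assumes "lt T a x" "lt T b x"
  shows "lt T a b \<or> a = b \<or> lt T b a"
proof -
  interpret w: well "Restr T (underS T x)" using wo_underS lt_Field2[OF assms(1)] .
  show ?thesis using w.cases3[of a b] assms unfolding Field_underS lt_Restr by auto
qed

lemma comparable_le:
  assumes "(a, x) \<in> T" "(b, x) \<in> T"
  shows "lt T a b \<or> a = b \<or> lt T b a"
  using assms comparable[of a x b] by (cases "a = x"; cases "b = x") (auto simp: lt_iff)

lemma ex_least_below:
  assumes "x \<in> Field T" "S \<subseteq> underS T x" "S \<noteq> {}"
  shows "\<exists>a\<in>S. \<forall>b\<in>S. \<not> lt T b a"
proof -
  interpret w: well "Restr T (underS T x)" using wo_underS[OF assms(1)] .
  obtain a where "a \<in> S" "\<forall>b\<in>S. (a, b) \<in> Restr T (underS T x)"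
    using w.ex_least[of S] assms(2,3) unfolding Field_underS by auto
  then show ?thesis using asym by (intro bexI[of _ a]) auto
qed

lemma wf_lt: "wf {(a, b). lt T a b}"
  unfolding wf_eq_minimal
proof (intro allI impI)
  fix S :: "'a set" and x assume x: "x \<in> S"
  show "\<exists>z\<in>S. \<forall>y. (y, z) \<in> {(a, b). lt T a b} \<longrightarrow> y \<notin> S"
  proof (cases "S \<inter> underS T x = {}")
    case True
    then show ?thesis using x by (intro bexI[of _ x]) auto
  next
    case False
    then obtain z where "lt T z x" by auto
    then have "x \<in> Field T" by (rule lt_Field2)
    then obtain a where a: "a \<in> S \<inter> underS T x" "\<forall>b\<in>S \<inter> underS T x. \<not> lt T b a"
      using ex_least_below[of x "S \<inter> underS T x"] False by auto
    then show ?thesis using ltt[of _ a x] by (intro bexI[of _ a]) auto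
  qed
qed

lemma underS_child: "x \<in> children T z \<Longrightarrow> underS T x = under T z"
proof -
  assume "x \<in> children T z"
  then have x: "lt T z x" "\<And>w. lt T z w \<Longrightarrow> \<not> lt T w x" by (auto simp: children_def immediate_pred_def)
  have zF: "z \<in> Field T" using lt_Field1[OF x(1)] .
  show ?thesis unfolding under_eq[OF po zF] using x comparable[of _ x z] ltt[of _ z x] by auto
qed

lemma child_iff: "x \<in> children T z \<longleftrightarrow> immediate_pred T z x"
  by (auto simp: children_def immediate_pred_def dest: lt_Field2)

text \<open>The first node outside \<open>W\<close> on the way to \<open>x\<close>. It turns a
  downward closed set of nodes below some node into the set of predecessors of a node.\<close>

lemma least_outside:
  assumes x: "x \<in> Field T" "x \<notin> W" and W: "W \<subseteq> underS T x" "\<And>w v. w \<in> W \<Longrightarrow> lt T v w \<Longrightarrow> v \<in> W"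
  shows "\<exists>a. (a, x) \<in> T \<and> a \<notin> W \<and> underS T a = W"
proof -
  have "\<exists>a. (a, x) \<in> T \<and> a \<notin> W \<and> (\<forall>b. lt T b a \<longrightarrow> b \<in> W)"
  proof (cases "underS T x \<subseteq> W")
    case True
    then show ?thesis using x refl by (intro exI[of _ x]) auto
  next
    case False
    then obtain a where a: "a \<in> underS T x - W" "\<forall>b\<in>underS T x - W. \<not> lt T b a"
      using ex_least_below[of x "underS T x - W"] x(1) by auto
    then show ?thesis using ltt[of _ a x] by (intro exI[of _ a]) (auto dest: lt_le)
  qed
  then obtain a where a: "(a, x) \<in> T" "a \<notin> W" "\<And>b. lt T b a \<Longrightarrow> b \<in> W" by auto
  have "lt T w a" if "w \<in> W" for w
    using comparable_le[of w x a] a(1,2) W(2)[OF that] that W(1) lt_le[of w T x] by auto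
  then show ?thesis using a by (intro exI[of _ a]) auto
qed

lemma immediate_pred_cong: "underS T x = underS T y \<Longrightarrow> immediate_pred T z x \<longleftrightarrow> immediate_pred T z y"
  by (simp add: immediate_pred_def)

end

lemma ordLess_card: "Well_order r \<Longrightarrow> Card_order k \<Longrightarrow> r <o k \<longleftrightarrow> |Field r| <o k"
proof
  assume "Card_order k" "r <o k"
  then have "Well_order r" by (simp add: ordLess_iff)
  then show "|Field r| <o k" using ordLeq_ordLess_trans[OF card_of_least \<open>r <o k\<close>] by simp
next
  assume *: "Well_order r" "Card_order k" "|Field r| <o k"
  show "r <o k"
  proof (rule ccontr)
    assume "\<not> r <o k"
    then have "k \<le>o r" using ordLess_or_ordLeq[OF *(1), of k] *(2) by (auto simp: card_order_on_well_order_on)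
    then have "|Field k| \<le>o |Field r|" by (rule card_of_mono2)
    then have "k \<le>o |Field r|" by (rule ordIso_ordLeq_trans[OF ordIso_symmetric[OF card_of_Field_ordIso[OF *(2)]]])
    then show False using not_ordLess_ordLeq[OF *(3)] by simp
  qed
qed

locale lk_tree =
  fixes lam :: "'l rel" and \<kappa> :: "'k rel" and T :: "'a rel"
  assumes lk: "lambda_kappa_tree lam \<kappa> T" and \<kappa>: "Card_order \<kappa>" "infinite (Field \<kappa>)"
    and lam_card': "Card_order lam"
begin

sublocale tree T
  using lk by unfold_locales (simp add: lambda_kappa_tree_def)

text \<open>The nodes below level \<kappa>. Cardinality can replace the order type because \<kappa>
  is a cardinal, see \<open>nontop_iff\<close>.\<close>

definition nontop :: "'a \<Rightarrow> bool" where
  "nontop x \<longleftrightarrow> |underS T x| <o \<kappa>"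

lemma height: "x \<in> Field T \<Longrightarrow> Restr T (underS T x) \<le>o \<kappa>"
  using lk by (simp add: lambda_kappa_tree_def)

lemma nontop_iff: "x \<in> Field T \<Longrightarrow> nontop x \<longleftrightarrow> Restr T (underS T x) <o \<kappa>"
  using ordLess_card[OF well.wo[OF wo_underS] \<kappa>(1)] unfolding Field_underS nontop_def by blast

lemma Restr_less:
  assumes "lt T z x"
  shows "Restr T (underS T z) <o Restr T (underS T x)"
proof -
  interpret w: well "Restr T (underS T x)" using wo_underS lt_Field2[OF assms] .
  have "initial (Restr T (underS T x)) z <o Restr T (underS T x)"
    by (rule w.initial_lt) (simp add: Field_underS assms)
  moreover have "initial (Restr T (underS T x)) z = Restr T (underS T z)"
    using ltt[OF _ assms] assms by (auto simp: initial_def lt_Restr)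
  ultimately show ?thesis by simp
qed

lemma nontop_below: "lt T z x \<Longrightarrow> nontop z"
  using Restr_less height nontop_iff ordLess_ordLeq_trans lt_Field1 lt_Field2 by metis

lemma limit_unique:
  assumes "x \<in> Field T" "y \<in> Field T" "underS T x = underS T y" "\<And>z. \<not> immediate_pred T z x"
  shows "x = y"
proof -
  have "\<forall>x\<in>Field T. \<forall>y\<in>Field T.
        (\<nexists>z. immediate_pred T z x) \<and> (\<nexists>z. immediate_pred T z y) \<and> underS T x = underS T y \<longrightarrow> x = y"
    using lk unfolding lambda_kappa_tree_def sim_def by (elim conjE)
  then show ?thesis using assms immediate_pred_cong[OF assms(3)] by simp
qed

lemma card_children: "|children T z| \<le>o lam"
proof (cases "children T z = {}")
  case True
  then show ?thesis using card_of_empty1[of lam] lam_card' card_order_on_well_order_on by fastforce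
next
  case False
  then obtain x where x: "x \<in> children T z" by auto
  then have xF: "x \<in> Field T" by (simp add: children_def)
  have "children T z \<subseteq> sim_class T x"
    using underS_child x by (auto simp: sim_class_def sim_def children_def)
  moreover have "|sim_class T x| <o cardSuc lam" using lk xF by (simp add: lambda_kappa_tree_def)
  ultimately have "|children T z| <o cardSuc lam" using card_of_mono1 ordLeq_ordLess_trans by metis
  then show ?thesis using cardSuc_ordLeq_ordLess[OF lam_card' card_of_Card_order] by metis
qed

end

section \<open>Building an isomorphism along the levels\<close>

lemma (in game) union_moves:
  assumes h: "\<And>w. w \<in> W \<Longrightarrow> legal (h w)"
    and chain: "\<And>w w'. w \<in> W \<Longrightarrow> w' \<in> W \<Longrightarrow> end_ext t (h w) (h w') \<or> end_ext t (h w') (h w)"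
    and b: "\<And>w. w \<in> W \<Longrightarrow> dom (h w) \<subseteq> underS t b"
  shows "\<exists>u. legal u \<and> (\<forall>w\<in>W. end_ext t (h w) u) \<and> dom u \<subseteq> underS t b"
proof -
  \<comment> \<open>Of two positions one end-extends the other, so they agree where both are defined
    and the choice of \<open>w\<close> does not matter.\<close>
  define u where "u z = (if \<exists>w\<in>W. z \<in> dom (h w) then h (SOME w. w \<in> W \<and> z \<in> dom (h w)) z else None)" for z
  have eq: "u z = h w z" if w: "w \<in> W" "z \<in> dom (h w)" for w z
  proof -
    let ?v = "SOME w. w \<in> W \<and> z \<in> dom (h w)"
    have v: "?v \<in> W \<and> z \<in> dom (h ?v)" by (rule someI[of _ w]) (use w in simp)
    have ext: "g z = g' z" if "end_ext t g g'" "z \<in> dom g" for g g' :: "('t, 'l, 'a, 'b) moves"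
      using that by (simp add: end_ext_def map_le_def)
    have "h ?v z = h w z"
      using chain[OF w(1) conjunct1[OF v]] ext[of "h w" "h ?v"] ext[of "h ?v" "h w"] w(2) v by fastforce
    then show ?thesis using w by (auto simp: u_def)
  qed
  have du: "z \<in> dom u \<longleftrightarrow> (\<exists>w\<in>W. z \<in> dom (h w))" for z
  proof
    assume "z \<in> dom u"
    then show "\<exists>w\<in>W. z \<in> dom (h w)" by (auto simp: u_def split: if_splits)
  next
    assume "\<exists>w\<in>W. z \<in> dom (h w)"
    then obtain w where "w \<in> W" "z \<in> dom (h w)" by auto
    then show "z \<in> dom u" using eq[of w z] by auto
  qed
  have bF: "dom u \<subseteq> underS t b"
  proof
    fix z assume "z \<in> dom u"
    then obtain w where "w \<in> W" "z \<in> dom (h w)" using du by metis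
    then show "lt t z b" using b by auto
  qed
  have "ran u \<subseteq> (\<Union>w\<in>W. ran (h w))"
  proof
    fix c assume "c \<in> ran u"
    then obtain z where z: "u z = Some c" by (auto simp: ran_def)
    then have "\<exists>w\<in>W. z \<in> dom (h w)" using du[of z] by auto
    then obtain w where "w \<in> W" "z \<in> dom (h w)" by auto
    then show "c \<in> (\<Union>w\<in>W. ran (h w))" using eq[of w z] z by (auto simp: ran_def)
  qed
  then have "legal u" unfolding legal_moves_def
  proof (intro conjI ballI)
    show F: "dom u \<subseteq> Field t" using bF lt_Field1 by fastforce
    show "(x, y) \<in> t \<or> (y, x) \<in> t" if "x \<in> dom u" "y \<in> dom u" for x y using t.total[OF subsetD[OF F that(1)] subsetD[OF F that(2)]] .
    fix c assume "c \<in> ran u"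
    then show "legal_challenge lam A B c" using \<open>ran u \<subseteq> _\<close> h by (auto simp: legal_moves_def)
  qed
  moreover have "end_ext t (h w) u" if w: "w \<in> W" for w
    unfolding end_ext_def map_le_def
  proof (intro conjI ballI)
    show "h w z = u z" if "z \<in> dom (h w)" for z using eq[OF w that] by simp
    fix y z assume y: "y \<in> dom u - dom (h w)" and z: "z \<in> dom (h w)"
    then have "\<exists>w\<in>W. y \<in> dom (h w)" using du[of y] by auto
    then obtain w' where w': "w' \<in> W" "y \<in> dom (h w')" by auto
    then have "\<not> end_ext t (h w') (h w)" using y map_le_implies_dom_le[of "h w'" "h w"] by (auto simp: end_ext_def)
    then show "lt t z y" using chain[OF w w'(1)] y z w'(2) by (auto simp: end_ext_def)
  qed
  ultimately show ?thesis using bF by auto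
qed

text \<open>
  \<open>Q A\<close> is the set of nodes of the clock by which a position may be bounded once the isomorphism
  has reached a node of \<open>I0\<close> with set of predecessors \<open>A\<close>.
\<close>

locale clocked = game mu lam t I0 I1 \<sigma> + I0: lk_tree lam \<kappa> I0 + I1: lk_tree lam \<kappa> I1
  for mu :: "'m rel" and lam :: "'l rel" and t :: "'t rel" and I0 :: "'a rel" and I1 :: "'b rel"
    and \<sigma> :: "('t, 'l, 'a, 'b) strategy" and \<kappa> :: "'k rel" +
  fixes Q :: "'a set \<Rightarrow> 't set"
  assumes ideal: "Field lam \<in> approachability_ideal lam"
    and Q_limit: "\<And>x bb. x \<in> Field I0 \<Longrightarrow> I0.nontop x \<Longrightarrow> (\<And>w. lt I0 w x \<Longrightarrow> bb w \<in> Q (underS I0 w)) \<Longrightarrow>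
      \<exists>b. \<exists>b'\<in>Q (underS I0 x). (\<forall>w\<in>underS I0 x. (bb w, b) \<in> t) \<and> lt t b b'"
    and Q_branch: "\<And>W bb. W \<subseteq> Field I0 \<Longrightarrow> |W| \<le>o \<kappa> \<Longrightarrow> (\<And>w. w \<in> W \<Longrightarrow> I0.nontop w \<and> bb w \<in> Q (underS I0 w)) \<Longrightarrow>
      \<exists>b\<in>Field t. \<forall>w\<in>W. (bb w, b) \<in> t"
    and Q_room: "\<And>z b. z \<in> Field I0 \<Longrightarrow> I0.nontop z \<Longrightarrow> b \<in> Q (underS I0 z) \<Longrightarrow> room t lam b (Q (under I0 z))"
    and Q_Field: "\<And>A. Q A \<subseteq> Field t"
begin

type_synonym (in -) ('t, 'l, 'a, 'b) state = "('t, 'l, 'a, 'b) moves \<times> 't \<times> 'b"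

abbreviation "ok h b z y \<equiv> legal h \<and> b \<in> Q (underS I0 z) \<and> dom h \<subseteq> underS t b \<and> (z, y) \<in> pairs h"

text \<open>The bijection is chosen from the state of \<open>z\<close> alone, so that all children
  of \<open>z\<close> are sent by the same one.\<close>

definition match :: "'a \<Rightarrow> ('t, 'l, 'a, 'b) state \<Rightarrow> 'a \<Rightarrow> 'b" where
  "match z = (\<lambda>(h, b, y). SOME \<pi>. bij_betw \<pi> (children I0 z) (children I1 y) \<and>
     (\<forall>x\<in>children I0 z. \<exists>h' b'. end_ext t h h' \<and> ok h' b' x (\<pi> x)))"

text \<open>A state consists of a position, a node of the clock bounding it, and the image. Nothing
  is demanded of the bound at level \<kappa>, where the position may already use the end of the
  clock.\<close>

definition step :: "'a \<Rightarrow> ('a \<Rightarrow> ('t, 'l, 'a, 'b) state) \<Rightarrow> ('t, 'l, 'a, 'b) state \<Rightarrow> bool" where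
  "step x F = (\<lambda>(h, b, y). legal h \<and> (x, y) \<in> pairs h \<and> (\<forall>z\<in>underS I0 x. end_ext t (fst (F z)) h) \<and>
     (I0.nontop x \<longrightarrow> ok h b x y) \<and> (\<forall>z. immediate_pred I0 z x \<longrightarrow> y = match z (F z) x))"

definition st :: "'a \<Rightarrow> ('t, 'l, 'a, 'b) state" where
  "st = wfrec {(a, b). lt I0 a b} (\<lambda>F x. SOME s. step x F s)"

definition hh where "hh x = fst (st x)"
definition bb where "bb x = fst (snd (st x))"
definition ff where "ff x = snd (snd (st x))"

lemma st_eq: "st x = (hh x, bb x, ff x)"
  by (simp add: hh_def bb_def ff_def)

lemma step_cong:
  assumes "\<And>z. lt I0 z x \<Longrightarrow> F z = G z"
  shows "step x F s = step x G s"
  unfolding step_def using assms by (cases s) (auto simp: immediate_pred_def)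

lemma st: "st x = (SOME s. step x st s)"
proof -
  have "st x = (SOME s. step x (cut st {(a, b). lt I0 a b} x) s)"
    unfolding st_def by (subst wfrec[OF I0.wf_lt]) simp
  moreover have "step x (cut st {(a, b). lt I0 a b} x) = step x st"
    by (rule ext, rule step_cong) (simp add: cut_apply)
  ultimately show ?thesis by simp
qed

lemma match:
  assumes "z \<in> Field I0" "I0.nontop z" "ok h b z y"
  shows "bij_betw (match z (h, b, y)) (children I0 z) (children I1 y)"
    and "x \<in> children I0 z \<Longrightarrow> \<exists>h' b'. end_ext t h h' \<and> ok h' b' x (match z (h, b, y) x)"
proof -
  interpret l: level mu lam t I0 I1 \<sigma> h b "Q (under I0 z)" z y
    by unfold_locales (use assms Q_Field I0.card_children I1.card_children ideal Q_room in auto)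
  have "\<exists>\<pi>. bij_betw \<pi> (children I0 z) (children I1 y) \<and>
     (\<forall>x\<in>children I0 z. \<exists>h' b'. end_ext t h h' \<and> ok h' b' x (\<pi> x))"
    using l.bijection unfolding l.realized_def by (auto simp: I0.underS_child) metis
  note * = someI_ex[OF this]
  have m: "match z (h, b, y) = (SOME \<pi>. bij_betw \<pi> (children I0 z) (children I1 y) \<and>
     (\<forall>x\<in>children I0 z. \<exists>h' b'. end_ext t h h' \<and> ok h' b' x (\<pi> x)))" by (simp add: match_def)
  show "bij_betw (match z (h, b, y)) (children I0 z) (children I1 y)" unfolding m using * by blast
  show "x \<in> children I0 z \<Longrightarrow> \<exists>h' b'. end_ext t h h' \<and> ok h' b' x (match z (h, b, y) x)"
    unfolding m using * by blast
qed

lemma imm_pred_unique: "immediate_pred I0 z x \<Longrightarrow> immediate_pred I0 z' x \<Longrightarrow> z = z'"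
  using I0.comparable[of z x z'] by (auto simp: immediate_pred_def)

text \<open>A child takes its state from the matching at its immediate predecessor. A limit node is
  nobody's child: the positions along the branch are united, and one additional move at the bound
  \<open>b\<close> asks for the node itself. Below level \<kappa> the bound leaves room to continue,
  at level \<kappa> it need not.\<close>

lemma step_st: "x \<in> Field I0 \<Longrightarrow> step x st (st x)"
proof (induct x rule: wf_induct_rule[OF I0.wf_lt])
  case (1 x)
  have IH: "step z st (st z)" if "lt I0 z x" for z using 1 that lt_Field1[OF that] by simp
  have okz: "ok (hh z) (bb z) z (ff z)" if "lt I0 z x" for z
    using IH[OF that] I0.nontop_below[OF that] unfolding step_def st_eq by simp
  have ext: "end_ext t (hh w) (hh z)" if "lt I0 z x" "lt I0 w z" for w z
    using IH[OF that(1)] that(2) unfolding step_def st_eq[of z] by (simp add: hh_def)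
  have "\<exists>s. step x st s"
  proof (cases "\<exists>z. immediate_pred I0 z x")
    case True
    then obtain z where z: "immediate_pred I0 z x" by auto
    then have xz: "x \<in> children I0 z" "lt I0 z x" by (auto simp: I0.child_iff immediate_pred_def)
    obtain h' b' where h': "end_ext t (hh z) h'" "ok h' b' x (match z (st z) x)"
      using match(2)[OF lt_Field1[OF xz(2)] I0.nontop_below[OF xz(2)] okz[OF xz(2)] xz(1)]
      unfolding st_eq[symmetric] by auto
    have "end_ext t (hh w) h'" if "lt I0 w x" for w
    proof (cases "w = z")
      case False
      then have "lt I0 w z" using that z I0.comparable[OF that xz(2)] by (auto simp: immediate_pred_def)
      then show ?thesis using ext[OF xz(2)] end_ext_trans[OF _ h'(1)] by simp
    qed (simp add: h')
    then have "step x st (h', b', match z (st z) x)"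
      unfolding step_def using h' z imm_pred_unique by (auto simp: hh_def)
    then show ?thesis by (rule exI)
  next
    case False
    have chain: "end_ext t (hh w) (hh w') \<or> end_ext t (hh w') (hh w)" if "lt I0 w x" "lt I0 w' x" for w w'
      using I0.comparable[OF that] ext that end_ext_refl by metis
    have "\<exists>b b'. b \<in> Field t \<and> (\<forall>w\<in>underS I0 x. (bb w, b) \<in> t) \<and> (I0.nontop x \<longrightarrow> b' \<in> Q (underS I0 x) \<and> lt t b b')"
    proof (cases "I0.nontop x")
      case True
      then have "\<exists>b. \<exists>b'\<in>Q (underS I0 x). (\<forall>w\<in>underS I0 x. (bb w, b) \<in> t) \<and> lt t b b'"
        using okz by (intro Q_limit[OF 1(2)]) auto
      then show ?thesis using lt_Field1 by metis
    next
      case False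
      have "|underS I0 x| \<le>o \<kappa>"
        using card_of_mono2[OF I0.height[OF 1(2)]] card_of_Field_ordIso[OF I0.\<kappa>(1)] ordLeq_ordIso_trans
        unfolding I0.Field_underS by metis
      then have "\<exists>b\<in>Field t. \<forall>w\<in>underS I0 x. (bb w, b) \<in> t"
        using okz I0.nontop_below by (intro Q_branch) (auto dest: lt_Field1)
      then show ?thesis using False by auto
    qed
    then obtain b b' where b: "b \<in> Field t" "\<And>w. lt I0 w x \<Longrightarrow> (bb w, b) \<in> t"
      "I0.nontop x \<Longrightarrow> b' \<in> Q (underS I0 x) \<and> lt t b b'" by auto
    have "\<exists>u. legal u \<and> (\<forall>w\<in>underS I0 x. end_ext t (hh w) u) \<and> dom u \<subseteq> underS t b"
    proof (rule union_moves)
      show "dom (hh w) \<subseteq> underS t b" if "w \<in> underS I0 x" for w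
        using okz[OF that] t.ltle[OF _ b(2)[OF that]] by auto
    qed (use okz chain in auto)
    then obtain u where u: "legal u" "\<And>w. lt I0 w x \<Longrightarrow> end_ext t (hh w) u" "dom u \<subseteq> underS t b" by auto
    obtain h' where h': "legal h'" "end_ext t u h'" "dom h' = insert b (dom u)" "\<exists>y. (x, y) \<in> pairs h'"
      using play_left[OF u(1) b(1) u(3), of "{x}"] 1(2) finite_le[of "{x}"] by auto
    then obtain y where y: "(x, y) \<in> pairs h'" by auto
    have "dom h' \<subseteq> underS t b'" if "I0.nontop x"
      unfolding h'(3) using u(3) b(3)[OF that] t.ltt by auto
    then have "step x st (h', b', y)"
      unfolding step_def using h'(1) y u(2) end_ext_trans[OF u(2) h'(2)] b(3) False by (auto simp: hh_def)
    then show ?thesis by (rule exI)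
  qed
  from someI_ex[OF this] show ?case unfolding st[symmetric] .
qed

lemma state:
  assumes "x \<in> Field I0"
  shows "legal (hh x)" "(x, ff x) \<in> pairs (hh x)" "lt I0 z x \<Longrightarrow> end_ext t (hh z) (hh x)"
    "I0.nontop x \<Longrightarrow> ok (hh x) (bb x) x (ff x)" "immediate_pred I0 z x \<Longrightarrow> ff x = match z (st z) x"
  using step_st[OF assms] unfolding step_def st_eq[of x] by (auto simp: hh_def)

lemma ff_Field: "x \<in> Field I0 \<Longrightarrow> ff x \<in> Field I1"
  using pairs_iso(2)[OF state(1,2,2)] .

lemma ff_mono:
  assumes "lt I0 z x"
  shows "lt I1 (ff z) (ff x)"
proof -
  note F = lt_Field1[OF assms] lt_Field2[OF assms]
  have "(z, ff z) \<in> pairs (hh x)" using state(2)[OF F(1)] pairs_mono[OF state(3)[OF F(2) assms]] by auto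
  then show ?thesis using pairs_iso(4)[OF state(1)[OF F(2)] _ state(2)[OF F(2)]] assms by metis
qed

lemma ff_children:
  assumes "z \<in> Field I0" "I0.nontop z"
  shows "bij_betw ff (children I0 z) (children I1 (ff z))"
proof -
  have "bij_betw (match z (st z)) (children I0 z) (children I1 (ff z))"
    unfolding st_eq by (rule match(1)[OF assms state(4)[OF assms]])
  moreover have "ff x = match z (st z) x" if "x \<in> children I0 z" for x
    using state(5)[of x z] that by (auto simp: I0.child_iff dest: lt_Field2 simp: immediate_pred_def)
  ultimately show ?thesis using bij_betw_cong[of "children I0 z" ff "match z (st z)"] by auto
qed

text \<open>In the limit case let \<open>y\<close> be a missed node below \<open>ff x\<close>. Below
  level \<kappa> one further move can ask for \<open>y\<close>; the answer is a node below
  \<open>x\<close>, whose image must then be \<open>y\<close>. At level \<kappa> there may be no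
  move left, but there the height decides: \<kappa> many images already lie below \<open>y\<close>,
  so \<open>ff x\<close> would be higher than \<kappa>.\<close>

lemma ff_pred: "x \<in> Field I0 \<Longrightarrow> underS I1 (ff x) = ff ` underS I0 x"
proof (induct x rule: wf_induct_rule[OF I0.wf_lt])
  case (1 x)
  have IH: "underS I1 (ff z) = ff ` underS I0 z" if "lt I0 z x" for z using 1 that lt_Field1[OF that] by simp
  show ?case
  proof (cases "\<exists>z. immediate_pred I0 z x")
    case True
    then obtain z where "immediate_pred I0 z x" by auto
    then have xz: "x \<in> children I0 z" "lt I0 z x" by (auto simp: I0.child_iff immediate_pred_def)
    have zF: "z \<in> Field I0" "ff z \<in> Field I1" using lt_Field1[OF xz(2)] ff_Field by auto
    have "ff x \<in> children I1 (ff z)" using bij_betwE[OF ff_children[OF zF(1) I0.nontop_below[OF xz(2)]]] xz(1) by simp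
    then show ?thesis using I1.underS_child I0.underS_child[OF xz(1)] IH[OF xz(2)]
      under_eq[OF I1.po zF(2)] under_eq[OF I0.po zF(1)] by simp
  next
    case False
    show ?thesis
    proof (rule ccontr)
      let ?W = "ff ` underS I0 x"
      have sub: "?W \<subseteq> underS I1 (ff x)" using ff_mono by auto
      assume "underS I1 (ff x) \<noteq> ?W"
      then obtain v where v: "lt I1 v (ff x)" "v \<notin> ?W" using sub by auto
      let ?S = "underS I1 (ff x) - ?W"
      obtain y where y: "y \<in> ?S" "\<forall>b\<in>?S. \<not> lt I1 b y"
        using I1.ex_least_below[of "ff x" ?S] ff_Field[OF 1(2)] v by auto
      have below: "lt I1 (ff z) y" if z: "lt I0 z x" for z
      proof -
        have "\<not> lt I1 y (ff z)" using IH[OF z] y I0.ltt[OF _ z] by auto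
        moreover have "y \<noteq> ff z" using y z by auto
        ultimately show ?thesis using I1.comparable[of y "ff x" "ff z"] y ff_mono[OF z] by auto
      qed
      show False
      proof (cases "I0.nontop x")
        case True
        note s = state(4)[OF 1(2) True]
        have yF: "y \<in> Field I1" using y lt_Field1 by fastforce
        have "bb x \<in> Field t" using s Q_Field by auto
        then obtain h' where h': "legal h'" "end_ext t (hh x) h'" "\<exists>x'. (x', y) \<in> pairs h'"
          using play_right[of "hh x" "bb x" "{y}"] s yF finite_le[of "{y}"] by auto
        then obtain x' where x': "(x', y) \<in> pairs h'" by auto
        have xp: "(x, ff x) \<in> pairs h'" using state(2)[OF 1(2)] pairs_mono[OF h'(2)] by auto
        have x'x: "lt I0 x' x" using pairs_iso(4)[OF h'(1) x' xp] y by simp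
        have "(x', ff x') \<in> pairs h'"
          using state(2)[OF lt_Field1[OF x'x]] pairs_mono[OF end_ext_trans[OF state(3)[OF 1(2) x'x] h'(2)]] by auto
        then have "y = ff x'" using pairs_iso(3)[OF h'(1) x', of x' "ff x'"] by simp
        then show False using y x'x by auto
      next
        case False
        then have "\<kappa> \<le>o Restr I0 (underS I0 x)"
          using I0.nontop_iff[OF 1(2)]
            ordLess_or_ordLeq[OF well.wo[OF I0.wo_underS[OF 1(2)]] card_order_on_well_order_on[OF I0.\<kappa>(1)]]
          by simp
        also have "Restr I0 (underS I0 x) \<le>o Restr I1 (underS I1 y)"
        proof (rule strict_mono_ordLeq[where f = ff])
          show "Well_order (Restr I0 (underS I0 x))" using well.wo[OF I0.wo_underS[OF 1(2)]] .
          have "y \<in> Field I1" using y lt_Field1 by fastforce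
          then show "Well_order (Restr I1 (underS I1 y))" using well.wo[OF I1.wo_underS] by simp
        qed (use below ff_mono in \<open>auto simp: I0.Field_underS I1.Field_underS I0.lt_Restr I1.lt_Restr\<close>)
        also (ordLeq_transitive) have "Restr I1 (underS I1 y) <o Restr I1 (underS I1 (ff x))"
          using I1.Restr_less y by simp
        also (ordLeq_ordLess_trans) have "Restr I1 (underS I1 (ff x)) \<le>o \<kappa>" using I1.height ff_Field[OF 1(2)] by simp
        finally (ordLess_ordLeq_trans) show False using ordLess_irreflexive by metis
      qed
    qed
  qed
qed

text \<open>Equal images force equal sets of predecessors by induction. The two nodes are then
  siblings, where the matching is injective, or limit nodes, which are determined by their
  predecessors.\<close>

lemma ff_inj: "x \<in> Field I0 \<Longrightarrow> x' \<in> Field I0 \<Longrightarrow> ff x = ff x' \<Longrightarrow> x = x'"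
proof (induct x arbitrary: x' rule: wf_induct_rule[OF I0.wf_lt])
  case (1 x)
  have im: "ff ` underS I0 x = ff ` underS I0 x'" using ff_pred 1(2-4) by metis
  have eq: "underS I0 x = underS I0 x'"
  proof
    show "underS I0 x \<subseteq> underS I0 x'"
    proof
      fix z assume z: "lt I0 z x"
      then obtain z' where z': "lt I0 z' x'" "ff z = ff z'" using im by auto
      then show "lt I0 z x'" using 1(1)[of z z'] z lt_Field1[OF z] lt_Field1[OF z'(1)] by simp
    qed
    show "underS I0 x' \<subseteq> underS I0 x"
    proof
      fix z' assume z': "lt I0 z' x'"
      then obtain z where z: "lt I0 z x" "ff z = ff z'" using im by (auto simp: image_iff set_eq_iff) metis
      then show "lt I0 z' x" using 1(1)[of z z'] z lt_Field1[OF z(1)] lt_Field1[OF z'] by simp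
    qed
  qed
  show ?case
  proof (cases "\<exists>z. immediate_pred I0 z x")
    case True
    then obtain z where z: "immediate_pred I0 z x" by auto
    then have "immediate_pred I0 z x'" using I0.immediate_pred_cong[OF eq] by simp
    then have c: "x \<in> children I0 z" "x' \<in> children I0 z" "lt I0 z x"
      using z by (auto simp: I0.child_iff immediate_pred_def)
    then show ?thesis using ff_children[OF lt_Field1[OF c(3)] I0.nontop_below[OF c(3)]] 1(4)
      by (auto simp: bij_betw_def inj_on_def)
  next
    case False
    then show ?thesis using I0.limit_unique[OF 1(2,3) eq] by simp
  qed
qed

lemma ff_less_iff: "x \<in> Field I0 \<Longrightarrow> x' \<in> Field I0 \<Longrightarrow> lt I0 x x' \<longleftrightarrow> lt I1 (ff x) (ff x')"
proof
  assume x: "x \<in> Field I0" "x' \<in> Field I0" "lt I1 (ff x) (ff x')"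
  then obtain z where "lt I0 z x'" "ff x = ff z" using ff_pred by auto
  then show "lt I0 x x'" using ff_inj[OF x(1) lt_Field1] by simp
qed (rule ff_mono)

lemma ff_nontop:
  assumes "z \<in> Field I0" "lt I1 (ff z) y"
  shows "I0.nontop z"
proof -
  have "inj_on ff (underS I0 z)" using ff_inj lt_Field1 by (metis inj_onI)
  then have "|underS I0 z| \<le>o |underS I1 (ff z)|"
    unfolding ff_pred[OF assms(1)] by (metis card_of_ordLeq subset_refl)
  then show ?thesis using I1.nontop_below[OF assms(2)] ordLeq_ordLess_trans
    unfolding I0.nontop_def I1.nontop_def by blast
qed

text \<open>In the limit case the branch below \<open>y\<close> has a preimage \<open>W\<close>,
  possibly of length \<kappa>. A last move above all bounds along \<open>W\<close> asks for
  \<open>y\<close>. The answer lies above \<open>W\<close>, so some node has exactly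
  \<open>W\<close> as predecessors, and by uniqueness of limit nodes its image is
  \<open>y\<close>.\<close>

lemma ff_surj: "y \<in> Field I1 \<Longrightarrow> y \<in> ff ` Field I0"
proof (induct y rule: wf_induct_rule[OF I1.wf_lt])
  case (1 y)
  have IH: "v \<in> ff ` Field I0" if "lt I1 v y" for v using 1(1)[of v] that lt_Field1[OF that] by simp
  show ?case
  proof (cases "\<exists>w. immediate_pred I1 w y")
    case True
    then obtain w where "immediate_pred I1 w y" by auto
    then have w: "y \<in> children I1 w" "lt I1 w y" by (auto simp: I1.child_iff immediate_pred_def)
    then obtain z where z: "z \<in> Field I0" "w = ff z" using IH by auto
    have "bij_betw ff (children I0 z) (children I1 w)" using ff_children[OF z(1) ff_nontop[OF z(1)]] w(2) z(2) by simp
    then obtain x where "x \<in> children I0 z" "y = ff x" using w(1) by (auto simp: bij_betw_def)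
    then show ?thesis by (auto simp: children_def)
  next
    case False
    define W where "W = {z \<in> Field I0. lt I1 (ff z) y}"
    have WF: "W \<subseteq> Field I0" by (auto simp: W_def)
    have fW: "ff ` W = underS I1 y" using IH by (auto simp: W_def)
    have down: "v \<in> W" if "w \<in> W" "lt I0 v w" for v w
      using that ff_mono[OF that(2)] I1.ltt lt_Field1[OF that(2)] by (auto simp: W_def)
    have nt: "I0.nontop w" if "w \<in> W" for w using that ff_nontop by (auto simp: W_def)
    have "inj_on ff W" using ff_inj WF by (auto simp: inj_on_def)
    then have "|W| \<le>o |underS I1 y|" using fW by (metis card_of_ordLeq subset_refl)
    also have "|underS I1 y| \<le>o \<kappa>"
      using card_of_mono2[OF I1.height[OF 1(2)]] card_of_Field_ordIso[OF I0.\<kappa>(1)] ordLeq_ordIso_trans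
      unfolding I1.Field_underS by metis
    finally (ordLeq_transitive) have Wc: "|W| \<le>o \<kappa>" .
    have oks: "ok (hh w) (bb w) w (ff w)" if "w \<in> W" for w using state(4) WF that nt by auto
    obtain b where b: "b \<in> Field t" "\<And>w. w \<in> W \<Longrightarrow> (bb w, b) \<in> t"
      using Q_branch[OF WF Wc, of bb] nt oks by auto
    have "\<exists>u. legal u \<and> (\<forall>w\<in>W. end_ext t (hh w) u) \<and> dom u \<subseteq> underS t b"
    proof (rule union_moves)
      show "dom (hh w) \<subseteq> underS t b" if "w \<in> W" for w
        using oks[OF that] t.ltle[OF _ b(2)[OF that]] by auto
      fix w w' assume w: "w \<in> W" "w' \<in> W"
      then have F: "w \<in> Field I0" "w' \<in> Field I0" "lt I1 (ff w) y" "lt I1 (ff w') y" by (auto simp: W_def)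
      have "lt I0 w w' \<or> w = w' \<or> lt I0 w' w"
        using I1.comparable[OF F(3,4)] ff_less_iff F(1,2) ff_inj[OF F(1,2)] by auto
      then show "end_ext t (hh w) (hh w') \<or> end_ext t (hh w') (hh w)" using state(3) F by auto
    qed (use oks in auto)
    then obtain u where u: "legal u" "\<And>w. w \<in> W \<Longrightarrow> end_ext t (hh w) u" "dom u \<subseteq> underS t b" by auto
    obtain h' where h': "legal h'" "end_ext t u h'" "\<exists>x. (x, y) \<in> pairs h'"
      using play_right[OF u(1) b(1) u(3), of "{y}"] 1(2) finite_le[of "{y}"] by auto
    then obtain x where x: "(x, y) \<in> pairs h'" by auto
    have "lt I0 w x" if "w \<in> W" for w
    proof -
      have "(w, ff w) \<in> pairs h'"
        using state(2) WF that pairs_mono[OF end_ext_trans[OF u(2)[OF that] h'(2)]] by auto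
      then show ?thesis using pairs_iso(4)[OF h'(1) _ x] that by (auto simp: W_def)
    qed
    moreover have xF: "x \<in> Field I0" using pairs_iso(1)[OF h'(1) x x] .
    ultimately obtain a where a: "(a, x) \<in> I0" "underS I0 a = W"
      using I0.least_outside[of x W] down by (metis lt_irrefl subsetI)
    have aF: "a \<in> Field I0" using a(1) by (auto simp: Field_def)
    have "underS I1 (ff a) = underS I1 y" using ff_pred[OF aF] a(2) fW by simp
    then have "y = ff a" using I1.limit_unique[OF 1(2) ff_Field[OF aF]] False by auto
    then show ?thesis using aF by simp
  qed
qed

theorem isomorphic: "isomorphic I0 I1"
  unfolding isomorphic_def
proof (intro exI[of _ ff] conjI ballI)
  have "inj_on ff (Field I0)" using ff_inj by (metis inj_onI)
  then show "bij_betw ff (Field I0) (Field I1)" unfolding bij_betw_def using ff_Field ff_surj by auto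
qed (rule ff_less_iff)

end

section \<open>The clocks\<close>

lemma ord_times_iff:
  "((x, y), (x', y')) \<in> ord_times r s \<longleftrightarrow> x \<in> Field r \<and> x' \<in> Field r \<and> y \<in> Field s \<and> y' \<in> Field s \<and>
     (lt s y y' \<or> y = y' \<and> (x, x') \<in> r)"
  by (simp add: ord_times_def)

lemma Field_ord_times:
  assumes "Well_order r" "Well_order s"
  shows "Field (ord_times r s) = Field r \<times> Field s"
proof
  show "Field (ord_times r s) \<subseteq> Field r \<times> Field s"
    unfolding ord_times_def by (auto simp: Field_def)
  show "Field r \<times> Field s \<subseteq> Field (ord_times r s)"
  proof clarify
    fix x y assume "x \<in> Field r" "y \<in> Field s"
    then have "((x, y), (x, y)) \<in> ord_times r s"
      using well.refl[of r] assms(1) by (simp add: well_def ord_times_iff)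
    then show "(x, y) \<in> Field (ord_times r s)" by (rule FieldI1)
  qed
qed

lemma lt_ord_times:
  "lt (ord_times r s) (x, y) (x', y') \<longleftrightarrow> x \<in> Field r \<and> x' \<in> Field r \<and> y \<in> Field s \<and> y' \<in> Field s \<and>
     (lt s y y' \<or> y = y' \<and> lt r x x')"
  by (auto simp: lt_iff ord_times_iff)

lemma Well_order_ord_times:
  assumes "Well_order r" "Well_order s"
  shows "Well_order (ord_times r s)"
proof -
  interpret r: well r using assms by unfold_locales
  interpret s: well s using assms by unfold_locales
  note F = Field_ord_times[OF assms]
  have "refl_on (Field (ord_times r s)) (ord_times r s)"
    unfolding refl_on_def F using r.refl by (auto simp: ord_times_iff)
  moreover have "trans (ord_times r s)"
    by (rule transI) (use s.ltt r.lele in \<open>auto simp: ord_times_iff\<close>)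
  moreover have "antisym (ord_times r s)"
  proof (rule antisymI, clarify)
    fix a b a' b' assume *: "((a, b), a', b') \<in> ord_times r s" "((a', b'), a, b) \<in> ord_times r s"
    then have "b = b'" using s.ltt[of b b' b] by (auto simp: ord_times_iff)
    then show "a = a' \<and> b = b'" using * r.antisym by (auto simp: ord_times_iff)
  qed
  moreover have "total_on (Field (ord_times r s)) (ord_times r s)"
    unfolding total_on_def F using s.cases3 r.total by (auto simp: ord_times_iff)
  moreover have "wf (ord_times r s - Id)"
  proof (rule wf_subset[OF wf_inv_image[OF wf_lex_prod[OF s.wf_lt r.wf_lt], of prod.swap]])
    show "ord_times r s - Id \<subseteq> inv_image ({(a, b). lt s a b} <*lex*> {(a, b). lt r a b}) prod.swap"
      by (auto simp: ord_times_iff in_inv_image lt_iff)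
  qed
  moreover have "ord_times r s \<subseteq> Field (ord_times r s) \<times> Field (ord_times r s)" by (auto simp: Field_def)
  ultimately show ?thesis by (simp add: order_on_defs well_order_on_def)
qed

lemma ord_succ_iff [simp]:
  "(Some x, Some y) \<in> ord_succ r \<longleftrightarrow> (x, y) \<in> r"
  "(None, Some y) \<notin> ord_succ r"
  "(Some x, None) \<in> ord_succ r \<longleftrightarrow> x \<in> Field r"
  "(None, None) \<in> ord_succ r"
  unfolding ord_succ_def by auto

lemma Field_ord_succ: "Field (ord_succ r) = insert None (Some ` Field r)"
proof
  show "Field (ord_succ r) \<subseteq> insert None (Some ` Field r)"
    unfolding ord_succ_def by (auto simp: Field_def)
  have "Some x \<in> Field (ord_succ r)" if "x \<in> Field r" for x
    using that ord_succ_iff(3) FieldI1 by metis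
  moreover have "None \<in> Field (ord_succ r)" using ord_succ_iff(4) FieldI1 by metis
  ultimately show "insert None (Some ` Field r) \<subseteq> Field (ord_succ r)" by auto
qed

lemma le_None: "z \<in> Field (ord_succ r) \<Longrightarrow> (z, None) \<in> ord_succ r"
  by (auto simp: Field_ord_succ)

lemma lt_ord_succ [simp]: "lt (ord_succ r) (Some x) (Some y) \<longleftrightarrow> lt r x y"
  by (simp add: lt_iff)

lemma Well_order_ord_succ:
  assumes "Well_order r"
  shows "Well_order (ord_succ r)"
proof -
  interpret r: well r using assms by unfold_locales
  have "refl_on (Field (ord_succ r)) (ord_succ r)"
    unfolding refl_on_def Field_ord_succ using r.refl by auto
  moreover have "trans (ord_succ r)"
  proof (rule transI)
    fix x y z assume "(x, y) \<in> ord_succ r" "(y, z) \<in> ord_succ r"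
    then show "(x, z) \<in> ord_succ r"
      by (cases x; cases y; cases z) (auto dest: r.lele FieldI1)
  qed
  moreover have "antisym (ord_succ r)"
  proof (rule antisymI)
    fix x y assume "(x, y) \<in> ord_succ r" "(y, x) \<in> ord_succ r"
    then show "x = y" by (cases x; cases y) (auto dest: r.antisym)
  qed
  moreover have "total_on (Field (ord_succ r)) (ord_succ r)"
    unfolding total_on_def Field_ord_succ using r.total by auto
  moreover have "wf (ord_succ r - Id)"
    unfolding wf_eq_minimal
  proof (intro allI impI)
    fix S :: "'a option set" and x assume x: "x \<in> S"
    show "\<exists>z\<in>S. \<forall>y. (y, z) \<in> ord_succ r - Id \<longrightarrow> y \<notin> S"
    proof (cases "\<exists>a. Some a \<in> S")
      case True
      then obtain a0 where "a0 \<in> {a. Some a \<in> S}" by auto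
      then have "\<exists>a\<in>{a. Some a \<in> S}. \<forall>b. (b, a) \<in> {(a, b). lt r a b} \<longrightarrow> b \<notin> {a. Some a \<in> S}"
        using r.wf_lt[unfolded wf_eq_minimal] by metis
      then obtain a where a: "Some a \<in> S" "\<And>b. lt r b a \<Longrightarrow> Some b \<notin> S" by auto
      have "y \<notin> S" if "(y, Some a) \<in> ord_succ r - Id" for y
        using that a(2) by (cases y) (auto simp: lt_iff)
      then show ?thesis using a(1) by auto
    next
      case False
      then have "y = None" if "y \<in> S" for y using that by (cases y) auto
      then have "S = {None}" using x by blast
      then show ?thesis by auto
    qed
  qed
  moreover have "ord_succ r \<subseteq> Field (ord_succ r) \<times> Field (ord_succ r)" by (auto simp: Field_def)
  ultimately show ?thesis by (simp add: order_on_defs well_order_on_def)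
qed

context succ_card begin

lemma card_Field_mu: "|Field mu| =o mu"
  using card_of_Field_ordIso[OF mu(1)] .

lemma mu_no_max: "a \<in> Field mu \<Longrightarrow> \<exists>b. lt mu a b"
  using infinite_Card_order_limit[OF mu] by (metis lt_iff)

text \<open>Fewer than \<open>mu\<close> elements lie below \<open>n\<close>, so \<open>mu\<close>
  many remain, and a well-order of that size is at least as long as the cardinal
  \<open>mu\<close>.\<close>

lemma upper_part:
  assumes "n \<in> Field mu"
  shows "mu \<le>o Restr mu {m. (n, m) \<in> mu}"
proof (rule ccontr)
  let ?M = "{m. (n, m) \<in> mu}"
  assume "\<not> ?thesis"
  then have "Restr mu ?M <o mu"
    using ordLess_or_ordLeq[OF mu.Well_order_Restr' mu.wo] by metis
  then have "|Field (Restr mu ?M)| <o mu" using ordLess_card[OF mu.Well_order_Restr' mu(1)] by metis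
  moreover have "?M \<subseteq> Field mu" by (auto simp: Field_def)
  ultimately have "|?M| <o mu" using mu.Field_Restr[of ?M] by simp
  moreover have "|underS mu n| <o mu" using card_of_underS[OF mu(1) assms] .
  ultimately have "|?M \<union> underS mu n| <o mu" by (rule card_of_Un_ordLess_infinite_Field[OF mu(2,1)])
  moreover have "?M \<union> underS mu n = Field mu"
    using mu.not_lt[OF _ assms] by (auto simp: Field_def dest: lt_Field1)
  ultimately have "|Field mu| <o mu" by simp
  then show False using card_Field_mu not_ordLess_ordIso by metis
qed

lemma ex_surj:
  assumes "underS lam \<gamma> \<noteq> {}"
  shows "\<exists>g. g ` Field mu = underS lam \<gamma>"
  using card_of_ordLeq2[OF assms, of "Field mu"] card_underS ordIso_symmetric[OF card_Field_mu]
    ordLeq_ordIso_trans by metis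

text \<open>
  The records of an enumeration of \<open>\<gamma>\<close> in order type \<open>\<mu>\<close>, that is, the values exceeding all earlier
  ones, are cofinal in \<open>\<gamma>\<close>.
\<close>

lemma ex_cofinal:
  "\<exists>e\<subseteq>underS lam \<gamma>. (\<forall>i\<in>underS lam \<gamma>. \<exists>i'\<in>e. (i, i') \<in> lam) \<and> Restr lam e \<le>o mu"
proof (cases "underS lam \<gamma> = {}")
  case True
  have "Well_order (Restr lam {})" by (rule lam.Well_order_Restr')
  then have "Restr lam {} \<le>o mu"
    by (intro strict_mono_ordLeq[of _ _ undefined] mu.wo) (auto simp: Field_def underS_def)
  then show ?thesis using True by (intro exI[of _ "{}"]) auto
next
  case False
  obtain g where g: "g ` Field mu = underS lam \<gamma>" using ex_surj[OF False] by auto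
  define M where "M = {m \<in> Field mu. \<forall>m'. lt mu m' m \<longrightarrow> lt lam (g m') (g m)}"
  have gF: "g m \<in> Field lam" if "m \<in> Field mu" for m using g that lt_Field1[of "g m" lam \<gamma>] by auto
  have mono: "lt mu m m'" if "m \<in> M" "m' \<in> M" "lt lam (g m) (g m')" for m m'
    using that mu.cases3[of m m'] lam.asym[of "g m'" "g m"] lt_le[OF that(3)] lt_irrefl
    unfolding M_def by auto
  have eF: "g ` M \<subseteq> underS lam \<gamma>" using g by (auto simp: M_def)
  have eF': "g ` M \<subseteq> Field lam" using gF by (auto simp: M_def)
  have "Restr lam (g ` M) \<le>o mu"
  proof (rule strict_mono_ordLeq[where f = "inv_into M g"])
    show "inv_into M g x \<in> Field mu" if "x \<in> Field (Restr lam (g ` M))" for x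
      using inv_into_into[of x g M] that lam.Field_Restr[OF eF'] by (auto simp: M_def)
    fix x y assume "lt (Restr lam (g ` M)) x y"
    then have xy: "x \<in> g ` M" "y \<in> g ` M" "lt lam x y" unfolding lam.lt_Restr by auto
    then show "lt mu (inv_into M g x) (inv_into M g y)"
      by (intro mono) (simp_all add: inv_into_into f_inv_into_f)
  qed (simp_all add: lam.Well_order_Restr' mu.wo)
  moreover have "\<exists>i'\<in>g ` M. (i, i') \<in> lam" if i: "i \<in> underS lam \<gamma>" for i
  proof -
    let ?S = "{m \<in> Field mu. (i, g m) \<in> lam}"
    have iF: "i \<in> Field lam" using i lt_Field1 by metis
    have "?S \<noteq> {}" using g i lam.refl[OF iF] by force
    then obtain m where m: "m \<in> ?S" "\<forall>m'\<in>?S. (m, m') \<in> mu" using mu.ex_least[of ?S] by auto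
    have "lt lam (g m') (g m)" if "lt mu m' m" for m'
    proof -
      have "m' \<in> Field mu" using lt_Field1[OF that] .
      moreover have "m' \<notin> ?S" using m(2) mu.asym[OF that] by auto
      ultimately have "lt lam (g m') i" using lam.not_lt[of "g m'" i] gF iF by auto
      then show ?thesis using m(1) lam.ltle by auto
    qed
    then show ?thesis using m(1) by (auto simp: M_def)
  qed
  ultimately show ?thesis using eF by (intro exI[of _ "g ` M"]) auto
qed

end

locale singular = succ_card +
  assumes sing: "\<not> regularCard mu"
begin

lemma ex_small_cofinal: "\<exists>K. K \<subseteq> Field mu \<and> cofinal K mu \<and> |K| <o mu"
proof -
  obtain K where K: "K \<subseteq> Field mu" "cofinal K mu" "\<not> |K| =o mu" using sing by (auto simp: regularCard_def)
  have "|K| \<le>o mu" using card_of_mono1[OF K(1)] card_Field_mu ordLeq_ordIso_trans by metis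
  then show ?thesis using K ordLeq_iff_ordLess_or_ordIso by metis
qed

text \<open>Enumerate \<gamma> along \<open>mu\<close> and let \<open>K\<close> be a small cofinal
  subset of \<open>mu\<close>. Either the values up to some \<open>k\<close> in \<open>K\<close> are
  already cofinal in \<gamma>, or each such set of values is bounded by some \<open>c k\<close>
  below \<gamma>, and the bounds \<open>c k\<close> are cofinal.\<close>

lemma ex_cofinal_small:
  "\<exists>e\<subseteq>underS lam \<gamma>. (\<forall>i\<in>underS lam \<gamma>. \<exists>i'\<in>e. (i, i') \<in> lam) \<and> |e| <o mu"
proof (cases "underS lam \<gamma> = {}")
  case True
  have "|{} :: 'b set| <o mu"
    using mu finite_ordLess_infinite[OF card_of_Well_order mu.wo, of "{}"] by (simp add: Field_card_of)
  then show ?thesis using True by (intro exI[of _ "{}"]) auto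
next
  case False
  obtain g where g: "g ` Field mu = underS lam \<gamma>" using ex_surj[OF False] by auto
  obtain K where K: "K \<subseteq> Field mu" "cofinal K mu" "|K| <o mu" using ex_small_cofinal by auto
  have gk: "g ` underS mu k \<subseteq> underS lam \<gamma>" for k using g lt_Field1 by fastforce
  show ?thesis
  proof (cases "\<exists>k\<in>K. \<forall>i\<in>underS lam \<gamma>. \<exists>i'\<in>g ` underS mu k. (i, i') \<in> lam")
    case True
    then obtain k where k: "k \<in> K" "\<forall>i\<in>underS lam \<gamma>. \<exists>i'\<in>g ` underS mu k. (i, i') \<in> lam" by auto
    have "|g ` underS mu k| <o mu"
      by (rule ordLeq_ordLess_trans[OF card_of_image card_of_underS[OF mu(1)]]) (use k(1) K(1) in auto)
    then show ?thesis using k(2) gk by (intro exI[of _ "g ` underS mu k"]) auto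
  next
    case no: False
    have "\<exists>c. \<forall>k\<in>K. c k \<in> underS lam \<gamma> \<and> (\<forall>i'\<in>g ` underS mu k. \<not> (c k, i') \<in> lam)"
      using no by (intro bchoice) auto
    then obtain c where c: "\<And>k. k \<in> K \<Longrightarrow> c k \<in> underS lam \<gamma>"
      "\<And>k i'. k \<in> K \<Longrightarrow> i' \<in> g ` underS mu k \<Longrightarrow> (c k, i') \<notin> lam" by auto
    have "\<exists>i'\<in>c ` K. (i, i') \<in> lam" if i: "lt lam i \<gamma>" for i
    proof -
      obtain m where m: "m \<in> Field mu" "i = g m" using g i by auto
      obtain k where k: "k \<in> K" "lt mu m k" using K(2) m(1) by (auto simp: cofinal_def lt_iff)
      have "(c k, i) \<notin> lam" using c(2)[OF k(1)] k(2) m(2) by auto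
      then have "lt lam i (c k)" using lam.not_le[of "c k" i] lt_Field1[OF i] lt_Field1[OF c(1)[OF k(1)]] by auto
      then show ?thesis using k(1) lt_le[of i lam "c k"] by auto
    qed
    moreover have "|c ` K| <o mu" by (rule ordLeq_ordLess_trans[OF card_of_image K(3)])
    ultimately show ?thesis using c(1) by (intro exI[of _ "c ` K"]) auto
  qed
qed

lemma bounded_cofinality:
  assumes "A \<subseteq> Field mu" "|A| <o cofinality mu"
  shows "\<exists>b\<in>Field mu. \<forall>a\<in>A. lt mu a b"
proof (rule ccontr)
  assume *: "\<not> ?thesis"
  have "cofinal A mu" unfolding cofinal_def
  proof
    fix a assume a: "a \<in> Field mu"
    obtain b where b: "lt mu a b" using mu_no_max[OF a] by auto
    have b': "b \<in> Field mu" using lt_Field2[OF b] .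
    then obtain c where c: "c \<in> A" "\<not> lt mu c b" using * by auto
    then have "(b, c) \<in> mu" using mu.not_lt[of c b] b' assms by auto
    then show "\<exists>b\<in>A. a \<noteq> b \<and> (a, b) \<in> mu" using mu.ltle[OF b] c(1) by (auto simp: lt_iff)
  qed
  moreover obtain K where "cofinality mu = |K|" "\<forall>K'. K' \<subseteq> Field mu \<and> cofinal K' mu \<longrightarrow> |K| \<le>o |K'|"
    using cofinality_exists[of "Field mu" mu] ex_small_cofinal cofinality_exists by metis
  ultimately have "cofinality mu \<le>o |A|" using assms(1) by simp
  then show False using assms(2) not_ordLess_ordLeq by metis
qed

text \<open>As \<open>e\<close> has fewer than \<open>mu\<close> elements, its copy above
  \<open>b\<close> ends before some \<open>q\<close> in \<open>mu\<close>. A level therefore costs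
  only a bounded part of the clock.\<close>

lemma ex_room_embedding:
  assumes "b \<in> Field mu"
  shows "\<exists>e j q. q \<in> Field mu \<and> e \<subseteq> underS lam \<gamma> \<and> (\<forall>i\<in>underS lam \<gamma>. \<exists>i'\<in>e. (i, i') \<in> lam) \<and>
    (\<forall>i\<in>e. (b, j i) \<in> mu \<and> lt mu (j i) q) \<and> (\<forall>i\<in>e. \<forall>i'\<in>e. lt lam i i' \<longrightarrow> lt mu (j i) (j i')) \<and> (b, q) \<in> mu"
proof -
  obtain e where e: "e \<subseteq> underS lam \<gamma>" "\<forall>i\<in>underS lam \<gamma>. \<exists>i'\<in>e. (i, i') \<in> lam" "|e| <o mu"
    using ex_cofinal_small by metis
  have "e \<subseteq> Field lam" using e(1) lt_Field1 by fastforce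
  then have F: "Field (Restr lam e) = e" using lam.Field_Restr by simp
  have "Restr lam e <o mu" using e(3) ordLess_card[OF lam.Well_order_Restr' mu(1), of e] F by simp
  then have "Restr lam e <o Restr mu {m. (b, m) \<in> mu}" using upper_part[OF assms] ordLess_ordLeq_trans by metis
  from strict_embedding_less[OF this] obtain j q where j: "q \<in> Field (Restr mu {m. (b, m) \<in> mu})"
    "\<forall>x\<in>e. lt (Restr mu {m. (b, m) \<in> mu}) (j x) q"
    "\<forall>x y. lt (Restr lam e) x y \<longrightarrow> lt (Restr mu {m. (b, m) \<in> mu}) (j x) (j y)" unfolding F by auto
  have "(b, q) \<in> mu" using j(1) by (auto simp: Field_def)
  then show ?thesis using e j(2,3) unfolding mu.lt_Restr lam.lt_Restr
    by (intro exI[of _ e] exI[of _ j] exI[of _ q]) (auto simp: Field_def)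
qed

end

text \<open>All levels share the set \<open>Field mu\<close> of bounds. A branch collects at most
  \<kappa> bounds, which is less than the cofinality of \<open>mu\<close>, so even at level \<kappa>
  a move below \<open>mu\<close> is left.\<close>

lemma game_equiv_isomorphic_singular:
  fixes mu :: "'m rel" and lam :: "'l rel" and I0 :: "'a rel" and I1 :: "'b rel"
  assumes "singular mu lam" and lk: "lk_tree lam \<kappa> I0" "lk_tree lam \<kappa> I1"
    and ideal: "Field lam \<in> approachability_ideal lam"
    and cof: "\<kappa> <o cofinality mu" and eq: "game_equiv lam mu I0 I1"
  shows "isomorphic I0 I1"
proof -
  interpret singular mu lam by fact
  interpret I0: lk_tree lam \<kappa> I0 by fact
  interpret I1: lk_tree lam \<kappa> I1 by fact
  obtain \<sigma> where \<sigma>: "winning_strategy lam mu I0 I1 \<sigma>" using eq by (auto simp: game_equiv_def)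
  interpret game mu lam mu I0 I1 \<sigma>
    by unfold_locales (use \<sigma> card_Field_mu ordIso_imp_ordLeq in auto)
  have small: "\<exists>b\<in>Field mu. \<forall>w\<in>W. (bb w, b) \<in> mu" if "|W| \<le>o \<kappa>" "\<And>w. w \<in> W \<Longrightarrow> bb w \<in> Field mu"
    for W :: "'a set" and bb
  proof -
    have "|bb ` W| <o cofinality mu"
      using ordLeq_transitive[OF card_of_image that(1)] cof ordLeq_ordLess_trans by metis
    then have "\<exists>b\<in>Field mu. \<forall>a\<in>bb ` W. lt mu a b" using that(2) by (intro bounded_cofinality) auto
    then show ?thesis using lt_le[of _ mu] by fastforce
  qed
  interpret clocked mu lam mu I0 I1 \<sigma> \<kappa> "\<lambda>_. Field mu"
  proof unfold_locales
    fix x bb assume "I0.nontop x" "\<And>w. lt I0 w x \<Longrightarrow> bb w \<in> Field mu"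
    then obtain b where b: "b \<in> Field mu" "\<forall>w\<in>underS I0 x. (bb w, b) \<in> mu"
      using small[of "underS I0 x" bb] ordLess_imp_ordLeq unfolding I0.nontop_def by metis
    obtain b' where "lt mu b b'" using mu_no_max[OF b(1)] by auto
    then show "\<exists>b. \<exists>b'\<in>Field mu. (\<forall>w\<in>underS I0 x. (bb w, b) \<in> mu) \<and> lt mu b b'"
      using b(2) lt_Field2 by metis
  next
    fix W :: "'a set" and bb assume "|W| \<le>o \<kappa>" "\<And>w. w \<in> W \<Longrightarrow> I0.nontop w \<and> bb w \<in> Field mu"
    then show "\<exists>b\<in>Field mu. \<forall>w\<in>W. (bb w, b) \<in> mu" using small[of W bb] by simp
  next
    fix b assume b: "b \<in> Field mu"
    show "room mu lam b (Field mu)" unfolding room_def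
    proof (intro conjI ballI)
      show "\<exists>q'\<in>Field mu. lt mu q q'" if "q \<in> Field mu" for q using mu_no_max[OF that] lt_Field2 by metis
      fix \<gamma>
      show "\<exists>e j. \<exists>q\<in>Field mu. e \<subseteq> underS lam \<gamma> \<and> (\<forall>i\<in>underS lam \<gamma>. \<exists>i'\<in>e. (i, i') \<in> lam) \<and>
        (\<forall>i\<in>e. (b, j i) \<in> mu \<and> lt mu (j i) q) \<and>
        (\<forall>i\<in>e. \<forall>i'\<in>e. lt lam i i' \<longrightarrow> lt mu (j i) (j i')) \<and> (b, q) \<in> mu"
        using ex_room_embedding[OF b, of \<gamma>] by metis
    qed simp
  qed (use ideal in auto)
  show ?thesis by (rule isomorphic)
qed

text \<open>Branches shorter than \<kappa> still have bounded positions, but those along a branch of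
  length \<kappa> may be cofinal in \<open>mu\<close>. The extra node \<open>None\<close> provides
  the one move that is then needed.\<close>

lemma game_equiv_isomorphic_singular_succ:
  fixes mu :: "'m rel" and lam :: "'l rel" and I0 :: "'a rel" and I1 :: "'b rel"
  assumes "singular mu lam" and lk: "lk_tree lam \<kappa> I0" "lk_tree lam \<kappa> I1"
    and ideal: "Field lam \<in> approachability_ideal lam"
    and cof: "\<kappa> =o cofinality mu" and eq: "game_equiv lam (ord_succ mu) I0 I1"
  shows "isomorphic I0 I1"
proof -
  interpret singular mu lam by fact
  interpret I0: lk_tree lam \<kappa> I0 by fact
  interpret I1: lk_tree lam \<kappa> I1 by fact
  let ?t = "ord_succ mu"
  obtain \<sigma> where \<sigma>: "winning_strategy lam ?t I0 I1 \<sigma>" using eq by (auto simp: game_equiv_def)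
  have "|Field ?t| \<le>o mu" unfolding Field_ord_succ
    by (intro card_insert_le image_le ordIso_imp_ordLeq card_Field_mu)
  then interpret game mu lam ?t I0 I1 \<sigma>
    by unfold_locales (use \<sigma> Well_order_ord_succ mu.wo in auto)
  interpret clocked mu lam ?t I0 I1 \<sigma> \<kappa> "\<lambda>_. Some ` Field mu"
  proof unfold_locales
    fix x bb assume x: "I0.nontop x" and bb: "\<And>w. lt I0 w x \<Longrightarrow> bb w \<in> Some ` Field mu"
    have "|(the \<circ> bb) ` underS I0 x| <o cofinality mu"
      using ordLeq_ordLess_trans[OF card_of_image x[unfolded I0.nontop_def]] cof ordLess_ordIso_trans by metis
    then have "\<exists>b\<in>Field mu. \<forall>a\<in>(the \<circ> bb) ` underS I0 x. lt mu a b"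
      by (intro bounded_cofinality) (use bb in fastforce)+
    then obtain b where b: "b \<in> Field mu" "\<And>w. lt I0 w x \<Longrightarrow> lt mu (the (bb w)) b" by auto
    obtain b' where b': "lt mu b b'" using mu_no_max[OF b(1)] by auto
    have "(bb w, Some b) \<in> ?t" if "lt I0 w x" for w
      using bb[OF that] lt_le[OF b(2)[OF that]] by auto
    then show "\<exists>b. \<exists>b'\<in>Some ` Field mu. (\<forall>w\<in>underS I0 x. (bb w, b) \<in> ?t) \<and> lt ?t b b'"
      using b' lt_Field2[OF b'] by (intro exI[of _ "Some b"] bexI[of _ "Some b'"]) auto
  next
    fix W :: "'a set" and bb assume *: "\<And>w. w \<in> W \<Longrightarrow> I0.nontop w \<and> bb w \<in> Some ` Field mu"
    have "bb w \<in> Field ?t" if "w \<in> W" for w using *[OF that] by (auto simp: Field_ord_succ)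
    then show "\<exists>b\<in>Field ?t. \<forall>w\<in>W. (bb w, b) \<in> ?t"
      by (intro bexI[of _ None]) (simp_all add: le_None, simp add: Field_ord_succ)
  next
    fix b assume "b \<in> Some ` Field mu"
    then obtain b0 where b: "b = Some b0" "b0 \<in> Field mu" by auto
    show "room ?t lam b (Some ` Field mu)" unfolding room_def
    proof (intro conjI ballI)
      show "Some ` Field mu \<subseteq> Field ?t" by (auto simp: Field_ord_succ)
      show "\<exists>q'\<in>Some ` Field mu. lt ?t q q'" if q: "q \<in> Some ` Field mu" for q
      proof -
        obtain q0 where q0: "q = Some q0" "q0 \<in> Field mu" using q by auto
        obtain q1 where "lt mu q0 q1" using mu_no_max[OF q0(2)] by auto
        then show ?thesis using q0 lt_Field2[of q0 mu q1] by (intro bexI[of _ "Some q1"]) auto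
      qed
      fix \<gamma>
      obtain e j q where *: "q \<in> Field mu" "e \<subseteq> underS lam \<gamma>" "\<forall>i\<in>underS lam \<gamma>. \<exists>i'\<in>e. (i, i') \<in> lam"
        "\<forall>i\<in>e. (b0, j i) \<in> mu \<and> lt mu (j i) q" "\<forall>i\<in>e. \<forall>i'\<in>e. lt lam i i' \<longrightarrow> lt mu (j i) (j i')" "(b0, q) \<in> mu"
        using ex_room_embedding[OF b(2), of \<gamma>] by auto
      then show "\<exists>e j. \<exists>q\<in>Some ` Field mu. e \<subseteq> underS lam \<gamma> \<and> (\<forall>i\<in>underS lam \<gamma>. \<exists>i'\<in>e. (i, i') \<in> lam) \<and>
        (\<forall>i\<in>e. (b, j i) \<in> ?t \<and> lt ?t (j i) q) \<and>
        (\<forall>i\<in>e. \<forall>i'\<in>e. lt lam i i' \<longrightarrow> lt ?t (j i) (j i')) \<and> (b, q) \<in> ?t"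
        by (intro exI[of _ e] exI[of _ "Some \<circ> j"] bexI[of _ "Some q"]) (auto simp: b)
    qed
  qed (use ideal in \<open>auto simp: Field_ord_succ\<close>)
  show ?thesis by (rule isomorphic)
qed

context lk_tree begin

lemma Well_order_under:
  assumes "z \<in> Field T"
  shows "Well_order (Restr T (under T z))"
proof -
  have "under T z \<subseteq> Field T" by (auto simp: under_def Field_def)
  then have F: "Field (Restr T (under T z)) = under T z"
    using po by (intro Refl_Field_Restr2) (auto simp: order_on_defs)
  have "Partial_order (Restr T (under T z))" by (rule Partial_order_Restr[OF po])
  moreover have "total_on (under T z) (Restr T (under T z))"
    unfolding total_on_def
  proof (intro ballI impI)
    fix a b assume "a \<in> under T z" "b \<in> under T z" "a \<noteq> b"
    then show "(a, b) \<in> Restr T (under T z) \<or> (b, a) \<in> Restr T (under T z)"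
      using comparable_le[of a z b] lt_le[of a T b] lt_le[of b T a] by (auto simp: under_def)
  qed
  moreover have "wf (Restr T (under T z) - Id)"
    by (rule wf_subset[OF wf_lt]) (auto simp: lt_iff)
  ultimately show ?thesis by (simp add: F well_order_on_def linear_order_on_def)
qed

lemma Restr_under_less:
  assumes "z \<in> Field T" "nontop z"
  shows "Restr T (underS T z) <o Restr T (under T z)" "Restr T (under T z) <o \<kappa>"
proof -
  interpret w: well "Restr T (under T z)" using Well_order_under[OF assms(1)] by unfold_locales
  have zu: "z \<in> under T z" using refl[OF assms(1)] by (simp add: under_def)
  have "under T z \<subseteq> Field T" by (auto simp: under_def Field_def)
  then have F: "Field (Restr T (under T z)) = under T z"
    using po by (intro Refl_Field_Restr2) (auto simp: order_on_defs)
  have "initial (Restr T (under T z)) z = Restr T (underS T z)"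
    using zu by (auto simp: initial_def lt_Restr under_def dest: lt_le)
  then show "Restr T (underS T z) <o Restr T (under T z)" using w.initial_lt[of z] F zu by simp
  have "|{z}| <o \<kappa>"
    using finite_ordLess_infinite[OF card_of_Well_order, of \<kappa> "{z}"] \<kappa> card_order_on_well_order_on
    by (auto simp: Field_card_of)
  then have "|{z} \<union> underS T z| <o \<kappa>"
    using assms(2) card_of_Un_ordLess_infinite_Field[OF \<kappa>(2,1)] unfolding nontop_def by metis
  then show "Restr T (under T z) <o \<kappa>"
    using ordLess_card[OF w.wo \<kappa>(1)] F under_eq[OF po assms(1)] by simp
qed

end

text \<open>A level \<alpha> is entered at a node \<open>(n, \<alpha>)\<close> with \<open>n\<close>
  finite. The matching runs through the rest of the copy \<alpha>, which still has type
  \<open>mu\<close>, and its \<omega> further moves are the finite nodes of the next copy. The node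
  \<open>None\<close> is reserved for cofinal branches.\<close>

lemma game_equiv_isomorphic:
  fixes mu :: "'m rel" and lam :: "'l rel" and I0 :: "'a rel" and I1 :: "'b rel"
  assumes "succ_card mu lam" and lk: "lk_tree lam \<kappa> I0" "lk_tree lam \<kappa> I1"
    and ideal: "Field lam \<in> approachability_ideal lam"
    and \<kappa>: "\<kappa> <o lam" and eq: "game_equiv lam (ord_succ (ord_times mu \<kappa>)) I0 I1"
  shows "isomorphic I0 I1"
proof -
  interpret succ_card mu lam by fact
  interpret I0: lk_tree lam \<kappa> I0 by fact
  interpret I1: lk_tree lam \<kappa> I1 by fact
  let ?s = "ord_times mu \<kappa>"
  let ?t = "ord_succ ?s"
  obtain \<sigma> where \<sigma>: "winning_strategy lam ?t I0 I1 \<sigma>" using eq by (auto simp: game_equiv_def)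
  interpret k: well \<kappa> using I0.\<kappa>(1) by unfold_locales (rule card_order_on_well_order_on)
  note Fs = Field_ord_times[OF mu.wo k.wo]
  have "|Field \<kappa>| \<le>o mu"
    using below ordIso_ordLess_trans[OF card_of_Field_ordIso[OF I0.\<kappa>(1)] \<kappa>] by metis
  then have "|Field ?t| \<le>o mu" unfolding Field_ord_succ Fs
    by (intro card_insert_le image_le Times_le ordIso_imp_ordLeq[OF card_Field_mu])
  then interpret game mu lam ?t I0 I1 \<sigma>
    by unfold_locales (use \<sigma> Well_order_ord_succ Well_order_ord_times mu.wo k.wo in auto)
  define Q where "Q A = {Some (n, \<alpha>) | n \<alpha>. n \<in> Field mu \<and> finite (underS mu n) \<and> \<alpha> \<in> Field \<kappa> \<and>
    Restr I0 A =o initial \<kappa> \<alpha>}" for A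
  have QF: "Q A \<subseteq> Field ?t" for A by (auto simp: Q_def Field_ord_succ Fs)
  obtain z0 where z0: "z0 \<in> Field mu" "underS mu z0 = {}"
  proof -
    have "Field mu \<noteq> {}" using mu by auto
    then obtain z where z: "z \<in> Field mu" "\<forall>b\<in>Field mu. (z, b) \<in> mu" using mu.ex_least[of "Field mu"] by auto
    have "underS mu z = {}"
    proof (rule equals0I)
      fix a assume a: "lt mu a z"
      then show False using z(2) lt_Field1[OF a] mu.asym by auto
    qed
    then show thesis using that z by simp
  qed
  have z0_le: "(z0, m) \<in> mu" if "m \<in> Field mu" for m using mu.not_lt[OF that z0(1)] z0(2) by simp
  have up: "\<exists>m. lt mu n m \<and> finite (underS mu m)" if n: "n \<in> Field mu" "finite (underS mu n)" for n
  proof -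
    have ne: "{m \<in> Field mu. lt mu n m} \<noteq> {}" using mu_no_max[OF n(1)] lt_Field2[of n mu] by auto
    have "\<exists>m\<in>{m \<in> Field mu. lt mu n m}. \<forall>b\<in>{m \<in> Field mu. lt mu n m}. (m, b) \<in> mu"
      by (rule mu.ex_least[OF _ ne]) auto
    then obtain m where m: "m \<in> Field mu" "lt mu n m" "\<And>b. b \<in> Field mu \<Longrightarrow> lt mu n b \<Longrightarrow> (m, b) \<in> mu" by auto
    have "underS mu m \<subseteq> insert n (underS mu n)"
    proof
      fix a assume a: "lt mu a m"
      then have "\<not> lt mu n a" using m(3)[OF lt_Field1[OF a]] mu.asym by auto
      then show "a \<in> insert n (underS mu n)" using mu.cases3[OF lt_Field1[OF a] n(1)] by auto
    qed
    then show ?thesis using m(2) n(2) finite_subset by blast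
  qed
  interpret clocked mu lam ?t I0 I1 \<sigma> \<kappa> Q
  proof unfold_locales
    fix x bb assume x: "x \<in> Field I0" "I0.nontop x" and bb: "\<And>w. lt I0 w x \<Longrightarrow> bb w \<in> Q (underS I0 w)"
    obtain \<alpha> where \<alpha>: "\<alpha> \<in> Field \<kappa>" "Restr I0 (underS I0 x) =o initial \<kappa> \<alpha>"
      using k.ordLess_initial I0.nontop_iff[OF x(1)] x(2) by metis
    obtain m where m: "lt mu z0 m" "finite (underS mu m)" using up[OF z0(1)] z0(2) by auto
    \<comment> \<open>All bounds along the branch lie in earlier copies of \<open>mu\<close>, so the
      limit node can be asked for at the first node of its own copy.\<close>
    have "(bb w, Some (z0, \<alpha>)) \<in> ?t" if w: "lt I0 w x" for w
    proof -
      obtain n \<beta> where n: "bb w = Some (n, \<beta>)" "n \<in> Field mu" "\<beta> \<in> Field \<kappa>" "Restr I0 (underS I0 w) =o initial \<kappa> \<beta>"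
        using bb[OF w] by (auto simp: Q_def)
      have "initial \<kappa> \<beta> <o initial \<kappa> \<alpha>"
        using ordIso_ordLess_trans[OF ordIso_symmetric[OF n(4)] I0.Restr_less[OF w]] \<alpha>(2) ordLess_ordIso_trans by metis
      then show ?thesis using n \<alpha>(1) z0(1) k.initial_less_iff by (simp add: ord_times_iff)
    qed
    moreover have "Some (m, \<alpha>) \<in> Q (underS I0 x)" using m \<alpha> lt_Field2[OF m(1)] by (auto simp: Q_def)
    moreover have "lt ?t (Some (z0, \<alpha>)) (Some (m, \<alpha>))"
      using m(1) \<alpha>(1) z0(1) lt_Field2[OF m(1)] by (simp add: lt_ord_times)
    ultimately show "\<exists>b. \<exists>b'\<in>Q (underS I0 x). (\<forall>w\<in>underS I0 x. (bb w, b) \<in> ?t) \<and> lt ?t b b'" by blast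
  next
    fix W :: "'a set" and bb assume *: "\<And>w. w \<in> W \<Longrightarrow> I0.nontop w \<and> bb w \<in> Q (underS I0 w)"
    have "bb w \<in> Field ?t" if "w \<in> W" for w using *[OF that] QF by blast
    then show "\<exists>b\<in>Field ?t. \<forall>w\<in>W. (bb w, b) \<in> ?t"
      by (intro bexI[of _ None]) (simp_all add: le_None, simp add: Field_ord_succ)
  next
    fix z b assume z: "z \<in> Field I0" "I0.nontop z" and "b \<in> Q (underS I0 z)"
    then obtain n \<alpha> where b: "b = Some (n, \<alpha>)" "n \<in> Field mu" "\<alpha> \<in> Field \<kappa>" "Restr I0 (underS I0 z) =o initial \<kappa> \<alpha>"
      by (auto simp: Q_def)
    obtain \<alpha>' where \<alpha>': "\<alpha>' \<in> Field \<kappa>" "Restr I0 (under I0 z) =o initial \<kappa> \<alpha>'"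
      using k.ordLess_initial[OF I0.Restr_under_less(2)[OF z]] by auto
    have "initial \<kappa> \<alpha> <o initial \<kappa> \<alpha>'"
      using ordIso_ordLess_trans[OF ordIso_symmetric[OF b(4)] I0.Restr_under_less(1)[OF z]] \<alpha>'(2) ordLess_ordIso_trans by metis
    then have \<alpha>\<alpha>': "lt \<kappa> \<alpha> \<alpha>'" using k.initial_less_iff b(3) \<alpha>'(1) by simp
    show "room ?t lam b (Q (under I0 z))" unfolding room_def
    proof (intro conjI ballI)
      show "Q (under I0 z) \<subseteq> Field ?t" by (rule QF)
      show "\<exists>q'\<in>Q (under I0 z). lt ?t q q'" if q: "q \<in> Q (under I0 z)" for q
      proof -
        obtain n \<beta> where n: "q = Some (n, \<beta>)" "n \<in> Field mu" "finite (underS mu n)" "\<beta> \<in> Field \<kappa>"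
          "Restr I0 (under I0 z) =o initial \<kappa> \<beta>" using q by (auto simp: Q_def)
        obtain m where m: "lt mu n m" "finite (underS mu m)" using up[OF n(2,3)] by auto
        then show ?thesis using n lt_Field2[OF m(1)]
          by (intro bexI[of _ "Some (m, \<beta>)"]) (auto simp: Q_def lt_ord_times)
      qed
      fix \<gamma>
      obtain e where e: "e \<subseteq> underS lam \<gamma>" "\<forall>i\<in>underS lam \<gamma>. \<exists>i'\<in>e. (i, i') \<in> lam" "Restr lam e \<le>o mu"
        using ex_cofinal by metis
      have "e \<subseteq> Field lam" using e(1) lt_Field1 by fastforce
      then have F: "Field (Restr lam e) = e" using lam.Field_Restr by simp
      have "Restr lam e \<le>o Restr mu {m. (n, m) \<in> mu}" using e(3) upper_part[OF b(2)] ordLeq_transitive by metis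
      from strict_embedding[OF this] obtain j where j: "\<forall>x\<in>e. j x \<in> Field (Restr mu {m. (n, m) \<in> mu})"
        "\<forall>x y. lt (Restr lam e) x y \<longrightarrow> lt (Restr mu {m. (n, m) \<in> mu}) (j x) (j y)" unfolding F by auto
      have jF: "(n, j i) \<in> mu" "j i \<in> Field mu" if "i \<in> e" for i
      proof -
        show "(n, j i) \<in> mu" using j(1) that by (auto simp: Field_def)
        then show "j i \<in> Field mu" by (rule FieldI2)
      qed
      have jm: "lt mu (j i) (j i')" if "i \<in> e" "i' \<in> e" "lt lam i i'" for i i'
        using j(2) that unfolding mu.lt_Restr lam.lt_Restr by auto
      show "\<exists>e j. \<exists>q\<in>Q (under I0 z). e \<subseteq> underS lam \<gamma> \<and> (\<forall>i\<in>underS lam \<gamma>. \<exists>i'\<in>e. (i, i') \<in> lam) \<and>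
        (\<forall>i\<in>e. (b, j i) \<in> ?t \<and> lt ?t (j i) q) \<and>
        (\<forall>i\<in>e. \<forall>i'\<in>e. lt lam i i' \<longrightarrow> lt ?t (j i) (j i')) \<and> (b, q) \<in> ?t"
      proof (intro exI[of _ e] exI[of _ "\<lambda>i. Some (j i, \<alpha>)"] bexI[of _ "Some (z0, \<alpha>')"] conjI)
        show "Some (z0, \<alpha>') \<in> Q (under I0 z)" using z0 \<alpha>' by (auto simp: Q_def)
        show "\<forall>i\<in>e. (b, Some (j i, \<alpha>)) \<in> ?t \<and> lt ?t (Some (j i, \<alpha>)) (Some (z0, \<alpha>'))"
          using jF b \<alpha>'(1) \<alpha>\<alpha>' z0(1) by (simp add: ord_times_iff lt_ord_times)
        show "\<forall>i\<in>e. \<forall>i'\<in>e. lt lam i i' \<longrightarrow> lt ?t (Some (j i, \<alpha>)) (Some (j i', \<alpha>))"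
          using jF jm b(3) by (simp add: lt_ord_times)
        show "(b, Some (z0, \<alpha>')) \<in> ?t" using b \<alpha>'(1) \<alpha>\<alpha>' z0(1) by (simp add: ord_times_iff)
      qed (use e in auto)
    qed
  qed (use ideal QF in auto)
  show ?thesis by (rule isomorphic)
qed

section \<open>Trees of sequences\<close>

locale tall = succ_card mu lam + k: well \<kappa>
  for mu :: "'m rel" and lam :: "'l rel" and \<kappa> :: "'k rel" +
  assumes \<kappa>: "Card_order \<kappa>" "infinite (Field \<kappa>)" "regularCard \<kappa>"
    and \<kappa>_mu: "|Field \<kappa>| \<le>o mu"
    and mu_reg: "regularCard mu"
    and power: "weak_power lam \<kappa> =o lam"
begin

definition short :: "('k \<rightharpoonup> 'l) set" where
  "short = {s. \<exists>\<alpha>\<in>Field \<kappa>. dom s = underS \<kappa> \<alpha> \<and> ran s \<subseteq> Field lam}"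

definition full :: "('k \<rightharpoonup> 'l) set" where
  "full = {s. dom s = Field \<kappa> \<and> ran s \<subseteq> Field lam}"

abbreviation "seqs \<equiv> short \<union> full"

abbreviation cut :: "('k \<rightharpoonup> 'l) \<Rightarrow> 'k \<Rightarrow> ('k \<rightharpoonup> 'l)" where
  "cut s \<nu> \<equiv> s |` underS \<kappa> \<nu>"

lemma dom_cut: "dom (s |` A) = dom s \<inter> A"
  by (auto simp: restrict_map_def split: if_splits)

text \<open>This is the use of \<open>power\<close> for the construction: a single ordinal below
  \<open>lam\<close> can name a whole sequence of length less than \<kappa>.\<close>

lemma ex_code: "\<exists>c. inj_on c short \<and> c ` short \<subseteq> Field lam"
proof -
  have "|short| =o lam" using power unfolding weak_power_def short_def .
  then have "|short| =o |Field lam|"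
    using card_of_Field_ordIso[OF lam_card] ordIso_symmetric ordIso_transitive by metis
  then show ?thesis using card_of_ordLeq ordIso_imp_ordLeq by metis
qed

definition code :: "('k \<rightharpoonup> 'l) \<Rightarrow> 'l" where
  "code = (SOME c. inj_on c short \<and> c ` short \<subseteq> Field lam)"

lemma code: "inj_on code short" "s \<in> short \<Longrightarrow> code s \<in> Field lam"
  using someI_ex[OF ex_code] unfolding code_def by auto

lemma ex_pairing: "\<exists>e. bij_betw e (Field lam) (Field lam \<times> Field lam)"
  using card_of_Times_same_infinite[OF infinite_lam] card_of_ordIso ordIso_symmetric by metis

text \<open>The pairs of ordinals are coded by single ordinals, so that the sequences are literally
  those counted by \<open>weak_power\<close>.\<close>

definition unpair :: "'l \<Rightarrow> 'l \<times> 'l" where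
  "unpair = (SOME e. bij_betw e (Field lam) (Field lam \<times> Field lam))"
definition og :: "'l \<Rightarrow> 'l" where "og v = fst (unpair v)"
definition xi :: "'l \<Rightarrow> 'l" where "xi v = snd (unpair v)"
definition mk :: "'l \<Rightarrow> 'l \<Rightarrow> 'l" where "mk a b = inv_into (Field lam) unpair (a, b)"

lemma unpair: "bij_betw unpair (Field lam) (Field lam \<times> Field lam)"
  using someI_ex[OF ex_pairing] unfolding unpair_def .

lemma og_xi: "v \<in> Field lam \<Longrightarrow> og v \<in> Field lam" "v \<in> Field lam \<Longrightarrow> xi v \<in> Field lam"
  using bij_betwE[OF unpair] unfolding og_def xi_def by (auto simp: mem_Times_iff)

lemma mk:
  assumes "a \<in> Field lam" "b \<in> Field lam"
  shows "mk a b \<in> Field lam" "og (mk a b) = a" "xi (mk a b) = b"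
proof -
  have *: "(a, b) \<in> unpair ` Field lam" using unpair assms by (simp add: bij_betw_def)
  show "mk a b \<in> Field lam" unfolding mk_def using inv_into_into[OF *] .
  show "og (mk a b) = a" "xi (mk a b) = b" unfolding mk_def og_def xi_def f_inv_into_f[OF *] by simp_all
qed

lemma mk_og_xi: "v \<in> Field lam \<Longrightarrow> mk (og v) (xi v) = v"
  unfolding mk_def og_def xi_def using unpair by (simp add: bij_betw_def)

lemma og_xi_eqI: "v \<in> Field lam \<Longrightarrow> w \<in> Field lam \<Longrightarrow> og v = og w \<Longrightarrow> xi v = xi w \<Longrightarrow> v = w"
  using mk_og_xi by metis

subsection \<open>Sequences and their initial segments\<close>

lemma k_no_max: "\<nu> \<in> Field \<kappa> \<Longrightarrow> \<exists>\<nu>'. lt \<kappa> \<nu> \<nu>'"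
  using infinite_Card_order_limit[OF \<kappa>(1,2)] by (metis lt_iff)

lemma ex_suc:
  assumes "\<nu> \<in> Field \<kappa>"
  shows "\<exists>\<alpha>\<in>Field \<kappa>. lt \<kappa> \<nu> \<alpha> \<and> underS \<kappa> \<alpha> = under \<kappa> \<nu>"
proof -
  let ?S = "{\<alpha> \<in> Field \<kappa>. lt \<kappa> \<nu> \<alpha>}"
  obtain a where "lt \<kappa> \<nu> a" using k_no_max[OF assms] by auto
  then have "?S \<noteq> {}" using lt_Field2[of \<nu> \<kappa> a] by auto
  moreover have "?S \<subseteq> Field \<kappa>" by auto
  ultimately have "\<exists>\<alpha>\<in>?S. \<forall>b\<in>?S. (\<alpha>, b) \<in> \<kappa>" by (intro k.ex_least)
  then obtain \<alpha> where \<alpha>: "\<alpha> \<in> ?S" "\<forall>b\<in>?S. (\<alpha>, b) \<in> \<kappa>" by auto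
  have "underS \<kappa> \<alpha> = under \<kappa> \<nu>"
  proof
    show "underS \<kappa> \<alpha> \<subseteq> under \<kappa> \<nu>"
    proof
      fix a assume a: "lt \<kappa> a \<alpha>"
      have aF: "a \<in> Field \<kappa>" using lt_Field1[OF a] .
      then have "a \<notin> ?S" using \<alpha>(2) k.asym[OF a] by auto
      then show "a \<in> under \<kappa> \<nu>" using aF k.not_lt[OF assms aF] by (simp add: under_def)
    qed
    show "under \<kappa> \<nu> \<subseteq> underS \<kappa> \<alpha>" using \<alpha>(1) k.lelt by (auto simp: under_def)
  qed
  then show ?thesis using \<alpha>(1) by auto
qed

lemma dom_Field: "s \<in> seqs \<Longrightarrow> dom s \<subseteq> Field \<kappa>"
proof -
  have "underS \<kappa> \<alpha> \<subseteq> Field \<kappa>" for \<alpha> by (rule subsetI) (rule lt_Field1)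
  then show "s \<in> seqs \<Longrightarrow> dom s \<subseteq> Field \<kappa>"
    unfolding short_def full_def by (elim UnE CollectE bexE conjE) simp_all
qed

lemma dom_down: "s \<in> seqs \<Longrightarrow> \<nu> \<in> dom s \<Longrightarrow> under \<kappa> \<nu> \<subseteq> dom s"
proof -
  assume s: "s \<in> seqs" "\<nu> \<in> dom s"
  then consider \<alpha> where "dom s = underS \<kappa> \<alpha>" | "dom s = Field \<kappa>" by (auto simp: short_def full_def)
  then show "under \<kappa> \<nu> \<subseteq> dom s"
  proof cases
    case 1
    then have "lt \<kappa> \<nu> \<alpha>" using s(2) by simp
    then show ?thesis unfolding 1 under_def using k.lelt by blast
  next
    case 2
    then show ?thesis by (auto simp: under_def intro: FieldI1)
  qed
qed

lemma ran_seqs: "s \<in> seqs \<Longrightarrow> s \<nu> = Some v \<Longrightarrow> v \<in> Field lam"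
  unfolding short_def full_def by (auto intro: ranI)

lemma cut_short:
  assumes "s \<in> seqs" "\<nu> \<in> dom s"
  shows "cut s \<nu> \<in> short" "dom (cut s \<nu>) = underS \<kappa> \<nu>"
proof -
  have "underS \<kappa> \<nu> \<subseteq> dom s" using dom_down[OF assms] by (auto simp: under_def underS_def)
  then show 1: "dom (cut s \<nu>) = underS \<kappa> \<nu>" unfolding dom_cut by auto
  have "ran (cut s \<nu>) \<subseteq> Field lam"
    using assms(1) by (auto simp: short_def full_def ran_def restrict_map_def)
  then show "cut s \<nu> \<in> short" unfolding short_def using 1 dom_Field[OF assms(1)] assms(2) by auto
qed

lemma cut_le: "cut s \<nu> \<subseteq>\<^sub>m s"
  by (auto simp: map_le_def)

lemma cut_cut: "lt \<kappa> \<nu> \<nu>' \<Longrightarrow> cut (cut s \<nu>') \<nu> = cut s \<nu>"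
  using k.ltt by (auto simp: restrict_map_def fun_eq_iff)

lemma cut_eq: "s \<subseteq>\<^sub>m s' \<Longrightarrow> A \<subseteq> dom s \<Longrightarrow> s |` A = s' |` A"
  unfolding map_le_def restrict_map_def by (auto simp: fun_eq_iff)

lemma seg:
  assumes "s \<in> seqs" "s' \<in> seqs" "s \<subseteq>\<^sub>m s'" "s \<noteq> s'"
  shows "\<exists>\<nu>\<in>dom s'. s = cut s' \<nu> \<and> dom s = underS \<kappa> \<nu>"
proof -
  have "dom s' - dom s \<noteq> {}"
  proof
    assume e: "dom s' - dom s = {}"
    have "s' a = s a" if "a \<in> dom s'" for a
    proof -
      have "a \<in> dom s" using e that by auto
      then show ?thesis using bspec[OF assms(3)[unfolded map_le_def]] by simp
    qed
    then have "s = s'" using assms(3) by (intro map_le_antisym) (simp_all add: map_le_def)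
    then show False using assms(4) by simp
  qed
  then obtain \<nu> where \<nu>: "\<nu> \<in> dom s' - dom s" "\<forall>b\<in>dom s' - dom s. (\<nu>, b) \<in> \<kappa>"
    using k.ex_least[of "dom s' - dom s"] dom_Field[OF assms(2)] by (metis Diff_subset subset_trans)
  have "dom s = underS \<kappa> \<nu>"
  proof
    show "dom s \<subseteq> underS \<kappa> \<nu>"
    proof
      fix a assume a: "a \<in> dom s"
      then have aF: "a \<in> Field \<kappa>" "\<nu> \<in> Field \<kappa>" using dom_Field assms(1,2) \<nu>(1) by auto
      have "\<not> (\<nu>, a) \<in> \<kappa>" using dom_down[OF assms(1) a] \<nu>(1) by (auto simp: under_def)
      then show "a \<in> underS \<kappa> \<nu>" using k.not_le[OF aF(2,1)] by simp
    qed
    show "underS \<kappa> \<nu> \<subseteq> dom s"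
    proof
      fix a assume a: "lt \<kappa> a \<nu>"
      then have "a \<in> dom s'" using dom_down[OF assms(2), of \<nu>] \<nu>(1) lt_le[OF a] by (auto simp: under_def)
      then show "a \<in> dom s" using \<nu>(2) k.asym[OF a] by auto
    qed
  qed
  moreover from this have "s = cut s' \<nu>"
  proof -
    have "s |` dom s = s" by (auto simp: restrict_map_def fun_eq_iff domIff)
    then show ?thesis using cut_eq[OF assms(3) subset_refl] \<open>dom s = underS \<kappa> \<nu>\<close> by simp
  qed
  ultimately show ?thesis using \<nu>(1) by auto
qed

lemma seg_iff:
  assumes "s' \<in> seqs"
  shows "s \<in> seqs \<and> s \<subseteq>\<^sub>m s' \<and> s \<noteq> s' \<longleftrightarrow> (\<exists>\<nu>\<in>dom s'. s = cut s' \<nu>)"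
proof
  assume "\<exists>\<nu>\<in>dom s'. s = cut s' \<nu>"
  then obtain \<nu> where \<nu>: "\<nu> \<in> dom s'" "s = cut s' \<nu>" by auto
  then have "\<nu> \<notin> dom s" unfolding dom_cut by (simp add: underS_def)
  then have "s \<noteq> s'" using \<nu>(1) by auto
  then show "s \<in> seqs \<and> s \<subseteq>\<^sub>m s' \<and> s \<noteq> s'" using \<nu> cut_short[OF assms] cut_le by auto
qed (use seg assms in blast)

lemma seqs_comparable:
  assumes "s \<in> seqs" "s' \<in> seqs" "u \<in> seqs" "s \<subseteq>\<^sub>m u" "s' \<subseteq>\<^sub>m u"
  shows "s \<subseteq>\<^sub>m s' \<or> s' \<subseteq>\<^sub>m s"
proof -
  have "s \<subseteq>\<^sub>m s'" if "dom s \<subseteq> dom s'" "s \<subseteq>\<^sub>m u" "s' \<subseteq>\<^sub>m u" for s s' :: "'k \<rightharpoonup> 'l"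
    using that unfolding map_le_def by (metis subsetD)
  moreover have "dom s \<subseteq> dom s' \<or> dom s' \<subseteq> dom s"
  proof (rule ccontr)
    assume "\<not> ?thesis"
    then obtain a b where ab: "a \<in> dom s" "a \<notin> dom s'" "b \<in> dom s'" "b \<notin> dom s" by auto
    then have "(a, b) \<in> \<kappa> \<or> (b, a) \<in> \<kappa>"
      by (intro k.total subsetD[OF dom_Field[OF assms(1)] ab(1)] subsetD[OF dom_Field[OF assms(2)] ab(3)])
    then show False using dom_down[OF assms(1) ab(1)] dom_down[OF assms(2) ab(3)] ab by (auto simp: under_def)
  qed
  ultimately show ?thesis using assms(4,5) by blast
qed

subsection \<open>The trees\<close>

abbreviation bot :: "'l \<Rightarrow> 'l list \<Rightarrow> 'l" where
  "bot a l \<equiv> (case l of [] \<Rightarrow> a | j # _ \<Rightarrow> j)"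

primrec desc :: "'l \<Rightarrow> 'l list \<Rightarrow> bool" where
  "desc a [] = True"
| "desc a (i # l) \<longleftrightarrow> desc a l \<and> lt lam i (bot a l)"

text \<open>The condition on \<open>dom s\<close> says that \<open>s\<close> has a last entry,
  namely at \<nu>. Sequences of limit length carry no tags.\<close>

definition tagged :: "('k \<rightharpoonup> 'l) \<Rightarrow> 'l \<Rightarrow> bool" where
  "tagged s a \<longleftrightarrow> (\<exists>\<nu>\<in>Field \<kappa>. dom s = under \<kappa> \<nu> \<and> a = og (the (s \<nu>)))"

text \<open>
  A node \<open>(s, l)\<close> with \<open>l \<noteq> []\<close> is a tag attached to \<open>s\<close>. The tags form the tree of descending
  sequences of ordinals below the first coordinate \<open>a\<close> of the last entry of \<open>s\<close> (latest element
  first); its rank makes \<open>a\<close> invariant under isomorphisms.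
\<close>

definition nodes :: "('k \<rightharpoonup> 'l) set \<Rightarrow> (('k \<rightharpoonup> 'l) \<times> 'l list) set" where
  "nodes Z = {(s, l). s \<in> short \<union> Z \<and> (l \<noteq> [] \<longrightarrow> s \<in> short \<and> (\<exists>a. tagged s a \<and> desc a l))}"

definition T :: "('k \<rightharpoonup> 'l) set \<Rightarrow> (('k \<rightharpoonup> 'l) \<times> 'l list) rel" where
  "T Z = {((s, l), (s', l')). (s, l) \<in> nodes Z \<and> (s', l') \<in> nodes Z \<and>
     (l = [] \<and> s \<subseteq>\<^sub>m s' \<or> s = s' \<and> (\<exists>u. l' = u @ l))}"

lemma nodes_Cons: "(s, i # l) \<in> nodes Z \<Longrightarrow> (s, l) \<in> nodes Z"
  unfolding nodes_def by auto

lemma Field_T: "Field (T Z) = nodes Z"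
proof
  show "Field (T Z) \<subseteq> nodes Z" unfolding T_def Field_def by auto
  show "nodes Z \<subseteq> Field (T Z)"
  proof
    fix x assume x: "x \<in> nodes Z"
    obtain s l where "x = (s, l)" by (cases x)
    then have "(x, x) \<in> T Z" using x unfolding T_def by auto
    then show "x \<in> Field (T Z)" by (rule FieldI1)
  qed
qed

end

locale seq_tree = tall mu lam \<kappa>
  for mu :: "'m rel" and lam :: "'l rel" and \<kappa> :: "'k rel" +
  fixes Z :: "('k \<rightharpoonup> 'l) set"
  assumes Z: "Z \<subseteq> full"
begin

lemma nodes_seqs: "(s, l) \<in> nodes Z \<Longrightarrow> s \<in> seqs"
  using Z unfolding nodes_def by auto

lemma nodes_Nil: "(s, []) \<in> nodes Z \<longleftrightarrow> s \<in> short \<union> Z"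
  unfolding nodes_def by auto

lemma nodes_tag: "(s, i # l) \<in> nodes Z \<longleftrightarrow> s \<in> short \<and> (\<exists>a. tagged s a \<and> desc a (i # l))"
  unfolding nodes_def by auto

lemma po_T: "Partial_order (T Z)"
proof -
  have "refl_on (Field (T Z)) (T Z)" unfolding refl_on_def Field_T
    by (auto simp: T_def)
  moreover have "trans (T Z)"
    by (rule transI) (auto simp: T_def intro: map_le_trans)
  moreover have "antisym (T Z)"
    by (rule antisymI) (auto simp: T_def intro: map_le_antisym)
  moreover have "T Z \<subseteq> Field (T Z) \<times> Field (T Z)" by (auto simp: Field_def)
  ultimately show ?thesis by (simp add: order_on_defs)
qed

lemma lt_T: "lt (T Z) (s, l) (s', l') \<longleftrightarrow> (s, l) \<in> nodes Z \<and> (s', l') \<in> nodes Z \<and>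
    (l = [] \<and> s \<subseteq>\<^sub>m s' \<and> s \<noteq> s' \<or> s = s' \<and> (\<exists>u. u \<noteq> [] \<and> l' = u @ l))"
  unfolding lt_iff T_def by auto

lemma underS_main:
  assumes "s \<in> short \<union> Z"
  shows "underS (T Z) (s, []) = (\<lambda>\<nu>. (cut s \<nu>, [])) ` dom s"
proof -
  have sq: "s \<in> seqs" using assms Z by auto
  have n: "(s, []) \<in> nodes Z" using assms nodes_Nil by simp
  have c: "(cut s \<nu>, []) \<in> nodes Z" if "\<nu> \<in> dom s" for \<nu>
    using cut_short(1)[OF sq that] nodes_Nil by simp
  show ?thesis
  proof (intro equalityI subsetI)
    fix y :: "('k \<rightharpoonup> 'l) \<times> 'l list" assume y: "y \<in> underS (T Z) (s, [])"
    obtain u l where u: "y = (u, l)" by (cases y)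
    have "u \<in> seqs \<and> u \<subseteq>\<^sub>m s \<and> u \<noteq> s" "l = []" using y nodes_seqs unfolding u lt_T by auto
    then show "y \<in> (\<lambda>\<nu>. (cut s \<nu>, [])) ` dom s" using seg_iff[OF sq, of u] u by auto
  next
    fix y :: "('k \<rightharpoonup> 'l) \<times> 'l list" assume "y \<in> (\<lambda>\<nu>. (cut s \<nu>, [])) ` dom s"
    then obtain \<nu> where \<nu>: "\<nu> \<in> dom s" "y = (cut s \<nu>, [])" by auto
    then have "cut s \<nu> \<in> seqs \<and> cut s \<nu> \<subseteq>\<^sub>m s \<and> cut s \<nu> \<noteq> s" using seg_iff[OF sq, of "cut s \<nu>"] by blast
    then show "y \<in> underS (T Z) (s, [])" using c[OF \<nu>(1)] n \<nu>(2) lt_T by simp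
  qed
qed

lemma underS_tag:
  assumes "(s, i # l) \<in> nodes Z"
  shows "underS (T Z) (s, i # l) = insert (s, l) (underS (T Z) (s, l))"
proof (intro equalityI subsetI)
  note n = nodes_Cons[OF assms]
  fix y assume y: "y \<in> underS (T Z) (s, i # l)"
  obtain u l' where u: "y = (u, l')" by (cases y)
  show "y \<in> insert (s, l) (underS (T Z) (s, l))"
    using y n unfolding u by (auto simp: lt_T Cons_eq_append_conv)
next
  note n = nodes_Cons[OF assms]
  fix y assume y: "y \<in> insert (s, l) (underS (T Z) (s, l))"
  have "lt (T Z) (s, l) (s, i # l)" unfolding lt_T using assms n by auto
  then show "y \<in> underS (T Z) (s, i # l)" using y lt_trans[OF po_T, of y "(s, l)" "(s, i # l)"] by blast
qed

text \<open>The level of the node in \<kappa> + 1, with \<open>None\<close> for the level \<kappa>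
  of the full sequences.\<close>

definition rank :: "('k \<rightharpoonup> 'l) \<Rightarrow> 'k option" where
  "rank s = (if s \<in> short then Some (SOME \<alpha>. \<alpha> \<in> Field \<kappa> \<and> dom s = underS \<kappa> \<alpha>) else None)"

lemma rank_short: "s \<in> short \<Longrightarrow> \<exists>\<alpha>\<in>Field \<kappa>. rank s = Some \<alpha> \<and> dom s = underS \<kappa> \<alpha>"
proof -
  assume s: "s \<in> short"
  then have "\<exists>\<alpha>. \<alpha> \<in> Field \<kappa> \<and> dom s = underS \<kappa> \<alpha>" by (auto simp: short_def)
  from someI_ex[OF this] show ?thesis using s unfolding rank_def by auto
qed

lemma rank_cut: "s \<in> seqs \<Longrightarrow> \<nu> \<in> dom s \<Longrightarrow> rank (cut s \<nu>) = Some \<nu>"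
  using rank_short[OF cut_short(1)] cut_short(2) k.underS_eq dom_Field by (metis subsetD)

lemma rank_mono:
  assumes "s \<in> seqs" "s' \<in> seqs" "s \<subseteq>\<^sub>m s'" "s \<noteq> s'"
  shows "lt (ord_succ \<kappa>) (rank s) (rank s')"
proof -
  obtain \<nu> where \<nu>: "\<nu> \<in> dom s'" "s = cut s' \<nu>" using seg[OF assms] by auto
  have r: "rank s = Some \<nu>" using rank_cut[OF assms(2) \<nu>(1)] \<nu>(2) by simp
  show ?thesis
  proof (cases "s' \<in> short")
    case True
    then obtain \<alpha> where "rank s' = Some \<alpha>" "dom s' = underS \<kappa> \<alpha>" using rank_short[OF True] by auto
    then show ?thesis using \<nu>(1) r by simp
  next
    case False
    then have "rank s' = None" by (simp add: rank_def)
    then show ?thesis using r dom_Field[OF assms(2)] \<nu>(1) by (auto simp: lt_iff)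
  qed
qed

text \<open>A step upwards either prolongs the sequence, which raises its level, or keeps the
  sequence and lengthens the list.\<close>

lemma wf_T: "wf {(x, y). lt (T Z) x y}"
proof (rule wf_subset)
  interpret w: well "ord_succ \<kappa>" by (rule well.intro[OF Well_order_ord_succ[OF k.wo]])
  let ?R = "{(a, b). lt (ord_succ \<kappa>) a b} <*lex*> measure length"
  show "wf (inv_image ?R (\<lambda>(s, l). (rank s, l)))"
    using w.wf_lt by (intro wf_inv_image wf_lex_prod) auto
  show "{(x, y). lt (T Z) x y} \<subseteq> inv_image ?R (\<lambda>(s, l). (rank s, l))"
  proof clarify
    fix s l s' l' assume *: "lt (T Z) (s, l) (s', l')"
    then show "((s, l), (s', l')) \<in> inv_image ?R (\<lambda>(s, l). (rank s, l))"
      using rank_mono[of s s'] nodes_seqs unfolding lt_T by (auto simp: in_inv_image)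
  qed
qed

lemma chain_T:
  assumes "lt (T Z) x z" "lt (T Z) y z"
  shows "(x, y) \<in> T Z \<or> (y, x) \<in> T Z"
proof -
  obtain s l s' l' u k where xyz: "x = (s, l)" "y = (s', l')" "z = (u, k)" by (metis surj_pair)
  have n: "(s, l) \<in> nodes Z" "(s', l') \<in> nodes Z" "(u, k) \<in> nodes Z"
    using assms unfolding xyz lt_T by auto
  have c: "s \<subseteq>\<^sub>m u \<Longrightarrow> s' \<subseteq>\<^sub>m u \<Longrightarrow> s \<subseteq>\<^sub>m s' \<or> s' \<subseteq>\<^sub>m s"
    using seqs_comparable nodes_seqs n by metis
  have su: "s \<subseteq>\<^sub>m u" "s' \<subseteq>\<^sub>m u" using assms unfolding xyz lt_T by auto
  show ?thesis
  proof (cases "l = [] \<and> l' = []")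
    case True
    then show ?thesis using c[OF su] n unfolding xyz T_def by auto
  next
    case False
    have app: "(\<exists>w. l' = w @ l) \<or> (\<exists>w. l = w @ l')" if "v @ l = v' @ l'" for v v'
      using that by (auto simp: append_eq_append_conv2)
    show ?thesis
    proof (cases "l = [] \<or> l' = []")
      case True
      have "l \<noteq> [] \<Longrightarrow> s = u" "l' \<noteq> [] \<Longrightarrow> s' = u" using assms unfolding xyz lt_T by simp_all
      then have "l = [] \<and> s \<subseteq>\<^sub>m s' \<or> l' = [] \<and> s' \<subseteq>\<^sub>m s" using True False su by (cases "l = []") auto
      then show ?thesis using n unfolding xyz T_def by auto
    next
      case F: False
      then obtain v where "k = v @ l" "s = u" using assms(1) unfolding xyz lt_T by auto
      moreover obtain v' where "k = v' @ l'" "s' = u" using F assms(2) unfolding xyz lt_T by auto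
      ultimately have "k = v @ l" "k = v' @ l'" "s = u" "s' = u" by simp_all
      then show ?thesis using app[of v v'] n unfolding xyz T_def by auto
    qed
  qed
qed

lemma wo_chain:
  assumes "x \<in> nodes Z"
  shows "Well_order (Restr (T Z) (underS (T Z) x))"
proof -
  have F: "Field (Restr (T Z) (underS (T Z) x)) = underS (T Z) x"
    using po_T by (intro Refl_Field_Restr2) (auto simp: order_on_defs dest: lt_Field1)
  have "Partial_order (Restr (T Z) (underS (T Z) x))" by (rule Partial_order_Restr[OF po_T])
  moreover have "total_on (underS (T Z) x) (Restr (T Z) (underS (T Z) x))"
    unfolding total_on_def using chain_T by auto
  moreover have "wf (Restr (T Z) (underS (T Z) x) - Id)"
    by (rule wf_subset[OF wf_T]) (auto simp: lt_iff)
  ultimately show ?thesis by (simp add: F well_order_on_def linear_order_on_def)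
qed

lemma is_tree_T: "is_tree (T Z)"
  unfolding is_tree_def using po_T wo_chain unfolding Field_T by auto

lemma card_dom: "s \<in> short \<Longrightarrow> |dom s| <o \<kappa>"
  using card_of_underS[OF \<kappa>(1)] by (auto simp: short_def)

text \<open>Below a node without list the levels embed the predecessors into \<kappa>. Below a tag
  there are the fewer than \<kappa> predecessors of its sequence and finitely many more, and a
  well-order of size less than \<kappa> is shorter than \<kappa>.\<close>

lemma height_T:
  assumes x: "x \<in> nodes Z"
  shows "Restr (T Z) (underS (T Z) x) \<le>o \<kappa>"
proof -
  obtain s l where sl: "x = (s, l)" by (cases x)
  have F: "Field (Restr (T Z) (underS (T Z) x)) = underS (T Z) x"
    using po_T by (intro Refl_Field_Restr2) (auto simp: order_on_defs dest: lt_Field1)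
  show ?thesis
  proof (cases l)
    case Nil
    then have s: "s \<in> short \<union> Z" using x sl nodes_Nil by simp
    then have sq: "s \<in> seqs" using Z by auto
    show ?thesis
    proof (rule strict_mono_ordLeq[where f = "\<lambda>(u, _). the (rank u)"])
      show "Well_order (Restr (T Z) (underS (T Z) x))" by (rule wo_chain[OF x])
      show "(\<lambda>(u, _). the (rank u)) y \<in> Field \<kappa>" if "y \<in> Field (Restr (T Z) (underS (T Z) x))" for y
      proof -
        have "y \<in> underS (T Z) x" using that F by simp
        then obtain \<nu> where "\<nu> \<in> dom s" "y = (cut s \<nu>, [])" unfolding sl Nil underS_main[OF s] by auto
        then show ?thesis using rank_cut[OF sq] subsetD[OF dom_Field[OF sq]] by simp
      qed
      fix y y' assume "lt (Restr (T Z) (underS (T Z) x)) y y'"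
      then have y: "y \<in> underS (T Z) x" "y' \<in> underS (T Z) x" "lt (T Z) y y'" by (auto simp: lt_iff)
      then obtain \<nu> \<nu>' where \<nu>: "\<nu> \<in> dom s" "\<nu>' \<in> dom s" "y = (cut s \<nu>, [])" "y' = (cut s \<nu>', [])"
        unfolding sl Nil underS_main[OF s] by auto
      then have "lt (ord_succ \<kappa>) (rank (cut s \<nu>)) (rank (cut s \<nu>'))"
        using y(3) cut_short(1)[OF sq] by (intro rank_mono) (auto simp: lt_T)
      then show "lt \<kappa> ((\<lambda>(u, _). the (rank u)) y) ((\<lambda>(u, _). the (rank u)) y')"
        using \<nu> rank_cut[OF sq] by simp
    qed (rule k.wo)
  next
    case (Cons i l')
    have small: "|underS (T Z) (s, l)| <o \<kappa>" if "(s, l) \<in> nodes Z" "s \<in> short" for l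
      using that(1)
    proof (induct l)
      case Nil
      show ?case using underS_main[of s] that(2) card_of_image ordLeq_ordLess_trans card_dom by fastforce
    next
      case (Cons i l)
      then have IH: "|underS (T Z) (s, l)| <o \<kappa>" using nodes_Cons by metis
      have "|{(s, l)}| <o \<kappa>"
        using finite_ordLess_infinite[OF card_of_Well_order k.wo, of "{(s, l)}"] \<kappa> by (simp add: Field_card_of)
      then have "|{(s, l)} \<union> underS (T Z) (s, l)| <o \<kappa>"
        using IH card_of_Un_ordLess_infinite_Field[OF \<kappa>(2,1)] by metis
      then show ?case using underS_tag[OF Cons(2)] by simp
    qed
    have "s \<in> short" using x unfolding sl Cons nodes_tag by simp
    then have "|underS (T Z) x| <o \<kappa>" using small x sl by simp
    then show ?thesis using ordLess_card[OF wo_chain[OF x] \<kappa>(1)] ordLess_imp_ordLeq F by auto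
  qed
qed

lemma immediate_tag:
  assumes "(s, i # l) \<in> nodes Z"
  shows "immediate_pred (T Z) (s, l) (s, i # l)"
  unfolding immediate_pred_def underS_tag[OF assms]
  using lt_asym[OF po_T, of "(s, l)"] lt_le[of _ "T Z" "(s, l)"] by auto

lemma immediate_main:
  assumes "s \<in> short \<union> Z" "\<nu> \<in> Field \<kappa>" "dom s = under \<kappa> \<nu>"
  shows "immediate_pred (T Z) (cut s \<nu>, []) (s, [])"
proof -
  have sq: "s \<in> seqs" using assms Z by auto
  have \<nu>: "\<nu> \<in> dom s" using assms k.refl by (simp add: under_def)
  have "\<not> lt (T Z) (cut s \<nu>, []) (cut s \<nu>', [])" if "\<nu>' \<in> dom s" for \<nu>'
  proof
    assume "lt (T Z) (cut s \<nu>, []) (cut s \<nu>', [])"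
    then have "lt (ord_succ \<kappa>) (rank (cut s \<nu>)) (rank (cut s \<nu>'))"
      using cut_short(1)[OF sq] \<nu> that by (intro rank_mono) (auto simp: lt_T)
    then have "lt \<kappa> \<nu> \<nu>'" using rank_cut[OF sq] that \<nu> by simp
    then show False using that assms(3) k.asym by (simp add: under_def)
  qed
  then show ?thesis unfolding immediate_pred_def underS_main[OF assms(1)] using \<nu> by auto
qed

lemma limit_main:
  assumes "s \<in> short \<union> Z" "\<And>z. \<not> immediate_pred (T Z) z (s, [])" "\<nu> \<in> dom s"
  shows "\<exists>\<nu>'\<in>dom s. lt \<kappa> \<nu> \<nu>'"
proof (rule ccontr)
  assume *: "\<not> ?thesis"
  have sq: "s \<in> seqs" using assms Z by auto
  have "dom s = under \<kappa> \<nu>"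
  proof
    show "dom s \<subseteq> under \<kappa> \<nu>"
      using * k.not_lt dom_Field[OF sq] assms(3) by (auto simp: under_def subset_iff)
  qed (rule dom_down[OF sq assms(3)])
  then show False using immediate_main[OF assms(1) _] assms dom_Field[OF sq] by blast
qed

text \<open>A sequence without immediate predecessor is the union of its proper initial segments,
  and these are among the predecessors of \<open>s'\<close>.\<close>

lemma limit_determined:
  assumes s: "s \<in> short \<union> Z" "\<And>z. \<not> immediate_pred (T Z) z (s, [])"
    and s': "s' \<in> short \<union> Z" and eq: "underS (T Z) (s, []) = underS (T Z) (s', [])"
  shows "s \<subseteq>\<^sub>m s'"
  unfolding map_le_def
proof
  fix \<nu> assume \<nu>: "\<nu> \<in> dom s"
  obtain \<nu>' where \<nu>': "\<nu>' \<in> dom s" "lt \<kappa> \<nu> \<nu>'" using limit_main[OF s \<nu>] by auto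
  have "(cut s \<nu>', []) \<in> underS (T Z) (s', [])" using eq underS_main[OF s(1)] \<nu>'(1) by auto
  then have "cut s \<nu>' \<subseteq>\<^sub>m s'" by (simp add: lt_T)
  then show "s \<nu> = s' \<nu>" using \<nu>'(2) \<nu> by (auto simp: map_le_def dom_cut restrict_map_def split: if_splits)
qed

theorem lambda_kappa_T: "lambda_kappa_tree lam \<kappa> (T Z)"
  unfolding lambda_kappa_tree_def Field_T
proof (intro conjI ballI)
  show "is_tree (T Z)" by (rule is_tree_T)
  show "Restr (T Z) (underS (T Z) x) \<le>o \<kappa>" if "x \<in> nodes Z" for x by (rule height_T[OF that])
  show "(\<nexists>z. immediate_pred (T Z) z x) \<and> (\<nexists>z. immediate_pred (T Z) z y) \<and> sim (T Z) x y \<longrightarrow> x = y"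
    if "x \<in> nodes Z" "y \<in> nodes Z" for x y
  proof (intro impI, elim conjE)
    assume no: "\<nexists>z. immediate_pred (T Z) z x" "\<nexists>z. immediate_pred (T Z) z y" and sim: "sim (T Z) x y"
    obtain s l s' l' where xy: "x = (s, l)" "y = (s', l')" by (metis surj_pair)
    have l: "l = []" "l' = []"
      using that no immediate_tag[of s "hd l" "tl l"] immediate_tag[of s' "hd l'" "tl l'"] unfolding xy
      by (metis list.collapse)+
    have s: "s \<in> short \<union> Z" "s' \<in> short \<union> Z" using that nodes_Nil unfolding xy l by auto
    have "s \<subseteq>\<^sub>m s'" "s' \<subseteq>\<^sub>m s"
      using limit_determined[OF s(1) _ s(2)] limit_determined[OF s(2) _ s(1)] no sim
      unfolding xy l sim_def by auto
    then show "x = y" unfolding xy l by (simp add: map_le_antisym)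
  qed
  show "\<exists>!x. x \<in> nodes Z \<and> underS (T Z) x = {}"
  proof (rule ex1I[of _ "(Map.empty, [])"])
    obtain z where z: "z \<in> Field \<kappa>" "\<forall>b\<in>Field \<kappa>. (z, b) \<in> \<kappa>"
      using k.ex_least[of "Field \<kappa>"] infinite_imp_nonempty[OF \<kappa>(2)] by auto
    have "underS \<kappa> z = {}" using z k.asym lt_Field1[of _ \<kappa> z] by fastforce
    then have e: "Map.empty \<in> short" using z(1) by (auto simp: short_def)
    then show "(Map.empty, []) \<in> nodes Z \<and> underS (T Z) (Map.empty, []) = {}"
      using underS_main[of Map.empty] nodes_Nil by auto
    fix x assume x: "x \<in> nodes Z \<and> underS (T Z) x = {}"
    obtain s l where sl: "x = (s, l)" by (cases x)
    show "x = (Map.empty, [])"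
    proof (cases l)
      case Nil
      then show ?thesis using x nodes_Nil underS_main[of s] unfolding sl by auto
    next
      case (Cons i l')
      then show ?thesis using x underS_tag[of s i l'] unfolding sl by auto
    qed
  qed
  fix x assume x: "x \<in> nodes Z"
  \<comment> \<open>The last predecessor of \<open>x\<close>, if there is one. The tags in the class
    of \<open>x\<close> prolong this node by one entry, which leaves at most \<open>lam\<close> of
    them.\<close>
  define zz where "zz = (SOME z. z \<in> underS (T Z) x \<and> (\<forall>w\<in>underS (T Z) x. (w, z) \<in> T Z))"
  have "sim_class (T Z) x \<subseteq> {x} \<union> (\<lambda>s. (s, [])) ` short \<union> (\<lambda>j. (fst zz, j # snd zz)) ` Field lam"
  proof
    fix y assume "y \<in> sim_class (T Z) x"
    then have y: "y \<in> nodes Z" "underS (T Z) y = underS (T Z) x"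
      by (auto simp: sim_class_def sim_def Field_T)
    obtain s' l' where y': "y = (s', l')" by (cases y)
    show "y \<in> {x} \<union> (\<lambda>s. (s, [])) ` short \<union> (\<lambda>j. (fst zz, j # snd zz)) ` Field lam"
    proof (cases l')
      case (Cons j l)
      note u = underS_tag[OF y(1)[unfolded y' Cons]]
      have n: "(s', l) \<in> nodes Z" using y(1) nodes_Cons unfolding y' Cons by metis
      have max: "(s', l) \<in> underS (T Z) x \<and> (\<forall>w\<in>underS (T Z) x. (w, (s', l)) \<in> T Z)"
        unfolding y(2)[symmetric] y' Cons u using n le_refl[OF po_T, of "(s', l)"] lt_le[of _ "T Z" "(s', l)"]
        by (auto simp: Field_T)
      have "zz = (s', l)" unfolding zz_def
      proof (rule some_equality)
        show "(s', l) \<in> underS (T Z) x \<and> (\<forall>w\<in>underS (T Z) x. (w, (s', l)) \<in> T Z)" by (rule max)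
        fix z assume "z \<in> underS (T Z) x \<and> (\<forall>w\<in>underS (T Z) x. (w, z) \<in> T Z)"
        then show "z = (s', l)" using max by (intro le_antisym[OF po_T]) auto
      qed
      moreover have "j \<in> Field lam"
        using y(1) lt_Field1[of j lam] unfolding y' Cons nodes_tag by auto
      ultimately show ?thesis unfolding y' Cons by auto
    next
      case Nil
      show ?thesis
      proof (cases "s' \<in> short")
        case True
        then show ?thesis unfolding y' Nil by auto
      next
        case False
        then have s': "s' \<in> Z" "dom s' = Field \<kappa>" using y(1) Z nodes_Nil unfolding y' Nil full_def by auto
        \<comment> \<open>Below a full sequence the predecessors have no last element. So
          \<open>x\<close> is neither a tag nor an immediate successor, and the class reduces to
          \<open>x\<close>.\<close>
        have nomax: "\<exists>w'\<in>underS (T Z) x. lt (T Z) w w'" if w: "w \<in> underS (T Z) x" for w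
        proof -
          obtain \<nu> where \<nu>: "\<nu> \<in> Field \<kappa>" "w = (cut s' \<nu>, [])"
            using w underS_main[of s'] s' unfolding y(2)[symmetric] y' Nil by auto
          obtain \<nu>' where \<nu>': "lt \<kappa> \<nu> \<nu>'" using k_no_max[OF \<nu>(1)] by auto
          have sq: "s' \<in> seqs" using s'(1) Z by auto
          have d: "\<nu> \<in> dom s'" "\<nu>' \<in> dom s'" using \<nu>(1) \<nu>' lt_Field2[OF \<nu>'] s'(2) by auto
          have "cut s' \<nu> = cut (cut s' \<nu>') \<nu>" using cut_cut[OF \<nu>'] by simp
          moreover have "\<nu> \<in> dom (cut s' \<nu>')" using d \<nu>' by (simp add: dom_cut)
          ultimately have "lt (T Z) (cut s' \<nu>, []) (cut s' \<nu>', [])"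
            using underS_main[of "cut s' \<nu>'"] cut_short(1)[OF sq d(2)] by auto
          moreover have "(cut s' \<nu>', []) \<in> underS (T Z) x"
            using underS_main[of s'] s' d unfolding y(2)[symmetric] y' Nil by auto
          ultimately show ?thesis using \<nu>(2) by auto
        qed
        obtain s l where sl: "x = (s, l)" by (cases x)
        have "l = []"
        proof (cases l)
          case (Cons j l2)
          then have u: "underS (T Z) x = insert (s, l2) (underS (T Z) (s, l2))" using underS_tag[of s j l2] x sl by simp
          then have "\<exists>w'\<in>underS (T Z) x. lt (T Z) (s, l2) w'" using nomax by auto
          then show ?thesis unfolding u using lt_asym[OF po_T] lt_le by fastforce
        qed
        then have s: "s \<in> short \<union> Z" "x = (s, [])" using x sl nodes_Nil by auto
        have noimm: "\<not> immediate_pred (T Z) z x" "\<not> immediate_pred (T Z) z y" for z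
          unfolding immediate_pred_def y(2) using nomax by blast+
        have "s \<subseteq>\<^sub>m s'" "s' \<subseteq>\<^sub>m s"
          using limit_determined[of s s'] limit_determined[of s' s] s s'(1) noimm y(2) unfolding y' Nil by auto
        then show ?thesis unfolding y' Nil s(2) by (simp add: map_le_antisym)
      qed
    qed
  qed
  moreover have "|{x} \<union> (\<lambda>s. (s, [])) ` short \<union> (\<lambda>j. (fst zz, j # snd zz)) ` Field lam| \<le>o lam"
  proof -
    have inf: "\<not> finite (Field lam)" using infinite_lam .
    have "|short| =o lam" using power unfolding weak_power_def short_def .
    then have 1: "|(\<lambda>s. (s, [] :: 'l list)) ` short| \<le>o lam"
      using card_of_image ordLeq_ordIso_trans by metis
    have 2: "|(\<lambda>j. (fst zz, j # snd zz)) ` Field lam| \<le>o lam"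
      using card_of_image card_of_Field_ordIso[OF lam_card] ordLeq_ordIso_trans by metis
    have 3: "|{x}| \<le>o lam"
      using finite_ordLess_infinite[OF card_of_Well_order lam.wo, of "{x}"] inf ordLess_imp_ordLeq
      by (auto simp: Field_card_of)
    show ?thesis
      using card_of_Un_ordLeq_infinite_Field[OF inf card_of_Un_ordLeq_infinite_Field[OF inf 3 1 lam_card] 2 lam_card] .
  qed
  ultimately have "|sim_class (T Z) x| \<le>o lam" using card_of_mono1 ordLeq_transitive by metis
  then show "|sim_class (T Z) x| <o cardSuc lam"
    using cardSuc_greater[OF lam_card] ordLeq_ordLess_trans by metis
qed

end

context tall begin

section \<open>The strategy for the long trees\<close>

text \<open>As \<open>\<mu>\<close> is regular, these are the ordinals of cofinality \<open>\<mu>\<close>.\<close>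

definition stat :: "'l set" where
  "stat = {\<delta> \<in> Field lam. \<forall>C. C \<subseteq> underS lam \<delta> \<and> |C| <o mu \<longrightarrow> (\<exists>\<beta>\<in>underS lam \<delta>. \<forall>c\<in>C. lt lam c \<beta>)}"

section \<open>The answers of \<open>\<exists>\<close> in (b): permuting second coordinates block by
  block\<close>

lemma split_infinite:
  assumes "infinite A"
  shows "\<exists>B C. B \<subseteq> A \<and> C \<subseteq> A \<and> B \<inter> C = {} \<and> |B| =o |A| \<and> |C| =o |A|"
proof -
  have "|A \<times> (UNIV :: bool set)| =o |A|"
  proof (rule card_of_Times_infinite_simps(1)[OF assms])
    show "|UNIV :: bool set| \<le>o |A|"
      using assms by (intro ordLess_imp_ordLeq finite_ordLess_infinite card_of_Well_order) (simp_all add: Field_card_of)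
  qed simp
  then obtain f where f: "bij_betw f (A \<times> (UNIV :: bool set)) A" using card_of_ordIso by blast
  have inj: "inj_on f (A \<times> UNIV)" and im: "f ` (A \<times> UNIV) = A" using f by (auto simp: bij_betw_def)
  have "|f ` (A \<times> {b})| =o |A|" for b
  proof -
    have "bij_betw (\<lambda>a. f (a, b)) A (f ` (A \<times> {b}))"
      using inj by (auto simp: bij_betw_def inj_on_def image_iff)
    then show ?thesis using card_of_ordIsoI ordIso_symmetric by blast
  qed
  moreover have "f ` (A \<times> {True}) \<inter> f ` (A \<times> {False}) = {}"
    using inj_on_image_Int[OF inj, of "A \<times> {True}" "A \<times> {False}"] by auto
  moreover have "f ` (A \<times> {b}) \<subseteq> A" for b using im by blast
  ultimately show ?thesis
    by (intro exI[of _ "f ` (A \<times> {True})"] exI[of _ "f ` (A \<times> {False})"]) simp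
qed

text \<open>Only half of \<open>A\<close> is filled with the image of \<open>D\<close>. The other
  half keeps the complement of this image as large as the complement of \<open>D\<close>, which
  contains \<open>A\<close>; so the injection extends to a permutation of \<open>K\<close>.\<close>

lemma squeeze:
  fixes K A D :: "'l set"
  assumes K: "|K| \<le>o mu" and A: "A \<subseteq> K" "mu \<le>o |A|" and D: "D \<subseteq> K" "D \<inter> A = {}"
  shows "\<exists>\<pi>. bij_betw \<pi> K K \<and> \<pi> ` D \<subseteq> A"
proof -
  have "infinite A" using A(2) mu card_of_ordLeq_infinite[OF ordIso_ordLeq_trans[OF card_Field_mu A(2)]] by simp
  then obtain B C where BC: "B \<subseteq> A" "C \<subseteq> A" "B \<inter> C = {}" "|B| =o |A|" "|C| =o |A|" using split_infinite by metis
  have le: "|X| \<le>o |Y|" if "X \<subseteq> K" "mu \<le>o |Y|" for X Y :: "'l set"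
    using that K card_of_mono1 ordLeq_transitive by metis
  have muB: "mu \<le>o |B|" "mu \<le>o |C|"
    using A(2) BC(4,5) ordIso_symmetric ordLeq_ordIso_trans by metis+
  obtain f where f: "inj_on f D" "f ` D \<subseteq> B" using le[OF D(1) muB(1)] card_of_ordLeq by metis
  have "A \<subseteq> K - D" "C \<subseteq> K - f ` D" using D A BC f(2) by auto
  then have "mu \<le>o |K - D|" "mu \<le>o |K - f ` D|"
    using A(2) muB(2) card_of_mono1 ordLeq_transitive by metis+
  then have "|K - D| =o |K - f ` D|" using le ordIso_iff_ordLeq by (metis Diff_subset)
  then obtain h where h: "bij_betw h (K - D) (K - f ` D)" using card_of_ordIso by blast
  define \<pi> where "\<pi> x = (if x \<in> D then f x else h x)" for x
  have "bij_betw \<pi> D (f ` D)" using f(1) by (auto simp: \<pi>_def bij_betw_def inj_on_def)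
  moreover have "bij_betw \<pi> (K - D) (K - f ` D)"
    using h by (subst bij_betw_cong[of "K - D" \<pi> h]) (auto simp: \<pi>_def)
  ultimately have "bij_betw \<pi> (D \<union> (K - D)) (f ` D \<union> (K - f ` D))" by (rule bij_betw_combine) auto
  moreover have "D \<union> (K - D) = K" "f ` D \<union> (K - f ` D) = K" using D f(2) BC(1) A(1) by blast+
  ultimately have "bij_betw \<pi> K K" by simp
  moreover have "\<pi> ` D \<subseteq> A" using f(2) BC(1) by (auto simp: \<pi>_def)
  ultimately show ?thesis by auto
qed

definition regressive :: "'l set \<Rightarrow> ('l \<Rightarrow> 'l) \<Rightarrow> bool" where
  "regressive K \<pi> \<longleftrightarrow> (\<forall>\<xi>\<in>K \<inter> stat. lt lam (\<pi> \<xi>) \<xi>)"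

text \<open>Let \<sigma> be the first element of \<open>K\<close> in \<open>stat\<close>. Fewer than
  \<open>mu\<close> elements of \<open>K\<close> below \<sigma> would have a strict bound below
  \<sigma>; it lies above \<open>m\<close>, hence in \<open>K\<close> by convexity, and would be
  below itself. So there are \<open>mu\<close> many, and all of \<open>K \<inter> stat\<close> can
  be moved into them.\<close>

lemma ex_regressive:
  assumes K: "K \<subseteq> Field lam" "|K| \<le>o mu" and m: "m \<in> K" "m \<notin> stat" "\<And>\<xi>. \<xi> \<in> K \<Longrightarrow> (m, \<xi>) \<in> lam"
    and convex: "\<And>a b. (m, a) \<in> lam \<Longrightarrow> lt lam a b \<Longrightarrow> b \<in> K \<Longrightarrow> a \<in> K"
  shows "\<exists>\<pi>. bij_betw \<pi> K K \<and> regressive K \<pi>"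
proof (cases "K \<inter> stat = {}")
  case True
  then show ?thesis by (intro exI[of _ id]) (auto simp: regressive_def)
next
  case False
  then obtain \<sigma> where \<sigma>: "\<sigma> \<in> K \<inter> stat" "\<forall>b\<in>K \<inter> stat. (\<sigma>, b) \<in> lam"
    using lam.ex_least[of "K \<inter> stat"] K(1) by auto
  let ?A = "{\<xi> \<in> K. lt lam \<xi> \<sigma>}"
  have "m \<noteq> \<sigma>" using \<sigma>(1) m(2) by auto
  then have mA: "m \<in> ?A" using m \<sigma>(1) by (auto simp: lt_iff)
  have "mu \<le>o |?A|"
  proof (rule ccontr)
    assume "\<not> ?thesis"
    then have "|?A| <o mu" using ordLess_or_ordLeq[OF card_of_Well_order mu.wo] by metis
    then have A: "?A \<subseteq> underS lam \<sigma> \<and> |?A| <o mu" by auto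
    have "\<forall>C. C \<subseteq> underS lam \<sigma> \<and> |C| <o mu \<longrightarrow> (\<exists>\<beta>\<in>underS lam \<sigma>. \<forall>c\<in>C. lt lam c \<beta>)"
      using \<sigma>(1) unfolding stat_def by simp
    from mp[OF spec[OF this, of ?A] A] have "\<exists>\<beta>\<in>underS lam \<sigma>. \<forall>c\<in>?A. lt lam c \<beta>" .
    then obtain \<beta> where \<beta>: "lt lam \<beta> \<sigma>" "\<forall>c\<in>?A. lt lam c \<beta>" by (rule bexE)
    then have "(m, \<beta>) \<in> lam" using mA lt_le[of m lam \<beta>] by simp
    then have "\<beta> \<in> ?A" using convex[OF _ \<beta>(1)] \<sigma>(1) \<beta>(1) by auto
    then show False using \<beta>(2) by auto
  qed
  moreover have "(K \<inter> stat) \<inter> ?A = {}" using \<sigma>(2) lam.asym by auto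
  ultimately obtain \<pi> where \<pi>: "bij_betw \<pi> K K" "\<pi> ` (K \<inter> stat) \<subseteq> ?A"
    using squeeze[of K ?A "K \<inter> stat"] K(2) by auto
  have "lt lam (\<pi> \<xi>) \<xi>" if "\<xi> \<in> K \<inter> stat" for \<xi> using \<pi>(2) \<sigma>(2) that lam.ltle by blast
  then show ?thesis using \<pi>(1) by (auto simp: regressive_def)
qed

definition perm :: "'l set \<Rightarrow> 'l \<Rightarrow> 'l" where
  "perm K = (if \<exists>\<pi>. bij_betw \<pi> K K \<and> regressive K \<pi> then SOME \<pi>. bij_betw \<pi> K K \<and> regressive K \<pi> else id)"

lemma perm: "bij_betw (perm K) K K"
  and perm_regressive: "\<exists>\<pi>. bij_betw \<pi> K K \<and> regressive K \<pi> \<Longrightarrow> regressive K (perm K)"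
  using someI_ex[of "\<lambda>\<pi>. bij_betw \<pi> K K \<and> regressive K \<pi>"] unfolding perm_def by auto

text \<open>
  \<open>\<Gamma> a\<close> bounds the second coordinates played up to time \<open>a\<close>. A block consists of second coordinates
  of children of \<open>s\<close> that become relevant at the same time, and \<open>tr\<close> permutes each block of the
  children \<open>v\<close> with \<open>og v = code s\<close>.
\<close>

definition bound :: "('t \<Rightarrow> 'l) \<Rightarrow> 't \<Rightarrow> ('k \<rightharpoonup> 'l) \<Rightarrow> bool" where
  "bound \<Gamma> a s \<longleftrightarrow> (\<forall>\<nu> v. s \<nu> = Some v \<longrightarrow> (xi v, \<Gamma> a) \<in> lam)"

definition block :: "'t set \<Rightarrow> ('t \<Rightarrow> 'l) \<Rightarrow> ('k \<rightharpoonup> 'l) \<Rightarrow> 'l \<Rightarrow> 'l set" where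
  "block A \<Gamma> s \<xi> = {\<xi>' \<in> Field lam. \<forall>a\<in>A. bound \<Gamma> a s \<longrightarrow> ((\<xi>, \<Gamma> a) \<in> lam \<longleftrightarrow> (\<xi>', \<Gamma> a) \<in> lam)}"

definition tr :: "'t set \<Rightarrow> ('t \<Rightarrow> 'l) \<Rightarrow> ('k \<rightharpoonup> 'l) \<Rightarrow> 'l \<Rightarrow> 'l" where
  "tr A \<Gamma> s v = (if og v = code s then mk (og v) (perm (block A \<Gamma> s (xi v)) (xi v)) else v)"

text \<open>Each entry is moved according to the original initial segment before it. Therefore
  \<open>gg\<close> commutes with cutting and respects the tree order.\<close>

definition gg :: "'t set \<Rightarrow> ('t \<Rightarrow> 'l) \<Rightarrow> ('k \<rightharpoonup> 'l) \<Rightarrow> ('k \<rightharpoonup> 'l)" where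
  "gg A \<Gamma> s = (\<lambda>\<nu>. map_option (tr A \<Gamma> (cut s \<nu>)) (s \<nu>))"

context
  fixes A :: "'t set" and \<Gamma> :: "'t \<Rightarrow> 'l"
begin

lemma block_self: "\<xi> \<in> Field lam \<Longrightarrow> \<xi> \<in> block A \<Gamma> s \<xi>"
  by (simp add: block_def)

lemma block_eq: "\<xi>' \<in> block A \<Gamma> s \<xi> \<Longrightarrow> block A \<Gamma> s \<xi>' = block A \<Gamma> s \<xi>"
  by (auto simp: block_def)

lemma perm_block: "\<xi> \<in> Field lam \<Longrightarrow> perm (block A \<Gamma> s \<xi>) \<xi> \<in> block A \<Gamma> s \<xi>"
  using bij_betwE[OF perm] block_self by metis

lemma block_Field: "block A \<Gamma> s \<xi> \<subseteq> Field lam"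
  by (auto simp: block_def)

lemma tr:
  assumes "v \<in> Field lam"
  shows "tr A \<Gamma> s v \<in> Field lam" "og (tr A \<Gamma> s v) = og v" "xi (tr A \<Gamma> s v) \<in> block A \<Gamma> s (xi v)"
    and "og v = code s \<Longrightarrow> xi (tr A \<Gamma> s v) = perm (block A \<Gamma> s (xi v)) (xi v)"
    and "og v \<noteq> code s \<Longrightarrow> tr A \<Gamma> s v = v"
proof -
  note v = og_xi[OF assms]
  have p: "perm (block A \<Gamma> s (xi v)) (xi v) \<in> Field lam" using perm_block[OF v(2)] block_Field by blast
  show "tr A \<Gamma> s v \<in> Field lam" "og (tr A \<Gamma> s v) = og v" "xi (tr A \<Gamma> s v) \<in> block A \<Gamma> s (xi v)"
    using mk[OF v(1) p] assms perm_block[OF v(2)] block_self[OF v(2)] by (auto simp: tr_def)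
  show "og v = code s \<Longrightarrow> xi (tr A \<Gamma> s v) = perm (block A \<Gamma> s (xi v)) (xi v)"
    using mk[OF v(1) p] by (simp add: tr_def)
  show "og v \<noteq> code s \<Longrightarrow> tr A \<Gamma> s v = v" by (simp add: tr_def)
qed

text \<open>The blocks partition the second coordinates; \<open>tr\<close> keeps the first
  coordinate and permutes every block, or does nothing.\<close>

lemma tr_bij: "bij_betw (tr A \<Gamma> s) (Field lam) (Field lam)"
proof -
  have "inj_on (tr A \<Gamma> s) (Field lam)"
  proof (rule inj_onI)
    fix v w assume vw: "v \<in> Field lam" "w \<in> Field lam" "tr A \<Gamma> s v = tr A \<Gamma> s w"
    then have og: "og v = og w" using tr(2) by metis
    show "v = w"
    proof (cases "og v = code s")
      case True
      let ?K = "block A \<Gamma> s"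
      have eq: "?K (xi v) = ?K (xi w)"
        using block_eq[OF tr(3)[OF vw(1)]] block_eq[OF tr(3)[OF vw(2)]] vw(3) by metis
      then have "perm (?K (xi v)) (xi v) = perm (?K (xi v)) (xi w)"
        using tr(4)[OF vw(1) True] tr(4)[OF vw(2)] True og vw(3) by simp
      moreover have "xi v \<in> ?K (xi v)" "xi w \<in> ?K (xi v)"
        using block_self[OF og_xi(2)[OF vw(1)], of s] block_self[OF og_xi(2)[OF vw(2)], of s] unfolding eq .
      ultimately have "xi v = xi w" using perm[of "?K (xi v)"] unfolding bij_betw_def inj_on_def by metis
      then show ?thesis using og_xi_eqI vw og by metis
    next
      case False
      then show ?thesis using tr(5)[OF vw(1)] tr(5)[OF vw(2)] og vw(3) by simp
    qed
  qed
  moreover have "Field lam \<subseteq> tr A \<Gamma> s ` Field lam"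
  proof
    fix w assume w: "w \<in> Field lam"
    show "w \<in> tr A \<Gamma> s ` Field lam"
    proof (cases "og w = code s")
      case True
      let ?K = "block A \<Gamma> s (xi w)"
      have "xi w \<in> perm ?K ` ?K" using perm[of ?K] block_self[OF og_xi(2)[OF w]] by (simp add: bij_betw_def)
      then obtain \<xi> where \<xi>: "\<xi> \<in> ?K" "perm ?K \<xi> = xi w" by auto
      have \<xi>F: "\<xi> \<in> Field lam" using \<xi>(1) block_Field by blast
      note m = mk[OF og_xi(1)[OF w] \<xi>F]
      have "xi (tr A \<Gamma> s (mk (og w) \<xi>)) = xi w"
        using tr(4)[OF m(1), of s] m True block_eq[OF \<xi>(1)] \<xi>(2) by simp
      then have "tr A \<Gamma> s (mk (og w) \<xi>) = w"
        using og_xi_eqI[OF tr(1)[OF m(1)] w] tr(2)[OF m(1)] m(2) by simp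
      then show ?thesis using m(1) by (metis imageI)
    next
      case False
      then show ?thesis using tr(5)[OF w] w by (metis imageI)
    qed
  qed
  ultimately show ?thesis using tr(1) by (auto simp: bij_betw_def)
qed

lemma dom_gg [simp]: "dom (gg A \<Gamma> s) = dom s"
  by (auto simp: gg_def)

lemma gg_apply: "s \<nu> = Some v \<Longrightarrow> gg A \<Gamma> s \<nu> = Some (tr A \<Gamma> (cut s \<nu>) v)"
  by (simp add: gg_def)

lemma ran_gg: "ran s \<subseteq> Field lam \<Longrightarrow> ran (gg A \<Gamma> s) \<subseteq> Field lam"
proof
  fix w assume s: "ran s \<subseteq> Field lam" and "w \<in> ran (gg A \<Gamma> s)"
  then obtain \<nu> where "gg A \<Gamma> s \<nu> = Some w" by (auto simp: ran_def)
  then obtain v where "s \<nu> = Some v" "w = tr A \<Gamma> (cut s \<nu>) v" by (auto simp: gg_def)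
  then show "w \<in> Field lam" using tr(1) s ranI[of s \<nu> v] by auto
qed

lemma gg_short: "s \<in> short \<Longrightarrow> gg A \<Gamma> s \<in> short"
  using ran_gg by (auto simp: short_def)

lemma gg_full: "s \<in> full \<Longrightarrow> gg A \<Gamma> s \<in> full"
  using ran_gg by (auto simp: full_def)

lemma gg_seqs: "s \<in> seqs \<Longrightarrow> gg A \<Gamma> s \<in> seqs"
  using gg_short gg_full by auto

lemma gg_cut: "gg A \<Gamma> (cut s \<nu>) = cut (gg A \<Gamma> s) \<nu>"
proof
  fix \<nu>'
  show "gg A \<Gamma> (cut s \<nu>) \<nu>' = cut (gg A \<Gamma> s) \<nu> \<nu>'"
    using cut_cut[of \<nu>' \<nu> s] by (cases "lt \<kappa> \<nu>' \<nu>") (simp_all add: gg_def)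
qed

lemma seqs_induct [consumes 2, case_names less]:
  assumes "s \<in> seqs" "\<nu> \<in> dom s" "\<And>\<nu>. \<nu> \<in> dom s \<Longrightarrow> (\<And>\<nu>'. lt \<kappa> \<nu>' \<nu> \<Longrightarrow> P \<nu>') \<Longrightarrow> P \<nu>"
  shows "P \<nu>"
proof -
  have "\<nu> \<in> Field \<kappa>" using dom_Field assms by auto
  then have "\<nu> \<in> dom s \<longrightarrow> P \<nu>"
  proof (induct \<nu> rule: k.induct)
    case (less \<nu>)
    show ?case
    proof
      assume \<nu>: "\<nu> \<in> dom s"
      have "P \<nu>'" if "lt \<kappa> \<nu>' \<nu>" for \<nu>'
      proof -
        have "\<nu>' \<in> dom s" using dom_down[OF assms(1) \<nu>] lt_le[OF that] by (auto simp: under_def)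
        then show ?thesis using less(2)[OF that] by simp
      qed
      then show "P \<nu>" using assms(3)[OF \<nu>] by simp
    qed
  qed
  then show ?thesis using assms(2) by simp
qed

text \<open>By induction along the sequence: once the initial segments before \<nu> agree, the
  entries at \<nu> are moved by the same bijection.\<close>

lemma gg_inj:
  assumes "s \<in> seqs" "s' \<in> seqs" "gg A \<Gamma> s = gg A \<Gamma> s'"
  shows "s = s'"
proof
  fix \<nu>
  have dom: "dom s = dom s'" using assms(3) dom_gg by metis
  show "s \<nu> = s' \<nu>"
  proof (cases "\<nu> \<in> dom s")
    case True
    then show ?thesis
    proof (induct \<nu> rule: seqs_induct[OF assms(1), consumes 1, case_names less])
      case (less \<nu>)
      have c: "cut s \<nu> = cut s' \<nu>" using less(2) by (auto simp: restrict_map_def)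
      obtain v v' where v: "s \<nu> = Some v" "s' \<nu> = Some v'"
        using domD[OF less(1)] domD[OF less(1)[unfolded dom]] by auto
      have "tr A \<Gamma> (cut s \<nu>) v = tr A \<Gamma> (cut s \<nu>) v'"
        using gg_apply[of s \<nu>, OF v(1)] gg_apply[of s' \<nu>, OF v(2)] assms(3) c by simp
      then have "v = v'" using tr_bij[of "cut s \<nu>"] ran_seqs[OF assms(1) v(1)] ran_seqs[OF assms(2) v(2)]
        unfolding bij_betw_def inj_on_def by metis
      then show ?case using v by simp
    qed
  next
    case False
    then show ?thesis using dom by (auto simp: domIff)
  qed
qed

lemma gg_le_iff:
  assumes "s \<in> seqs" "s' \<in> seqs"
  shows "gg A \<Gamma> s \<subseteq>\<^sub>m gg A \<Gamma> s' \<longleftrightarrow> s \<subseteq>\<^sub>m s'"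
proof (cases "s = s'")
  case False
  have ne: "gg A \<Gamma> s \<noteq> gg A \<Gamma> s'" using gg_inj[OF assms] False by auto
  note g = gg_seqs[OF assms(1)] gg_seqs[OF assms(2)]
  have "gg A \<Gamma> s \<subseteq>\<^sub>m gg A \<Gamma> s' \<longleftrightarrow> (\<exists>\<nu>\<in>dom s'. gg A \<Gamma> s = cut (gg A \<Gamma> s') \<nu>)"
    using seg_iff[OF g(2), of "gg A \<Gamma> s"] g(1) ne by simp
  also have "\<dots> \<longleftrightarrow> (\<exists>\<nu>\<in>dom s'. s = cut s' \<nu>)"
    unfolding gg_cut[symmetric] using gg_inj[OF assms(1)] cut_short(1)[OF assms(2)] by auto
  also have "\<dots> \<longleftrightarrow> s \<subseteq>\<^sub>m s'" using seg_iff[OF assms(2), of s] assms(1) False by simp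
  finally show ?thesis .
qed simp

lemma gg_surj:
  assumes "s' \<in> seqs"
  shows "\<exists>s\<in>seqs. gg A \<Gamma> s = s'"
proof -
  \<comment> \<open>The preimage is built recursively: the entries found so far determine which
    bijection has to be inverted at \<nu>.\<close>
  define F where "F f \<nu> = inv_into (Field lam)
    (tr A \<Gamma> (\<lambda>\<nu>'. if lt \<kappa> \<nu>' \<nu> \<and> \<nu>' \<in> dom s' then Some (f \<nu>') else None)) (the (s' \<nu>))" for f \<nu>
  define f where "f = wfrec {(a, b). lt \<kappa> a b} F"
  have f: "f \<nu> = F f \<nu>" for \<nu>
  proof -
    have "f \<nu> = F (Wfrec.cut f {(a, b). lt \<kappa> a b} \<nu>) \<nu>" unfolding f_def by (subst wfrec[OF k.wf_lt]) simp
    also have "F (Wfrec.cut f {(a, b). lt \<kappa> a b} \<nu>) \<nu> = F f \<nu>"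
    proof -
      have "(\<lambda>\<nu>'. if lt \<kappa> \<nu>' \<nu> \<and> \<nu>' \<in> dom s' then Some (Wfrec.cut f {(a, b). lt \<kappa> a b} \<nu> \<nu>') else None) =
        (\<lambda>\<nu>'. if lt \<kappa> \<nu>' \<nu> \<and> \<nu>' \<in> dom s' then Some (f \<nu>') else None)"
        by (auto simp: fun_eq_iff cut_apply)
      then show ?thesis by (simp add: F_def)
    qed
    finally show ?thesis .
  qed
  define s where "s \<nu> = (if \<nu> \<in> dom s' then Some (f \<nu>) else None)" for \<nu>
  have c: "cut s \<nu> = (\<lambda>\<nu>'. if lt \<kappa> \<nu>' \<nu> \<and> \<nu>' \<in> dom s' then Some (f \<nu>') else None)" for \<nu>
    by (auto simp: s_def restrict_map_def)
  have val: "f \<nu> \<in> Field lam" "tr A \<Gamma> (cut s \<nu>) (f \<nu>) = v" if "s' \<nu> = Some v" for \<nu> v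
  proof -
    have "v \<in> tr A \<Gamma> (cut s \<nu>) ` Field lam"
      using tr_bij[of "cut s \<nu>"] ran_seqs[OF assms that] by (simp add: bij_betw_def)
    moreover have "f \<nu> = inv_into (Field lam) (tr A \<Gamma> (cut s \<nu>)) v"
      using f[of \<nu>] that unfolding c F_def by simp
    ultimately show "f \<nu> \<in> Field lam" "tr A \<Gamma> (cut s \<nu>) (f \<nu>) = v"
      using inv_into_into[of v "tr A \<Gamma> (cut s \<nu>)" "Field lam"] f_inv_into_f[of v "tr A \<Gamma> (cut s \<nu>)" "Field lam"] by simp_all
  qed
  have d: "dom s = dom s'" by (auto simp: s_def split: if_splits)
  have r: "ran s \<subseteq> Field lam" using val(1) by (auto simp: s_def ran_def)
  have "s \<in> seqs" using assms d r by (auto simp: short_def full_def)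
  moreover have "gg A \<Gamma> s = s'"
  proof
    fix \<nu>
    show "gg A \<Gamma> s \<nu> = s' \<nu>"
    proof (cases "s' \<nu>")
      case (Some v)
      then have "s \<nu> = Some (f \<nu>)" by (auto simp: s_def)
      then show ?thesis using gg_apply[of s \<nu>] val(2)[OF Some] Some by simp
    next
      case None
      then show ?thesis using d by (auto simp: gg_def s_def)
    qed
  qed
  ultimately show ?thesis by auto
qed

text \<open>If the initial segment before an entry is bounded at time \<open>a\<close>, then
  \<Gamma> at \<open>a\<close> does not split the blocks used for the entry, so moving it does not
  change on which side it lies. For the converse this premise has to be established first, hence the
  induction.\<close>

lemma bound_gg:
  assumes "s \<in> seqs" "a \<in> A"
  shows "bound \<Gamma> a (gg A \<Gamma> s) \<longleftrightarrow> bound \<Gamma> a s"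
proof -
  have eq: "(xi (tr A \<Gamma> x v), \<Gamma> a) \<in> lam \<longleftrightarrow> (xi v, \<Gamma> a) \<in> lam" if "bound \<Gamma> a x" "v \<in> Field lam" for x v
    using tr(3)[OF that(2), of x] that(1) assms(2) by (auto simp: block_def)
  show ?thesis
  proof
    assume b: "bound \<Gamma> a s"
    show "bound \<Gamma> a (gg A \<Gamma> s)" unfolding bound_def
    proof (intro allI impI)
      fix \<nu> w assume "gg A \<Gamma> s \<nu> = Some w"
      then obtain v where v: "s \<nu> = Some v" "w = tr A \<Gamma> (cut s \<nu>) v" by (auto simp: gg_def)
      have "bound \<Gamma> a (cut s \<nu>)" using b by (auto simp: bound_def restrict_map_def)
      then show "(xi w, \<Gamma> a) \<in> lam" using eq ran_seqs[OF assms(1) v(1)] b v by (auto simp: bound_def)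
    qed
  next
    assume b: "bound \<Gamma> a (gg A \<Gamma> s)"
    have "\<forall>v. s \<nu> = Some v \<longrightarrow> (xi v, \<Gamma> a) \<in> lam" if "\<nu> \<in> dom s" for \<nu>
      using that
    proof (induct \<nu> rule: seqs_induct[OF assms(1), consumes 1, case_names less])
      case (less \<nu>)
      have "bound \<Gamma> a (cut s \<nu>)" using less(2) by (auto simp: bound_def restrict_map_def)
      moreover have "(xi (tr A \<Gamma> (cut s \<nu>) v), \<Gamma> a) \<in> lam" if "s \<nu> = Some v" for v
        using b gg_apply[of s \<nu>, OF that] by (auto simp: bound_def)
      ultimately show ?case using eq ran_seqs[OF assms(1)] by blast
    qed
    then show "bound \<Gamma> a s" by (auto simp: bound_def)
  qed
qed

end

definition increasing :: "'t rel \<Rightarrow> ('t \<Rightarrow> 'l) \<Rightarrow> bool" where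
  "increasing t \<Gamma> \<longleftrightarrow> (\<forall>a\<in>Field t. \<Gamma> a \<in> Field lam) \<and> (\<forall>a b. lt t a b \<longrightarrow> lt lam (\<Gamma> a) (\<Gamma> b))"

lemma increasing_Field: "increasing t \<Gamma> \<Longrightarrow> a \<in> Field t \<Longrightarrow> \<Gamma> a \<in> Field lam"
  by (simp add: increasing_def)

lemma increasing_le: "increasing t \<Gamma> \<Longrightarrow> (a, b) \<in> t \<Longrightarrow> (\<Gamma> a, \<Gamma> b) \<in> lam"
  using lam.refl[of "\<Gamma> a"] FieldI1[of a b t] lt_le[of "\<Gamma> a" lam "\<Gamma> b"] lt_iff[of a t b]
  by (cases "a = b") (auto simp only: increasing_def)

lemma bound_mono: "increasing t \<Gamma> \<Longrightarrow> (a, b) \<in> t \<Longrightarrow> bound \<Gamma> a s \<Longrightarrow> bound \<Gamma> b s"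
  using lam.lele[OF _ increasing_le[of t \<Gamma> a b]] by (simp add: bound_def)

lemma bound_cut: "bound \<Gamma> a s \<Longrightarrow> bound \<Gamma> a (s |` X)"
  by (auto simp: bound_def restrict_map_def)

text \<open>Times after \<open>a\<close> have values at or above that of \<open>a\<close>, so they
  do not separate ordinals up to this value. Only times up to \<open>a\<close> matter, and there
  \<Gamma> and \<Gamma>' coincide.\<close>

lemma block_agree:
  assumes t: "well t" and \<Gamma>: "increasing t \<Gamma>" "increasing t \<Gamma>'" and a: "a \<in> Field t" "\<forall>b\<in>under t a. \<Gamma> b = \<Gamma>' b"
    and b: "bound \<Gamma> a x" "(\<xi>, \<Gamma> a) \<in> lam"
  shows "block (Field t) \<Gamma> x \<xi> \<subseteq> block (Field t) \<Gamma>' x \<xi>"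
proof
  interpret t: well t by fact
  fix \<xi>' assume "\<xi>' \<in> block (Field t) \<Gamma> x \<xi>"
  then have 1: "\<xi>' \<in> Field lam" "\<And>b. b \<in> Field t \<Longrightarrow> bound \<Gamma> b x \<Longrightarrow> (\<xi>, \<Gamma> b) \<in> lam \<longleftrightarrow> (\<xi>', \<Gamma> b) \<in> lam"
    by (auto simp: block_def)
  have a': "(\<xi>', \<Gamma> a) \<in> lam" using 1(2)[OF a(1) b(1)] b(2) by simp
  have "(\<xi>, \<Gamma>' c) \<in> lam \<longleftrightarrow> (\<xi>', \<Gamma>' c) \<in> lam" if c: "c \<in> Field t" "bound \<Gamma>' c x" for c
  proof (cases "(c, a) \<in> t")
    case True
    then have e: "\<Gamma> c = \<Gamma>' c" using a(2) by (simp add: under_def)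
    then have "bound \<Gamma> c x" using c(2) by (simp add: bound_def)
    then show ?thesis using 1(2)[OF c(1)] e by simp
  next
    case False
    then have "(a, c) \<in> t" using t.total[OF c(1) a(1)] by blast
    then have "(\<Gamma>' a, \<Gamma>' c) \<in> lam" by (rule increasing_le[OF \<Gamma>(2)])
    moreover have "\<Gamma>' a = \<Gamma> a" using a(2) t.refl[OF a(1)] by (simp add: under_def)
    ultimately show ?thesis using lam.lele[OF a'] lam.lele[OF b(2)] by simp
  qed
  then show "\<xi>' \<in> block (Field t) \<Gamma>' x \<xi>" using 1(1) by (simp add: block_def)
qed

text \<open>Later moves of \<open>\<forall>\<close> change \<Gamma> only at later times. This lemma
  says that they do not affect the answers about sequences that are already bounded.\<close>

lemma gg_agree:
  assumes t: "well t" and \<Gamma>: "increasing t \<Gamma>" "increasing t \<Gamma>'" and a: "a \<in> Field t" "\<forall>b\<in>under t a. \<Gamma> b = \<Gamma>' b"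
    and s: "bound \<Gamma> a s"
  shows "gg (Field t) \<Gamma> s = gg (Field t) \<Gamma>' s"
proof
  interpret t: well t by fact
  fix \<nu>
  show "gg (Field t) \<Gamma> s \<nu> = gg (Field t) \<Gamma>' s \<nu>"
  proof (cases "s \<nu>")
    case (Some v)
    have b: "bound \<Gamma> a (cut s \<nu>)" "(xi v, \<Gamma> a) \<in> lam" using bound_cut[OF s] s Some by (simp_all add: bound_def)
    have e: "\<Gamma>' a = \<Gamma> a" using a t.refl[OF a(1)] by (simp add: under_def)
    then have b': "bound \<Gamma>' a (cut s \<nu>)" "(xi v, \<Gamma>' a) \<in> lam" using b by (simp_all add: bound_def)
    have "\<forall>b\<in>under t a. \<Gamma>' b = \<Gamma> b" using a(2) by simp
    then have "block (Field t) \<Gamma> (cut s \<nu>) (xi v) = block (Field t) \<Gamma>' (cut s \<nu>) (xi v)"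
      using block_agree[OF t \<Gamma> a b] block_agree[OF t \<Gamma>(2,1) a(1) _ b'] by simp
    then show ?thesis using Some by (simp add: gg_def tr_def)
  qed (simp add: gg_def)
qed

lemma block_convex:
  assumes "m \<in> block A \<Gamma> x \<xi>" "b \<in> block A \<Gamma> x \<xi>" "(m, a) \<in> lam" "lt lam a b"
  shows "a \<in> block A \<Gamma> x \<xi>"
proof -
  have "(\<xi>, \<Gamma> c) \<in> lam \<longleftrightarrow> (a, \<Gamma> c) \<in> lam" if c: "c \<in> A" "bound \<Gamma> c x" for c
  proof
    assume "(\<xi>, \<Gamma> c) \<in> lam"
    then have "(b, \<Gamma> c) \<in> lam" using assms(2) c by (simp add: block_def)
    then show "(a, \<Gamma> c) \<in> lam" by (rule lam.lele[OF lt_le[OF assms(4)]])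
  next
    assume "(a, \<Gamma> c) \<in> lam"
    then have "(m, \<Gamma> c) \<in> lam" by (rule lam.lele[OF assms(3)])
    then show "(\<xi>, \<Gamma> c) \<in> lam" using assms(1) c by (simp add: block_def)
  qed
  then show ?thesis using lt_Field1[OF assms(4)] by (simp add: block_def)
qed

lemma statD:
  assumes "\<delta> \<in> stat" "C \<subseteq> underS lam \<delta>" "|C| <o mu"
  shows "\<exists>\<beta>. lt lam \<beta> \<delta> \<and> (\<forall>c\<in>C. lt lam c \<beta>)"
  using assms unfolding stat_def by blast

abbreviation clock :: "('m \<times> 'k) rel" where "clock \<equiv> ord_times mu \<kappa>"

lemma Field_clock: "Field clock = Field mu \<times> Field \<kappa>"
  by (rule Field_ord_times[OF mu.wo k.wo])

lemma well_clock: "well clock"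
  by (rule well.intro[OF Well_order_ord_times[OF mu.wo k.wo]])

sublocale t: well clock by (rule well_clock)

text \<open>
  In the second case of \<open>safe\<close> the block of \<open>xi v\<close> begins at a supremum of fewer than \<open>\<mu>\<close> values of
  \<open>\<Gamma>\<close>, hence not in \<open>stat\<close>.
\<close>

lemma tr_regressive:
  assumes \<Gamma>: "increasing clock \<Gamma>" and v: "v \<in> Field lam" "og v = code x" "xi v \<in> stat"
    and k: "k \<in> Field clock" "bound \<Gamma> k x" "(xi v, \<Gamma> k) \<in> lam"
    and min: "\<And>a. lt clock a k \<Longrightarrow> bound \<Gamma> a x \<Longrightarrow> \<not> (xi v, \<Gamma> a) \<in> lam"
    and safe: "(\<forall>a. lt clock a k \<longrightarrow> \<not> bound \<Gamma> a x) \<or> (\<exists>i. lt mu i (fst k))"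
  shows "lt lam (xi (tr (Field clock) \<Gamma> x v)) (xi v)"
proof -
  let ?K = "block (Field clock) \<Gamma> x (xi v)"
  have K: "?K \<subseteq> Field lam" by (rule block_Field)
  have self: "xi v \<in> ?K" by (rule block_self[OF og_xi(2)[OF v(1)]])
  have cK: "(xi v, \<Gamma> c) \<in> lam \<longleftrightarrow> (\<xi>, \<Gamma> c) \<in> lam" if "\<xi> \<in> ?K" "c \<in> Field clock" "bound \<Gamma> c x" for \<xi> c
    using that by (simp add: block_def)
  have "?K \<subseteq> insert (\<Gamma> k) (underS lam (\<Gamma> k))" using cK[OF _ k(1,2)] k(3) by (auto simp: lt_iff)
  then have card: "|?K| \<le>o mu" using card_insert_le[OF card_underS] subset_le by blast
  obtain m where m: "m \<in> ?K" "\<forall>\<xi>\<in>?K. (m, \<xi>) \<in> lam" using lam.ex_least[OF K] self by auto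
  have mF: "m \<in> Field lam" using m(1) K by auto
  have "m \<notin> stat"
  proof
    assume st: "m \<in> stat"
    show False
    proof (cases "\<forall>a. lt clock a k \<longrightarrow> \<not> bound \<Gamma> a x")
      case True
      \<comment> \<open>No time before \<open>k\<close> counts for \<open>x\<close>, so the block is
        an initial segment of \<open>lam\<close>. It begins with \<open>zero\<close>, which is not
        in \<open>stat\<close>.\<close>
      have "(xi v, \<Gamma> c) \<in> lam \<and> (zero, \<Gamma> c) \<in> lam" if c: "c \<in> Field clock" "bound \<Gamma> c x" for c
      proof -
        have "(k, c) \<in> clock" using spec[OF True, of c] c(2) t.not_lt[OF c(1) k(1)] by blast
        then show ?thesis using lam.lele[OF k(3) increasing_le[OF \<Gamma>]] zero(2)[OF increasing_Field[OF \<Gamma> c(1)]] by simp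
      qed
      then have "zero \<in> ?K" using zero(1) by (simp add: block_def)
      then have "m = zero" using m(2) zero(2)[OF mF] lam.antisym by auto
      moreover have "|{} :: 'l set| <o mu"
        using finite_ordLess_infinite[OF card_of_Well_order mu.wo, of "{} :: 'l set"] mu(2) by (simp add: Field_card_of)
      then have "\<exists>\<beta>. lt lam \<beta> m \<and> (\<forall>c\<in>{}. lt lam c \<beta>)" by (intro statD[OF st]) auto
      ultimately show False using zero(3) by auto
    next
      case False
      obtain i0 \<beta> where ik: "k = (i0, \<beta>)" by (cases k)
      have F: "i0 \<in> Field mu" "\<beta> \<in> Field \<kappa>" using k(1) unfolding ik Field_clock by auto
      obtain i1 where i1: "lt mu i1 i0" using safe False ik by auto
      \<comment> \<open>The values at the times before \<open>k\<close> in the same copy of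
        \<open>mu\<close> that count for \<open>x\<close>. There are fewer than \<open>mu\<close> of
        them, all below the least element \<open>m\<close> of the block. Were \<open>m\<close> in
        \<open>stat\<close>, some \<beta>0 below \<open>m\<close> would be above all of them; as no
        relevant time separates it from the block, it would belong to the block.\<close>
      let ?C = "(\<lambda>i. \<Gamma> (i, \<beta>)) ` {i. lt mu i i0 \<and> bound \<Gamma> (i, \<beta>) x}"
      have below: "lt clock (i, \<beta>) k" if "lt mu i i0" for i
        using that F lt_Field1[OF that] unfolding ik lt_ord_times by simp
      have "|{i. lt mu i i0 \<and> bound \<Gamma> (i, \<beta>) x}| \<le>o |underS mu i0|" by (rule card_of_mono1) auto
      then have "|?C| <o mu"
        by (rule ordLeq_ordLess_trans[OF ordLeq_transitive[OF card_of_image] card_of_underS[OF mu(1) F(1)]])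
      moreover have "?C \<subseteq> underS lam m"
      proof clarify
        fix i assume i: "lt mu i i0" "bound \<Gamma> (i, \<beta>) x"
        have iF: "(i, \<beta>) \<in> Field clock" using lt_Field1[OF below[OF i(1)]] .
        have "\<not> (m, \<Gamma> (i, \<beta>)) \<in> lam" using min[OF below[OF i(1)] i(2)] cK[OF m(1) iF i(2)] by simp
        then show "lt lam (\<Gamma> (i, \<beta>)) m" using lam.not_le[OF mF increasing_Field[OF \<Gamma> iF]] by simp
      qed
      ultimately have "\<exists>\<beta>. lt lam \<beta> m \<and> (\<forall>c\<in>?C. lt lam c \<beta>)" by (rule statD[OF st, rotated])
      then obtain \<beta>0 where \<beta>0: "lt lam \<beta>0 m" "\<forall>c\<in>?C. lt lam c \<beta>0" by auto
      have "(xi v, \<Gamma> c) \<in> lam \<longleftrightarrow> (\<beta>0, \<Gamma> c) \<in> lam" if c: "c \<in> Field clock" "bound \<Gamma> c x" for c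
      proof
        assume "(xi v, \<Gamma> c) \<in> lam"
        then have "(m, \<Gamma> c) \<in> lam" using cK[OF m(1) c] by simp
        then show "(\<beta>0, \<Gamma> c) \<in> lam" by (rule lam.lele[OF lt_le[OF \<beta>0(1)]])
      next
        assume \<beta>c: "(\<beta>0, \<Gamma> c) \<in> lam"
        show "(xi v, \<Gamma> c) \<in> lam"
        proof (rule ccontr)
          assume no: "\<not> ?thesis"
          have "\<not> (k, c) \<in> clock"
          proof
            assume "(k, c) \<in> clock"
            then show False using no lam.lele[OF k(3) increasing_le[OF \<Gamma>]] by simp
          qed
          then have ck: "lt clock c k" using t.not_le[OF k(1) c(1)] by simp
          obtain i \<beta>' where ic: "c = (i, \<beta>')" by (cases c)
          have cF: "i \<in> Field mu" "\<beta>' \<in> Field \<kappa>" using c(1) unfolding ic Field_clock by auto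
          \<comment> \<open>A time in an earlier copy of \<open>mu\<close> is overtaken by
            \<open>(i1, \<beta>)\<close>, which is still before \<open>k\<close>. This is where
            \<open>i0\<close> must not be the first element of \<open>mu\<close>.\<close>
          obtain i' where i': "lt mu i' i0" "(c, (i', \<beta>)) \<in> clock"
          proof (cases "lt \<kappa> \<beta>' \<beta>")
            case True
            then show ?thesis using that[OF i1] cF F lt_Field1[OF i1] unfolding ic ord_times_iff by simp
          next
            case False
            then have "\<beta>' = \<beta>" "lt mu i i0" using ck unfolding ic ik lt_ord_times by auto
            then show ?thesis using that[of i] t.refl[OF c(1)] unfolding ic by simp
          qed
          have "bound \<Gamma> (i', \<beta>) x" by (rule bound_mono[OF \<Gamma> i'(2) c(2)])
          then have "lt lam (\<Gamma> (i', \<beta>)) \<beta>0" using \<beta>0(2) i'(1) by simp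
          moreover have "(\<beta>0, \<Gamma> (i', \<beta>)) \<in> lam" by (rule lam.lele[OF \<beta>c increasing_le[OF \<Gamma> i'(2)]])
          ultimately show False using lam.asym by simp
        qed
      qed
      then have "\<beta>0 \<in> ?K" using lt_Field1[OF \<beta>0(1)] by (simp add: block_def)
      then show False using m(2) lam.asym[OF \<beta>0(1)] by simp
    qed
  qed
  then have "\<exists>\<pi>. bij_betw \<pi> ?K ?K \<and> regressive ?K \<pi>"
  proof (rule ex_regressive[OF K card m(1)])
    show "(m, \<xi>) \<in> lam" if "\<xi> \<in> ?K" for \<xi> using m(2) that by simp
    show "a \<in> ?K" if "(m, a) \<in> lam" "lt lam a b" "b \<in> ?K" for a b by (rule block_convex[OF m(1) that(3,1,2)])
  qed
  then have "regressive ?K (perm ?K)" by (rule perm_regressive)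
  then show ?thesis using self v(3) by (simp add: regressive_def tr(4)[OF v(1,2)])
qed

text \<open>The first coordinates of \<open>b\<close> name all proper initial segments of \<beta>,
  so \<beta> is determined by \<open>b\<close>. The second condition makes \<beta> its own
  origin.\<close>

definition orig :: "('k \<rightharpoonup> 'l) \<Rightarrow> ('k \<rightharpoonup> 'l) \<Rightarrow> bool" where
  "orig b \<beta> \<longleftrightarrow> b \<in> full \<and> \<beta> \<in> full \<and>
     (\<forall>\<nu>\<in>Field \<kappa>. og (the (b \<nu>)) = code (cut \<beta> \<nu>) \<and> og (the (\<beta> \<nu>)) = code (cut \<beta> \<nu>))"

definition good :: "('k \<rightharpoonup> 'l) \<Rightarrow> ('k \<rightharpoonup> 'l) \<Rightarrow> bool" where
  "good b \<beta> \<longleftrightarrow> (\<exists>\<nu>0\<in>Field \<kappa>. \<forall>\<nu>. lt \<kappa> \<nu>0 \<nu> \<longrightarrow> xi (the (\<beta> \<nu>)) \<in> stat \<longrightarrow>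
     lt lam (xi (the (b \<nu>))) (xi (the (\<beta> \<nu>))))"

definition Z0 :: "('k \<rightharpoonup> 'l) set" where
  "Z0 = {b. \<exists>\<beta>. orig b \<beta> \<and> (b = \<beta> \<or> good b \<beta>)}"

definition Z1 :: "('k \<rightharpoonup> 'l) set" where
  "Z1 = {b. \<exists>\<beta>. orig b \<beta> \<and> good b \<beta>}"

lemma full_val: "s \<in> full \<Longrightarrow> \<nu> \<in> Field \<kappa> \<Longrightarrow> \<exists>v\<in>Field lam. s \<nu> = Some v"
  using ran_seqs[of s \<nu>] domIff[of \<nu> s] by (auto simp: full_def)

lemma og_gg: "s \<in> seqs \<Longrightarrow> \<nu> \<in> dom s \<Longrightarrow> og (the (gg A \<Gamma> s \<nu>)) = og (the (s \<nu>))"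
proof -
  assume s: "s \<in> seqs" "\<nu> \<in> dom s"
  then obtain v where v: "s \<nu> = Some v" by auto
  then show ?thesis using v by (simp add: tr(2)[OF ran_seqs[of s \<nu>, OF s(1) v]] gg_apply[of s \<nu>, OF v])
qed

lemma bound_under:
  assumes "s \<nu> = Some v" "\<nu> \<in> Field \<kappa>"
  shows "bound \<Gamma> a (s |` under \<kappa> \<nu>) \<longleftrightarrow> bound \<Gamma> a (cut s \<nu>) \<and> (xi v, \<Gamma> a) \<in> lam"
  using assms unfolding under_eq[OF k.po assms(2)] bound_def
  by (auto simp: restrict_map_def split: if_splits)

text \<open>
  For the levels \<open>\<nu>\<close> at which \<open>tr_regressive\<close> fails, the least times \<open>k \<nu>\<close> that bound \<open>\<beta>\<close> up to \<open>\<nu>\<close>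
  are strictly increasing and have the first coordinate \<open>0\<close>. So their second coordinates are
  distinct elements below that of \<open>a\<close>.
\<close>

lemma good_gg:
  assumes \<Gamma>: "increasing clock \<Gamma>" and \<beta>: "orig \<beta> \<beta>" and a: "a \<in> Field clock" "bound \<Gamma> a \<beta>"
  shows "good (gg (Field clock) \<Gamma> \<beta>) \<beta>"
proof -
  let ?g = "gg (Field clock) \<Gamma>"
  have f: "\<beta> \<in> full" using \<beta> by (simp add: orig_def)
  have "\<forall>\<nu>\<in>Field \<kappa>. \<exists>k. k \<in> Field clock \<and> bound \<Gamma> k (\<beta> |` under \<kappa> \<nu>) \<and>
    (\<forall>c\<in>Field clock. bound \<Gamma> c (\<beta> |` under \<kappa> \<nu>) \<longrightarrow> (k, c) \<in> clock)"
  proof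
    fix \<nu> assume "\<nu> \<in> Field \<kappa>"
    let ?S = "{c \<in> Field clock. bound \<Gamma> c (\<beta> |` under \<kappa> \<nu>)}"
    have "a \<in> ?S" using a bound_cut by simp
    then have "\<exists>k\<in>?S. \<forall>c\<in>?S. (k, c) \<in> clock" by (intro t.ex_least) blast+
    then show "\<exists>k. k \<in> Field clock \<and> bound \<Gamma> k (\<beta> |` under \<kappa> \<nu>) \<and>
      (\<forall>c\<in>Field clock. bound \<Gamma> c (\<beta> |` under \<kappa> \<nu>) \<longrightarrow> (k, c) \<in> clock)" by blast
  qed
  from bchoice[OF this] obtain k where k: "\<And>\<nu>. \<nu> \<in> Field \<kappa> \<Longrightarrow> k \<nu> \<in> Field clock"
    "\<And>\<nu>. \<nu> \<in> Field \<kappa> \<Longrightarrow> bound \<Gamma> (k \<nu>) (\<beta> |` under \<kappa> \<nu>)"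
    "\<And>\<nu> c. \<nu> \<in> Field \<kappa> \<Longrightarrow> c \<in> Field clock \<Longrightarrow> bound \<Gamma> c (\<beta> |` under \<kappa> \<nu>) \<Longrightarrow> (k \<nu>, c) \<in> clock" by auto
  define bad where "bad = {\<nu> \<in> Field \<kappa>. xi (the (\<beta> \<nu>)) \<in> stat \<and> \<not> lt lam (xi (the (?g \<beta> \<nu>))) (xi (the (\<beta> \<nu>)))}"
  have bad: "(\<exists>c. lt clock c (k \<nu>) \<and> bound \<Gamma> c (cut \<beta> \<nu>)) \<and> \<not> (\<exists>i. lt mu i (fst (k \<nu>)))" if \<nu>b: "\<nu> \<in> bad" for \<nu>
  proof (rule ccontr)
    assume no: "\<not> ?thesis"
    have \<nu>: "\<nu> \<in> Field \<kappa>" "xi (the (\<beta> \<nu>)) \<in> stat" using \<nu>b by (auto simp: bad_def)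
    obtain v where v: "v \<in> Field lam" "\<beta> \<nu> = Some v" using full_val[OF f \<nu>(1)] by auto
    have "og (the (\<beta> \<nu>)) = code (cut \<beta> \<nu>)" using \<beta> \<nu>(1) by (simp add: orig_def)
    then have og: "og v = code (cut \<beta> \<nu>)" unfolding v(2) by simp
    have "lt lam (xi (tr (Field clock) \<Gamma> (cut \<beta> \<nu>) v)) (xi v)"
    proof (rule tr_regressive[OF \<Gamma> v(1) og])
      show "xi v \<in> stat" using \<nu>(2) v(2) by simp
      show "k \<nu> \<in> Field clock" by (rule k(1)[OF \<nu>(1)])
      show "bound \<Gamma> (k \<nu>) (cut \<beta> \<nu>)" "(xi v, \<Gamma> (k \<nu>)) \<in> lam"
        using k(2)[OF \<nu>(1)] unfolding bound_under[of \<beta>, OF v(2) \<nu>(1)] by auto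
      show "(\<forall>a. lt clock a (k \<nu>) \<longrightarrow> \<not> bound \<Gamma> a (cut \<beta> \<nu>)) \<or> (\<exists>i. lt mu i (fst (k \<nu>)))" using no by blast
      show "\<not> (xi v, \<Gamma> c) \<in> lam" if c: "lt clock c (k \<nu>)" "bound \<Gamma> c (cut \<beta> \<nu>)" for c
      proof
        assume "(xi v, \<Gamma> c) \<in> lam"
        then have "bound \<Gamma> c (\<beta> |` under \<kappa> \<nu>)" using c(2) by (simp add: bound_under[of \<beta>, OF v(2) \<nu>(1)])
        then show False using k(3)[OF \<nu>(1) lt_Field1[OF c(1)]] t.asym[OF c(1)] by simp
      qed
    qed
    moreover have "?g \<beta> \<nu> = Some (tr (Field clock) \<Gamma> (cut \<beta> \<nu>) v)" by (rule gg_apply[of \<beta> \<nu>, OF v(2)])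
    ultimately show False using \<nu>b v(2) by (simp add: bad_def)
  qed
  have badF: "bad \<subseteq> Field \<kappa>" by (auto simp: bad_def)
  have kF: "fst (k \<nu>) \<in> Field mu" if "\<nu> \<in> bad" for \<nu>
    using k(1)[of \<nu>] that badF unfolding Field_clock by (auto simp: mem_Times_iff)
  have incr: "lt \<kappa> (snd (k \<nu>)) (snd (k \<nu>'))" if \<nu>b: "\<nu> \<in> bad" "\<nu>' \<in> bad" "lt \<kappa> \<nu> \<nu>'" for \<nu> \<nu>'
  proof -
    obtain c where c: "lt clock c (k \<nu>')" "bound \<Gamma> c (cut \<beta> \<nu>')" using bad[OF \<nu>b(2)] by blast
    have "under \<kappa> \<nu> \<subseteq> underS \<kappa> \<nu>'" using k.lelt[OF _ \<nu>b(3)] by (auto simp: under_def)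
    then have "\<beta> |` under \<kappa> \<nu> = (cut \<beta> \<nu>') |` under \<kappa> \<nu>" by (simp add: Int_absorb1)
    then have "bound \<Gamma> c (\<beta> |` under \<kappa> \<nu>)" using bound_cut[OF c(2)] by simp
    then have "(k \<nu>, c) \<in> clock" using k(3)[OF _ lt_Field1[OF c(1)]] \<nu>b(1) badF by auto
    then have "lt clock (k \<nu>) (k \<nu>')" by (rule t.lelt[OF _ c(1)])
    moreover have "fst (k \<nu>) = fst (k \<nu>')"
      using mu.cases3[OF kF[OF \<nu>b(1)] kF[OF \<nu>b(2)]] bad[OF \<nu>b(1)] bad[OF \<nu>b(2)] by blast
    ultimately show ?thesis by (cases "k \<nu>"; cases "k \<nu>'") (simp add: lt_ord_times)
  qed
  have "inj_on (\<lambda>\<nu>. snd (k \<nu>)) bad"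
  proof (rule inj_onI)
    fix \<nu> \<nu>' assume *: "\<nu> \<in> bad" "\<nu>' \<in> bad" "snd (k \<nu>) = snd (k \<nu>')"
    then show "\<nu> = \<nu>'" using k.cases3[of \<nu> \<nu>'] badF incr[of \<nu> \<nu>'] incr[of \<nu>' \<nu>] by auto
  qed
  moreover obtain c where c: "lt \<kappa> (snd a) c" using k_no_max[of "snd a"] a(1) unfolding Field_clock by auto
  have "(\<lambda>\<nu>. snd (k \<nu>)) ` bad \<subseteq> underS \<kappa> c"
  proof clarify
    fix \<nu> assume "\<nu> \<in> bad"
    then have \<nu>: "\<nu> \<in> Field \<kappa>" using badF by auto
    have "(k \<nu>, a) \<in> clock" using k(3)[OF \<nu> a(1) bound_cut[OF a(2)]] .
    then have "(snd (k \<nu>), snd a) \<in> \<kappa>"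
      using ord_times_iff[of "fst (k \<nu>)" "snd (k \<nu>)" "fst a" "snd a" mu \<kappa>] lt_le[of _ \<kappa>] k.refl by auto
    then show "lt \<kappa> (snd (k \<nu>)) c" by (rule k.lelt[OF _ c])
  qed
  ultimately have "|bad| \<le>o |underS \<kappa> c|" by (intro iffD1[OF card_of_ordLeq] exI conjI)
  then have "|bad| <o \<kappa>" using card_of_underS[OF \<kappa>(1) lt_Field2[OF c]] ordLeq_ordLess_trans by blast
  \<comment> \<open>Regularity of \<kappa>: fewer than \<kappa> exceptional levels are bounded, and
    goodness ignores a bounded set of levels.\<close>
  then obtain d where d: "d \<in> Field \<kappa>" "\<forall>\<nu>\<in>bad. (\<nu>, d) \<in> \<kappa>" using k.regular_bounded[OF \<kappa>(3) badF] by auto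
  show ?thesis unfolding good_def
  proof (intro bexI[OF _ d(1)] allI impI)
    fix \<nu> assume \<nu>: "lt \<kappa> d \<nu>" "xi (the (\<beta> \<nu>)) \<in> stat"
    then have "\<nu> \<notin> bad" using d(2) k.asym by auto
    then show "lt lam (xi (the (?g \<beta> \<nu>))) (xi (the (\<beta> \<nu>)))" using \<nu> lt_Field2[OF \<nu>(1)] by (simp add: bad_def)
  qed
qed

lemma orig_gg: "b \<in> full \<Longrightarrow> orig (gg A \<Gamma> b) \<beta> \<longleftrightarrow> orig b \<beta>"
proof -
  assume b: "b \<in> full"
  then have "dom b = Field \<kappa>" by (simp add: full_def)
  then have "\<forall>\<nu>\<in>Field \<kappa>. og (the (gg A \<Gamma> b \<nu>)) = og (the (b \<nu>))" using b by (simp add: og_gg[of b])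
  then show ?thesis using b by (simp add: orig_def gg_full[OF b])
qed

text \<open>Beyond the first disagreement with \<beta>, the entries of \<open>b\<close> name initial
  segments of \<beta>, which differ from those of \<open>b\<close>. Since \<open>code\<close> is
  injective, \<open>tr\<close> is the identity there.\<close>

lemma gg_tail:
  assumes "orig b \<beta>" "b \<noteq> \<beta>"
  shows "\<exists>\<nu>1\<in>Field \<kappa>. \<forall>\<nu>. lt \<kappa> \<nu>1 \<nu> \<longrightarrow> gg A \<Gamma> b \<nu> = b \<nu>"
proof -
  have f: "b \<in> full" "\<beta> \<in> full" using assms(1) by (auto simp: orig_def)
  then have dom: "dom b = Field \<kappa>" "dom \<beta> = Field \<kappa>" by (auto simp: full_def)
  obtain \<nu>1 where \<nu>1: "b \<nu>1 \<noteq> \<beta> \<nu>1" using assms(2) by auto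
  have "b \<nu>1 = \<beta> \<nu>1" if no: "\<nu>1 \<notin> Field \<kappa>"
  proof -
    have "\<nu>1 \<notin> dom b" "\<nu>1 \<notin> dom \<beta>" using no dom by simp_all
    then show ?thesis by (simp add: domIff)
  qed
  then have \<nu>1F: "\<nu>1 \<in> Field \<kappa>" using \<nu>1 by blast
  have "gg A \<Gamma> b \<nu> = b \<nu>" if \<nu>: "lt \<kappa> \<nu>1 \<nu>" for \<nu>
  proof -
    have \<nu>F: "\<nu> \<in> Field \<kappa>" using lt_Field2[OF \<nu>] .
    obtain v where v: "v \<in> Field lam" "b \<nu> = Some v" using full_val[OF f(1) \<nu>F] by auto
    have "cut b \<nu> \<nu>1 \<noteq> cut \<beta> \<nu> \<nu>1" using \<nu>1 \<nu> by simp
    then have "cut b \<nu> \<noteq> cut \<beta> \<nu>" by auto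
    moreover have "cut b \<nu> \<in> short" "cut \<beta> \<nu> \<in> short" using cut_short(1) f dom \<nu>F by auto
    ultimately have "code (cut b \<nu>) \<noteq> code (cut \<beta> \<nu>)" using code(1) by (meson inj_onD)
    moreover have "og v = code (cut \<beta> \<nu>)" using assms(1)[unfolded orig_def] bspec[of "Field \<kappa>" _ \<nu>] \<nu>F v(2) by fastforce
    ultimately have "tr A \<Gamma> (cut b \<nu>) v = v" by (intro tr(5)[OF v(1)]) simp
    then show ?thesis using v(2) by (simp add: gg_apply[of b \<nu>, OF v(2)])
  qed
  then show ?thesis using \<nu>1F by blast
qed

lemma good_tail:
  assumes "good b \<beta>" "\<nu>1 \<in> Field \<kappa>" "\<forall>\<nu>. lt \<kappa> \<nu>1 \<nu> \<longrightarrow> b' \<nu> = b \<nu>"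
  shows "good b' \<beta>"
proof -
  obtain \<nu>0 where \<nu>0: "\<nu>0 \<in> Field \<kappa>" "\<forall>\<nu>. lt \<kappa> \<nu>0 \<nu> \<longrightarrow> xi (the (\<beta> \<nu>)) \<in> stat \<longrightarrow> lt lam (xi (the (b \<nu>))) (xi (the (\<beta> \<nu>)))"
    using assms(1) by (auto simp: good_def)
  obtain c where c: "c \<in> Field \<kappa>" "(\<nu>0, c) \<in> \<kappa>" "(\<nu>1, c) \<in> \<kappa>"
    using k.total[OF \<nu>0(1) assms(2)] k.refl \<nu>0(1) assms(2) by blast
  show ?thesis unfolding good_def
  proof (intro bexI[OF _ c(1)] allI impI)
    fix \<nu> assume \<nu>: "lt \<kappa> c \<nu>" "xi (the (\<beta> \<nu>)) \<in> stat"
    then show "lt lam (xi (the (b' \<nu>))) (xi (the (\<beta> \<nu>)))"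
      using \<nu>0(2) assms(3) k.lelt[OF c(2) \<nu>(1)] k.lelt[OF c(3) \<nu>(1)] by simp
  qed
qed

text \<open>The map makes an origin good and leaves the tail of every other branch alone. So it
  absorbs exactly the difference between \<open>Z0\<close> and \<open>Z1\<close>, provided the
  branch is bounded at some time of the clock.\<close>

lemma Z_iff:
  assumes \<Gamma>: "increasing clock \<Gamma>" and b: "b \<in> full" and a: "a \<in> Field clock" "bound \<Gamma> a b"
  shows "gg (Field clock) \<Gamma> b \<in> Z1 \<longleftrightarrow> b \<in> Z0"
proof -
  let ?g = "gg (Field clock) \<Gamma>"
  have "good (?g b) \<beta> \<longleftrightarrow> b = \<beta> \<or> good b \<beta>" if o: "orig b \<beta>" for \<beta>
  proof (cases "b = \<beta>")
    case True
    then show ?thesis using good_gg[OF \<Gamma> _ a] o by simp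
  next
    case False
    obtain \<nu>1 where \<nu>1: "\<nu>1 \<in> Field \<kappa>" "\<forall>\<nu>. lt \<kappa> \<nu>1 \<nu> \<longrightarrow> ?g b \<nu> = b \<nu>" using gg_tail[OF o False] by metis
    show ?thesis using good_tail[OF _ \<nu>1(1), of b \<beta> "?g b"] good_tail[OF _ \<nu>1(1), of "?g b" \<beta> b] \<nu>1(2) False by auto
  qed
  then show ?thesis unfolding Z0_def Z1_def using orig_gg[OF b] by blast
qed

lemma Z_full: "Z0 \<subseteq> full" "Z1 \<subseteq> full"
  by (auto simp: Z0_def Z1_def orig_def)

sublocale z0: seq_tree mu lam \<kappa> Z0 by unfold_locales (rule Z_full)
sublocale z1: seq_tree mu lam \<kappa> Z1 by unfold_locales (rule Z_full)

lemma gg_short_iff: "s \<in> seqs \<Longrightarrow> gg A \<Gamma> s \<in> short \<longleftrightarrow> s \<in> short"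
  using gg_short[of s] by (auto simp: short_def full_def)

lemma tagged_gg:
  assumes "s \<in> seqs"
  shows "tagged (gg A \<Gamma> s) o' \<longleftrightarrow> tagged s o'"
proof -
  have "og (the (gg A \<Gamma> s \<nu>)) = og (the (s \<nu>))" if "\<nu> \<in> Field \<kappa>" "dom s = under \<kappa> \<nu>" for \<nu>
    using that k.refl by (intro og_gg[OF assms]) (simp add: under_def)
  then have "dom s = under \<kappa> \<nu> \<and> o' = og (the (gg A \<Gamma> s \<nu>)) \<longleftrightarrow> dom s = under \<kappa> \<nu> \<and> o' = og (the (s \<nu>))"
    if "\<nu> \<in> Field \<kappa>" for \<nu> using that by (intro conj_cong) simp_all
  then show ?thesis unfolding tagged_def dom_gg by (intro bex_cong) simp_all
qed

lemma nodes_gg: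
  assumes \<Gamma>: "increasing clock \<Gamma>" and s: "s \<in> seqs" and a: "a \<in> Field clock" "bound \<Gamma> a s"
  shows "(gg (Field clock) \<Gamma> s, l) \<in> nodes Z1 \<longleftrightarrow> (s, l) \<in> nodes Z0"
proof -
  let ?g = "gg (Field clock) \<Gamma>"
  have "?g s \<in> short \<union> Z1 \<longleftrightarrow> s \<in> short \<union> Z0"
  proof (cases "s \<in> short")
    case True
    then show ?thesis using gg_short_iff[OF s] by auto
  next
    case False
    then have "s \<in> full" using s by auto
    then show ?thesis using Z_iff[OF \<Gamma> _ a] gg_short_iff[OF s] False by auto
  qed
  then show ?thesis unfolding nodes_def by (simp add: tagged_gg[OF s] gg_short_iff[OF s])
qed

definition move :: "('m \<times> 'k \<Rightarrow> 'l) \<Rightarrow> ('k \<rightharpoonup> 'l) \<times> 'l list \<Rightarrow> ('k \<rightharpoonup> 'l) \<times> 'l list" where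
  "move \<Gamma> x = (gg (Field clock) \<Gamma> (fst x), snd x)"

text \<open>The function is needed at every node of the clock, although \<open>\<forall>\<close> may
  skip nodes; there \<open>D\<close> will be empty. Each value is chosen from \<open>D\<close> up to
  that node only, so later moves do not disturb it.\<close>

definition limits :: "('m \<times> 'k \<Rightarrow> 'l set) \<Rightarrow> 'm \<times> 'k \<Rightarrow> 'l" where
  "limits D = wfrec {(a, b). lt clock a b} (\<lambda>f a. SOME \<gamma>. \<gamma> \<in> Field lam \<and>
     (\<forall>b. lt clock b a \<longrightarrow> lt lam (f b) \<gamma>) \<and> (\<forall>\<xi>\<in>D a. (\<xi>, \<gamma>) \<in> lam))"

lemma limits_eq: "limits D a = (SOME \<gamma>. \<gamma> \<in> Field lam \<and>
     (\<forall>b. lt clock b a \<longrightarrow> lt lam (limits D b) \<gamma>) \<and> (\<forall>\<xi>\<in>D a. (\<xi>, \<gamma>) \<in> lam))"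
  unfolding limits_def by (subst wfrec[OF t.wf_lt]) (simp add: cut_apply)

lemma card_clock: "|Field clock| \<le>o mu"
  unfolding Field_clock using Times_le[OF ordIso_imp_ordLeq[OF card_Field_mu] \<kappa>_mu] .

lemma limits:
  assumes D: "\<And>a. D a \<subseteq> Field lam" "\<And>a. |D a| \<le>o mu"
  shows "increasing clock (limits D)" "a \<in> Field clock \<Longrightarrow> \<xi> \<in> D a \<Longrightarrow> (\<xi>, limits D a) \<in> lam"
proof -
  have *: "limits D a \<in> Field lam \<and> (\<forall>b. lt clock b a \<longrightarrow> lt lam (limits D b) (limits D a)) \<and>
    (\<forall>\<xi>\<in>D a. (\<xi>, limits D a) \<in> lam)" if "a \<in> Field clock" for a
    using that
  proof (induct a rule: t.induct)
    case (less a)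
    let ?X = "limits D ` underS clock a \<union> D a"
    have "underS clock a \<subseteq> Field clock" by (rule subsetI) (rule lt_Field1)
    then have "|?X| \<le>o mu" by (intro Un_le image_le subset_le[OF card_clock] D(2))
    moreover have "?X \<subseteq> Field lam" using less(2) D(1) by auto
    ultimately obtain \<gamma> where \<gamma>: "\<gamma> \<in> Field lam" "\<forall>x\<in>?X. lt lam x \<gamma>" using bounded by blast
    have "\<gamma> \<in> Field lam \<and> (\<forall>b. lt clock b a \<longrightarrow> lt lam (limits D b) \<gamma>) \<and> (\<forall>\<xi>\<in>D a. (\<xi>, \<gamma>) \<in> lam)"
      using \<gamma> lt_le[of _ lam \<gamma>] by auto
    from someI[of "\<lambda>\<gamma>. \<gamma> \<in> Field lam \<and> (\<forall>b. lt clock b a \<longrightarrow> lt lam (limits D b) \<gamma>) \<and> (\<forall>\<xi>\<in>D a. (\<xi>, \<gamma>) \<in> lam)", OF this]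
    show ?case unfolding limits_eq[of D a] .
  qed
  show "increasing clock (limits D)" unfolding increasing_def
  proof (intro conjI ballI allI impI)
    fix a b assume "lt clock a b"
    then show "lt lam (limits D a) (limits D b)" using *[OF lt_Field2[of a clock b]] by blast
  qed (use * in blast)
  show "a \<in> Field clock \<Longrightarrow> \<xi> \<in> D a \<Longrightarrow> (\<xi>, limits D a) \<in> lam" using *[of a] by blast
qed

lemma limits_agree:
  assumes "a \<in> Field clock" "\<And>b. (b, a) \<in> clock \<Longrightarrow> D b = D' b"
  shows "limits D a = limits D' a"
  using assms
proof (induct a rule: t.induct)
  case (less a)
  have "limits D b = limits D' b" if "lt clock b a" for b
    using less(2)[OF that less(3)[OF t.lele[OF _ lt_le[OF that]]]] .
  moreover have "D a = D' a" using less(3)[OF t.refl[OF less(1)]] .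
  ultimately have "(\<lambda>\<gamma>. \<gamma> \<in> Field lam \<and> (\<forall>b. lt clock b a \<longrightarrow> lt lam (limits D b) \<gamma>) \<and> (\<forall>\<xi>\<in>D a. (\<xi>, \<gamma>) \<in> lam)) =
    (\<lambda>\<gamma>. \<gamma> \<in> Field lam \<and> (\<forall>b. lt clock b a \<longrightarrow> lt lam (limits D' b) \<gamma>) \<and> (\<forall>\<xi>\<in>D' a. (\<xi>, \<gamma>) \<in> lam))"
    by (intro ext) simp
  then show ?case unfolding limits_eq[of D a] limits_eq[of D' a] by (rule arg_cong)
qed

text \<open>Up to the decodings \<open>dA\<close> and \<open>dB\<close> of copies of the two trees,
  the answers are given by \<open>move\<close>, with \<Gamma> computed from the moves so far. The
  element asked for enters the demand of the current node, so it is bounded at that node when the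
  answer is due.\<close>

lemma game_equiv_clock:
  fixes A :: "'a rel" and B :: "'b rel"
  assumes A: "bij_betw dA (Field A) (nodes Z0)"
      "\<And>x y. x \<in> Field A \<Longrightarrow> y \<in> Field A \<Longrightarrow> lt A x y \<longleftrightarrow> lt (T Z0) (dA x) (dA y)"
    and B: "bij_betw dB (Field B) (nodes Z1)"
      "\<And>x y. x \<in> Field B \<Longrightarrow> y \<in> Field B \<Longrightarrow> lt B x y \<longleftrightarrow> lt (T Z1) (dB x) (dB y)"
  shows "game_equiv lam clock A B"
proof -
  define entries :: "('k \<rightharpoonup> 'l) set \<Rightarrow> 'l set" where "entries S = (\<Union>s\<in>S. xi ` ran s)" for S
  define seen :: "('l, 'a, 'b) challenge \<Rightarrow> ('k \<rightharpoonup> 'l) set" where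
    "seen c = {s \<in> seqs. s \<in> (\<lambda>x. fst (dA x)) ` left_elems lam c \<union> (\<lambda>y. fst (dB y)) ` right_elems lam c}" for c
  define demand :: "('m \<times> 'k, 'l, 'a, 'b) moves \<Rightarrow> 'm \<times> 'k \<Rightarrow> 'l set" where
    "demand h a = (if a \<in> dom h then entries (seen (the (h a))) else {})" for h a
  define \<Gamma> where "\<Gamma> h = limits (demand h)" for h
  have el: "|left_elems lam c| \<le>o mu" "|right_elems lam c| \<le>o mu" for c :: "('l, 'a, 'b) challenge"
  proof -
    show "|left_elems lam c| \<le>o mu"
    proof (cases c)
      case (Choose_left l f)
      show ?thesis unfolding Choose_left left_elems.simps by (rule image_le[OF card_underS])
    next
      case (Choose_right l f)
      show ?thesis unfolding Choose_right left_elems.simps by (rule finite_le[OF finite.emptyI])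
    qed
    show "|right_elems lam c| \<le>o mu"
    proof (cases c)
      case (Choose_left l f)
      show ?thesis unfolding Choose_left right_elems.simps by (rule finite_le[OF finite.emptyI])
    next
      case (Choose_right l f)
      show ?thesis unfolding Choose_right right_elems.simps by (rule image_le[OF card_underS])
    qed
  qed
  have "|seen c| \<le>o mu" for c
    by (rule subset_le[OF Un_le[OF image_le[OF el(1)[of c]] image_le[OF el(2)[of c]]]]) (auto simp: seen_def)
  moreover have ran: "|ran s| \<le>o mu" if "s \<in> seqs" for s
  proof -
    have "ran s \<subseteq> (\<lambda>\<nu>. the (s \<nu>)) ` dom s" by (force simp: ran_def)
    then show ?thesis using subset_le[OF image_le[OF subset_le[OF \<kappa>_mu dom_Field[OF that]]]] by blast
  qed
  moreover have seen: "seen c \<subseteq> seqs" for c by (auto simp: seen_def)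
  ultimately have "|entries (seen c)| \<le>o mu" for c
    unfolding entries_def by (intro UN_le image_le) (blast+)
  then have demand_le: "|demand h a| \<le>o mu" for h a by (simp add: demand_def finite_le)
  have "xi v \<in> Field lam" if "s \<in> seqs" "v \<in> ran s" for s v
    using that og_xi(2) ran_seqs by (auto simp: ran_def)
  then have demand_F: "demand h a \<subseteq> Field lam" for h a
    using seen unfolding demand_def entries_def by auto
  have \<Gamma>: "increasing clock (\<Gamma> h)" "\<And>a \<xi>. a \<in> Field clock \<Longrightarrow> \<xi> \<in> demand h a \<Longrightarrow> (\<xi>, \<Gamma> h a) \<in> lam" for h
    unfolding \<Gamma>_def using limits[of "demand h", OF demand_F demand_le] by blast+
  have \<Gamma>_agree: "\<Gamma> (h |` under clock x) a = \<Gamma> h a" if "a \<in> under clock x" for h x a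
  proof -
    have ax: "(a, x) \<in> clock" using that by (simp add: under_def)
    have "demand (h |` under clock x) b = demand h b" if "(b, a) \<in> clock" for b
      using t.lele[OF that ax] by (auto simp: demand_def under_def domIff restrict_map_def)
    then show ?thesis unfolding \<Gamma>_def by (intro limits_agree FieldI1[OF ax])
  qed
  have seenI: "bound (\<Gamma> h) x s" if "x \<in> dom h" "x \<in> Field clock" "s \<in> seen (the (h x))" for h x s
    unfolding bound_def
  proof (intro allI impI)
    fix \<nu> v assume "s \<nu> = Some v"
    then have "xi v \<in> demand h x" using that by (auto simp: demand_def entries_def intro: ranI)
    then show "(xi v, \<Gamma> h x) \<in> lam" using \<Gamma>(2) that(2) by blast
  qed
  define R where "R h = {(x, y). x \<in> Field A \<and> y \<in> Field B \<and> dB y = move (\<Gamma> h) (dA x)}" for h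
  define P where "P h = {(x, y) \<in> R h. \<exists>a\<in>Field clock. bound (\<Gamma> h) a (fst (dA x))}" for h
  have dA: "dA x \<in> nodes Z0" "fst (dA x) \<in> seqs" if "x \<in> Field A" for x
    using bij_betwE[OF A(1)] that z0.nodes_seqs[of "fst (dA x)" "snd (dA x)"] by auto
  have dB: "dB y \<in> nodes Z1" "fst (dB y) \<in> seqs" if "y \<in> Field B" for y
    using bij_betwE[OF B(1)] that z1.nodes_seqs[of "fst (dB y)" "snd (dB y)"] by auto
  have move: "\<exists>y. (x, y) \<in> R h"
    if x: "x \<in> Field A" "a \<in> Field clock" "bound (\<Gamma> h) a (fst (dA x))" for x a h
  proof -
    have "move (\<Gamma> h) (dA x) \<in> nodes Z1"
      unfolding move_def using nodes_gg[OF \<Gamma>(1) dA(2)[OF x(1)] x(2,3), of "snd (dA x)"] dA(1)[OF x(1)] by simp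
    then have "move (\<Gamma> h) (dA x) \<in> dB ` Field B" using B(1) by (simp add: bij_betw_def)
    then show ?thesis using x(1) by (auto simp: R_def)
  qed
  have pull: "\<exists>x. (x, y) \<in> R h"
    if y: "y \<in> Field B" "a \<in> Field clock" "bound (\<Gamma> h) a (fst (dB y))" for y a h
  proof -
    obtain s where s: "s \<in> seqs" "gg (Field clock) (\<Gamma> h) s = fst (dB y)" using gg_surj[OF dB(2)[OF y(1)]] by blast
    have b: "bound (\<Gamma> h) a s" using bound_gg[OF s(1) y(2), of "\<Gamma> h"] y(3) s(2) by simp
    have "(s, snd (dB y)) \<in> nodes Z0" using nodes_gg[OF \<Gamma>(1) s(1) y(2) b, of "snd (dB y)"] s(2) dB(1)[OF y(1)] by simp
    then have "(s, snd (dB y)) \<in> dA ` Field A" using A(1) by (simp add: bij_betw_def)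
    then obtain x where "x \<in> Field A" "dA x = (s, snd (dB y))" by auto
    then have "(x, y) \<in> R h" using s(2) y(1) by (simp add: R_def move_def)
    then show ?thesis ..
  qed
  show ?thesis
  proof (rule game_equivI[OF well_clock, where R = R and P = P])
    fix h :: "('m \<times> 'k, 'l, 'a, 'b) moves" assume h: "legal_moves lam clock A B h"
    have domF: "dom h \<subseteq> Field clock" using h by (simp add: legal_moves_def)
    have in_dom: "x \<in> dom (h |` under clock x)" "the ((h |` under clock x) x) = the (h x)" if "x \<in> dom h" for x
    proof -
      have "x \<in> under clock x" using t.refl[OF subsetD[OF domF that]] by (simp add: under_def)
      then show "x \<in> dom (h |` under clock x)" "the ((h |` under clock x) x) = the (h x)"
        using that by (auto simp: restrict_map_def)
    qed
    have bnd_left: "bound (\<Gamma> (h |` under clock x)) x (fst (dA a))"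
      if "x \<in> dom h" "a \<in> left_elems lam (the (h x))" for x a
    proof (rule seenI[OF in_dom(1)[OF that(1)] subsetD[OF domF that(1)]])
      have "a \<in> Field A" using legal_elems(1)[OF h that(1)] that(2) by auto
      then show "fst (dA a) \<in> seen (the ((h |` under clock x) x))"
        unfolding in_dom(2)[OF that(1)] using dA(2) that(2) by (simp add: seen_def)
    qed
    have bnd_right: "bound (\<Gamma> (h |` under clock x)) x (fst (dB b))"
      if "x \<in> dom h" "b \<in> right_elems lam (the (h x))" for x b
    proof (rule seenI[OF in_dom(1)[OF that(1)] subsetD[OF domF that(1)]])
      have "b \<in> Field B" using legal_elems(2)[OF h that(1)] that(2) by auto
      then show "fst (dB b) \<in> seen (the ((h |` under clock x) x))"
        unfolding in_dom(2)[OF that(1)] using dB(2) that(2) by (simp add: seen_def)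
    qed
    show "\<exists>b. (a, b) \<in> R (h |` under clock x)" if "x \<in> dom h" "a \<in> left_elems lam (the (h x))" for x a
      using move[OF subsetD[OF legal_elems(1)[OF h that(1)] that(2)] subsetD[OF domF that(1)] bnd_left[OF that]] .
    show "\<exists>a. (a, b) \<in> R (h |` under clock x)" if "x \<in> dom h" "b \<in> right_elems lam (the (h x))" for x b
      using pull[OF subsetD[OF legal_elems(2)[OF h that(1)] that(2)] subsetD[OF domF that(1)] bnd_right[OF that]] .
    show "partial_isomorphism A B (P h)" unfolding partial_isomorphism_def
    proof (intro conjI)
      show "P h \<subseteq> Field A \<times> Field B" by (auto simp: P_def R_def)
      have "(x = x' \<longleftrightarrow> y = y') \<and> (lt A x x' \<longleftrightarrow> lt B y y')" if p: "(x, y) \<in> P h" "(x', y') \<in> P h" for x y x' y'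
      proof -
        have F: "x \<in> Field A" "x' \<in> Field A" "y \<in> Field B" "y' \<in> Field B" using p by (auto simp: P_def R_def)
        obtain s l s' l' where d: "dA x = (s, l)" "dA x' = (s', l')" by (metis surj_pair)
        have e: "dB y = (gg (Field clock) (\<Gamma> h) s, l)" "dB y' = (gg (Field clock) (\<Gamma> h) s', l')"
          using p d by (simp_all add: P_def R_def move_def)
        have n: "(s, l) \<in> nodes Z0" "(s', l') \<in> nodes Z0" "s \<in> seqs" "s' \<in> seqs"
          using dA(1)[OF F(1)] dA(1)[OF F(2)] dA(2)[OF F(1)] dA(2)[OF F(2)] d by simp_all
        have n': "(gg (Field clock) (\<Gamma> h) s, l) \<in> nodes Z1" "(gg (Field clock) (\<Gamma> h) s', l') \<in> nodes Z1"
          using dB(1)[OF F(3)] dB(1)[OF F(4)] e by simp_all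
        have i: "gg (Field clock) (\<Gamma> h) s = gg (Field clock) (\<Gamma> h) s' \<longleftrightarrow> s = s'"
          using gg_inj[OF n(3,4)] by metis
        have "x = x' \<longleftrightarrow> dA x = dA x'" using A(1) F by (auto simp: bij_betw_def inj_on_def)
        moreover have "y = y' \<longleftrightarrow> dB y = dB y'" using B(1) F by (auto simp: bij_betw_def inj_on_def)
        moreover have "lt (T Z0) (dA x) (dA x') \<longleftrightarrow> lt (T Z1) (dB y) (dB y')"
          unfolding d e z0.lt_T z1.lt_T using n n' i by (simp add: gg_le_iff[OF n(3,4)])
        ultimately show ?thesis using A(2)[OF F(1,2)] B(2)[OF F(3,4)] d e i by simp
      qed
      then show "\<forall>(a, b)\<in>P h. \<forall>(a', b')\<in>P h. (a = a' \<longleftrightarrow> b = b') \<and> (lt A a a' \<longleftrightarrow> lt B b b')" by fast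
    qed
    show "(a, b) \<in> P h" if x: "x \<in> dom h" and ab: "(a, b) \<in> R (h |` under clock x)"
      and el: "a \<in> left_elems lam (the (h x)) \<or> b \<in> right_elems lam (the (h x))" for x a b
    proof -
      let ?h = "h |` under clock x"
      have xF: "x \<in> Field clock" using domF x by auto
      have F: "a \<in> Field A" "b \<in> Field B" "dB b = move (\<Gamma> ?h) (dA a)" using ab by (auto simp: R_def)
      have b1: "bound (\<Gamma> ?h) x (fst (dA a))" using el
      proof
        assume "b \<in> right_elems lam (the (h x))"
        then have "bound (\<Gamma> ?h) x (fst (dB b))" by (rule bnd_right[OF x])
        then show ?thesis using bound_gg[OF dA(2)[OF F(1)] xF, of "\<Gamma> ?h"] F(3) by (simp add: move_def)
      qed (rule bnd_left[OF x])
      have "gg (Field clock) (\<Gamma> ?h) (fst (dA a)) = gg (Field clock) (\<Gamma> h) (fst (dA a))"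
        by (rule gg_agree[OF well_clock \<Gamma>(1) \<Gamma>(1) xF _ b1]) (use \<Gamma>_agree in blast)
      then have "(a, b) \<in> R h" using F by (simp add: R_def move_def)
      moreover have "\<Gamma> h x = \<Gamma> ?h x" using \<Gamma>_agree[of x x h] t.refl[OF xF] by (simp add: under_def)
      then have "bound (\<Gamma> h) x (fst (dA a))" using b1 by (simp add: bound_def)
      ultimately show ?thesis using xF by (auto simp: P_def)
    qed
  qed
qed

section \<open>The trees are not isomorphic\<close>

lemma extend:
  assumes s: "s \<in> short" "dom s = underS \<kappa> \<nu>" "\<nu> \<in> Field \<kappa>" "v \<in> Field lam"
  shows "s(\<nu> \<mapsto> v) \<in> short" "dom (s(\<nu> \<mapsto> v)) = under \<kappa> \<nu>" "cut (s(\<nu> \<mapsto> v)) \<nu> = s"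
    "s \<subseteq>\<^sub>m s(\<nu> \<mapsto> v)" "s \<noteq> s(\<nu> \<mapsto> v)"
proof -
  have \<nu>: "\<nu> \<notin> dom s" unfolding s(2) by simp
  show d: "dom (s(\<nu> \<mapsto> v)) = under \<kappa> \<nu>" using s(2) under_eq[OF k.po s(3)] by simp
  obtain \<alpha> where \<alpha>: "\<alpha> \<in> Field \<kappa>" "underS \<kappa> \<alpha> = under \<kappa> \<nu>" using ex_suc[OF s(3)] by auto
  have "ran (s(\<nu> \<mapsto> v)) \<subseteq> Field lam" using s(1,4) \<nu> by (auto simp: short_def ran_def)
  then show "s(\<nu> \<mapsto> v) \<in> short" unfolding short_def using \<alpha> d by auto
  show "s \<subseteq>\<^sub>m s(\<nu> \<mapsto> v)" using \<nu> by (auto simp: map_le_def)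
  have "s \<nu> = None" using \<nu> by (simp add: domIff)
  then show "s \<noteq> s(\<nu> \<mapsto> v)" by (metis fun_upd_same option.distinct(1))
  show "cut (s(\<nu> \<mapsto> v)) \<nu> = s"
  proof
    fix \<nu>'
    show "cut (s(\<nu> \<mapsto> v)) \<nu> \<nu>' = s \<nu>'"
    proof (cases "lt \<kappa> \<nu>' \<nu>")
      case True
      then show ?thesis by (auto simp: restrict_map_def)
    next
      case False
      then have "\<nu>' \<notin> dom s" using s(2) by simp
      then show ?thesis using False by (simp add: domIff)
    qed
  qed
qed

lemma short_dom: "s \<in> short \<Longrightarrow> \<exists>\<nu>\<in>Field \<kappa>. dom s = underS \<kappa> \<nu>"
  by (auto simp: short_def)

lemma ex_extend: "s \<in> short \<Longrightarrow> \<exists>u\<in>short. s \<subseteq>\<^sub>m u \<and> s \<noteq> u"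
  using short_dom[of s] extend(1,4,5)[of s _ zero] zero(1) by blast

lemma short_full: "s \<in> short \<Longrightarrow> s \<notin> full"
  using lt_irrefl[of _ \<kappa>] by (auto simp: short_def full_def)

lemma desc_hd: "desc a (j # w @ i # l) \<Longrightarrow> lt lam j i"
proof (induct w arbitrary: j)
  case (Cons k w)
  then have "lt lam j k" "lt lam k i" by simp_all
  then show ?case by (rule lam.ltt)
qed simp

lemma desc_below: "desc a (i # l) \<Longrightarrow> lt lam i a"
proof (induct l arbitrary: i)
  case (Cons k l)
  then have "lt lam i k" "lt lam k a" by simp_all
  then show ?case by (rule lam.ltt)
qed simp

lemma tagged_iff:
  assumes "dom s = under \<kappa> \<nu>" "\<nu> \<in> Field \<kappa>"
  shows "tagged s a \<longleftrightarrow> a = og (the (s \<nu>))"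
proof -
  have "\<nu>' = \<nu>" if "\<nu>' \<in> Field \<kappa>" "under \<kappa> \<nu> = under \<kappa> \<nu>'" for \<nu>'
  proof -
    have "\<nu> \<in> under \<kappa> \<nu>'" "\<nu>' \<in> under \<kappa> \<nu>"
      using that k.refl[OF assms(2)] k.refl[OF that(1)] by (auto simp: under_def)
    then show ?thesis using k.antisym by (simp add: under_def)
  qed
  then show ?thesis unfolding tagged_def assms(1) using assms(2) by blast
qed

text \<open>The sequence \<open>c\<close> of length \<open>mu\<close> closes off under preimages: if
  \<open>\<eta> x\<close> is below \<open>c j\<close>, then \<open>x\<close> is below
  \<open>c i\<close> for all later \<open>i\<close>. Its supremum \<delta> is in \<open>stat\<close>
  by regularity of \<open>mu\<close>. If \<open>\<eta> \<delta>\<close> were below \<delta>, it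
  would be below some \<open>c i\<close>, and so \<delta> would be below \<delta>.\<close>

lemma ex_stat:
  assumes \<eta>: "inj_on \<eta> (Field lam)"
  shows "\<exists>\<delta>\<in>stat. \<not> lt lam (\<eta> \<delta>) \<delta>"
proof -
  define Q where "Q c i \<gamma> \<longleftrightarrow> \<gamma> \<in> Field lam \<and> (\<forall>j. lt mu j i \<longrightarrow> lt lam (c j) \<gamma> \<and>
    (\<forall>x\<in>Field lam. lt lam (\<eta> x) (c j) \<longrightarrow> lt lam x \<gamma>))" for c i \<gamma>
  define c where "c = wfrec {(j, i). lt mu j i} (\<lambda>c i. SOME \<gamma>. Q c i \<gamma>)"
  have "Q (Wfrec.cut c {(j, i). lt mu j i} i) i = Q c i" for c i
    by (rule ext) (simp add: Q_def cut_apply)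
  then have c_eq: "c i = (SOME \<gamma>. Q c i \<gamma>)" for i
    unfolding c_def by (subst wfrec[OF mu.wf_lt]) simp
  have c: "Q c i (c i)" if "i \<in> Field mu" for i
    using that
  proof (induct i rule: mu.induct)
    case (less i)
    have pre: "|{x \<in> Field lam. lt lam (\<eta> x) b}| \<le>o mu" for b
    proof -
      have "inj_on \<eta> {x \<in> Field lam. lt lam (\<eta> x) b}" using \<eta> by (auto simp: inj_on_def)
      moreover have "\<eta> ` {x \<in> Field lam. lt lam (\<eta> x) b} \<subseteq> underS lam b" by auto
      ultimately have "|{x \<in> Field lam. lt lam (\<eta> x) b}| \<le>o |underS lam b|"
        by (intro iffD1[OF card_of_ordLeq] exI conjI)
      then show ?thesis using card_underS ordLeq_transitive by blast
    qed
    have iF: "underS mu i \<subseteq> Field mu" by (rule subsetI) (rule lt_Field1)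
    have i_le: "|underS mu i| \<le>o mu"
      using subset_le[OF ordIso_imp_ordLeq[OF card_Field_mu] iF] .
    let ?X = "c ` underS mu i \<union> (\<Union>j\<in>underS mu i. {x \<in> Field lam. lt lam (\<eta> x) (c j)})"
    have "|?X| \<le>o mu" by (intro Un_le image_le UN_le i_le pre)
    moreover have "?X \<subseteq> Field lam" using less(2) by (auto simp: Q_def)
    ultimately have "\<exists>\<gamma>\<in>Field lam. \<forall>x\<in>?X. lt lam x \<gamma>" by (intro bounded)
    then obtain \<gamma> where "\<gamma> \<in> Field lam" "\<forall>x\<in>?X. lt lam x \<gamma>" by (rule bexE)
    then have "Q c i \<gamma>" unfolding Q_def by blast
    then show ?case unfolding c_eq[of i] by (rule someI)
  qed
  have cF: "c ` Field mu \<subseteq> Field lam" using c by (auto simp: Q_def)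
  obtain B where B: "B \<in> Field lam" "\<And>x. x \<in> c ` Field mu \<Longrightarrow> (x, B) \<in> lam"
    using ex_upper[OF cF image_le[OF ordIso_imp_ordLeq[OF card_Field_mu]]] by auto
  define \<delta> where "\<delta> = lub (c ` Field mu)"
  have below: "lt lam (c i) \<delta>" if i: "i \<in> Field mu" for i
  proof -
    obtain j where j: "lt mu i j" using mu_no_max[OF i] by blast
    have jF: "j \<in> Field mu" using lt_Field2[OF j] .
    have "lt lam (c i) (c j)" using c[OF jF] j by (auto simp: Q_def)
    moreover have "(c j, \<delta>) \<in> lam" unfolding \<delta>_def by (rule lub_upper[OF cF B(1)]) (use B(2) jF in simp_all)
    ultimately show ?thesis by (rule lam.ltle)
  qed
  have reach: "\<exists>i\<in>Field mu. lt lam x (c i)" if "lt lam x \<delta>" for x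
    using lt_lub[OF cF B(1), of x] B(2) that unfolding \<delta>_def by blast
  have \<delta>F: "\<delta> \<in> Field lam" unfolding \<delta>_def by (rule lub_Field[OF cF B])
  have "\<delta> \<in> stat" unfolding stat_def
  proof (intro CollectI conjI allI impI)
    fix C assume C: "C \<subseteq> underS lam \<delta> \<and> |C| <o mu"
    then have "\<forall>x\<in>C. \<exists>i. i \<in> Field mu \<and> lt lam x (c i)" using reach by blast
    from bchoice[OF this] obtain i where i: "\<And>x. x \<in> C \<Longrightarrow> i x \<in> Field mu" "\<And>x. x \<in> C \<Longrightarrow> lt lam x (c (i x))" by auto
    have "|i ` C| <o mu" using card_of_image ordLeq_ordLess_trans C by blast
    moreover have "i ` C \<subseteq> Field mu" using i(1) by auto
    ultimately obtain m where m: "m \<in> Field mu" "\<forall>j\<in>i ` C. (j, m) \<in> mu"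
      using mu.regular_bounded[OF mu_reg] by blast
    obtain m' where m': "lt mu m m'" using mu_no_max[OF m(1)] by blast
    have m'F: "m' \<in> Field mu" using lt_Field2[OF m'] .
    have "lt lam x (c m')" if x: "x \<in> C" for x
    proof -
      have "(i x, m) \<in> mu" using m(2) x by simp
      then have "lt mu (i x) m'" by (rule mu.lelt[OF _ m'])
      then have "lt lam (c (i x)) (c m')" using c[OF m'F] by (simp add: Q_def)
      then show ?thesis by (rule lam.ltt[OF i(2)[OF x]])
    qed
    then show "\<exists>\<beta>\<in>underS lam \<delta>. \<forall>c\<in>C. lt lam c \<beta>" using below[OF m'F] by blast
  qed (rule \<delta>F)
  moreover have "\<not> lt lam (\<eta> \<delta>) \<delta>"
  proof
    assume "lt lam (\<eta> \<delta>) \<delta>"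
    then obtain i where i: "i \<in> Field mu" "lt lam (\<eta> \<delta>) (c i)" using reach by blast
    obtain j where j: "lt mu i j" using mu_no_max[OF i(1)] by blast
    have jF: "j \<in> Field mu" using lt_Field2[OF j] .
    have "lt lam \<delta> (c j)" using c[OF jF] j i(2) \<delta>F unfolding Q_def by blast
    then show False using below[OF jF] lam.ltt lt_irrefl by metis
  qed
  ultimately show ?thesis by blast
qed

end

context seq_tree begin

lemma above_tag:
  assumes "lt (T Z) (s, i # l) y"
  shows "\<exists>j l'. y = (s, j # l') \<and> lt lam j i"
proof -
  obtain s' l' where y: "y = (s', l')" by (cases y)
  obtain w where w: "w \<noteq> []" "l' = w @ i # l" "s' = s" "(s, l') \<in> nodes Z"
    using assms unfolding y lt_T by auto
  obtain j w' where j: "w = j # w'" using w(1) by (cases w) auto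
  have "(s, j # (w' @ i # l)) \<in> nodes Z" using w j by simp
  then obtain a where "desc a (j # w' @ i # l)" unfolding nodes_tag by auto
  then have "lt lam j i" by (rule desc_hd)
  then show ?thesis using y w j by auto
qed

lemma tag_Field: "(s, i # l) \<in> nodes Z \<Longrightarrow> i \<in> Field lam"
  unfolding nodes_tag using desc_below lt_Field1[of i lam] by blast

end

locale tree_iso = tall mu lam \<kappa>
  for mu :: "'m rel" and lam :: "'l rel" and \<kappa> :: "'k rel" +
  fixes Z Z' :: "('k \<rightharpoonup> 'l) set" and f :: "('k \<rightharpoonup> 'l) \<times> 'l list \<Rightarrow> ('k \<rightharpoonup> 'l) \<times> 'l list"
  assumes Z: "Z \<subseteq> full" and Z': "Z' \<subseteq> full"
    and f_bij: "bij_betw f (nodes Z) (nodes Z')"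
    and f_lt: "x \<in> nodes Z \<Longrightarrow> y \<in> nodes Z \<Longrightarrow> lt (T Z') (f x) (f y) \<longleftrightarrow> lt (T Z) x y"
begin

sublocale a: seq_tree mu lam \<kappa> Z by unfold_locales (rule Z)
sublocale b: seq_tree mu lam \<kappa> Z' by unfold_locales (rule Z')

abbreviation g where "g \<equiv> inv_into (nodes Z) f"

lemma f_nodes: "x \<in> nodes Z \<Longrightarrow> f x \<in> nodes Z'"
  and g_nodes: "y \<in> nodes Z' \<Longrightarrow> g y \<in> nodes Z"
  and fg: "y \<in> nodes Z' \<Longrightarrow> f (g y) = y" and gf: "x \<in> nodes Z \<Longrightarrow> g (f x) = x"
proof -
  have "f ` nodes Z = nodes Z'" "inj_on f (nodes Z)" using f_bij by (simp_all add: bij_betw_def)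
  then show "x \<in> nodes Z \<Longrightarrow> f x \<in> nodes Z'" "y \<in> nodes Z' \<Longrightarrow> g y \<in> nodes Z"
    "y \<in> nodes Z' \<Longrightarrow> f (g y) = y" "x \<in> nodes Z \<Longrightarrow> g (f x) = x"
    using inv_into_into[of y f "nodes Z"] f_inv_into_f[of y f "nodes Z"] inv_into_f_f[of f "nodes Z" x] by auto
qed

text \<open>It lets each one-sided estimate about \<open>f\<close> be applied to the inverse as
  well, which yields equalities.\<close>

lemma inverse: "tree_iso mu lam \<kappa> Z' Z g"
proof
  show "bij_betw g (nodes Z') (nodes Z)" by (rule bij_betw_inv_into[OF f_bij])
  show "lt (T Z) (g x) (g y) \<longleftrightarrow> lt (T Z') x y" if "x \<in> nodes Z'" "y \<in> nodes Z'" for x y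
    using f_lt[OF g_nodes[OF that(1)] g_nodes[OF that(2)]] fg that by simp
qed (rule Z Z')+

text \<open>Infinite descent: a short sequence has a proper extension that is again short. If the
  former went to a tag, the latter would go to a higher tag, whose latest entry is smaller.\<close>

lemma main_not_tag:
  assumes "s \<in> short"
  shows "f (s, []) \<noteq> (s', i # l)"
proof
  assume *: "f (s, []) = (s', i # l)"
  let ?H = "{i. \<exists>s\<in>short. \<exists>s' l. f (s, []) = (s', i # l)}"
  have n: "(s, []) \<in> nodes Z" if "s \<in> short" for s using that a.nodes_Nil by simp
  have "?H \<subseteq> Field lam"
  proof clarify
    fix i s s' l assume "s \<in> short" "f (s, []) = (s', i # l)"
    then show "i \<in> Field lam" using f_nodes[OF n[of s]] b.tag_Field by simp
  qed
  moreover have "?H \<noteq> {}" using * assms by auto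
  ultimately have "\<exists>m\<in>?H. \<forall>i\<in>?H. (m, i) \<in> lam" by (rule lam.ex_least)
  then obtain m where m: "m \<in> ?H" "\<forall>i\<in>?H. (m, i) \<in> lam" by (rule bexE)
  then obtain s s' l where s: "s \<in> short" "f (s, []) = (s', m # l)" by auto
  obtain u where u: "u \<in> short" "s \<subseteq>\<^sub>m u" "s \<noteq> u" using ex_extend[OF s(1)] by auto
  have "lt (T Z) (s, []) (u, [])" unfolding a.lt_T using n[OF s(1)] n[OF u(1)] u(2,3) by simp
  then have "lt (T Z') (s', m # l) (f (u, []))" using f_lt[OF n[OF s(1)] n[OF u(1)]] s(2) by simp
  then obtain j l' where j: "f (u, []) = (s', j # l')" "lt lam j m" using b.above_tag by blast
  then have "j \<in> ?H" using u(1) by blast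
  then show False using m(2) lam.asym[OF j(2)] by blast
qed

definition F :: "('k \<rightharpoonup> 'l) \<Rightarrow> ('k \<rightharpoonup> 'l)" where "F s = fst (f (s, []))"

text \<open>The image of \<open>s\<close> is short because it lies properly below the image of a
  longer sequence.\<close>

lemma F:
  assumes "s \<in> short"
  shows "f (s, []) = (F s, [])" "F s \<in> short"
proof -
  have f: "f (s, []) = (F s, [])" if "s \<in> short" for s
  proof -
    obtain s' l where *: "f (s, []) = (s', l)" by (cases "f (s, [])")
    then have "l = []" using main_not_tag[OF that] by (cases l) auto
    then show ?thesis using * by (simp add: F_def)
  qed
  have n: "(s, []) \<in> nodes Z" if "s \<in> short" for s using that a.nodes_Nil by simp
  obtain u where u: "u \<in> short" "s \<subseteq>\<^sub>m u" "s \<noteq> u" using ex_extend[OF assms] by auto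
  have "lt (T Z) (s, []) (u, [])" unfolding a.lt_T using n[OF assms] n[OF u(1)] u(2,3) by simp
  then have "lt (T Z') (F s, []) (F u, [])" using f_lt[OF n[OF assms] n[OF u(1)]] f assms u(1) by simp
  then have *: "F s \<subseteq>\<^sub>m F u" "F s \<noteq> F u" "(F s, []) \<in> nodes Z'" "(F u, []) \<in> nodes Z'"
    by (simp_all add: b.lt_T)
  obtain \<nu> where \<nu>: "\<nu> \<in> dom (F u)" "F s = cut (F u) \<nu>"
    using seg[OF b.nodes_seqs[OF *(3)] b.nodes_seqs[OF *(4)] *(1,2)] by auto
  show "F s \<in> short" unfolding \<nu>(2) by (rule cut_short(1)[OF b.nodes_seqs[OF *(4)] \<nu>(1)])
  show "f (s, []) = (F s, [])" using f[OF assms] .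
qed

lemma F_less:
  assumes "s \<in> short" "u \<in> short"
  shows "F s \<subseteq>\<^sub>m F u \<and> F s \<noteq> F u \<longleftrightarrow> s \<subseteq>\<^sub>m u \<and> s \<noteq> u"
proof -
  have n: "(s, []) \<in> nodes Z" "(u, []) \<in> nodes Z" "(F s, []) \<in> nodes Z'" "(F u, []) \<in> nodes Z'"
    using assms F(2) a.nodes_Nil b.nodes_Nil by auto
  show ?thesis using f_lt[OF n(1,2)] n unfolding F(1)[OF assms(1)] F(1)[OF assms(2)] a.lt_T b.lt_T by simp
qed

lemma F_le:
  assumes "s \<in> short" "u \<in> short"
  shows "F s = F u \<longleftrightarrow> s = u" "F s \<subseteq>\<^sub>m F u \<longleftrightarrow> s \<subseteq>\<^sub>m u"
proof -
  have n: "(s, []) \<in> nodes Z" "(u, []) \<in> nodes Z" using assms a.nodes_Nil by auto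
  show 1: "F s = F u \<longleftrightarrow> s = u"
  proof
    assume "F s = F u"
    then have "f (s, []) = f (u, [])" by (simp only: F(1)[OF assms(1)] F(1)[OF assms(2)])
    from inj_onD[OF bij_betw_imp_inj_on[OF f_bij] this n] show "s = u" by (rule Pair_inject)
  qed simp
  show "F s \<subseteq>\<^sub>m F u \<longleftrightarrow> s \<subseteq>\<^sub>m u" using F_less[OF assms] 1 by (cases "s = u") simp_all
qed

lemma dom_F_le:
  assumes "s \<in> short"
  shows "dom s \<subseteq> dom (F s)"
proof -
  obtain \<alpha> where "\<alpha> \<in> Field \<kappa>" "dom s = underS \<kappa> \<alpha>" using short_dom[OF assms] by auto
  then show ?thesis using assms
  proof (induct \<alpha> arbitrary: s rule: k.induct)
    case (less \<alpha>)
    show ?case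
    proof
      fix \<nu> assume \<nu>: "\<nu> \<in> dom s"
      have s: "s \<in> seqs" using less(4) by simp
      note c = cut_short[OF s \<nu>]
      have d: "underS \<kappa> \<nu> \<subseteq> dom (F (cut s \<nu>))"
        using less(2)[of \<nu> "cut s \<nu>"] \<nu> less(3) c by simp
      have "cut s \<nu> \<in> seqs \<and> cut s \<nu> \<subseteq>\<^sub>m s \<and> cut s \<nu> \<noteq> s" unfolding seg_iff[OF s] using \<nu> by blast
      then have "F (cut s \<nu>) \<subseteq>\<^sub>m F s" "F (cut s \<nu>) \<noteq> F s" using F_less[OF c(1) less(4)] by auto
      moreover have Fs: "F s \<in> seqs" "F (cut s \<nu>) \<in> seqs" using F(2)[OF c(1)] F(2)[OF less(4)] by simp_all
      ultimately obtain \<nu>' where \<nu>': "\<nu>' \<in> dom (F s)" "dom (F (cut s \<nu>)) = underS \<kappa> \<nu>'"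
        using seg by blast
      have "\<not> lt \<kappa> \<nu>' \<nu>" using d \<nu>'(2) by auto
      then have "(\<nu>, \<nu>') \<in> \<kappa>"
        using k.not_lt[OF subsetD[OF dom_Field[OF Fs(1)] \<nu>'(1)] subsetD[OF dom_Field[OF s] \<nu>]] by simp
      then show "\<nu> \<in> dom (F s)" using dom_down[OF Fs(1) \<nu>'(1)] by (auto simp: under_def)
    qed
  qed
qed

end

lemma (in tree_iso) g_F:
  assumes "s \<in> short"
  shows "tree_iso.F g (F s) = s"
proof -
  interpret i: tree_iso mu lam \<kappa> Z' Z g by (rule inverse)
  have "(s, []) \<in> nodes Z" using a.nodes_Nil assms by simp
  from gf[OF this] show ?thesis unfolding i.F_def F(1)[OF assms] by simp
qed

context tree_iso begin

lemma g_main: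
  assumes "s' \<in> short"
  shows "\<exists>s\<in>short. g (s', []) = (s, []) \<and> F s = s'"
proof -
  interpret i: tree_iso mu lam \<kappa> Z' Z g by (rule inverse)
  note g = i.F[OF assms]
  have "(s', []) \<in> nodes Z'" using b.nodes_Nil assms by simp
  from fg[OF this] show ?thesis unfolding g(1) using g F(1)[OF g(2)] by auto
qed

lemma dom_F:
  assumes "s \<in> short"
  shows "dom (F s) = dom s"
proof -
  interpret i: tree_iso mu lam \<kappa> Z' Z g by (rule inverse)
  show ?thesis using dom_F_le[OF assms] i.dom_F_le[OF F(2)[OF assms]] unfolding g_F[OF assms] by auto
qed

text \<open>The image cannot be a short sequence, as those are images of short ones. If it were a
  tag attached to \<open>t'\<close>, then \<open>t'\<close> would be the image of some initial
  segment of \<open>t\<close>; but the images of all longer initial segments lie below that tag as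
  well, hence within \<open>t'\<close>.\<close>

lemma top:
  assumes "t \<in> Z"
  shows "\<exists>t'\<in>Z'. f (t, []) = (t', []) \<and> (\<forall>\<nu>\<in>Field \<kappa>. cut t' \<nu> = F (cut t \<nu>))"
proof -
  have t: "t \<in> full" "t \<in> seqs" "(t, []) \<in> nodes Z" using assms Z a.nodes_Nil by auto
  have domt: "dom t = Field \<kappa>" using t(1) by (simp add: full_def)
  obtain t' l where *: "f (t, []) = (t', l)" by (cases "f (t, [])")
  have n': "(t', l) \<in> nodes Z'" using f_nodes[OF t(3)] * by simp
  have c: "cut t \<nu> \<in> short" "(cut t \<nu>, []) \<in> nodes Z" "lt (T Z) (cut t \<nu>, []) (t, [])"
    "lt (T Z') (F (cut t \<nu>), []) (t', l)" if \<nu>: "\<nu> \<in> Field \<kappa>" for \<nu>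
  proof -
    show 1: "cut t \<nu> \<in> short" using cut_short(1)[OF t(2)] \<nu> domt by simp
    then show 2: "(cut t \<nu>, []) \<in> nodes Z" using a.nodes_Nil by simp
    have "cut t \<nu> \<in> seqs \<and> cut t \<nu> \<subseteq>\<^sub>m t \<and> cut t \<nu> \<noteq> t" unfolding seg_iff[OF t(2)] using \<nu> domt by blast
    then show 3: "lt (T Z) (cut t \<nu>, []) (t, [])" unfolding a.lt_T using 2 t(3) by simp
    show "lt (T Z') (F (cut t \<nu>), []) (t', l)" using f_lt[OF 2 t(3)] 3 F(1)[OF 1] * by simp
  qed
  have "l = []"
  proof (cases l)
    case (Cons i l')
    then have sh: "t' \<in> short" using n' b.nodes_tag by auto
    then have m: "(t', []) \<in> nodes Z'" using b.nodes_Nil by simp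
    obtain u where u: "u \<in> short" "g (t', []) = (u, [])" "F u = t'" using g_main[OF sh] by auto
    have un: "(u, []) \<in> nodes Z" using u(1) a.nodes_Nil by simp
    have "lt (T Z') (F u, []) (t', l)" unfolding b.lt_T using u(3) m n' Cons by simp
    then have "lt (T Z) (u, []) (t, [])" using f_lt[OF un t(3)] F(1)[OF u(1)] * by simp
    then have "u \<in> seqs \<and> u \<subseteq>\<^sub>m t \<and> u \<noteq> t" unfolding a.lt_T using u(1) by simp
    then obtain \<nu> where \<nu>: "\<nu> \<in> Field \<kappa>" "u = cut t \<nu>" unfolding seg_iff[OF t(2)] domt by auto
    obtain \<nu>' where \<nu>': "lt \<kappa> \<nu> \<nu>'" using k_no_max[OF \<nu>(1)] by auto
    have \<nu>'F: "\<nu>' \<in> Field \<kappa>" using lt_Field2[OF \<nu>'] .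
    have "\<nu> \<in> dom (cut t \<nu>')" unfolding dom_cut using \<nu>(1) \<nu>' domt by simp
    moreover have "u = cut (cut t \<nu>') \<nu>" using cut_cut[OF \<nu>'] \<nu>(2) by simp
    moreover have "cut t \<nu>' \<in> seqs" using c(1)[OF \<nu>'F] by simp
    ultimately have "u \<subseteq>\<^sub>m cut t \<nu>' \<and> u \<noteq> cut t \<nu>'" using seg_iff[of "cut t \<nu>'" u] by blast
    then have "t' \<subseteq>\<^sub>m F (cut t \<nu>') \<and> t' \<noteq> F (cut t \<nu>')" using F_less[OF u(1) c(1)[OF \<nu>'F]] u(3) by simp
    moreover have "F (cut t \<nu>') \<subseteq>\<^sub>m t'" using c(4)[OF \<nu>'F] unfolding b.lt_T by auto
    ultimately show ?thesis using map_le_antisym by blast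
  qed
  moreover have "t' \<notin> short"
  proof
    assume sh: "t' \<in> short"
    obtain u where u: "u \<in> short" "g (t', []) = (u, [])" using g_main[OF sh] by auto
    have "g (t', []) = (t, [])" using gf[OF t(3)] * \<open>l = []\<close> by simp
    then show False using u t(1) short_full by auto
  qed
  moreover have "cut t' \<nu> = F (cut t \<nu>)" if \<nu>: "\<nu> \<in> Field \<kappa>" for \<nu>
  proof -
    have sq: "t' \<in> seqs" using b.nodes_seqs[OF n'] .
    have "F (cut t \<nu>) \<subseteq>\<^sub>m t'" "F (cut t \<nu>) \<noteq> t'" "F (cut t \<nu>) \<in> seqs"
      using c(4)[OF \<nu>] \<open>l = []\<close> b.nodes_seqs unfolding b.lt_T by auto
    then obtain \<nu>' where \<nu>': "\<nu>' \<in> dom t'" "F (cut t \<nu>) = cut t' \<nu>'" "dom (F (cut t \<nu>)) = underS \<kappa> \<nu>'"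
      using seg[OF _ sq] by blast
    have "underS \<kappa> \<nu> = underS \<kappa> \<nu>'"
      using dom_F[OF c(1)[OF \<nu>]] cut_short(2)[OF t(2), of \<nu>] \<nu>'(3) \<nu> domt by simp
    then have "\<nu> = \<nu>'" using k.underS_eq[OF \<nu> subsetD[OF dom_Field[OF sq] \<nu>'(1)]] by simp
    then show ?thesis using \<nu>'(2) by simp
  qed
  ultimately show ?thesis using n' * b.nodes_Nil by auto
qed

text \<open>The tag can be prolonged by every \<open>j\<close> below \<open>i\<close>. By induction
  the latest entry of the image of that prolongation is at least \<open>j\<close>, and it is below
  \<open>i'\<close>; thus everything below \<open>i\<close> is below \<open>i'\<close>.\<close>

lemma tag_le:
  assumes "(s, i # l) \<in> nodes Z" "f (s, i # l) = (s', i' # l')"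
  shows "(i, i') \<in> lam"
  using a.tag_Field[OF assms(1)] assms
proof (induct i arbitrary: l i' l' rule: lam.induct)
  case (less i)
  have i'F: "i' \<in> Field lam" using f_nodes[OF less(3)] less(4) b.tag_Field by simp
  have "lt lam j i'" if j: "lt lam j i" for j
  proof -
    have n: "(s, j # i # l) \<in> nodes Z" using less(3) j unfolding a.nodes_tag by auto
    have "lt (T Z) (s, i # l) (s, j # i # l)" unfolding a.lt_T using less(3) n by simp
    then have "lt (T Z') (s', i' # l') (f (s, j # i # l))" using f_lt[OF less(3) n] less(4) by simp
    then obtain j' l'' where j': "f (s, j # i # l) = (s', j' # l'')" "lt lam j' i'" using b.above_tag by blast
    show ?thesis using less(2)[OF j n j'(1)] lam.lelt[OF _ j'(2)] by simp
  qed
  \<comment> \<open>If \<open>i'\<close> were below \<open>i\<close>, it would be below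
    itself.\<close>
  from this[of i'] have "\<not> lt lam i' i" using lt_irrefl[of i' lam] by argo
  then show ?case using lam.not_lt[OF i'F less(1)] by simp
qed

text \<open>The image is a tag by what is known about the inverse. It is attached to the image of
  some \<open>u\<close>; comparing the nodes below the tag in both trees gives that \<open>u\<close>
  and \<open>s\<close> extend each other.\<close>

lemma tag_image:
  assumes "(s, [i]) \<in> nodes Z"
  shows "\<exists>i' l'. f (s, [i]) = (F s, i' # l')"
proof -
  interpret i: tree_iso mu lam \<kappa> Z' Z g by (rule inverse)
  have s: "s \<in> short" using assms a.nodes_tag by auto
  have n: "(s, []) \<in> nodes Z" using s a.nodes_Nil by simp
  obtain s' l where *: "f (s, [i]) = (s', l)" by (cases "f (s, [i])")
  have n': "(s', l) \<in> nodes Z'" using f_nodes[OF assms] * by simp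
  have g: "g (s', l) = (s, [i])" using gf[OF assms] * by simp
  have "l \<noteq> []"
  proof
    assume l: "l = []"
    then consider "s' \<in> short" | "s' \<in> Z'" using n' b.nodes_Nil by auto
    then show False
    proof cases
      case 1
      then show False using g_main[OF 1] g l by auto
    next
      case 2
      then show False using i.top[OF 2] g l by auto
    qed
  qed
  then obtain i' l' where l: "l = i' # l'" by (cases l) auto
  then have s': "s' \<in> short" using n' b.nodes_tag by auto
  then have m: "(s', []) \<in> nodes Z'" using b.nodes_Nil by simp
  obtain u where u: "u \<in> short" "F u = s'" using g_main[OF s'] by auto
  have un: "(u, []) \<in> nodes Z" using u(1) a.nodes_Nil by simp
  have "lt (T Z') (F u, []) (s', l)" unfolding b.lt_T using u(2) m n' l by simp
  then have "lt (T Z) (u, []) (s, [i])" using f_lt[OF un assms] F(1)[OF u(1)] * by simp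
  then have "u \<subseteq>\<^sub>m s" unfolding a.lt_T by auto
  moreover have "lt (T Z) (s, []) (s, [i])" unfolding a.lt_T using n assms by simp
  then have "lt (T Z') (F s, []) (s', l)" using f_lt[OF n assms] F(1)[OF s] * by simp
  then have "F s \<subseteq>\<^sub>m F u" unfolding b.lt_T u(2) by auto
  then have "s \<subseteq>\<^sub>m u" using F_le(2)[OF s u(1)] by simp
  ultimately have "u = s" by (rule map_le_antisym)
  then show ?thesis using * l u(2) by simp
qed

text \<open>Every \<open>i\<close> below the first coordinate at \<open>s\<close> occurs as a tag
  \<open>[i]\<close>. Its image is a tag over \<open>F s\<close> with latest entry at least
  \<open>i\<close>, and hence shows that \<open>i\<close> is below the first coordinate at
  \<open>F s\<close>.\<close>

lemma og_F_le:
  assumes s: "s \<in> short" "dom s = under \<kappa> \<nu>" "\<nu> \<in> Field \<kappa>"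
  shows "(og (the (s \<nu>)), og (the (F s \<nu>))) \<in> lam"
proof -
  have ogF: "og (the (u \<nu>)) \<in> Field lam" if "u \<in> short" "dom u = under \<kappa> \<nu>" for u
  proof -
    have "\<nu> \<in> dom u" using that(2) k.refl[OF s(3)] by (simp add: under_def)
    then obtain v where "u \<nu> = Some v" by auto
    then show ?thesis using og_xi(1)[OF ran_seqs[of u \<nu>]] that(1) by simp
  qed
  have d: "dom (F s) = under \<kappa> \<nu>" using dom_F[OF s(1)] s(2) by simp
  have "lt lam i (og (the (F s \<nu>)))" if i: "lt lam i (og (the (s \<nu>)))" for i
  proof -
    have n: "(s, [i]) \<in> nodes Z" unfolding a.nodes_tag tagged_iff[OF s(2,3)] using s(1) i by simp
    obtain i' l' where i': "f (s, [i]) = (F s, i' # l')" using tag_image[OF n] by auto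
    have "(F s, i' # l') \<in> nodes Z'" using f_nodes[OF n] i' by simp
    then have "lt lam i' (og (the (F s \<nu>)))"
      unfolding b.nodes_tag tagged_iff[OF d s(3)] using desc_below by blast
    then show ?thesis by (rule lam.lelt[OF tag_le[OF n i']])
  qed
  from this[of "og (the (F s \<nu>))"] have "\<not> lt lam (og (the (F s \<nu>))) (og (the (s \<nu>)))"
    using lt_irrefl[of "og (the (F s \<nu>))" lam] by argo
  then show ?thesis using lam.not_lt[OF ogF[OF F(2)[OF s(1)] d] ogF[OF s(1,2)]] by simp
qed

lemma og_F:
  assumes s: "s \<in> short" "dom s = under \<kappa> \<nu>" "\<nu> \<in> Field \<kappa>"
  shows "og (the (F s \<nu>)) = og (the (s \<nu>))"
proof -
  interpret i: tree_iso mu lam \<kappa> Z' Z g by (rule inverse)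
  have d: "dom (F s) = under \<kappa> \<nu>" using dom_F[OF s(1)] s(2) by simp
  show ?thesis using og_F_le[OF s] i.og_F_le[OF F(2)[OF s(1)] d s(3)] lam.antisym
    unfolding g_F[OF s(1)] by blast
qed

end

context tall begin

text \<open>An origin \<beta> is built by recursion against the isomorphism: at each level the
  second coordinate is an element of \<open>stat\<close> that the induced injection does not move
  down, and the first one is the code required of an origin. First coordinates are preserved, so the
  image of \<beta> still has the origin \<beta>, and it would have to be good.\<close>

theorem not_isomorphic: "\<not> isomorphic (T Z0) (T Z1)"
proof
  assume "isomorphic (T Z0) (T Z1)"
  then obtain f where f: "bij_betw f (nodes Z0) (nodes Z1)"
    "\<forall>x\<in>nodes Z0. \<forall>y\<in>nodes Z0. lt (T Z0) x y \<longleftrightarrow> lt (T Z1) (f x) (f y)"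
    unfolding isomorphic_def Field_T by blast
  interpret tree_iso mu lam \<kappa> Z0 Z1 f
    by unfold_locales (use f Z_full in auto)
  \<comment> \<open>The action of the isomorphism on the second coordinates of those children of
    \<open>s\<close> whose first coordinate names \<open>s\<close>. It is injective because first
    coordinates are preserved.\<close>
  define \<eta> where "\<eta> \<nu> s \<xi> = xi (the (F (s(\<nu> \<mapsto> mk (code s) \<xi>)) \<nu>))" for \<nu> s \<xi>
  have inj: "inj_on (\<eta> \<nu> s) (Field lam)" if s: "s \<in> short" "dom s = underS \<kappa> \<nu>" "\<nu> \<in> Field \<kappa>" for \<nu> s
  proof (rule inj_onI)
    fix \<xi> \<xi>' assume \<xi>: "\<xi> \<in> Field lam" "\<xi>' \<in> Field lam" "\<eta> \<nu> s \<xi> = \<eta> \<nu> s \<xi>'"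
    have co: "code s \<in> Field lam" by (rule code(2)[OF s(1)])
    note m = mk[OF co \<xi>(1)] and m' = mk[OF co \<xi>(2)]
    let ?u = "s(\<nu> \<mapsto> mk (code s) \<xi>)" and ?u' = "s(\<nu> \<mapsto> mk (code s) \<xi>')"
    note e = extend[OF s m(1)] and e' = extend[OF s m'(1)]
    have Fs: "F s \<in> seqs" "F ?u \<in> seqs" "F ?u' \<in> seqs" using F(2) s(1) e(1) e'(1) by simp_all
    have sub: "F s \<subseteq>\<^sub>m F ?u" "F s \<subseteq>\<^sub>m F ?u'"
      using F_le(2)[OF s(1) e(1)] F_le(2)[OF s(1) e'(1)] e(4) e'(4) by auto
    have d: "dom (F ?u) = under \<kappa> \<nu>" "dom (F ?u') = under \<kappa> \<nu>" "dom (F s) = underS \<kappa> \<nu>"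
      using dom_F e(1,2) e'(1,2) s(1,2) by simp_all
    have \<nu>: "\<nu> \<in> under \<kappa> \<nu>" using k.refl[OF s(3)] by (simp add: under_def)
    obtain v where v: "F ?u \<nu> = Some v" using \<nu> unfolding d(1)[symmetric] by auto
    obtain v' where v': "F ?u' \<nu> = Some v'" using \<nu> unfolding d(2)[symmetric] by auto
    have "og v = og v'" using og_F[OF e(1,2) s(3)] og_F[OF e'(1,2) s(3)] v v' m(2) m'(2) by simp
    moreover have "xi v = xi v'" using \<xi>(3) v v' by (simp add: \<eta>_def)
    ultimately have vv: "v = v'" using og_xi_eqI[OF ran_seqs[OF Fs(2) v] ran_seqs[OF Fs(3) v']] by simp
    have "F ?u = F ?u'"
    proof
      fix \<nu>'
      consider "\<nu>' = \<nu>" | "\<nu>' \<in> dom (F s)" | "\<nu>' \<notin> under \<kappa> \<nu>"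
        unfolding d(3) under_eq[OF k.po s(3)] by auto
      then show "F ?u \<nu>' = F ?u' \<nu>'"
      proof cases
        case 2
        then have "F s \<nu>' = F ?u \<nu>'" "F s \<nu>' = F ?u' \<nu>'"
          using bspec[OF sub(1)[unfolded map_le_def]] bspec[OF sub(2)[unfolded map_le_def]] by blast+
        then show ?thesis by simp
      next
        case 3
        then have "\<nu>' \<notin> dom (F ?u)" "\<nu>' \<notin> dom (F ?u')" using d by simp_all
        then show ?thesis by (simp add: domIff)
      qed (use v v' vv in simp)
    qed
    then have "?u = ?u'" using F_le(1)[OF e(1) e'(1)] by simp
    then have "mk (code s) \<xi> = mk (code s) \<xi>'" by (metis fun_upd_same option.inject)
    then show "\<xi> = \<xi>'" using m(3) m'(3) by metis
  qed
  define dl where "dl \<nu> s = (SOME \<delta>. \<delta> \<in> stat \<and> \<not> lt lam (\<eta> \<nu> s \<delta>) \<delta>)" for \<nu> s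
  have dl: "dl \<nu> s \<in> stat" "\<not> lt lam (\<eta> \<nu> s (dl \<nu> s)) (dl \<nu> s)" "dl \<nu> s \<in> Field lam"
    if s: "s \<in> short" "dom s = underS \<kappa> \<nu>" "\<nu> \<in> Field \<kappa>" for \<nu> s
  proof -
    have "\<exists>\<delta>. \<delta> \<in> stat \<and> \<not> lt lam (\<eta> \<nu> s \<delta>) \<delta>" using ex_stat[OF inj[OF s]] by blast
    from someI_ex[OF this] show "dl \<nu> s \<in> stat" "\<not> lt lam (\<eta> \<nu> s (dl \<nu> s)) (dl \<nu> s)"
      unfolding dl_def by auto
    then show "dl \<nu> s \<in> Field lam" by (simp add: stat_def)
  qed
  define nxt where "nxt \<nu> s = mk (code s) (dl \<nu> s)" for \<nu> s
  define p where "p = wfrec {(a, b). lt \<kappa> a b} (\<lambda>p \<nu>. nxt \<nu> (\<lambda>\<nu>'. if lt \<kappa> \<nu>' \<nu> then Some (p \<nu>') else None))"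
  have p_eq: "p \<nu> = nxt \<nu> (\<lambda>\<nu>'. if lt \<kappa> \<nu>' \<nu> then Some (p \<nu>') else None)" for \<nu>
    unfolding p_def by (subst wfrec[OF k.wf_lt]) (simp add: cut_apply cong: if_cong)
  define \<beta> where "\<beta> \<nu> = (if \<nu> \<in> Field \<kappa> then Some (p \<nu>) else None)" for \<nu>
  have cut_\<beta>: "cut \<beta> \<nu> = (\<lambda>\<nu>'. if lt \<kappa> \<nu>' \<nu> then Some (p \<nu>') else None)" for \<nu>
    using lt_Field1[of _ \<kappa> \<nu>] by (auto simp: \<beta>_def restrict_map_def fun_eq_iff)
  have dom_\<beta>: "dom (cut \<beta> \<nu>) = underS \<kappa> \<nu>" for \<nu> unfolding cut_\<beta> by (auto split: if_splits)
  have pF: "p \<nu> \<in> Field lam \<and> cut \<beta> \<nu> \<in> short" if "\<nu> \<in> Field \<kappa>" for \<nu>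
    using that
  proof (induct \<nu> rule: k.induct)
    case (less \<nu>)
    have "ran (cut \<beta> \<nu>) \<subseteq> Field lam" unfolding cut_\<beta> using less(2) by (auto simp: ran_def split: if_splits)
    then have sh: "cut \<beta> \<nu> \<in> short" unfolding short_def using dom_\<beta> less(1) by auto
    have "p \<nu> \<in> Field lam" unfolding p_eq[of \<nu>] cut_\<beta>[symmetric] nxt_def
      by (rule mk(1)[OF code(2)[OF sh] dl(3)[OF sh dom_\<beta> less(1)]])
    then show ?case using sh by simp
  qed
  have val: "og (p \<nu>) = code (cut \<beta> \<nu>)" "xi (p \<nu>) = dl \<nu> (cut \<beta> \<nu>)" if \<nu>: "\<nu> \<in> Field \<kappa>" for \<nu>
  proof -
    have sh: "cut \<beta> \<nu> \<in> short" using pF[OF \<nu>] by simp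
    show "og (p \<nu>) = code (cut \<beta> \<nu>)" "xi (p \<nu>) = dl \<nu> (cut \<beta> \<nu>)"
      unfolding p_eq[of \<nu>] cut_\<beta>[symmetric] nxt_def
      using mk[OF code(2)[OF sh] dl(3)[OF sh dom_\<beta> \<nu>]] by simp_all
  qed
  have \<beta>: "\<beta> \<in> full" unfolding full_def using pF by (auto simp: \<beta>_def ran_def split: if_splits)
  have "orig \<beta> \<beta>" unfolding orig_def using \<beta> val(1) by (simp add: \<beta>_def)
  then have "\<beta> \<in> Z0" by (auto simp: Z0_def)
  then obtain b where b: "b \<in> Z1" "\<And>\<nu>. \<nu> \<in> Field \<kappa> \<Longrightarrow> cut b \<nu> = F (cut \<beta> \<nu>)" using top by blast
  then obtain \<beta>' where \<beta>': "orig b \<beta>'" "good b \<beta>'" by (auto simp: Z1_def)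
  have b_val: "og (the (b \<nu>)) = code (cut \<beta> \<nu>)" "xi (the (b \<nu>)) = \<eta> \<nu> (cut \<beta> \<nu>) (dl \<nu> (cut \<beta> \<nu>))"
    if \<nu>: "\<nu> \<in> Field \<kappa>" for \<nu>
  proof -
    have sh: "cut \<beta> \<nu> \<in> short" using pF[OF \<nu>] by simp
    note e = extend[OF sh dom_\<beta> \<nu> conjunct1[OF pF[OF \<nu>]]]
    obtain \<alpha> where \<alpha>: "\<alpha> \<in> Field \<kappa>" "lt \<kappa> \<nu> \<alpha>" "underS \<kappa> \<alpha> = under \<kappa> \<nu>" using ex_suc[OF \<nu>] by auto
    have "cut \<beta> \<alpha> = (cut \<beta> \<nu>)(\<nu> \<mapsto> p \<nu>)"
    proof
      fix \<nu>'
      show "cut \<beta> \<alpha> \<nu>' = ((cut \<beta> \<nu>)(\<nu> \<mapsto> p \<nu>)) \<nu>'"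
        unfolding fun_upd_apply cut_\<beta> unfolding \<alpha>(3) under_eq[OF k.po \<nu>] by simp
    qed
    then have "cut b \<alpha> = F ((cut \<beta> \<nu>)(\<nu> \<mapsto> p \<nu>))" using b(2)[OF \<alpha>(1)] by simp
    moreover have "cut b \<alpha> \<nu> = b \<nu>" using \<alpha>(2) by simp
    ultimately have bv: "b \<nu> = F ((cut \<beta> \<nu>)(\<nu> \<mapsto> p \<nu>)) \<nu>" by simp
    show "og (the (b \<nu>)) = code (cut \<beta> \<nu>)" using og_F[OF e(1,2) \<nu>] val(1)[OF \<nu>] by (simp add: bv)
    have "p \<nu> = mk (code (cut \<beta> \<nu>)) (dl \<nu> (cut \<beta> \<nu>))" unfolding p_eq[of \<nu>] cut_\<beta>[symmetric] nxt_def ..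
    then show "xi (the (b \<nu>)) = \<eta> \<nu> (cut \<beta> \<nu>) (dl \<nu> (cut \<beta> \<nu>))" by (simp add: \<eta>_def bv)
  qed
  \<comment> \<open>The origin is read off from the first coordinates of \<open>b\<close>, which are
    those of \<beta>.\<close>
  have "cut \<beta>' \<nu> = cut \<beta> \<nu>" if \<nu>: "\<nu> \<in> Field \<kappa>" for \<nu>
  proof -
    have f': "\<beta>' \<in> full" "code (cut \<beta>' \<nu>) = code (cut \<beta> \<nu>)" using \<beta>'(1) b_val(1)[OF \<nu>] \<nu> by (auto simp: orig_def)
    have "cut \<beta>' \<nu> \<in> short" using cut_short(1)[of \<beta>' \<nu>] f'(1) \<nu> by (auto simp: full_def)
    then show ?thesis using f'(2) pF[OF \<nu>] code(1) by (meson inj_onD)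
  qed
  then have same: "\<beta>' \<nu> = \<beta> \<nu>" if "\<nu> \<in> Field \<kappa>" for \<nu>
  proof -
    obtain \<nu>' where \<nu>': "lt \<kappa> \<nu> \<nu>'" using k_no_max[OF \<open>\<nu> \<in> Field \<kappa>\<close>] by auto
    have "cut \<beta>' \<nu>' \<nu> = cut \<beta> \<nu>' \<nu>" using \<open>\<And>\<nu>. \<nu> \<in> Field \<kappa> \<Longrightarrow> cut \<beta>' \<nu> = cut \<beta> \<nu>\<close>[OF lt_Field2[OF \<nu>']] by simp
    then show ?thesis using \<nu>' by simp
  qed
  obtain \<nu>0 where \<nu>0: "\<nu>0 \<in> Field \<kappa>" "\<And>\<nu>. lt \<kappa> \<nu>0 \<nu> \<Longrightarrow> xi (the (\<beta>' \<nu>)) \<in> stat \<Longrightarrow> lt lam (xi (the (b \<nu>))) (xi (the (\<beta>' \<nu>)))"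
    using \<beta>'(2) by (auto simp: good_def)
  obtain \<nu> where \<nu>: "lt \<kappa> \<nu>0 \<nu>" using k_no_max[OF \<nu>0(1)] by auto
  have \<nu>F: "\<nu> \<in> Field \<kappa>" using lt_Field2[OF \<nu>] .
  have sh: "cut \<beta> \<nu> \<in> short" using pF[OF \<nu>F] by simp
  have x: "xi (the (\<beta>' \<nu>)) = dl \<nu> (cut \<beta> \<nu>)" using same[OF \<nu>F] val(2)[OF \<nu>F] \<nu>F by (simp add: \<beta>_def)
  show False using \<nu>0(2)[OF \<nu>] dl(1,2)[OF sh dom_\<beta> \<nu>F] unfolding x b_val(2)[OF \<nu>F] by simp
qed

end

section \<open>Transfer along injections\<close>

lemma dir_image_iff:
  assumes "inj_on e (Field T)" "x \<in> Field T" "y \<in> Field T"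
  shows "(e x, e y) \<in> dir_image T e \<longleftrightarrow> (x, y) \<in> T"
proof
  assume "(e x, e y) \<in> dir_image T e"
  then obtain a b where ab: "(a, b) \<in> T" "e x = e a" "e y = e b" by (auto simp: dir_image_def)
  then have "x = a" "y = b"
    using inj_onD[OF assms(1)] FieldI1[OF ab(1)] FieldI2[OF ab(1)] assms(2,3) by blast+
  then show "(x, y) \<in> T" using ab(1) by simp
qed (auto simp: dir_image_def)

lemma lt_dir_image:
  assumes "inj_on e (Field T)" "x \<in> Field T" "y \<in> Field T"
  shows "lt (dir_image T e) (e x) (e y) \<longleftrightarrow> lt T x y"
  using dir_image_iff[OF assms] inj_on_eq_iff[OF assms] by (simp add: lt_iff)

lemma underS_dir_image:
  assumes "inj_on e (Field T)" "x \<in> Field T"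
  shows "underS (dir_image T e) (e x) = e ` underS T x"
proof (intro equalityI subsetI)
  fix y assume y: "lt (dir_image T e) y (e x)"
  then have "y \<in> e ` Field T" using lt_Field1[OF y] by (simp add: dir_image_Field)
  then obtain z where "z \<in> Field T" "y = e z" by auto
  then show "y \<in> e ` underS T x" using y lt_dir_image[OF assms(1) _ assms(2)] by simp
next
  fix y assume "y \<in> e ` underS T x"
  then obtain z where z: "lt T z x" "y = e z" by auto
  then show "lt (dir_image T e) y (e x)" using lt_dir_image[OF assms(1) lt_Field1[OF z(1)] assms(2)] by simp
qed

lemma isomorphic_dir_image:
  assumes "inj_on e (Field A)" "inj_on e' (Field B)" "isomorphic (dir_image A e) (dir_image B e')"
  shows "isomorphic A B"
proof -
  obtain f where f: "bij_betw f (e ` Field A) (e' ` Field B)"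
    "\<forall>x\<in>e ` Field A. \<forall>y\<in>e ` Field A. lt (dir_image A e) x y \<longleftrightarrow> lt (dir_image B e') (f x) (f y)"
    using assms(3) unfolding isomorphic_def dir_image_Field by auto
  let ?g = "\<lambda>x. inv_into (Field B) e' (f (e x))"
  have e: "bij_betw e (Field A) (e ` Field A)" "bij_betw e' (Field B) (e' ` Field B)"
    using assms(1,2) by (simp_all add: bij_betw_def)
  have "bij_betw (inv_into (Field B) e' \<circ> (f \<circ> e)) (Field A) (Field B)"
    using bij_betw_trans[OF bij_betw_trans[OF e(1) f(1)] bij_betw_inv_into[OF e(2)]] .
  then have b: "bij_betw ?g (Field A) (Field B)" by (simp add: comp_def)
  have "lt A x y \<longleftrightarrow> lt B (?g x) (?g y)" if xy: "x \<in> Field A" "y \<in> Field A" for x y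
  proof -
    have fx: "e' (?g x) = f (e x)" if "x \<in> Field A" for x
      using bij_betwE[OF f(1)] that by (intro f_inv_into_f) simp
    have gB: "?g x \<in> Field B" "?g y \<in> Field B" using bij_betwE[OF b] xy by auto
    have "lt A x y \<longleftrightarrow> lt (dir_image A e) (e x) (e y)" using lt_dir_image[OF assms(1) xy] by simp
    also have "\<dots> \<longleftrightarrow> lt (dir_image B e') (f (e x)) (f (e y))" using f(2) xy by simp
    also have "\<dots> \<longleftrightarrow> lt B (?g x) (?g y)"
      using lt_dir_image[OF assms(2) gB] unfolding fx[OF xy(1)] fx[OF xy(2)] .
    finally show ?thesis .
  qed
  then show ?thesis unfolding isomorphic_def using b by (intro exI[of _ ?g]) simp
qed

lemma lambda_kappa_tree_dir_image:
  assumes e: "inj_on e (Field T)" and T: "lambda_kappa_tree lam \<kappa> T"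
  shows "lambda_kappa_tree lam \<kappa> (dir_image T e)"
proof -
  let ?T = "dir_image T e"
  have po: "Partial_order T" and wo: "\<And>x. x \<in> Field T \<Longrightarrow> Well_order (Restr T (underS T x))"
    using T by (auto simp: lambda_kappa_tree_def is_tree_def)
  have F: "Field ?T = e ` Field T" by (rule dir_image_Field)
  note uS = underS_dir_image[OF e]
  have uF: "underS T x \<subseteq> Field T" for x by (rule subsetI) (rule lt_Field1)
  have R: "Restr ?T (e ` S) = dir_image (Restr T S) e" if "S \<subseteq> Field T" for S
  proof (intro equalityI subrelI)
    fix a b assume ab: "(a, b) \<in> Restr ?T (e ` S)"
    then obtain x y where xy: "x \<in> S" "y \<in> S" "a = e x" "b = e y" by auto
    then have "(x, y) \<in> T" using dir_image_iff[OF e, of x y] ab that by auto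
    then show "(a, b) \<in> dir_image (Restr T S) e" using xy by (auto simp: dir_image_def)
  qed (auto simp: dir_image_def)
  have eq: "underS ?T (e x) = underS ?T (e y) \<longleftrightarrow> underS T x = underS T y" if "x \<in> Field T" "y \<in> Field T" for x y
    unfolding uS[OF that(1)] uS[OF that(2)] by (rule inj_on_image_eq_iff[OF e uF uF])
  have iso: "Restr T (underS T x) =o Restr ?T (underS ?T (e x))" "Well_order (Restr ?T (underS ?T (e x)))"
    if x: "x \<in> Field T" for x
  proof -
    have "Field (Restr T (underS T x)) \<subseteq> Field T" using uF[of x] by (auto simp: Field_def)
    then have inj: "inj_on e (Field (Restr T (underS T x)))" using inj_on_subset[OF e] by simp
    show "Restr T (underS T x) =o Restr ?T (underS ?T (e x))" "Well_order (Restr ?T (underS ?T (e x)))"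
      unfolding uS[OF x] R[OF uF] by (rule dir_image_ordIso[OF wo[OF x] inj] Well_order_dir_image[OF wo[OF x] inj])+
  qed
  have "is_tree ?T" unfolding is_tree_def using Partial_order_dir_image[OF po e] iso(2) by (simp add: F[symmetric]) (simp add: F)
  moreover have "|sim_class ?T (e x)| <o cardSuc lam" if x: "x \<in> Field T" for x
  proof -
    have "sim_class ?T (e x) = e ` sim_class T x"
      unfolding sim_class_def sim_def F using eq[OF x] by auto
    moreover have "|sim_class T x| <o cardSuc lam" using T x by (simp add: lambda_kappa_tree_def)
    ultimately show ?thesis using card_of_image ordLeq_ordLess_trans by metis
  qed
  moreover have "Restr ?T (underS ?T (e x)) \<le>o \<kappa>" if x: "x \<in> Field T" for x
  proof -
    have "Restr T (underS T x) \<le>o \<kappa>" using T x by (simp add: lambda_kappa_tree_def)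
    then show ?thesis by (rule ordIso_ordLeq_trans[OF ordIso_symmetric[OF iso(1)[OF x]]])
  qed
  moreover have "\<exists>!x. x \<in> Field ?T \<and> underS ?T x = {}"
  proof -
    have "\<exists>!x. x \<in> Field T \<and> underS T x = {}" using T by (simp add: lambda_kappa_tree_def)
    then obtain r where r: "r \<in> Field T" "underS T r = {}" "\<And>x. x \<in> Field T \<Longrightarrow> underS T x = {} \<Longrightarrow> x = r" by blast
    show ?thesis
    proof (intro ex1I[of _ "e r"] conjI)
      show "e r \<in> Field ?T" "underS ?T (e r) = {}" using r(1,2) uS[OF r(1)] F by simp_all
      fix y assume y: "y \<in> Field ?T \<and> underS ?T y = {}"
      then obtain x where x: "x \<in> Field T" "y = e x" unfolding F by auto
      then have "underS T x = {}" using y uS[OF x(1)] by simp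
      then show "y = e r" using r(3)[OF x(1)] x(2) by simp
    qed
  qed
  moreover have "e x = e y"
    if xy: "x \<in> Field T" "y \<in> Field T" "\<nexists>z. immediate_pred ?T z (e x)" "\<nexists>z. immediate_pred ?T z (e y)" "sim ?T (e x) (e y)"
    for x y
  proof -
    have im: "immediate_pred ?T (e z) (e x)" if x: "x \<in> Field T" and z: "immediate_pred T z x" for z x
    proof -
      have zx: "lt T z x" "\<not> (\<exists>w. lt T z w \<and> lt T w x)" using z by (auto simp: immediate_pred_def)
      have zF: "z \<in> Field T" using lt_Field1[OF zx(1)] .
      have "\<not> (lt ?T (e z) w \<and> lt ?T w (e x))" for w
      proof
        assume w: "lt ?T (e z) w \<and> lt ?T w (e x)"
        then obtain v where v: "lt T v x" "w = e v" unfolding uS[OF x] by auto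
        then show False using w lt_dir_image[OF e zF lt_Field1[OF v(1)]] zx(2) by blast
      qed
      then show ?thesis unfolding immediate_pred_def using lt_dir_image[OF e zF x] zx(1) by simp
    qed
    have "sim T x y" using xy(5) eq[OF xy(1,2)] by (simp add: sim_def)
    moreover have "\<nexists>z. immediate_pred T z x" "\<nexists>z. immediate_pred T z y" using im xy(1-4) by blast+
    ultimately have "x = y" using T xy(1,2) unfolding lambda_kappa_tree_def by blast
    then show ?thesis by simp
  qed
  ultimately show ?thesis unfolding lambda_kappa_tree_def F by simp
qed

context tall begin

lemma desc_Field: "desc a l \<Longrightarrow> set l \<subseteq> Field lam"
proof (induct l)
  case (Cons i l)
  then show ?case using lt_Field1[of i lam "bot a l"] by simp
qed simp

text \<open>The sequence and the list of a node are merged into a single partial function with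
  values in \<open>lam\<close>.\<close>

definition chart :: "('k \<rightharpoonup> 'l) \<times> 'l list \<Rightarrow> 'k + nat \<Rightarrow> 'l option" where
  "chart x = case_sum (fst x) (\<lambda>n. if n < length (snd x) then Some (snd x ! n) else None)"

lemma chart_inj: "chart x = chart y \<Longrightarrow> x = y"
proof -
  assume *: "chart x = chart y"
  have "fst x \<nu> = fst y \<nu>" for \<nu> using fun_cong[OF *, of "Inl \<nu>"] by (simp add: chart_def)
  then have 1: "fst x = fst y" by (rule ext)
  have n: "(if n < length (snd x) then Some (snd x ! n) else None) = (if n < length (snd y) then Some (snd y ! n) else None)" for n
    using fun_cong[OF *, of "Inr n"] by (simp add: chart_def)
  then have i: "n < length (snd x) \<longleftrightarrow> n < length (snd y)" for n by (metis option.distinct(1))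
  then have l: "length (snd x) = length (snd y)" by (metis linorder_neqE_nat less_irrefl)
  have "snd x = snd y" by (rule nth_equalityI[OF l]) (use n l in \<open>metis option.inject\<close>)
  then show "x = y" using 1 by (rule prod_eqI[rotated])
qed

lemma ex_index: "\<exists>u. inj_on u (Field \<kappa> <+> UNIV) \<and> u ` (Field \<kappa> <+> (UNIV :: nat set)) \<subseteq> Field lam"
proof -
  have "|UNIV :: nat set| \<le>o |Field mu|" using mu(2) infinite_iff_card_of_nat by blast
  then have "|Field \<kappa> <+> (UNIV :: nat set)| \<le>o mu"
    using \<kappa>_mu ordLeq_ordIso_trans[OF _ card_Field_mu] mu
    by (intro card_of_Plus_ordLeq_infinite_Field) auto
  then have "|Field \<kappa> <+> (UNIV :: nat set)| \<le>o |Field lam|"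
    using ordLeq_transitive[OF _ ordLeq_ordIso_trans[OF ordLess_imp_ordLeq[OF mu_less] ordIso_symmetric[OF card_of_Field_ordIso[OF lam_card]]]]
    by blast
  then show ?thesis using card_of_ordLeq by blast
qed

definition index :: "'k + nat \<Rightarrow> 'l" where
  "index = (SOME u. inj_on u (Field \<kappa> <+> UNIV) \<and> u ` (Field \<kappa> <+> UNIV) \<subseteq> Field lam)"

lemma index: "inj_on index (Field \<kappa> <+> UNIV)" "index ` (Field \<kappa> <+> UNIV) \<subseteq> Field lam"
  using someI_ex[OF ex_index] unfolding index_def by auto

text \<open>The graph of \<open>chart x\<close>, turned into a set of ordinals below
  \<open>lam\<close> by means of \<open>index\<close> and the pairing.\<close>

definition encode :: "('k \<rightharpoonup> 'l) \<times> 'l list \<Rightarrow> 'l set" where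
  "encode x = {mk (index a) v | a v. chart x a = Some v}"

lemma inj_encode:
  assumes "Z \<subseteq> full"
  shows "inj_on encode (nodes Z)"
proof (rule inj_onI)
  interpret seq_tree mu lam \<kappa> Z by unfold_locales (rule assms)
  have dom: "a \<in> Field \<kappa> <+> UNIV" "v \<in> Field lam" if x: "x \<in> nodes Z" "chart x a = Some v" for x a v
  proof -
    obtain s l where sl: "x = (s, l)" by (cases x)
    have s: "s \<in> seqs" using nodes_seqs x(1) sl by simp
    have "set l \<subseteq> Field lam" using x(1) desc_Field unfolding sl nodes_def by (cases "l = []") auto
    then show "a \<in> Field \<kappa> <+> UNIV" "v \<in> Field lam"
      using x(2) dom_Field[OF s] ran_seqs[OF s] unfolding sl chart_def
      by (auto split: sum.splits if_splits)
  qed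
  have le: "chart x a = Some v \<Longrightarrow> chart y a = Some v" if xy: "x \<in> nodes Z" "y \<in> nodes Z" "encode x = encode y" for x y a v
  proof -
    assume c: "chart x a = Some v"
    then have "mk (index a) v \<in> encode x" unfolding encode_def by blast
    then have "mk (index a) v \<in> encode y" unfolding xy(3) .
    then obtain a' v' where a': "mk (index a) v = mk (index a') v'" "chart y a' = Some v'" unfolding encode_def by blast
    note d = dom[OF xy(1) c] and d' = dom[OF xy(2) a'(2)]
    have i: "index a \<in> Field lam" "index a' \<in> Field lam" using index(2) d(1) d'(1) by auto
    have "index a = index a'" "v = v'" using mk[OF i(1) d(2)] mk[OF i(2) d'(2)] a'(1) by metis+
    then have "a = a'" using inj_onD[OF index(1)] d(1) d'(1) by blast
    then show "chart y a = Some v" using a'(2) \<open>v = v'\<close> by simp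
  qed
  fix x y assume xy: "x \<in> nodes Z" "y \<in> nodes Z" "encode x = encode y"
  have "chart x = chart y"
  proof
    fix a
    show "chart x a = chart y a"
      using le[OF xy, of a] le[OF xy(2,1) xy(3)[symmetric], of a] by (cases "chart x a"; cases "chart y a") auto
  qed
  then show "x = y" by (rule chart_inj)
qed

theorem game_equiv_not_isomorphic:
  "\<exists>(I0 :: 'l set rel) (I1 :: 'l set rel). lambda_kappa_tree lam \<kappa> I0 \<and> lambda_kappa_tree lam \<kappa> I1 \<and>
     game_equiv lam (ord_times mu \<kappa>) I0 I1 \<and> \<not> isomorphic I0 I1"
proof (intro exI conjI)
  note e0 = inj_encode[OF Z_full(1)] and e1 = inj_encode[OF Z_full(2)]
  let ?A = "dir_image (T Z0) encode" and ?B = "dir_image (T Z1) encode"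
  show "lambda_kappa_tree lam \<kappa> ?A"
    by (rule lambda_kappa_tree_dir_image[OF _ z0.lambda_kappa_T]) (use e0 Field_T in metis)
  show "lambda_kappa_tree lam \<kappa> ?B"
    by (rule lambda_kappa_tree_dir_image[OF _ z1.lambda_kappa_T]) (use e1 Field_T in metis)
  show "\<not> isomorphic ?A ?B"
    using isomorphic_dir_image[of encode "T Z0" encode "T Z1"] e0 e1 not_isomorphic unfolding Field_T by blast
  have dec: "bij_betw (inv_into (nodes Z) encode) (Field (dir_image (T Z) encode)) (nodes Z)"
    "\<And>x y. x \<in> Field (dir_image (T Z) encode) \<Longrightarrow> y \<in> Field (dir_image (T Z) encode) \<Longrightarrow>
      lt (dir_image (T Z) encode) x y \<longleftrightarrow> lt (T Z) (inv_into (nodes Z) encode x) (inv_into (nodes Z) encode y)"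
    if e: "inj_on encode (nodes Z)" for Z
  proof -
    have F: "Field (dir_image (T Z) encode) = encode ` nodes Z" using dir_image_Field[of "T Z" encode] Field_T by simp
    show "bij_betw (inv_into (nodes Z) encode) (Field (dir_image (T Z) encode)) (nodes Z)"
      unfolding F by (rule bij_betw_inv_into) (use e in \<open>simp add: bij_betw_def\<close>)
    fix x y assume xy: "x \<in> Field (dir_image (T Z) encode)" "y \<in> Field (dir_image (T Z) encode)"
    then obtain x' y' where "x' \<in> nodes Z" "x = encode x'" "y' \<in> nodes Z" "y = encode y'" unfolding F by auto
    then show "lt (dir_image (T Z) encode) x y \<longleftrightarrow> lt (T Z) (inv_into (nodes Z) encode x) (inv_into (nodes Z) encode y)"
      using lt_dir_image[of encode "T Z" x' y'] e unfolding Field_T by simp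
  qed
  show "game_equiv lam clock ?A ?B"
    by (rule game_equiv_clock[OF dec(1)[OF e0] dec(2)[OF e0] dec(1)[OF e1] dec(2)[OF e1]])
qed

end

theorem mainTheorem3:
  fixes mu :: "'m rel" and lam :: "'m set rel" and \<kappa> :: "'k rel"
  assumes mu: "Card_order mu" "infinite (Field mu)"
    and lam: "lam = cardSuc mu"
    and \<kappa>: "Card_order \<kappa>" "infinite (Field \<kappa>)" "regularCard \<kappa>" "\<kappa> <o lam"
    and ideal: "Field lam \<in> approachability_ideal lam"
  shows
    "(\<forall>(I0 :: 'a rel) (I1 :: 'b rel).
        lambda_kappa_tree lam \<kappa> I0 \<and> lambda_kappa_tree lam \<kappa> I1 \<longrightarrow>
        (game_equiv lam (ord_succ (ord_times mu \<kappa>)) I0 I1 \<longleftrightarrow> isomorphic I0 I1)) \<and>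
     (regularCard mu \<and> weak_power lam \<kappa> =o lam \<longrightarrow>
        (\<exists>(I0 :: 'm set set rel) (I1 :: 'm set set rel).
          lambda_kappa_tree lam \<kappa> I0 \<and> lambda_kappa_tree lam \<kappa> I1 \<and>
          game_equiv lam (ord_times mu \<kappa>) I0 I1 \<and> \<not> isomorphic I0 I1)) \<and>
     (\<not> regularCard mu \<longrightarrow>
        (\<kappa> <o cofinality mu \<and> cofinality mu <o mu \<longrightarrow>
          (\<forall>(I0 :: 'a rel) (I1 :: 'b rel).
            lambda_kappa_tree lam \<kappa> I0 \<and> lambda_kappa_tree lam \<kappa> I1 \<longrightarrow>
            (game_equiv lam mu I0 I1 \<longleftrightarrow> isomorphic I0 I1))) \<and>
        (\<kappa> =o cofinality mu \<and> cofinality mu <o mu \<longrightarrow>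
          (\<forall>(I0 :: 'a rel) (I1 :: 'b rel).
            lambda_kappa_tree lam \<kappa> I0 \<and> lambda_kappa_tree lam \<kappa> I1 \<longrightarrow>
            (game_equiv lam (ord_succ mu) I0 I1 \<longleftrightarrow> isomorphic I0 I1))))"
proof -
  interpret succ_card mu lam unfolding lam by (rule succ_card_cardSuc[OF mu])
  interpret k: well \<kappa> using \<kappa>(1) by unfold_locales (simp add: card_order_on_well_order_on)
  have lk: "lk_tree lam \<kappa> I" if "lambda_kappa_tree lam \<kappa> I" for I :: "'t rel"
    using that \<kappa>(1,2) lam_card by unfold_locales (simp_all add: lambda_kappa_tree_def)
  have wt: "Well_order (ord_times mu \<kappa>)" by (rule Well_order_ord_times[OF mu.wo k.wo])
  have a: "game_equiv lam (ord_succ (ord_times mu \<kappa>)) I0 I1 \<longleftrightarrow> isomorphic I0 I1"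
    if "lambda_kappa_tree lam \<kappa> I0" "lambda_kappa_tree lam \<kappa> I1" for I0 :: "'a rel" and I1 :: "'b rel"
    using game_equiv_isomorphic[OF succ_card_axioms lk[OF that(1)] lk[OF that(2)] ideal \<kappa>(4)]
      isomorphic_game_equiv[OF well.intro[OF Well_order_ord_succ[OF wt]]] by metis
  have b: "\<exists>(I0 :: 'm set set rel) (I1 :: 'm set set rel). lambda_kappa_tree lam \<kappa> I0 \<and> lambda_kappa_tree lam \<kappa> I1 \<and>
    game_equiv lam (ord_times mu \<kappa>) I0 I1 \<and> \<not> isomorphic I0 I1"
    if "regularCard mu" "weak_power lam \<kappa> =o lam"
  proof -
    have "|Field \<kappa>| \<le>o mu"
      by (rule below) (rule ordIso_ordLess_trans[OF card_of_Field_ordIso[OF \<kappa>(1)] \<kappa>(4)])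
    then interpret tall mu lam \<kappa> using that \<kappa> by unfold_locales
    show ?thesis by (rule game_equiv_not_isomorphic)
  qed
  have c: "game_equiv lam mu I0 I1 \<longleftrightarrow> isomorphic I0 I1"
    if "lambda_kappa_tree lam \<kappa> I0" "lambda_kappa_tree lam \<kappa> I1" "\<not> regularCard mu" "\<kappa> <o cofinality mu"
    for I0 :: "'a rel" and I1 :: "'b rel"
  proof -
    have "singular mu lam" using that(3) by unfold_locales
    then show ?thesis
      using game_equiv_isomorphic_singular[OF _ lk[OF that(1)] lk[OF that(2)] ideal that(4)]
        isomorphic_game_equiv[OF mu.well_axioms] by metis
  qed
  have d: "game_equiv lam (ord_succ mu) I0 I1 \<longleftrightarrow> isomorphic I0 I1"
    if "lambda_kappa_tree lam \<kappa> I0" "lambda_kappa_tree lam \<kappa> I1" "\<not> regularCard mu" "\<kappa> =o cofinality mu"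
    for I0 :: "'a rel" and I1 :: "'b rel"
  proof -
    have "singular mu lam" using that(3) by unfold_locales
    then show ?thesis
      using game_equiv_isomorphic_singular_succ[OF _ lk[OF that(1)] lk[OF that(2)] ideal that(4)]
        isomorphic_game_equiv[OF well.intro[OF Well_order_ord_succ[OF mu.wo]]] by metis
  qed
  show ?thesis using a b c d by (intro conjI impI allI) simp_all
qed

end
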